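(* For $\hat T\in\widehat{\mathsf{GT}}$ and $\mathsf{N}\in\mathsf{NFI}_{\mathrm{PB}_4}(\mathrm{B}_4)$, let $T_{\mathsf{N}}$ be the $\mathsf{GT}$-shadow with target $\mathsf{N}$ obtained from $\hat T$ by reduction modulo $\mathsf{N}$, and let $T_{\mathsf{N}}^{\mathrm{PB}_4}:\mathrm{PB}_4\to\mathrm{PB}_4/\mathsf{N}$ be the corresponding homomorphism. The assignment $$\mathsf{N}^{\hat T}:=\ker\big(\mathrm{PB}_4\xrightarrow{\,T_{\mathsf{N}}^{\mathrm{PB}_4}\,}\mathrm{PB}_4/\mathsf{N}\big)$$ defines a right action of the group $\widehat{\mathsf{GT}}$ on the set $\mathsf{NFI}_{\mathrm{PB}_4}(\mathrm{B}_4)$. Moreover, the assignment $\hat T\mapsto T_{\mathsf{N}}$ (with the identity map on objects) defines a functor $\mathscr{PR}$ from the corresponding transformation groupoid $\widehat{\mathsf{GT}}_{\mathsf{NFI}}$ to $\mathsf{GTSh}$.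
   Context: Braid groups. $\mathrm{B}_n$ is the Artin braid group on $n$ strands with standard generators $\sigma_1,\dots,\sigma_{n-1}$; $\mathrm{PB}_n\le \mathrm{B}_n$ is the pure braid group with generators $x_{ij} := \sigma_{j-1}\cdots\sigma_{i+1}\sigma_i^2\sigma_{i+1}^{-1}\cdots\sigma_{j-1}^{-1}$, $1\le i<j\le n$. Set $c := x_{23}x_{12}x_{13}\in \mathrm{PB}_3$; it generates the center of $\mathrm{PB}_3$. The elements $x:=x_{12}$, $y:=x_{23}$ generate a free subgroup of rank 2 in $\mathrm{PB}_3$, which is identified with the free group $\mathsf{F}_2$, and $\mathrm{PB}_3=\mathsf{F}_2\times\langle c\rangle$. $\mathsf{NFI}_{\mathrm{PB}_4}(\mathrm{B}_4)$ is the poset of finite index normal subgroups $\mathsf{N}\unlhd \mathrm{B}_4$ with $\mathsf{N}\le\mathrm{PB}_4$. Hats denote profinite completions. Homomorphisms $\mathrm{PB}_3\to\mathrm{PB}_4$ (values on $x_{12},x_{23},x_{13}$): $\varphi_{123}: x_{12}, x_{23}, x_{13}$; $\varphi_{234}: x_{23}, x_{34}, x_{24}$; $\varphi_{12,3,4}: x_{13}x_{23},\ x_{34},\ x_{14}x_{24}$; $\varphi_{1,23,4}: x_{12}x_{13},\ x_{24}x_{34},\ x_{14}$; $\varphi_{1,2,34}: x_{12},\ x_{23}x_{24},\ x_{13}x_{14}$. For $\mathsf{N}\in\mathsf{NFI}_{\mathrm{PB}_4}(\mathrm{B}_4)$ let $\mathsf{N}_{\mathrm{PB}_3}$ be the intersection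 of the preimages of $\mathsf{N}$ under these five homomorphisms, and let $N_{\mathrm{ord}}$ be the least common multiple of the orders of $x_{12}\mathsf{N}_{\mathrm{PB}_3}, x_{23}\mathsf{N}_{\mathrm{PB}_3}, c\,\mathsf{N}_{\mathrm{PB}_3}$ in $\mathrm{PB}_3/\mathsf{N}_{\mathrm{PB}_3}$. $\mathsf{GT}$-shadows. A $\mathsf{GT}$-shadow with target $\mathsf{N}$ is a pair $[m,f]:=(m+N_{\mathrm{ord}}\mathbb{Z},\ f\,\mathsf{N}_{\mathrm{PB}_3})$ represented by some $(m,f)\in\mathbb{Z}\times\mathsf{F}_2$ such that: (i) $\sigma_1 x_{12}^m f^{-1}\sigma_2 x_{23}^m f\,\mathsf{N}_{\mathrm{PB}_3} = f^{-1}\sigma_1\sigma_2 x_{12}^{-m}c^m\,\mathsf{N}_{\mathrm{PB}_3}$ and $f^{-1}\sigma_2x_{23}^m f\sigma_1x_{12}^m\,\mathsf{N}_{\mathrm{PB}_3} = \sigma_2\sigma_1x_{23}^{-m}c^m f\,\mathsf{N}_{\mathrm{PB}_3}$ in $\mathrm{B}_3/\mathsf{N}_{\mathrm{PB}_3}$; (ii) $\varphi_{234}(f)\varphi_{1,23,4}(f)\varphi_{123}(f)\,\mathsf{N}=\varphi_{1,2,34}(f)\varphi_{12,3,4}(f)\,\mathsf{N}$ in $\mathrm{PB}_4/\mathsf{N}$; (iii) $2m+1$ is a unit modulo $N_{\mathrm{ord}}$; (iv) the homomorphism $\mathrm{PB}_3\to\mathrm{PB}_3/\mathsf{N}_{\mathrm{PB}_3}$,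 $x_{12}\mapsto x_{12}^{2m+1}\mathsf{N}_{\mathrm{PB}_3}$, $x_{23}\mapsto f^{-1}x_{23}^{2m+1}f\,\mathsf{N}_{\mathrm{PB}_3}$, $c\mapsto c^{2m+1}\mathsf{N}_{\mathrm{PB}_3}$, is onto. $\mathsf{GT}(\mathsf{N})$ is the set of $\mathsf{GT}$-shadows with target $\mathsf{N}$. For $[m,f]\in\mathsf{GT}(\mathsf{N})$ the formulas $\sigma_1\mapsto\sigma_1^{2m+1}\mathsf{N}$, $\sigma_2\mapsto\varphi_{123}(f)^{-1}\sigma_2^{2m+1}\varphi_{123}(f)\mathsf{N}$, $\sigma_3\mapsto\varphi_{12,3,4}(f)^{-1}\sigma_3^{2m+1}\varphi_{12,3,4}(f)\mathsf{N}$ define a homomorphism $\mathrm{B}_4\to\mathrm{B}_4/\mathsf{N}$ with restriction $T^{\mathrm{PB}_4}_{m,f}:\mathrm{PB}_4\to\mathrm{PB}_4/\mathsf{N}$. It is known that $\ker(T^{\mathrm{PB}_4}_{m,f})\in\mathsf{NFI}_{\mathrm{PB}_4}(\mathrm{B}_4)$; this kernel is the source of $[m,f]$. It is known that $\mathsf{GT}$-shadows form a groupoid $\mathsf{GTSh}$ with object set $\mathsf{NFI}_{\mathrm{PB}_4}(\mathrm{B}_4)$; morphisms from $\mathsf{N}^{(2)}$ to $\mathsf{N}^{(1)}$ are the $[m,f]\in\mathsf{GT}(\mathsf{N}^{(1)})$ with source $\mathsf{N}^{(2)}$; composition is $[m_1,f_1]\circ[m_2,f_2]=[2m_1m_2+m_1+m_2,\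 f_1(x,y)f_2(x^{2m_1+1},f_1^{-1}y^{2m_1+1}f_1)]$. The group $\widehat{\mathsf{GT}}$. Consider pairs $(\hat m,\hat f)\in\widehat{\mathbb{Z}}\times\widehat{\mathsf{F}}_2$ satisfying the two relations in (i) in $\widehat{\mathrm{B}}_3$ and the relation in (ii) in $\widehat{\mathrm{PB}}_4$ (with $m,f$ replaced by $\hat m,\hat f$ and no quotient). They form a monoid under $(\hat m_1,\hat f_1)\circ(\hat m_2,\hat f_2)=(2\hat m_1\hat m_2+\hat m_1+\hat m_2,\ \hat f_1 E_1(\hat f_2))$, where $E_1$ is the continuous endomorphism of $\widehat{\mathsf{F}}_2$ with $x\mapsto x^{2\hat m_1+1}$, $y\mapsto\hat f_1^{-1}y^{2\hat m_1+1}\hat f_1$. $\widehat{\mathsf{GT}}$ is the group of invertible elements of this monoid (equivalently, the group of continuous automorphisms of the profinite completion of the operad of parenthesized braids that are trivial on objects). For $\hat T=(\hat m,\hat f)\in\widehat{\mathsf{GT}}$ and $\mathsf{N}\in\mathsf{NFI}_{\mathrm{PB}_4}(\mathrm{B}_4)$, $T_{\mathsf{N}}$ is given by the residue of $\hat m$ modulo $N_{\mathrm{ord}}$ and the image of $\hat f$ in $\mathrm{PB}_3/\mathsf{N}_{\mathrm{PB}_3}$; it is known that $T_{\mathsf{N}}\in\mathsf{GT}(\mathsf{N})$. For $T_{\mathsf{N}}=[m,f]$ one sets $T_{\mathsf{N}}^{\mathrm{PB}_4}:=T^{\mathrm{PB}_4}_{m,f}$. Transformation groupoid $\widehat{\mathsf{GT}}_{\mathsf{NFI}}$: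 objects are the elements of $\mathsf{NFI}_{\mathrm{PB}_4}(\mathrm{B}_4)$, morphisms from $\mathsf{N}^{(1)}$ to $\mathsf{N}^{(2)}$ are the $\hat T\in\widehat{\mathsf{GT}}$ with $(\mathsf{N}^{(2)})^{\hat T}=\mathsf{N}^{(1)}$, and composition is the multiplication of $\widehat{\mathsf{GT}}$. The functor sends a morphism $\hat T$ with target $\mathsf{N}$ to $T_{\mathsf{N}}$. *)

theory Defs
  imports
    "HOL-Algebra.Sym_Groups"
    "HOL-Algebra.Product_Groups"
    "HOL-Algebra.Multiplicative_Group"
    "HOL-Analysis.Function_Topology"
    "HOL-Number_Theory.Cong"
begin

section \<open>Groups given by generators and relations\<close>

text \<open>A letter \<open>(a, True)\<close> stands for the generator \<open>a\<close>, and \<open>(a, False)\<close> for its formal inverse.\<close>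

type_synonym 'a word = "('a \<times> bool) list"

inductive word_eq :: "'a set \<Rightarrow> ('a word \<times> 'a word) set \<Rightarrow> 'a word \<Rightarrow> 'a word \<Rightarrow> bool"
  for S :: "'a set" and R :: "('a word \<times> 'a word) set" where
  refl: "w \<in> lists (S \<times> UNIV) \<Longrightarrow> word_eq S R w w"
| sym: "word_eq S R u v \<Longrightarrow> word_eq S R v u"
| trans: "word_eq S R u v \<Longrightarrow> word_eq S R v w \<Longrightarrow> word_eq S R u w"
| append: "word_eq S R u u' \<Longrightarrow> word_eq S R v v' \<Longrightarrow> word_eq S R (u @ v) (u' @ v')"
| cancel: "a \<in> S \<Longrightarrow> word_eq S R [(a, b), (a, \<not> b)] []"
| relator: "(u, v) \<in> R \<Longrightarrow> u \<in> lists (S \<times> UNIV) \<Longrightarrow> v \<in> lists (S \<times> UNIV) \<Longrightarrow> word_eq S R u v"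

definition word_class :: "'a set \<Rightarrow> ('a word \<times> 'a word) set \<Rightarrow> 'a word \<Rightarrow> 'a word set" where
  "word_class S R w = {v. word_eq S R w v}"

definition presented_group ::
  "'a set \<Rightarrow> ('a word \<times> 'a word) set \<Rightarrow> 'a word set monoid" where
  "presented_group S R =
    \<lparr> carrier = word_class S R ` lists (S \<times> UNIV),
      mult = (\<lambda>X Y. \<Union>u\<in>X. \<Union>v\<in>Y. word_class S R (u @ v)),
      one = word_class S R [] \<rparr>"

text \<open>The homomorphism \<open>G \<rightarrow> H\<close> with prescribed values on a list of generators of \<open>G\<close>.\<close>

definition hom_with_values ::
  "('a, 'c) monoid_scheme \<Rightarrow> ('b, 'd) monoid_scheme \<Rightarrow> ('a \<times> 'b) list \<Rightarrow> 'a \<Rightarrow> 'b" where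
  "hom_with_values G H vals =
    (THE h. h \<in> hom G H \<and> h \<in> extensional (carrier G) \<and> (\<forall>(g, v) \<in> set vals. h g = v))"


section \<open>The free group of rank two, braid groups and pure braid groups\<close>

definition F2 :: "nat word set monoid" where
  "F2 = presented_group {1, 2} {}"

definition F2_x :: "nat word set" where
  "F2_x = word_class {1, 2} {} [(1, True)]"

definition F2_y :: "nat word set" where
  "F2_y = word_class {1, 2} {} [(2, True)]"

definition braid_relations :: "nat \<Rightarrow> (nat word \<times> nat word) set" where
  "braid_relations n =
    {([(i, True), (j, True)], [(j, True), (i, True)]) | i j.
        i \<in> {1..<n} \<and> j \<in> {1..<n} \<and> i + 2 \<le> j} \<union>
    {([(i, True), (i + 1, True), (i, True)], [(i + 1, True), (i, True), (i + 1, True)]) | i.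
        i \<in> {1..<n} \<and> i + 1 \<in> {1..<n}}"

definition B :: "nat \<Rightarrow> nat word set monoid" where
  "B n = presented_group {1..<n} (braid_relations n)"

definition sigma :: "nat \<Rightarrow> nat \<Rightarrow> nat word set" where
  "sigma n i = word_class {1..<n} (braid_relations n) [(i, True)]"

text \<open>The permutation of the end points of a braid.\<close>

definition braid_perm :: "nat \<Rightarrow> nat word set \<Rightarrow> nat \<Rightarrow> nat" where
  "braid_perm n =
    hom_with_values (B n) (sym_group n)
      (map (\<lambda>i. (sigma n i, Transposition.transpose i (i + 1))) [1..<n])"

definition PB :: "nat \<Rightarrow> nat word set monoid" where
  "PB n = (B n)\<lparr>carrier := kernel (B n) (sym_group n) (braid_perm n)\<rparr>"

definition pure_gen :: "nat \<Rightarrow> nat \<Rightarrow> nat \<Rightarrow> nat word set" where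
  "pure_gen n i j =
    (let g = foldr (\<lambda>k h. sigma n k \<otimes>\<^bsub>B n\<^esub> h) (rev [i + 1..<j]) \<one>\<^bsub>B n\<^esub>
     in g \<otimes>\<^bsub>B n\<^esub> (sigma n i [^]\<^bsub>B n\<^esub> (2::nat)) \<otimes>\<^bsub>B n\<^esub> inv\<^bsub>B n\<^esub> g)"

definition central_c :: "nat word set" where
  "central_c = pure_gen 3 2 3 \<otimes>\<^bsub>B 3\<^esub> pure_gen 3 1 2 \<otimes>\<^bsub>B 3\<^esub> pure_gen 3 1 3"

text \<open>The identification of \<^const>\<open>F2\<close> with the subgroup of \<open>PB 3\<close> generated by
  \<open>x\<^sub>1\<^sub>2\<close> and \<open>x\<^sub>2\<^sub>3\<close>.\<close>

definition F2_emb :: "nat word set \<Rightarrow> nat word set" where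
  "F2_emb = hom_with_values F2 (PB 3) [(F2_x, pure_gen 3 1 2), (F2_y, pure_gen 3 2 3)]"


section \<open>The homomorphisms from \<open>PB 3\<close> to \<open>PB 4\<close>\<close>

definition PB_hom :: "nat word set \<Rightarrow> nat word set \<Rightarrow> nat word set \<Rightarrow> nat word set \<Rightarrow> nat word set" where
  "PB_hom u v w =
    hom_with_values (PB 3) (PB 4)
      [(pure_gen 3 1 2, u), (pure_gen 3 2 3, v), (pure_gen 3 1 3, w)]"

definition phi_123 :: "nat word set \<Rightarrow> nat word set" where
  "phi_123 = PB_hom (pure_gen 4 1 2) (pure_gen 4 2 3) (pure_gen 4 1 3)"

definition phi_234 :: "nat word set \<Rightarrow> nat word set" where
  "phi_234 = PB_hom (pure_gen 4 2 3) (pure_gen 4 3 4) (pure_gen 4 2 4)"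

definition phi_12_3_4 :: "nat word set \<Rightarrow> nat word set" where
  "phi_12_3_4 =
    PB_hom (pure_gen 4 1 3 \<otimes>\<^bsub>B 4\<^esub> pure_gen 4 2 3) (pure_gen 4 3 4)
      (pure_gen 4 1 4 \<otimes>\<^bsub>B 4\<^esub> pure_gen 4 2 4)"

definition phi_1_23_4 :: "nat word set \<Rightarrow> nat word set" where
  "phi_1_23_4 =
    PB_hom (pure_gen 4 1 2 \<otimes>\<^bsub>B 4\<^esub> pure_gen 4 1 3)
      (pure_gen 4 2 4 \<otimes>\<^bsub>B 4\<^esub> pure_gen 4 3 4) (pure_gen 4 1 4)"

definition phi_1_2_34 :: "nat word set \<Rightarrow> nat word set" where
  "phi_1_2_34 =
    PB_hom (pure_gen 4 1 2) (pure_gen 4 2 3 \<otimes>\<^bsub>B 4\<^esub> pure_gen 4 2 4)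
      (pure_gen 4 1 3 \<otimes>\<^bsub>B 4\<^esub> pure_gen 4 1 4)"


section \<open>The poset \<open>NFI\<close> and the numbers \<open>N_ord\<close>\<close>

definition finite_index_normal :: "('a, 'b) monoid_scheme \<Rightarrow> 'a set set" where
  "finite_index_normal G = {N. N \<lhd> G \<and> finite (rcosets\<^bsub>G\<^esub> N)}"

definition NFI_PB4 :: "nat word set set set" where
  "NFI_PB4 = {N \<in> finite_index_normal (B 4). N \<subseteq> carrier (PB 4)}"

definition N_PB3 :: "nat word set set \<Rightarrow> nat word set set" where
  "N_PB3 N =
    {w \<in> carrier (PB 3).
      \<forall>\<phi> \<in> {phi_123, phi_234, phi_12_3_4, phi_1_23_4, phi_1_2_34}. \<phi> w \<in> N}"

definition N_ord :: "nat word set set \<Rightarrow> nat" where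
  "N_ord N =
    Lcm ((\<lambda>w. group.ord (PB 3 Mod N_PB3 N) (N_PB3 N #>\<^bsub>PB 3\<^esub> w)) `
      {pure_gen 3 1 2, pure_gen 3 2 3, central_c})"


section \<open>GT-shadows\<close>

text \<open>Cosets are written as right cosets, as in the library's quotient groups; the subgroups
  involved are normal.\<close>

type_synonym shadow = "int set \<times> nat word set set"

definition shadow :: "nat word set set \<Rightarrow> int \<Rightarrow> nat word set \<Rightarrow> shadow" where
  "shadow N m f = ({k. [k = m] (mod int (N_ord N))}, N_PB3 N #>\<^bsub>PB 3\<^esub> F2_emb f)"

definition hexagons_mod :: "nat word set set \<Rightarrow> int \<Rightarrow> nat word set \<Rightarrow> bool" where
  "hexagons_mod K m f \<longleftrightarrow>
    (let G = B 3; s1 = sigma 3 1; s2 = sigma 3 2;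
         x12 = pure_gen 3 1 2; x23 = pure_gen 3 2 3; c = central_c; g = F2_emb f
     in
      K #>\<^bsub>G\<^esub> (s1 \<otimes>\<^bsub>G\<^esub> x12 [^]\<^bsub>G\<^esub> m \<otimes>\<^bsub>G\<^esub> inv\<^bsub>G\<^esub> g \<otimes>\<^bsub>G\<^esub> s2 \<otimes>\<^bsub>G\<^esub> x23 [^]\<^bsub>G\<^esub> m \<otimes>\<^bsub>G\<^esub> g)
      = K #>\<^bsub>G\<^esub> (inv\<^bsub>G\<^esub> g \<otimes>\<^bsub>G\<^esub> s1 \<otimes>\<^bsub>G\<^esub> s2 \<otimes>\<^bsub>G\<^esub> x12 [^]\<^bsub>G\<^esub> (- m) \<otimes>\<^bsub>G\<^esub> c [^]\<^bsub>G\<^esub> m)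
      \<and>
      K #>\<^bsub>G\<^esub> (inv\<^bsub>G\<^esub> g \<otimes>\<^bsub>G\<^esub> s2 \<otimes>\<^bsub>G\<^esub> x23 [^]\<^bsub>G\<^esub> m \<otimes>\<^bsub>G\<^esub> g \<otimes>\<^bsub>G\<^esub> s1 \<otimes>\<^bsub>G\<^esub> x12 [^]\<^bsub>G\<^esub> m)
      = K #>\<^bsub>G\<^esub> (s2 \<otimes>\<^bsub>G\<^esub> s1 \<otimes>\<^bsub>G\<^esub> x23 [^]\<^bsub>G\<^esub> (- m) \<otimes>\<^bsub>G\<^esub> c [^]\<^bsub>G\<^esub> m \<otimes>\<^bsub>G\<^esub> g))"

definition pentagon_mod :: "nat word set set \<Rightarrow> nat word set \<Rightarrow> bool" where
  "pentagon_mod N f \<longleftrightarrow>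
    (let g = F2_emb f
     in
      N #>\<^bsub>PB 4\<^esub> (phi_234 g \<otimes>\<^bsub>PB 4\<^esub> phi_1_23_4 g \<otimes>\<^bsub>PB 4\<^esub> phi_123 g)
      = N #>\<^bsub>PB 4\<^esub> (phi_1_2_34 g \<otimes>\<^bsub>PB 4\<^esub> phi_12_3_4 g))"

definition is_GT_pair :: "nat word set set \<Rightarrow> int \<Rightarrow> nat word set \<Rightarrow> bool" where
  "is_GT_pair N m f \<longleftrightarrow>
    hexagons_mod (N_PB3 N) m f \<and>
    pentagon_mod N f \<and>
    (\<exists>k. [(2 * m + 1) * k = 1] (mod int (N_ord N))) \<and>
    (let G = PB 3; K = N_PB3 N;
         x12 = pure_gen 3 1 2; x23 = pure_gen 3 2 3; c = central_c; g = F2_emb f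
     in \<exists>h \<in> epi G (G Mod K).
          h x12 = K #>\<^bsub>G\<^esub> (x12 [^]\<^bsub>G\<^esub> (2 * m + 1)) \<and>
          h x23 = K #>\<^bsub>G\<^esub> (inv\<^bsub>G\<^esub> g \<otimes>\<^bsub>G\<^esub> x23 [^]\<^bsub>G\<^esub> (2 * m + 1) \<otimes>\<^bsub>G\<^esub> g) \<and>
          h c = K #>\<^bsub>G\<^esub> (c [^]\<^bsub>G\<^esub> (2 * m + 1)))"

definition GT :: "nat word set set \<Rightarrow> shadow set" where
  "GT N = {shadow N m f | m f. f \<in> carrier F2 \<and> is_GT_pair N m f}"

definition T_B4 :: "nat word set set \<Rightarrow> int \<Rightarrow> nat word set \<Rightarrow> nat word set \<Rightarrow> nat word set set" where
  "T_B4 N m f =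
    (let G = B 4; g = phi_123 (F2_emb f); h = phi_12_3_4 (F2_emb f)
     in hom_with_values G (G Mod N)
      [(sigma 4 1, N #>\<^bsub>G\<^esub> (sigma 4 1 [^]\<^bsub>G\<^esub> (2 * m + 1))),
       (sigma 4 2, N #>\<^bsub>G\<^esub> (inv\<^bsub>G\<^esub> g \<otimes>\<^bsub>G\<^esub> sigma 4 2 [^]\<^bsub>G\<^esub> (2 * m + 1) \<otimes>\<^bsub>G\<^esub> g)),
       (sigma 4 3, N #>\<^bsub>G\<^esub> (inv\<^bsub>G\<^esub> h \<otimes>\<^bsub>G\<^esub> sigma 4 3 [^]\<^bsub>G\<^esub> (2 * m + 1) \<otimes>\<^bsub>G\<^esub> h))])"

definition T_PB4 :: "nat word set set \<Rightarrow> int \<Rightarrow> nat word set \<Rightarrow> nat word set \<Rightarrow> nat word set set" where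
  "T_PB4 N m f = restrict (T_B4 N m f) (carrier (PB 4))"

text \<open>The common value of \<^const>\<open>T_PB4\<close> on all representatives of a GT-shadow.\<close>

definition shadow_PB4 :: "nat word set set \<Rightarrow> shadow \<Rightarrow> nat word set \<Rightarrow> nat word set set" where
  "shadow_PB4 N s =
    (THE h. \<forall>m. \<forall>f \<in> carrier F2. s = shadow N m f \<longrightarrow> h = T_PB4 N m f)"

definition shadow_source :: "nat word set set \<Rightarrow> shadow \<Rightarrow> nat word set set" where
  "shadow_source N s = kernel (PB 4) (PB 4 Mod N) (shadow_PB4 N s)"


section \<open>Categories and functors, right actions\<close>

text \<open>Hom-sets need not be disjoint, so composition takes the three objects as arguments:
  \<open>Comp C a b c g f\<close> is the composite of \<open>f : a \<rightarrow> b\<close> and \<open>g : b \<rightarrow> c\<close>.\<close>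

record ('o, 'm) category_data =
  Obj :: "'o set"
  Hom :: "'o \<Rightarrow> 'o \<Rightarrow> 'm set"
  Id :: "'o \<Rightarrow> 'm"
  Comp :: "'o \<Rightarrow> 'o \<Rightarrow> 'o \<Rightarrow> 'm \<Rightarrow> 'm \<Rightarrow> 'm"

locale category =
  fixes C :: "('o, 'm) category_data"
  assumes Id_in_Hom: "a \<in> Obj C \<Longrightarrow> Id C a \<in> Hom C a a"
    and Comp_in_Hom: "\<lbrakk> a \<in> Obj C; b \<in> Obj C; c \<in> Obj C; f \<in> Hom C a b; g \<in> Hom C b c \<rbrakk>
      \<Longrightarrow> Comp C a b c g f \<in> Hom C a c"
    and Comp_Id_right: "\<lbrakk> a \<in> Obj C; b \<in> Obj C; f \<in> Hom C a b \<rbrakk>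
      \<Longrightarrow> Comp C a a b f (Id C a) = f"
    and Comp_Id_left: "\<lbrakk> a \<in> Obj C; b \<in> Obj C; f \<in> Hom C a b \<rbrakk>
      \<Longrightarrow> Comp C a b b (Id C b) f = f"
    and Comp_assoc: "\<lbrakk> a \<in> Obj C; b \<in> Obj C; c \<in> Obj C; d \<in> Obj C;
        f \<in> Hom C a b; g \<in> Hom C b c; h \<in> Hom C c d \<rbrakk>
      \<Longrightarrow> Comp C a c d h (Comp C a b c g f) = Comp C a b d (Comp C b c d h g) f"

locale category_functor = source: category C + target: category D
  for C :: "('o, 'm) category_data" and D :: "('p, 'n) category_data" +
  fixes F_obj :: "'o \<Rightarrow> 'p" and F_mor :: "'o \<Rightarrow> 'o \<Rightarrow> 'm \<Rightarrow> 'n"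
  assumes F_obj: "a \<in> Obj C \<Longrightarrow> F_obj a \<in> Obj D"
    and F_mor: "\<lbrakk> a \<in> Obj C; b \<in> Obj C; f \<in> Hom C a b \<rbrakk>
      \<Longrightarrow> F_mor a b f \<in> Hom D (F_obj a) (F_obj b)"
    and F_Id: "a \<in> Obj C \<Longrightarrow> F_mor a a (Id C a) = Id D (F_obj a)"
    and F_Comp: "\<lbrakk> a \<in> Obj C; b \<in> Obj C; c \<in> Obj C; f \<in> Hom C a b; g \<in> Hom C b c \<rbrakk>
      \<Longrightarrow> F_mor a c (Comp C a b c g f)
        = Comp D (F_obj a) (F_obj b) (F_obj c) (F_mor b c g) (F_mor a b f)"

locale right_group_action = group G for G (structure) +
  fixes E :: "'e set" and act :: "'e \<Rightarrow> 'a \<Rightarrow> 'e"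
  assumes act_closed: "\<lbrakk> e \<in> E; g \<in> carrier G \<rbrakk> \<Longrightarrow> act e g \<in> E"
    and act_one: "e \<in> E \<Longrightarrow> act e \<one> = e"
    and act_mult: "\<lbrakk> e \<in> E; g \<in> carrier G; h \<in> carrier G \<rbrakk>
      \<Longrightarrow> act e (g \<otimes> h) = act (act e g) h"


section \<open>The groupoid GTSh\<close>

definition F2_endo :: "int \<Rightarrow> nat word set \<Rightarrow> nat word set \<Rightarrow> nat word set" where
  "F2_endo m f =
    hom_with_values F2 F2
      [(F2_x, F2_x [^]\<^bsub>F2\<^esub> (2 * m + 1)),
       (F2_y, inv\<^bsub>F2\<^esub> f \<otimes>\<^bsub>F2\<^esub> F2_y [^]\<^bsub>F2\<^esub> (2 * m + 1) \<otimes>\<^bsub>F2\<^esub> f)]"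

text \<open>For \<open>s1 : N2 \<rightarrow> N1\<close> and \<open>s2 : N3 \<rightarrow> N2\<close>, the common value of the composition formula on
  all representatives.\<close>

definition shadow_comp ::
  "nat word set set \<Rightarrow> nat word set set \<Rightarrow> shadow \<Rightarrow> shadow \<Rightarrow> shadow" where
  "shadow_comp N2 N1 s1 s2 =
    (THE t. \<forall>m1 m2. \<forall>f1 \<in> carrier F2. \<forall>f2 \<in> carrier F2.
      s1 = shadow N1 m1 f1 \<longrightarrow> s2 = shadow N2 m2 f2 \<longrightarrow>
      t = shadow N1 (2 * m1 * m2 + m1 + m2) (f1 \<otimes>\<^bsub>F2\<^esub> F2_endo m1 f1 f2))"

definition GTSh :: "(nat word set set, shadow) category_data" where
  "GTSh =
    \<lparr> Obj = NFI_PB4,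
      Hom = (\<lambda>N2 N1. {s \<in> GT N1. shadow_source N1 s = N2}),
      Id = (\<lambda>N. shadow N 0 \<one>\<^bsub>F2\<^esub>),
      Comp = (\<lambda>N3 N2 N1 s1 s2. shadow_comp N2 N1 s1 s2) \<rparr>"


section \<open>Profinite completions\<close>

text \<open>The inverse limit of the finite quotients of \<open>G\<close>.  For \<open>N \<subseteq> M\<close> the transition map sends
  a coset of \<open>N\<close> to the coset of \<open>M\<close> containing it.\<close>

definition profinite_completion ::
  "('a, 'b) monoid_scheme \<Rightarrow> ('a set \<Rightarrow> 'a set) monoid" where
  "profinite_completion G =
    (let P = product_group (finite_index_normal G) (\<lambda>N. G Mod N)
     in P\<lparr>carrier := {g \<in> carrier P.
          \<forall>N \<in> finite_index_normal G. \<forall>M \<in> finite_index_normal G. N \<subseteq> M \<longrightarrow> g N \<subseteq> g M}\<rparr>)"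

definition profinite_topology :: "('a, 'b) monoid_scheme \<Rightarrow> ('a set \<Rightarrow> 'a set) topology" where
  "profinite_topology G =
    subtopology
      (product_topology (\<lambda>N. discrete_topology (carrier (G Mod N))) (finite_index_normal G))
      (carrier (profinite_completion G))"

definition to_completion :: "('a, 'b) monoid_scheme \<Rightarrow> 'a \<Rightarrow> 'a set \<Rightarrow> 'a set" where
  "to_completion G g = (\<lambda>N \<in> finite_index_normal G. N #>\<^bsub>G\<^esub> g)"

text \<open>The map of completions induced by a homomorphism \<open>h\<close>.\<close>

definition completion_map ::
  "('a, 'c) monoid_scheme \<Rightarrow> ('b, 'd) monoid_scheme \<Rightarrow> ('a \<Rightarrow> 'b) \<Rightarrow>
    ('a set \<Rightarrow> 'a set) \<Rightarrow> 'b set \<Rightarrow> 'b set" where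
  "completion_map G H h g =
    (\<lambda>M \<in> finite_index_normal H. \<Union>a \<in> g {a \<in> carrier G. h a \<in> M}. M #>\<^bsub>H\<^esub> h a)"

text \<open>The ring of profinite integers, as the inverse limit of the rings of integers modulo \<open>n\<close>;
  residues are represented in \<open>{0..<n}\<close>.\<close>

definition Zhat :: "(nat \<Rightarrow> int) set" where
  "Zhat = {a \<in> carrier (product_group {1..} integer_mod_group).
    \<forall>m \<ge> 1. \<forall>n \<ge> 1. m dvd n \<longrightarrow> a n mod int m = a m}"

definition Zhat_of_residues :: "(nat \<Rightarrow> int) \<Rightarrow> nat \<Rightarrow> int" where
  "Zhat_of_residues a = (\<lambda>n \<in> {1..}. a n mod int n)"

text \<open>Powers with profinite exponents: in the finite group \<open>G Mod N\<close>, only the residue of the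
  exponent modulo the order of this group matters.\<close>

definition completion_pow ::
  "('a, 'b) monoid_scheme \<Rightarrow> ('a set \<Rightarrow> 'a set) \<Rightarrow> (nat \<Rightarrow> int) \<Rightarrow> 'a set \<Rightarrow> 'a set" where
  "completion_pow G g a =
    (\<lambda>N \<in> finite_index_normal G. g N [^]\<^bsub>G Mod N\<^esub> a (order (G Mod N)))"


section \<open>The group \<open>GT_hat\<close>\<close>

type_synonym hat_pair = "(nat \<Rightarrow> int) \<times> (nat word set set \<Rightarrow> nat word set set)"

definition hexagons_hat :: "hat_pair \<Rightarrow> bool" where
  "hexagons_hat T \<longleftrightarrow>
    (let G = profinite_completion (B 3);
         s1 = to_completion (B 3) (sigma 3 1);
         s2 = to_completion (B 3) (sigma 3 2);
         pow_m = (\<lambda>w. completion_pow (B 3) (to_completion (B 3) w) (fst T));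
         x12 = pow_m (pure_gen 3 1 2); x23 = pow_m (pure_gen 3 2 3); c = pow_m central_c;
         f = completion_map F2 (B 3) F2_emb (snd T)
     in
      s1 \<otimes>\<^bsub>G\<^esub> x12 \<otimes>\<^bsub>G\<^esub> inv\<^bsub>G\<^esub> f \<otimes>\<^bsub>G\<^esub> s2 \<otimes>\<^bsub>G\<^esub> x23 \<otimes>\<^bsub>G\<^esub> f
      = inv\<^bsub>G\<^esub> f \<otimes>\<^bsub>G\<^esub> s1 \<otimes>\<^bsub>G\<^esub> s2 \<otimes>\<^bsub>G\<^esub> inv\<^bsub>G\<^esub> x12 \<otimes>\<^bsub>G\<^esub> c
      \<and>
      inv\<^bsub>G\<^esub> f \<otimes>\<^bsub>G\<^esub> s2 \<otimes>\<^bsub>G\<^esub> x23 \<otimes>\<^bsub>G\<^esub> f \<otimes>\<^bsub>G\<^esub> s1 \<otimes>\<^bsub>G\<^esub> x12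
      = s2 \<otimes>\<^bsub>G\<^esub> s1 \<otimes>\<^bsub>G\<^esub> inv\<^bsub>G\<^esub> x23 \<otimes>\<^bsub>G\<^esub> c \<otimes>\<^bsub>G\<^esub> f)"

definition pentagon_hat :: "hat_pair \<Rightarrow> bool" where
  "pentagon_hat T \<longleftrightarrow>
    (let G = profinite_completion (PB 4);
         f = completion_map F2 (PB 3) F2_emb (snd T);
         hat = completion_map (PB 3) (PB 4)
     in
      hat phi_234 f \<otimes>\<^bsub>G\<^esub> hat phi_1_23_4 f \<otimes>\<^bsub>G\<^esub> hat phi_123 f
      = hat phi_1_2_34 f \<otimes>\<^bsub>G\<^esub> hat phi_12_3_4 f)"

text \<open>The continuous endomorphism of the completion of \<^const>\<open>F2\<close> that sends \<open>x\<close> to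
  \<open>x\<^sup>2\<^sup>m\<^sup>+\<^sup>1\<close> and \<open>y\<close> to \<open>f\<^sup>-\<^sup>1 y\<^sup>2\<^sup>m\<^sup>+\<^sup>1 f\<close>, where \<open>T = (m, f)\<close>.\<close>

definition hat_endo ::
  "hat_pair \<Rightarrow> (nat word set set \<Rightarrow> nat word set set) \<Rightarrow> nat word set set \<Rightarrow> nat word set set" where
  "hat_endo T =
    (let G = profinite_completion F2;
         x = to_completion F2 F2_x; y = to_completion F2 F2_y;
         a = Zhat_of_residues (\<lambda>n. 2 * fst T n + 1); f = snd T
     in THE E. E \<in> hom G G \<and> E \<in> extensional (carrier G) \<and>
          continuous_map (profinite_topology F2) (profinite_topology F2) E \<and>
          E x = completion_pow F2 x a \<and>
          E y = inv\<^bsub>G\<^esub> f \<otimes>\<^bsub>G\<^esub> completion_pow F2 y a \<otimes>\<^bsub>G\<^esub> f)"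

definition GT_hat_monoid :: "hat_pair monoid" where
  "GT_hat_monoid =
    \<lparr> carrier = {T \<in> Zhat \<times> carrier (profinite_completion F2). hexagons_hat T \<and> pentagon_hat T},
      mult = (\<lambda>T1 T2.
        (Zhat_of_residues (\<lambda>n. 2 * fst T1 n * fst T2 n + fst T1 n + fst T2 n),
         snd T1 \<otimes>\<^bsub>profinite_completion F2\<^esub> hat_endo T1 (snd T2))),
      one = (Zhat_of_residues (\<lambda>n. 0), \<one>\<^bsub>profinite_completion F2\<^esub>) \<rparr>"

definition GT_hat :: "hat_pair monoid" where
  "GT_hat = units_of GT_hat_monoid"

text \<open>The GT-shadow \<open>T\<^sub>N\<close>.\<close>

definition reduction :: "nat word set set \<Rightarrow> hat_pair \<Rightarrow> shadow" where
  "reduction N T =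
    ({k. [k = fst T (N_ord N)] (mod int (N_ord N))},
     completion_map F2 (PB 3) F2_emb (snd T) (N_PB3 N))"

definition NFI_act :: "nat word set set \<Rightarrow> hat_pair \<Rightarrow> nat word set set" where
  "NFI_act N T = kernel (PB 4) (PB 4 Mod N) (shadow_PB4 N (reduction N T))"

definition GT_hat_NFI :: "(nat word set set, hat_pair) category_data" where
  "GT_hat_NFI =
    \<lparr> Obj = NFI_PB4,
      Hom = (\<lambda>N1 N2. {T \<in> carrier GT_hat. NFI_act N2 T = N1}),
      Id = (\<lambda>N. \<one>\<^bsub>GT_hat\<^esub>),
      Comp = (\<lambda>N1 N2 N3 S T. S \<otimes>\<^bsub>GT_hat\<^esub> T) \<rparr>"

end

theory Submission
  imports Defs
begin

text \<open>Let \<open>(m, f)\<close> satisfy the hexagon relations modulo \<open>N_PB3 N\<close> and the pentagon relation modulo \<open>N\<close>.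
  The hexagons give a homomorphism \<open>T3\<close> from \<open>B 3\<close> to its quotient by \<open>N_PB3 N\<close>, and together with the
  pentagon a homomorphism \<open>T4\<close> from \<open>B 4\<close> to its quotient by \<open>N\<close>.  The homomorphisms \<open>PB 3 \<rightarrow> PB 4\<close> double
  a strand or add one; since \<open>T3\<close> and \<open>T4\<close> raise full twists to the power \<open>2 m + 1\<close>, they are intertwined
  by these homomorphisms up to conjugation.  Therefore the kernel of \<open>T4\<close> on \<open>PB 4\<close> is again an object,
  its \<open>N_PB3\<close> is the kernel of \<open>T3\<close> on \<open>PB 3\<close>, and such pairs compose.

  A profinite pair satisfies the relations in the completions iff all its reductions satisfy them,
  because the objects are cofinal among the finite index normal subgroups of \<open>PB 4\<close> (take cores in \<open>B 4\<close>)
  and the subgroups \<open>N_PB3 N\<close> among those of \<open>B 3\<close> (pull back along a retraction \<open>B 4 \<rightarrow> B 3\<close>).  Reduction is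
  compatible with composition, which yields the action law and the functor; for an invertible pair, the
  composite with the inverse has trivial reduction, hence conditions (iii) and (iv) hold.\<close>

section \<open>Presented groups\<close>

text \<open>The face maps exist only on \<open>PB 3\<close>, while the hexagons live in
  \<open>B 3\<close>, so it is not evident that \<open>N_PB3 N\<close> is normal in
  \<open>B 3\<close>. All five maps are therefore extended to \<open>B 3\<close>: two become
  homomorphisms to \<open>B 4\<close>, the other three become doublings of a strand, multiplicative
  only up to the permutation of the end points. Conjugation by a braid permutes the three doublings,
  which gives normality. For \<open>T4\<close>, the hexagons provide the braid relation of the last
  two images only for a conjugate of the shifted pair; the pentagon says that this conjugate
  contains the prescribed image of \<sigma>_3. More generally, the conjugating element attached to a
  face is the product of the factors to its right in the pentagon, and for this reason pentagons can
  be composed. The integer of a shadow is known only modulo \<open>N_ord\<close>, and in a composite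
  the second integer only modulo \<open>N_ord\<close> of the source N'. The composite is well
  defined because \<open>N_ord N\<close> divides (2 m + 1) times \<open>N_ord N'\<close>, as
  \<open>T3\<close> multiplies exponents by 2 m + 1.\<close>

declare in_lists_conv_set [simp del] and in_listsD [rule del] and in_listsI [rule del]

lemma in_lists_times_UNIV [simp]: "w \<in> lists (S \<times> UNIV) \<longleftrightarrow> (\<forall>x\<in>set w. fst x \<in> S)"
  by (auto simp: in_lists_conv_set)

lemma word_eq_lists:
  assumes "word_eq S R u v"
  shows "u \<in> lists (S \<times> UNIV)" "v \<in> lists (S \<times> UNIV)"
proof -
  have "u \<in> lists (S \<times> UNIV) \<and> v \<in> lists (S \<times> UNIV)"
    using assms by induct auto
  then show "u \<in> lists (S \<times> UNIV)" "v \<in> lists (S \<times> UNIV)" by auto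
qed

lemma word_class_eqI: "word_eq S R u v \<Longrightarrow> word_class S R u = word_class S R v"
  unfolding word_class_def by (blast intro: word_eq.sym word_eq.trans)

lemma word_class_self: "w \<in> lists (S \<times> UNIV) \<Longrightarrow> w \<in> word_class S R w"
  by (simp add: word_class_def word_eq.refl)

lemma word_class_carrier:
  "w \<in> lists (S \<times> UNIV) \<Longrightarrow> word_class S R w \<in> carrier (presented_group S R)"
  by (simp add: presented_group_def)

lemma word_class_mult:
  assumes "u \<in> lists (S \<times> UNIV)" "v \<in> lists (S \<times> UNIV)"
  shows "word_class S R u \<otimes>\<^bsub>presented_group S R\<^esub> word_class S R v = word_class S R (u @ v)"
proof -
  have "word_class S R (u' @ v') = word_class S R (u @ v)"
    if "u' \<in> word_class S R u" "v' \<in> word_class S R v" for u' v'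
    using that by (metis mem_Collect_eq word_class_def word_class_eqI word_eq.append)
  then have "word_class S R u \<otimes>\<^bsub>presented_group S R\<^esub> word_class S R v
      = (\<Union>u'\<in>word_class S R u. \<Union>v'\<in>word_class S R v. word_class S R (u @ v))"
    by (simp add: presented_group_def)
  then show ?thesis
    using word_class_self[OF assms(1), of R] word_class_self[OF assms(2), of R] by blast
qed

lemma word_class_one: "\<one>\<^bsub>presented_group S R\<^esub> = word_class S R []"
  by (simp add: presented_group_def)

definition inverse_word :: "'a word \<Rightarrow> 'a word" where
  "inverse_word w = rev (map (\<lambda>(a, b). (a, \<not> b)) w)"

lemma inverse_word_lists: "w \<in> lists (S \<times> UNIV) \<Longrightarrow> inverse_word w \<in> lists (S \<times> UNIV)"
  by (force simp: inverse_word_def)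

lemma inverse_word_cancel:
  "w \<in> lists (S \<times> UNIV) \<Longrightarrow> word_eq S R (inverse_word w @ w) []"
proof (induct w)
  case Nil
  then show ?case by (simp add: inverse_word_def word_eq.refl)
next
  case (Cons l w)
  obtain a b where l: "l = (a, b)" by (cases l)
  have w: "w \<in> lists (S \<times> UNIV)" and a: "a \<in> S" using Cons l by auto
  have "word_eq S R ([(a, \<not> b)] @ [(a, \<not> \<not> b)]) []"
    using word_eq.cancel[OF a, of R "\<not> b"] by simp
  then have "word_eq S R (inverse_word w @ ([(a, \<not> b)] @ [(a, b)]) @ w) (inverse_word w @ [] @ w)"
    by (intro word_eq.append word_eq.refl w inverse_word_lists) simp_all
  then show ?case
    using Cons(1)[OF w] by (auto simp: l inverse_word_def intro: word_eq.trans)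
qed

lemma presented_groupE:
  assumes "X \<in> carrier (presented_group S R)"
  obtains w where "w \<in> lists (S \<times> UNIV)" "X = word_class S R w"
  using assms by (auto simp: presented_group_def)

lemma group_presented_group: "group (presented_group S R)"
proof (rule groupI)
  fix X assume "X \<in> carrier (presented_group S R)"
  then obtain w where w: "w \<in> lists (S \<times> UNIV)" "X = word_class S R w"
    by (rule presented_groupE)
  then show "\<exists>Y\<in>carrier (presented_group S R). Y \<otimes>\<^bsub>presented_group S R\<^esub> X = \<one>\<^bsub>presented_group S R\<^esub>"
    using inverse_word_lists[OF w(1)] word_class_eqI[OF inverse_word_cancel[OF w(1), of R]]
    by (intro bexI[of _ "word_class S R (inverse_word w)"])
      (simp_all add: word_class_mult word_class_one word_class_carrier)
qed (auto elim!: presented_groupE simp: word_class_mult word_class_one word_class_carrier ball_Un)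

lemma word_class_inv:
  assumes "w \<in> lists (S \<times> UNIV)"
  shows "inv\<^bsub>presented_group S R\<^esub> word_class S R w = word_class S R (inverse_word w)"
  using assms inverse_word_lists[OF assms] word_class_eqI[OF inverse_word_cancel[OF assms, of R]]
  by (intro group.inv_equality[OF group_presented_group])
    (simp_all add: word_class_mult word_class_one word_class_carrier)

section \<open>Evaluation of words and maps out of presented groups\<close>

definition word_eval :: "('b, 'd) monoid_scheme \<Rightarrow> ('a \<Rightarrow> 'b) \<Rightarrow> 'a word \<Rightarrow> 'b" where
  "word_eval H v w =
    foldr (\<lambda>(a, b) h. (if b then v a else inv\<^bsub>H\<^esub> v a) \<otimes>\<^bsub>H\<^esub> h) w \<one>\<^bsub>H\<^esub>"

lemma word_eval_simps [simp]:
  "word_eval H v [] = \<one>\<^bsub>H\<^esub>"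
  "word_eval H v ((a, b) # w) = (if b then v a else inv\<^bsub>H\<^esub> v a) \<otimes>\<^bsub>H\<^esub> word_eval H v w"
  by (simp_all add: word_eval_def)

context group begin

lemma word_eval_closed:
  assumes "v \<in> S \<rightarrow> carrier G" "w \<in> lists (S \<times> UNIV)"
  shows "word_eval G v w \<in> carrier G"
  using assms(2) by (induct w) (use assms(1) in \<open>auto simp: Pi_iff\<close>)

lemma word_eval_append:
  assumes "v \<in> S \<rightarrow> carrier G" "u \<in> lists (S \<times> UNIV)" "w \<in> lists (S \<times> UNIV)"
  shows "word_eval G v (u @ w) = word_eval G v u \<otimes> word_eval G v w"
  using assms(2)
proof (induct u)
  case (Cons l u)
  then show ?case using assms(1,3) word_eval_closed[OF assms(1)]
    by (cases l) (auto simp: m_assoc Pi_iff)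
qed (simp add: word_eval_closed[OF assms(1,3)])

lemma word_eval_cong:
  assumes v: "v \<in> S \<rightarrow> carrier G"
    and R: "\<And>r s. (r, s) \<in> R \<Longrightarrow> word_eval G v r = word_eval G v s"
    and "word_eq S R u w"
  shows "word_eval G v u = word_eval G v w"
  using assms(3)
proof induct
  case (append u u' w w')
  then show ?case
    using word_eq_lists[OF append(1)] word_eq_lists[OF append(3)] by (simp add: word_eval_append[OF v])
next
  case (cancel a b)
  then show ?case using v by (cases b) (auto simp: Pi_iff)
qed (use R in auto)

text \<open>This is von Dyck's theorem: evaluation is constant on classes by
  \<open>word_eval_cong\<close>, so the value at an arbitrarily chosen word of a class is the value
  at each of its words.\<close>

lemma presented_group_hom:
  assumes v: "v \<in> S \<rightarrow> carrier G"
    and R: "\<And>r s. (r, s) \<in> R \<Longrightarrow> word_eval G v r = word_eval G v s"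
  obtains h where "h \<in> hom (presented_group S R) G"
    and "\<And>w. w \<in> lists (S \<times> UNIV) \<Longrightarrow> h (word_class S R w) = word_eval G v w"
    and "\<And>a. a \<in> S \<Longrightarrow> h (word_class S R [(a, True)]) = v a"
proof -
  define h where "h X = word_eval G v (SOME w. w \<in> X)" for X
  have h: "h (word_class S R w) = word_eval G v w" if "w \<in> lists (S \<times> UNIV)" for w
  proof -
    have "(SOME u. u \<in> word_class S R w) \<in> word_class S R w"
      using word_class_self[OF that] by (rule someI)
    then have "word_eq S R w (SOME u. u \<in> word_class S R w)"
      by (simp add: word_class_def)
    from word_eval_cong[OF v _ this] R show ?thesis by (simp add: h_def)
  qed
  show thesis
  proof
    show "h \<in> hom (presented_group S R) G"
      by (rule homI)
        (auto elim!: presented_groupE simp: h word_class_mult word_eval_append[OF v] word_eval_closed[OF v] ball_Un)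
    show "h (word_class S R [(a, True)]) = v a" if "a \<in> S" for a
      using that v by (subst h) (auto simp: Pi_iff)
  qed (rule h)
qed

end

lemma generate_presented_group:
  "generate (presented_group S R) ((\<lambda>a. word_class S R [(a, True)]) ` S) = carrier (presented_group S R)"
  (is "generate ?P ?A = _")
proof
  interpret group ?P by (rule group_presented_group)
  have A: "?A \<subseteq> carrier ?P" by (auto intro!: word_class_carrier)
  then show "generate ?P ?A \<subseteq> carrier ?P" using generate_in_carrier by blast
  have "word_class S R w \<in> generate ?P ?A" if "w \<in> lists (S \<times> UNIV)" for w
    using that
  proof (induct w)
    case Nil
    then show ?case using generate.one[of ?P ?A] by (simp add: word_class_one)
  next
    case (Cons l w)
    obtain a b where l: "l = (a, b)" by (cases l)
    with Cons have a: "a \<in> S" "w \<in> lists (S \<times> UNIV)" by auto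
    have "inv\<^bsub>?P\<^esub> word_class S R [(a, True)] = word_class S R [(a, False)]"
      using a by (subst word_class_inv) (auto simp: inverse_word_def)
    then have "word_class S R [l] \<in> generate ?P ?A"
      using a l generate.inv[of "word_class S R [(a, True)]" ?A ?P]
      by (cases b) (auto intro: generate.incl)
    moreover have "word_class S R (l # w) = word_class S R [l] \<otimes>\<^bsub>?P\<^esub> word_class S R w"
      using a l by (subst word_class_mult) auto
    ultimately show ?case using Cons by (auto intro: generate.eng)
  qed
  then show "carrier ?P \<subseteq> generate ?P ?A" by (auto elim!: presented_groupE)
qed

section \<open>Homomorphisms determined by their values on generators\<close>

lemma hom_eq_on_generate:
  assumes "group G" "group H" "f \<in> hom G H" "g \<in> hom G H" "A \<subseteq> carrier G"
    and "\<And>a. a \<in> A \<Longrightarrow> f a = g a" and "x \<in> generate G A"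
  shows "f x = g x"
proof -
  interpret G: group G by fact
  interpret f: group_hom G H f using assms by (simp add: group_hom_def group_hom_axioms_def)
  interpret g: group_hom G H g using assms by (simp add: group_hom_def group_hom_axioms_def)
  show ?thesis using assms(7)
  proof induct
    case (inv h)
    then show ?case using assms(5,6) by (metis f.hom_inv g.hom_inv subsetD)
  next
    case (eng h k)
    then show ?case using G.generate_in_carrier[OF assms(5)] by simp
  qed (use assms in auto)
qed

text \<open>Resolves the definite description in \<open>hom_with_values\<close>. Uniqueness holds
  because the listed elements generate \<open>G\<close>; the description asks for an extensional
  function, hence the restriction.\<close>

lemma hom_with_values_eq:
  assumes "group G" "group H" "h \<in> hom G H" "generate G (fst ` set vals) = carrier G"
    and "\<And>g v. (g, v) \<in> set vals \<Longrightarrow> h g = v"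
  shows "hom_with_values G H vals = restrict h (carrier G)"
  unfolding hom_with_values_def
proof (rule the_equality)
  interpret group G by fact
  have sub: "fst ` set vals \<subseteq> carrier G"
    using generate.incl[of _ "fst ` set vals" G] assms(4) by blast
  then have sub': "g \<in> carrier G" if "(g, v) \<in> set vals" for g v
    using that by force
  have r: "restrict h (carrier G) \<in> hom G H"
    using assms(3) by (auto simp: hom_def Pi_iff)
  then show "restrict h (carrier G) \<in> hom G H \<and> restrict h (carrier G) \<in> extensional (carrier G) \<and>
    (\<forall>(g, v)\<in>set vals. restrict h (carrier G) g = v)"
    using assms(5) sub' by auto
  fix k assume k: "k \<in> hom G H \<and> k \<in> extensional (carrier G) \<and> (\<forall>(g, v)\<in>set vals. k g = v)"
  show "k = restrict h (carrier G)"
  proof (rule extensionalityI[of _ "carrier G"])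
    fix x assume x: "x \<in> carrier G"
    show "k x = restrict h (carrier G) x"
      by (rule hom_eq_on_generate[OF assms(1,2) _ r sub])
        (use k x assms(4,5) sub' in \<open>auto split: prod.splits\<close>)
  qed (use k in auto)
qed

section \<open>Pairs of elements satisfying the braid relation\<close>

context group begin

lemma inv_mult_cancel [simp]:
  assumes "x \<in> carrier G" "y \<in> carrier G"
  shows "inv x \<otimes> (x \<otimes> y) = y" "x \<otimes> (inv x \<otimes> y) = y"
  using assms by (simp_all flip: m_assoc)

lemma conj_int_pow:
  assumes "b \<in> carrier G" "g \<in> carrier G"
  shows "(inv g \<otimes> b \<otimes> g) [^] (k::int) = inv g \<otimes> b [^] k \<otimes> g"
proof -
  interpret conj: group_hom G G "\<lambda>b. inv g \<otimes> b \<otimes> g"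
  proof
    have "inv g \<otimes> (x \<otimes> y) \<otimes> g = inv g \<otimes> x \<otimes> g \<otimes> (inv g \<otimes> y \<otimes> g)"
      if "x \<in> carrier G" "y \<in> carrier G" for x y
      using that assms(2) by (simp add: m_assoc)
    then show "(\<lambda>b. inv g \<otimes> b \<otimes> g) \<in> hom G G"
      using assms(2) by (auto intro: homI)
  qed
  show ?thesis using conj.hom_int_pow[OF assms(1), of k] by simp
qed

lemma int_pow_intertwine:
  assumes "a \<in> carrier G" "b \<in> carrier G" "z \<in> carrier G" "a \<otimes> z = z \<otimes> b"
  shows "a [^] (k::int) \<otimes> z = z \<otimes> b [^] k"
proof -
  have "b = inv z \<otimes> a \<otimes> z"
    using assms by (simp add: m_assoc)
  then have "b [^] k = inv z \<otimes> a [^] k \<otimes> z"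
    using assms conj_int_pow by simp
  then show ?thesis using assms by (simp add: m_assoc[symmetric])
qed

lemma square_int_pow:
  "a \<in> carrier G \<Longrightarrow> (a \<otimes> a) [^] (k::int) = a [^] (2 * k)"
  using int_pow_pow[of a 2 k] by (simp add: int_pow_mult[of a 1 1, simplified])

lemma int_pow_commute:
  "a \<in> carrier G \<Longrightarrow> b \<in> carrier G \<Longrightarrow> a \<otimes> b = b \<otimes> a \<Longrightarrow> a [^] (k::int) \<otimes> b = b \<otimes> a [^] k"
  by (rule int_pow_intertwine)

end

text \<open>This is the word x_23 x_12 x_13 of \<open>central_c\<close>, with \<open>a\<close> and
  \<open>b\<close> for \<sigma>_1 and \<sigma>_2. For a braid pair it is the square of the half
  twist a b a.\<close>

definition full_twist :: "('a, 'b) monoid_scheme \<Rightarrow> 'a \<Rightarrow> 'a \<Rightarrow> 'a" where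
  "full_twist G a b = b \<otimes>\<^bsub>G\<^esub> b \<otimes>\<^bsub>G\<^esub> (a \<otimes>\<^bsub>G\<^esub> a) \<otimes>\<^bsub>G\<^esub> (b \<otimes>\<^bsub>G\<^esub> (a \<otimes>\<^bsub>G\<^esub> a) \<otimes>\<^bsub>G\<^esub> inv\<^bsub>G\<^esub> b)"

text \<open>The two hexagon relations with \<sigma>_1 x_12^m contracted to a^(2m+1) and \<sigma>_2
  x_23^m to b^(2m+1). Stated in any group, they can be carried along homomorphisms and imposed on
  other braid pairs.\<close>

definition hexagons :: "('a, 'b) monoid_scheme \<Rightarrow> 'a \<Rightarrow> 'a \<Rightarrow> int \<Rightarrow> 'a \<Rightarrow> bool" where
  "hexagons G a b m g \<longleftrightarrow>
    a [^]\<^bsub>G\<^esub> (2 * m + 1) \<otimes>\<^bsub>G\<^esub> (inv\<^bsub>G\<^esub> g \<otimes>\<^bsub>G\<^esub> b [^]\<^bsub>G\<^esub> (2 * m + 1) \<otimes>\<^bsub>G\<^esub> g)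
      = inv\<^bsub>G\<^esub> g \<otimes>\<^bsub>G\<^esub> (a \<otimes>\<^bsub>G\<^esub> b) \<otimes>\<^bsub>G\<^esub> a [^]\<^bsub>G\<^esub> (- 2 * m) \<otimes>\<^bsub>G\<^esub> full_twist G a b [^]\<^bsub>G\<^esub> m \<and>
    (inv\<^bsub>G\<^esub> g \<otimes>\<^bsub>G\<^esub> b [^]\<^bsub>G\<^esub> (2 * m + 1) \<otimes>\<^bsub>G\<^esub> g) \<otimes>\<^bsub>G\<^esub> a [^]\<^bsub>G\<^esub> (2 * m + 1)
      = b \<otimes>\<^bsub>G\<^esub> a \<otimes>\<^bsub>G\<^esub> b [^]\<^bsub>G\<^esub> (- 2 * m) \<otimes>\<^bsub>G\<^esub> full_twist G a b [^]\<^bsub>G\<^esub> m \<otimes>\<^bsub>G\<^esub> g"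

locale braid_pair = group +
  fixes a b
  assumes a [simp, intro]: "a \<in> carrier G" and b [simp, intro]: "b \<in> carrier G"
    and braid: "a \<otimes> b \<otimes> a = b \<otimes> a \<otimes> b"
begin

lemma braid': "a \<otimes> (b \<otimes> a) = b \<otimes> (a \<otimes> b)"
  using braid by (simp add: m_assoc)

lemma braid'': "z \<in> carrier G \<Longrightarrow> a \<otimes> (b \<otimes> (a \<otimes> z)) = b \<otimes> (a \<otimes> (b \<otimes> z))"
  using braid by (simp flip: m_assoc)

abbreviation D where "D \<equiv> a \<otimes> b \<otimes> a"

lemma a_D: "a \<otimes> D = D \<otimes> b"
  by (metis a b braid m_assoc m_closed)

lemma b_D: "b \<otimes> D = D \<otimes> a"
  by (metis a b braid m_assoc m_closed)

lemma full_twist_closed [simp, intro]: "full_twist G a b \<in> carrier G"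
  by (simp add: full_twist_def)

text \<open>For \<sigma>_1 and \<sigma>_2 both sides are words for the pure generator x_13.
  Switching between them lets inverses cancel against neighbouring squares.\<close>

lemma inv_conj_square: "inv a \<otimes> (b \<otimes> b) \<otimes> a = b \<otimes> (a \<otimes> a) \<otimes> inv b"
proof -
  have "b \<otimes> (b \<otimes> (a \<otimes> b)) = a \<otimes> (b \<otimes> (a \<otimes> a))"
    using braid' braid'' by (metis a b m_assoc m_closed)
  then have "inv a \<otimes> (b \<otimes> (b \<otimes> (a \<otimes> b))) = b \<otimes> (a \<otimes> a)"
    by simp
  then have "inv a \<otimes> (b \<otimes> b) \<otimes> a \<otimes> b = b \<otimes> (a \<otimes> a)"
    by (simp add: m_assoc)
  then show ?thesis
    by (metis a b inv_closed inv_solve_right m_closed)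
qed

text \<open>With the last factor written as a^-1 b^2 a, the inverse cancels and a positive word of
  length six remains, to which the braid relation applies.\<close>

lemma full_twist_eq: "full_twist G a b = D \<otimes> D"
proof -
  have "full_twist G a b = b \<otimes> b \<otimes> (a \<otimes> a) \<otimes> (inv a \<otimes> (b \<otimes> b) \<otimes> a)"
    by (simp add: full_twist_def inv_conj_square)
  also have "\<dots> = b \<otimes> (b \<otimes> (a \<otimes> (b \<otimes> (b \<otimes> a))))"
    by (simp add: m_assoc[symmetric]) (simp add: m_assoc)
  also have "\<dots> = b \<otimes> (a \<otimes> (b \<otimes> (a \<otimes> (b \<otimes> a))))"
    by (simp add: braid'')
  also have "\<dots> = D \<otimes> D"
    using braid by (simp add: m_assoc[symmetric])
  finally show ?thesis .
qed

text \<open>Geometrically, a doubled strand winds once around a third strand and is then twisted in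
  itself by a full turn. \<open>cable_full_twists\<close> uses the left-hand sides in this
  way.\<close>

lemma full_twist_eqs:
  "b \<otimes> (a \<otimes> a) \<otimes> b \<otimes> (a \<otimes> a) = full_twist G a b"
  "a \<otimes> (b \<otimes> b) \<otimes> a \<otimes> (b \<otimes> b) = full_twist G a b"
proof -
  have "b \<otimes> (a \<otimes> (a \<otimes> (b \<otimes> (a \<otimes> a)))) = a \<otimes> (b \<otimes> (a \<otimes> (a \<otimes> (b \<otimes> a))))"
    by (metis a b braid' braid'' m_closed)
  then show "b \<otimes> (a \<otimes> a) \<otimes> b \<otimes> (a \<otimes> a) = full_twist G a b"
    by (simp add: full_twist_eq m_assoc)
  have "a \<otimes> (b \<otimes> (b \<otimes> (a \<otimes> (b \<otimes> b)))) = a \<otimes> (b \<otimes> (a \<otimes> (a \<otimes> (b \<otimes> a))))"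
    by (metis a b braid' braid'' m_closed)
  then show "a \<otimes> (b \<otimes> b) \<otimes> a \<otimes> (b \<otimes> b) = full_twist G a b"
    by (simp add: full_twist_eq m_assoc)
qed

lemma full_twist_commute:
  "a \<otimes> full_twist G a b = full_twist G a b \<otimes> a"
  "b \<otimes> full_twist G a b = full_twist G a b \<otimes> b"
proof -
  show "a \<otimes> full_twist G a b = full_twist G a b \<otimes> a"
    unfolding full_twist_eq using a_D b_D by (metis a b m_assoc m_closed)
  show "b \<otimes> full_twist G a b = full_twist G a b \<otimes> b"
    unfolding full_twist_eq using a_D b_D by (metis a b m_assoc m_closed)
qed

lemma hom_full_twist:
  "h \<in> hom G H \<Longrightarrow> group H \<Longrightarrow> h (full_twist G a b) = full_twist H (h a) (h b)"
proof -
  assume "h \<in> hom G H" "group H"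
  then interpret h: group_hom G H h
    by (simp add: group_hom_def group_hom_axioms_def is_group)
  show ?thesis by (simp add: full_twist_def)
qed

end

locale hexagon_pair = braid_pair +
  fixes m :: int and g
  assumes g [simp, intro]: "g \<in> carrier G" and hex: "hexagons G a b m g"
begin

abbreviation c where "c \<equiv> full_twist G a b"
definition a' where "a' = a [^] (2 * m + 1)"
definition b' where "b' = inv g \<otimes> b [^] (2 * m + 1) \<otimes> g"

lemma ab'_closed [simp, intro]: "a' \<in> carrier G" "b' \<in> carrier G"
  by (simp_all add: a'_def b'_def)

lemma a_c: "a \<otimes> c [^] (k::int) = c [^] k \<otimes> a" and b_c: "b \<otimes> c [^] (k::int) = c [^] k \<otimes> b"
  by (simp_all add: full_twist_commute int_pow_commute)

lemma c_a: "c [^] (k::int) \<otimes> a [^] (l::int) = a [^] l \<otimes> c [^] k"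
  and c_b: "c [^] (k::int) \<otimes> b [^] (l::int) = b [^] l \<otimes> c [^] k"
  by (simp_all add: int_pow_commute a_c b_c)

lemma hex1: "a' \<otimes> b' = inv g \<otimes> (a \<otimes> b) \<otimes> a [^] (- 2 * m) \<otimes> c [^] m"
  and hex2: "b' \<otimes> a' = b \<otimes> a \<otimes> b [^] (- 2 * m) \<otimes> c [^] m \<otimes> g"
  using hex by (simp_all add: hexagons_def a'_def b'_def)

text \<open>When the first hexagon is multiplied by a^(2m+1) on the right, the powers of
  \<open>a\<close> collapse to a single \<open>a\<close>, because \<open>c\<close> commutes with
  \<open>a\<close>.\<close>

lemma half_twist1: "a' \<otimes> b' \<otimes> a' = inv g \<otimes> D \<otimes> c [^] m"
proof -
  have "a' \<otimes> b' \<otimes> a' = inv g \<otimes> (a \<otimes> b) \<otimes> (a [^] (- 2 * m) \<otimes> (c [^] m \<otimes> a [^] (2 * m + 1)))"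
    by (simp add: hex1 m_assoc) (simp add: a'_def)
  also have "\<dots> = inv g \<otimes> (a \<otimes> b) \<otimes> ((a [^] (- 2 * m) \<otimes> a [^] (2 * m + 1)) \<otimes> c [^] m)"
    by (simp add: c_a m_assoc)
  also have "a [^] (- 2 * m) \<otimes> a [^] (2 * m + 1) = a"
    by (simp flip: int_pow_mult)
  finally show ?thesis by (simp add: m_assoc)
qed

lemma b_pow_ab: "b [^] (k::int) \<otimes> (a \<otimes> b) = a \<otimes> b \<otimes> a [^] k"
  and a_pow_ba: "a [^] (k::int) \<otimes> (b \<otimes> a) = b \<otimes> a \<otimes> b [^] k"
proof -
  show "b [^] k \<otimes> (a \<otimes> b) = a \<otimes> b \<otimes> a [^] k"
    by (rule int_pow_intertwine) (use braid in \<open>simp_all add: m_assoc\<close>)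
  show "a [^] k \<otimes> (b \<otimes> a) = b \<otimes> a \<otimes> b [^] k"
    by (rule int_pow_intertwine) (use braid in \<open>simp_all add: m_assoc\<close>)
qed

text \<open>Multiplying the first hexagon by \<open>b'\<close> on the left gives the same element as
  multiplying it by \<open>a'\<close> on the right: b^k becomes a^k on passing a b.\<close>

lemma braid_ab': "a' \<otimes> b' \<otimes> a' = b' \<otimes> a' \<otimes> b'"
proof -
  have "b' \<otimes> (a' \<otimes> b') = inv g \<otimes> (b [^] (2 * m + 1) \<otimes> (a \<otimes> b)) \<otimes> a [^] (- 2 * m) \<otimes> c [^] m"
    by (simp add: hex1 m_assoc) (simp add: b'_def m_assoc )
  also have "\<dots> = inv g \<otimes> (a \<otimes> b) \<otimes> (a [^] (2 * m + 1) \<otimes> a [^] (- 2 * m)) \<otimes> c [^] m"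
    by (simp add: b_pow_ab m_assoc)
  also have "a [^] (2 * m + 1) \<otimes> a [^] (- 2 * m) = a"
    by (simp flip: int_pow_mult)
  finally show ?thesis by (simp add: half_twist1 m_assoc)
qed

sublocale pair': braid_pair G a' b'
  by unfold_locales (simp_all add: braid_ab')

lemma half_twist2: "a' \<otimes> b' \<otimes> a' = D \<otimes> c [^] m \<otimes> g"
proof -
  have "a' \<otimes> (b' \<otimes> a') = a [^] (2 * m + 1) \<otimes> (b \<otimes> a) \<otimes> b [^] (- 2 * m) \<otimes> c [^] m \<otimes> g"
    by (simp add: hex2 m_assoc) (simp add: a'_def m_assoc)
  also have "\<dots> = b \<otimes> a \<otimes> (b [^] (2 * m + 1) \<otimes> b [^] (- 2 * m)) \<otimes> c [^] m \<otimes> g"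
    by (simp add: a_pow_ba m_assoc)
  also have "b [^] (2 * m + 1) \<otimes> b [^] (- 2 * m) = b"
    by (simp flip: int_pow_mult)
  finally show ?thesis using braid by (simp add: m_assoc)
qed

text \<open>The half twist of the new pair has one expression ending in \<open>g\<close> and one
  beginning with its inverse. In their product \<open>g\<close> cancels and D c^m D c^m
  remains.\<close>

lemma full_twist': "full_twist G a' b' = c [^] (2 * m + 1)"
proof -
  have Dc: "c [^] m \<otimes> D = D \<otimes> c [^] m"
    by (rule int_pow_commute) (metis a b m_assoc m_closed full_twist_closed full_twist_commute)+
  have "full_twist G a' b' = D \<otimes> c [^] m \<otimes> g \<otimes> (inv g \<otimes> D \<otimes> c [^] m)"
    unfolding pair'.full_twist_eq using half_twist1 half_twist2 by simp
  also have "\<dots> = D \<otimes> (c [^] m \<otimes> D) \<otimes> c [^] m"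
    by (simp add: m_assoc)
  also have "\<dots> = c [^] (1::int) \<otimes> (c [^] m \<otimes> c [^] m)"
    by (simp add: Dc) (simp add: full_twist_eq m_assoc)
  also have "\<dots> = c [^] (2 * m + 1)"
    by (simp only: int_pow_mult[symmetric] full_twist_closed) (simp add: algebra_simps)
  finally show ?thesis .
qed

text \<open>The pair \<open>a'\<close>, \<open>b'\<close> takes the place of \<open>a\<close>,
  \<open>b\<close>, and its full twist is c^(2m+1) by \<open>full_twist'\<close>. Exponents combine
  through (2m+1)(2n+1), and powers of \<open>c\<close> move past all words in \<open>a\<close> and
  \<open>b\<close>.\<close>

lemma hexagons_compose:
  assumes e [simp]: "e \<in> carrier G" and "hexagons G a' b' n e"
  shows "hexagons G a b (2 * m * n + m + n) (g \<otimes> e)"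
proof -
  let ?k = "2 * m * n + m + n"
  interpret e: hexagon_pair G a' b' n e
    by unfold_locales (use assms in auto)
  have k: "(2 * m + 1) * (2 * n + 1) = 2 * ?k + 1" by (simp add: algebra_simps)
  have a'k: "a' [^] (l::int) = a [^] ((2 * m + 1) * l)" for l
    by (simp add: a'_def int_pow_pow)
  have b'k: "b' [^] (l::int) = inv g \<otimes> b [^] ((2 * m + 1) * l) \<otimes> g" for l
    by (simp add: b'_def conj_int_pow int_pow_pow)
  have c'k: "full_twist G a' b' [^] (l::int) = c [^] ((2 * m + 1) * l)" for l
    by (simp add: full_twist' int_pow_pow)
  have aa: "a [^] (2 * ?k + 1) = e.a'"
    by (simp add: e.a'_def a'k k)
  have bb: "inv (g \<otimes> e) \<otimes> b [^] (2 * ?k + 1) \<otimes> (g \<otimes> e) = e.b'"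
    by (simp add: e.b'_def b'k k inv_mult_group m_assoc)
  have "e.a' \<otimes> e.b' = inv e \<otimes> (a' \<otimes> b') \<otimes> a' [^] (- 2 * n) \<otimes> full_twist G a' b' [^] n"
    by (rule e.hex1)
  also have "\<dots> = inv e \<otimes> inv g \<otimes> (a \<otimes> b) \<otimes> (a [^] (- 2 * m) \<otimes> (c [^] m \<otimes> a [^] ((2 * m + 1) * (- 2 * n))) \<otimes> c [^] ((2 * m + 1) * n))"
    by (simp only: a'k c'k hex1) (simp add: m_assoc)
  also have "a [^] (- 2 * m) \<otimes> (c [^] m \<otimes> a [^] ((2 * m + 1) * (- 2 * n))) \<otimes> c [^] ((2 * m + 1) * n)
      = (a [^] (- 2 * m) \<otimes> a [^] ((2 * m + 1) * (- 2 * n))) \<otimes> (c [^] m \<otimes> c [^] ((2 * m + 1) * n))"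
    by (simp only: c_a) (simp add: m_assoc)
  also have "\<dots> = a [^] (- 2 * ?k) \<otimes> c [^] ?k"
    by (simp only: int_pow_mult[symmetric] full_twist_closed a) (simp add: algebra_simps)
  finally have 1: "e.a' \<otimes> e.b' = inv (g \<otimes> e) \<otimes> (a \<otimes> b) \<otimes> a [^] (- 2 * ?k) \<otimes> c [^] ?k"
    by (simp add: inv_mult_group m_assoc)
  have "b' [^] (- 2 * n) \<otimes> full_twist G a' b' [^] n = full_twist G a' b' [^] n \<otimes> b' [^] (- 2 * n)"
    by (simp only: e.c_b)
  then have "e.b' \<otimes> e.a' = b' \<otimes> a' \<otimes> (full_twist G a' b' [^] n \<otimes> b' [^] (- 2 * n)) \<otimes> e"
    using e.hex2 by (simp add: m_assoc)
  also have "\<dots> = full_twist G a' b' [^] n \<otimes> (b' \<otimes> a') \<otimes> b' [^] (- 2 * n) \<otimes> e"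
  proof -
    have "b' \<otimes> a' \<otimes> full_twist G a' b' [^] n = b' \<otimes> (full_twist G a' b' [^] n \<otimes> a')"
      by (simp only: m_assoc ab'_closed int_pow_closed pair'.full_twist_closed e.a_c)
    also have "\<dots> = full_twist G a' b' [^] n \<otimes> (b' \<otimes> a')"
      by (simp only: m_assoc[symmetric] ab'_closed int_pow_closed pair'.full_twist_closed e.b_c)
    finally have "b' \<otimes> a' \<otimes> full_twist G a' b' [^] n = full_twist G a' b' [^] n \<otimes> (b' \<otimes> a')" .
    moreover have "b' \<otimes> a' \<otimes> (full_twist G a' b' [^] n \<otimes> b' [^] (- 2 * n)) \<otimes> e
      = b' \<otimes> a' \<otimes> full_twist G a' b' [^] n \<otimes> b' [^] (- 2 * n) \<otimes> e"
      by (simp only: m_assoc m_closed ab'_closed int_pow_closed pair'.full_twist_closed e)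
    ultimately show ?thesis by simp
  qed
  also have "\<dots> = c [^] ((2 * m + 1) * n) \<otimes> (b \<otimes> a \<otimes> b [^] (- 2 * m) \<otimes> c [^] m) \<otimes> b [^] ((2 * m + 1) * (- 2 * n)) \<otimes> (g \<otimes> e)"
    by (simp only: b'k c'k hex2) (simp add: m_assoc)
  also have "\<dots> = b \<otimes> a \<otimes> (b [^] (- 2 * m) \<otimes> b [^] ((2 * m + 1) * (- 2 * n))) \<otimes> (c [^] ((2 * m + 1) * n) \<otimes> c [^] m) \<otimes> (g \<otimes> e)"
  proof -
    have "c [^] ((2 * m + 1) * n) \<otimes> (b \<otimes> a) = b \<otimes> a \<otimes> c [^] ((2 * m + 1) * n)"
      by (simp add: m_assoc[symmetric] b_c[symmetric]) (simp add: m_assoc a_c)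
    then have "c [^] ((2 * m + 1) * n) \<otimes> (b \<otimes> a) \<otimes> (b [^] (- 2 * m) \<otimes> (c [^] m \<otimes> b [^] ((2 * m + 1) * (- 2 * n))))
      = b \<otimes> a \<otimes> c [^] ((2 * m + 1) * n) \<otimes> (b [^] (- 2 * m) \<otimes> (c [^] m \<otimes> b [^] ((2 * m + 1) * (- 2 * n))))"
      by (simp only:)
    also have "\<dots> = b \<otimes> a \<otimes> (c [^] ((2 * m + 1) * n) \<otimes> b [^] (- 2 * m)) \<otimes> (c [^] m \<otimes> b [^] ((2 * m + 1) * (- 2 * n)))"
      by (simp add: m_assoc)
    also have "\<dots> = b \<otimes> a \<otimes> (b [^] (- 2 * m) \<otimes> c [^] ((2 * m + 1) * n)) \<otimes> (b [^] ((2 * m + 1) * (- 2 * n)) \<otimes> c [^] m)"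
      by (simp only: c_b)
    also have "\<dots> = b \<otimes> a \<otimes> b [^] (- 2 * m) \<otimes> (c [^] ((2 * m + 1) * n) \<otimes> b [^] ((2 * m + 1) * (- 2 * n))) \<otimes> c [^] m"
      by (simp add: m_assoc)
    also have "\<dots> = b \<otimes> a \<otimes> b [^] (- 2 * m) \<otimes> (b [^] ((2 * m + 1) * (- 2 * n)) \<otimes> c [^] ((2 * m + 1) * n)) \<otimes> c [^] m"
      by (simp only: c_b)
    finally show ?thesis by (simp add: m_assoc)
  qed
  also have "b [^] (- 2 * m) \<otimes> b [^] ((2 * m + 1) * (- 2 * n)) = b [^] (- 2 * ?k)"
    by (simp only: int_pow_mult[symmetric] b) (simp add: algebra_simps)
  also have "c [^] ((2 * m + 1) * n) \<otimes> c [^] m = c [^] ?k"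
    by (simp only: int_pow_mult[symmetric] full_twist_closed) (simp add: algebra_simps)
  finally have 2: "e.b' \<otimes> e.a' = b \<otimes> a \<otimes> b [^] (- 2 * ?k) \<otimes> c [^] ?k \<otimes> (g \<otimes> e)" .
  show ?thesis unfolding hexagons_def aa bb using 1 2 by blast
qed

end

lemma hexagons_hom:
  assumes "h \<in> hom G H" "group G" "group H" "a \<in> carrier G" "b \<in> carrier G" "g \<in> carrier G"
    "hexagons G a b m g"
  shows "hexagons H (h a) (h b) m (h g)"
proof -
  interpret G: group G by fact
  interpret h: group_hom G H h using assms by (simp add: group_hom_def group_hom_axioms_def)
  have c [simp]: "full_twist G a b \<in> carrier G" using assms by (simp add: full_twist_def)
  have [simp]: "h (full_twist G a b) = full_twist H (h a) (h b)" using assms by (simp add: full_twist_def)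
  have eq: "h u = h v" if "u = v" for u v using that by simp
  show ?thesis
    using assms(4-6) assms(7)[unfolded hexagons_def, THEN conjunct1, THEN eq]
      assms(7)[unfolded hexagons_def, THEN conjunct2, THEN eq]
    by (simp add: hexagons_def h.hom_int_pow)
qed

section \<open>Braid groups and pure braid groups\<close>

declare One_nat_def [simp del]

lemma group_B: "group (B n)"
  unfolding B_def by (rule group_presented_group)

interpretation B: group "B n" for n
  by (rule group_B)

lemma sigma_closed [simp, intro]: "i \<in> {1..<n} \<Longrightarrow> sigma n i \<in> carrier (B n)"
  unfolding sigma_def B_def by (rule word_class_carrier) auto

lemma generate_B: "generate (B n) (sigma n ` {1..<n}) = carrier (B n)"
  unfolding sigma_def B_def by (rule generate_presented_group)

lemma sigma_commute:
  assumes "i \<in> {1..<n}" "j \<in> {1..<n}" "i + 2 \<le> j"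
  shows "sigma n i \<otimes>\<^bsub>B n\<^esub> sigma n j = sigma n j \<otimes>\<^bsub>B n\<^esub> sigma n i"
proof -
  have "word_eq {1..<n} (braid_relations n) [(i, True), (j, True)] [(j, True), (i, True)]"
    by (rule word_eq.relator) (use assms in \<open>auto simp: braid_relations_def\<close>)
  then show ?thesis
    unfolding sigma_def B_def using assms by (subst (1 2) word_class_mult) (auto dest: word_class_eqI)
qed

lemma sigma_braid:
  assumes "i \<in> {1..<n}" "i + 1 \<in> {1..<n}"
  shows "sigma n i \<otimes>\<^bsub>B n\<^esub> sigma n (i + 1) \<otimes>\<^bsub>B n\<^esub> sigma n i
    = sigma n (i + 1) \<otimes>\<^bsub>B n\<^esub> sigma n i \<otimes>\<^bsub>B n\<^esub> sigma n (i + 1)"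
proof -
  have "word_eq {1..<n} (braid_relations n)
      [(i, True), (i + 1, True), (i, True)] [(i + 1, True), (i, True), (i + 1, True)]"
    by (rule word_eq.relator) (use assms in \<open>auto simp: braid_relations_def\<close>)
  then show ?thesis
    unfolding sigma_def B_def using assms by (simp add: word_class_mult word_class_eqI)
qed

lemma (in group) B_hom:
  assumes v: "\<And>i. i \<in> {1..<n} \<Longrightarrow> v i \<in> carrier G"
    and comm: "\<And>i j. i \<in> {1..<n} \<Longrightarrow> j \<in> {1..<n} \<Longrightarrow> i + 2 \<le> j \<Longrightarrow> v i \<otimes> v j = v j \<otimes> v i"
    and braid: "\<And>i. i \<in> {1..<n} \<Longrightarrow> i + 1 \<in> {1..<n} \<Longrightarrow>
      v i \<otimes> v (i + 1) \<otimes> v i = v (i + 1) \<otimes> v i \<otimes> v (i + 1)"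
  obtains h where "h \<in> hom (B n) G" "\<And>i. i \<in> {1..<n} \<Longrightarrow> h (sigma n i) = v i"
    and "\<And>w. w \<in> lists ({1..<n} \<times> UNIV) \<Longrightarrow>
      h (word_class {1..<n} (braid_relations n) w) = word_eval G v w"
proof -
  have v': "v \<in> {1..<n} \<rightarrow> carrier G" using v by blast
  have "word_eval G v r = word_eval G v s" if "(r, s) \<in> braid_relations n" for r s
    using that unfolding braid_relations_def
  proof (elim UnE)
    assume "(r, s) \<in> {([(i, True), (j, True)], [(j, True), (i, True)]) | i j.
        i \<in> {1..<n} \<and> j \<in> {1..<n} \<and> i + 2 \<le> j}"
    then obtain i j where "r = [(i, True), (j, True)]" "s = [(j, True), (i, True)]"
      and "i \<in> {1..<n}" "j \<in> {1..<n}" "i + 2 \<le> j" by blast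
    then show ?thesis using comm[of i j] v by simp
  next
    assume "(r, s) \<in> {([(i, True), (i + 1, True), (i, True)], [(i + 1, True), (i, True), (i + 1, True)]) | i.
        i \<in> {1..<n} \<and> i + 1 \<in> {1..<n}}"
    then obtain i where "r = [(i, True), (i + 1, True), (i, True)]" "s = [(i + 1, True), (i, True), (i + 1, True)]"
      and i: "i \<in> {1..<n}" "i + 1 \<in> {1..<n}" by blast
    then show ?thesis using braid[OF i] v[OF i(1)] v[OF i(2)] by (simp add: m_assoc)
  qed
  from presented_group_hom[OF v' this] obtain h where
    "h \<in> hom (presented_group {1..<n} (braid_relations n)) G"
    "\<And>w. w \<in> lists ({1..<n} \<times> UNIV) \<Longrightarrow> h (word_class {1..<n} (braid_relations n) w) = word_eval G v w"
    "\<And>a. a \<in> {1..<n} \<Longrightarrow> h (word_class {1..<n} (braid_relations n) [(a, True)]) = v a"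
    by blast
  then show thesis by (intro that) (auto simp: B_def sigma_def)
qed

lemma (in group) B3_hom:
  assumes "braid_pair G a b"
  obtains h where "h \<in> hom (B 3) G" "h (sigma 3 1) = a" "h (sigma 3 2) = b"
proof -
  interpret braid_pair G a b by fact
  define v where "v i = (if i = 1 then a else b)" for i :: nat
  have 3: "i \<in> {1..<3} \<longleftrightarrow> i = 1 \<or> i = 2" for i :: nat by auto
  have v [simp]: "v 1 = a" "v 2 = b" "v (1 + 1) = b" by (simp_all add: v_def)
  obtain h where h: "h \<in> hom (B 3) G" "\<And>i. i \<in> {1..<3} \<Longrightarrow> h (sigma 3 i) = v i"
    by (rule B_hom[of 3 v]) (unfold 3, use braid in auto)
  then show thesis using that[of h] h(2)[of 1] h(2)[of 2] by simp
qed

lemma (in group) B4_hom: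
  assumes "braid_pair G a b" "braid_pair G b c" "a \<otimes> c = c \<otimes> a"
  obtains h where "h \<in> hom (B 4) G" "h (sigma 4 1) = a" "h (sigma 4 2) = b" "h (sigma 4 3) = c"
proof -
  interpret ab: braid_pair G a b by fact
  interpret bc: braid_pair G b c by fact
  define v where "v i = (if i = 1 then a else if i = 2 then b else c)" for i :: nat
  have 4: "i \<in> {1..<4} \<longleftrightarrow> i = 1 \<or> i = 2 \<or> i = 3" for i :: nat by auto
  have v [simp]: "v 1 = a" "v 2 = b" "v 3 = c"
    by (simp_all add: v_def)
  obtain h where h: "h \<in> hom (B 4) G" "\<And>i. i \<in> {1..<4} \<Longrightarrow> h (sigma 4 i) = v i"
    by (rule B_hom[of 4 v]) (unfold 4, use ab.braid bc.braid assms(3) in auto)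
  then show thesis using that[of h] h(2)[of 1] h(2)[of 2] h(2)[of 3] by simp
qed

section \<open>Permutations of braids and pure braid groups\<close>

lemma braid_perm_hom: "braid_perm n \<in> hom (B n) (sym_group n)"
  and braid_perm_sigma: "i \<in> {1..<n} \<Longrightarrow> braid_perm n (sigma n i) = Transposition.transpose i (i + 1)"
  and braid_perm_word: "w \<in> lists ({1..<n} \<times> UNIV) \<Longrightarrow>
    braid_perm n (word_class {1..<n} (braid_relations n) w)
      = word_eval (sym_group n) (\<lambda>i. Transposition.transpose i (i + 1)) w"
proof -
  interpret S: group "sym_group n" by (rule sym_group_is_group)
  let ?t = "\<lambda>i::nat. Transposition.transpose i (i + 1)"
  obtain h where h: "h \<in> hom (B n) (sym_group n)" "\<And>i. i \<in> {1..<n} \<Longrightarrow> h (sigma n i) = ?t i"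
    and w: "\<And>w. w \<in> lists ({1..<n} \<times> UNIV) \<Longrightarrow>
      h (word_class {1..<n} (braid_relations n) w) = word_eval (sym_group n) ?t w"
  proof (rule S.B_hom[of n ?t])
    show "?t i \<in> carrier (sym_group n)" if "i \<in> {1..<n}" for i
      using that by (auto simp: sym_group_carrier intro: permutes_swap_id)
  qed (auto simp: sym_group_mult fun_eq_iff Transposition.transpose_def)
  have "braid_perm n = restrict h (carrier (B n))"
    unfolding braid_perm_def
    by (rule hom_with_values_eq[OF group_B sym_group_is_group h(1)])
      (auto simp: h(2) image_image simp flip: generate_B intro!: arg_cong[of _ _ "generate (B n)"])
  then have eq: "braid_perm n x = h x" if "x \<in> carrier (B n)" for x
    using that by simp
  show "braid_perm n \<in> hom (B n) (sym_group n)"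
    using h(1) by (auto simp: hom_def Pi_iff eq)
  show "i \<in> {1..<n} \<Longrightarrow> braid_perm n (sigma n i) = ?t i"
    using h(2) eq by simp
  show "w \<in> lists ({1..<n} \<times> UNIV) \<Longrightarrow>
      braid_perm n (word_class {1..<n} (braid_relations n) w) = word_eval (sym_group n) ?t w"
    using w eq word_class_carrier[of w "{1..<n}" "braid_relations n"] by (simp add: B_def)
qed

interpretation perm: group_hom "B n" "sym_group n" "braid_perm n" for n
  by (simp add: group_hom_def group_hom_axioms_def group_B sym_group_is_group braid_perm_hom)

lemma carrier_PB: "carrier (PB n) = {w \<in> carrier (B n). braid_perm n w = id}"
  by (simp add: PB_def kernel_def sym_group_one)

lemma mult_PB [simp]: "mult (PB n) = mult (B n)" and one_PB [simp]: "one (PB n) = one (B n)"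
  by (simp_all add: PB_def)

lemma PB_normal: "carrier (PB n) \<lhd> B n"
  using perm.normal_kernel by (simp add: PB_def)

lemma PB_subgroup: "subgroup (carrier (PB n)) (B n)"
  by (rule normal_imp_subgroup[OF PB_normal])

lemma PB_eq: "PB n = (B n)\<lparr>carrier := carrier (PB n)\<rparr>"
  by (simp add: PB_def)

interpretation PB: group "PB n" for n
  by (subst PB_eq) (rule B.subgroup_imp_group[OF PB_subgroup])

lemma PB_in_B [simp, intro]: "w \<in> carrier (PB n) \<Longrightarrow> w \<in> carrier (B n)"
  by (simp add: carrier_PB)

lemma inv_PB [simp]: "w \<in> carrier (PB n) \<Longrightarrow> inv\<^bsub>PB n\<^esub> w = inv\<^bsub>B n\<^esub> w"
  by (subst PB_eq) (rule B.m_inv_consistent[OF PB_subgroup])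

lemma int_pow_PB [simp]: "w \<in> carrier (PB n) \<Longrightarrow> w [^]\<^bsub>PB n\<^esub> (k::int) = w [^]\<^bsub>B n\<^esub> k"
  using B.int_pow_consistent[OF PB_subgroup] PB_eq by metis

lemma PB_mult_closed [simp, intro]:
  "u \<in> carrier (PB n) \<Longrightarrow> v \<in> carrier (PB n) \<Longrightarrow> u \<otimes>\<^bsub>B n\<^esub> v \<in> carrier (PB n)"
  using PB.m_closed by simp

lemma PB_inv_closed [simp, intro]: "u \<in> carrier (PB n) \<Longrightarrow> inv\<^bsub>B n\<^esub> u \<in> carrier (PB n)"
  using PB.inv_closed[of u n] by simp

lemma PB_one_closed [simp, intro]: "\<one>\<^bsub>B n\<^esub> \<in> carrier (PB n)"
  using PB.one_closed by simp

lemma PB_int_pow_closed [simp, intro]: "u \<in> carrier (PB n) \<Longrightarrow> u [^]\<^bsub>B n\<^esub> (k::int) \<in> carrier (PB n)"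
  using PB.int_pow_closed[of u n k] by simp

lemma PB_conj_closed [intro]:
  assumes "g \<in> carrier (B n)" "u \<in> carrier (PB n)"
  shows "g \<otimes>\<^bsub>B n\<^esub> u \<otimes>\<^bsub>B n\<^esub> inv\<^bsub>B n\<^esub> g \<in> carrier (PB n)" "inv\<^bsub>B n\<^esub> g \<otimes>\<^bsub>B n\<^esub> u \<otimes>\<^bsub>B n\<^esub> g \<in> carrier (PB n)"
  using normal.inv_op_closed1[OF PB_normal assms] normal.inv_op_closed2[OF PB_normal assms] by auto

lemma sigma_square_PB [simp, intro]:
  "i \<in> {1..<n} \<Longrightarrow> sigma n i \<otimes>\<^bsub>B n\<^esub> sigma n i \<in> carrier (PB n)"
  unfolding carrier_PB mem_Collect_eq by (simp add: braid_perm_sigma sym_group_mult)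

lemma foldr_sigma_closed:
  "set ks \<subseteq> {1..<n} \<Longrightarrow> foldr (\<lambda>k h. sigma n k \<otimes>\<^bsub>B n\<^esub> h) ks \<one>\<^bsub>B n\<^esub> \<in> carrier (B n)"
  by (induct ks) auto

lemma pure_gen_closed:
  assumes "1 \<le> i" "i < j" "j \<le> n"
  shows "pure_gen n i j \<in> carrier (PB n)"
proof -
  have i: "i \<in> {1..<n}" using assms by auto
  have "set (rev [i + 1..<j]) \<subseteq> {1..<n}" using assms by auto
  from PB_conj_closed(1)[OF foldr_sigma_closed[OF this] sigma_square_PB[OF i]] show ?thesis
    using sigma_closed[OF i] by (simp add: pure_gen_def Let_def numeral_2_eq_2)
qed

lemma pure_gen_Suc:
  "i \<in> {1..<n} \<Longrightarrow> pure_gen n i (Suc i) = sigma n i \<otimes>\<^bsub>B n\<^esub> sigma n i"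
  by (simp add: pure_gen_def numeral_2_eq_2 B.m_assoc)

lemma pure_gen_Suc2:
  "i \<in> {1..<n} \<Longrightarrow> i + 1 \<in> {1..<n} \<Longrightarrow> pure_gen n i (i + 2) =
    sigma n (i + 1) \<otimes>\<^bsub>B n\<^esub> (sigma n i \<otimes>\<^bsub>B n\<^esub> sigma n i) \<otimes>\<^bsub>B n\<^esub> inv\<^bsub>B n\<^esub> sigma n (i + 1)"
  by (simp add: pure_gen_def numeral_2_eq_2 B.m_assoc Let_def One_nat_def)

section \<open>Generators of the pure braid group on three strands\<close>

lemma B_induct [consumes 1, case_names one right_mult right_inv]:
  assumes "w \<in> carrier (B n)" "P \<one>\<^bsub>B n\<^esub>"
    and "\<And>w i. w \<in> carrier (B n) \<Longrightarrow> i \<in> {1..<n} \<Longrightarrow> P w \<Longrightarrow> P (w \<otimes>\<^bsub>B n\<^esub> sigma n i)"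
    and "\<And>w i. w \<in> carrier (B n) \<Longrightarrow> i \<in> {1..<n} \<Longrightarrow> P w \<Longrightarrow> P (w \<otimes>\<^bsub>B n\<^esub> inv\<^bsub>B n\<^esub> sigma n i)"
  shows "P w"
proof -
  have "\<forall>u \<in> carrier (B n). P u \<longrightarrow> P (u \<otimes>\<^bsub>B n\<^esub> w)" if "w \<in> generate (B n) (sigma n ` {1..<n})" for w
    using that
  proof induct
    case (eng h k)
    then show ?case using generate_B[of n] by (simp flip: B.m_assoc)
  qed (use assms(3,4) in auto)
  then show ?thesis using assms(1,2) generate_B[of n] by force
qed

context braid_pair begin

text \<open>The coset representatives of \<open>PB 3\<close> in \<open>B 3\<close>; multiplying them by a generator shows
  that \<open>PB 3\<close> is generated by the \<open>x\<^sub>i\<^sub>j\<close>.\<close>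

definition cosets6 :: "'a set" where
  "cosets6 = {\<one>, a, b, a \<otimes> b, b \<otimes> a, a \<otimes> b \<otimes> a}"

lemma cosets6_step:
  assumes "subgroup H G" and H: "a \<otimes> a \<in> H" "b \<otimes> b \<in> H" "b \<otimes> (a \<otimes> a) \<otimes> inv b \<in> H"
    and t: "t \<in> cosets6" and s: "s = a \<or> s = b"
  shows "\<exists>h \<in> H. \<exists>u \<in> cosets6. t \<otimes> s = h \<otimes> u" "\<exists>h \<in> H. \<exists>u \<in> cosets6. t \<otimes> inv s = h \<otimes> u"
proof -
  interpret H: subgroup H G by fact
  let ?x = "a \<otimes> a" and ?y = "b \<otimes> b" and ?z = "b \<otimes> (a \<otimes> a) \<otimes> inv b"
  \<comment> \<open>a b^2 a^-1 is the conjugate by a^2 of a^-1 b^2 a, which is \<open>?z\<close>. It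
    is the element of \<open>H\<close> that appears when the representative a b is multiplied by
    b.\<close>
  let ?z' = "?x \<otimes> ?z \<otimes> inv ?x"
  have z'H: "?z' \<in> H" using H by auto
  have "?z' = ?x \<otimes> (inv a \<otimes> (b \<otimes> b) \<otimes> a) \<otimes> inv ?x"
    by (simp only: inv_conj_square)
  then have ab_b: "a \<otimes> b \<otimes> b = ?z' \<otimes> a"
    by (simp add: inv_mult_group m_assoc)
  define step where "step s t u \<longleftrightarrow> (\<exists>h\<in>H. t \<otimes> s = h \<otimes> u)" for s t u
  have stepI: "step s t u" if "t \<otimes> s = h \<otimes> u" "h \<in> H" for s t u h
    using that by (auto simp: step_def)
  have a_steps: "step a \<one> a" "step a a \<one>" "step a b (b \<otimes> a)" "step a (b \<otimes> a) b"
    "step a (a \<otimes> b) (a \<otimes> b \<otimes> a)" "step a (a \<otimes> b \<otimes> a) (a \<otimes> b)"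
  proof -
    show "step a (b \<otimes> a) b" by (rule stepI[OF _ H(3)]) (simp add: m_assoc)
    show "step a (a \<otimes> b \<otimes> a) (a \<otimes> b)"
      by (rule stepI[OF _ H(2)]) (use braid' in \<open>simp add: m_assoc braid''\<close>)
    show "step a a \<one>" by (rule stepI[OF _ H(1)]) simp
  qed (rule stepI[OF _ H.one_closed], simp add: m_assoc)+
  have b_steps: "step b \<one> b" "step b b \<one>" "step b a (a \<otimes> b)" "step b (a \<otimes> b) a"
    "step b (b \<otimes> a) (a \<otimes> b \<otimes> a)" "step b (a \<otimes> b \<otimes> a) (b \<otimes> a)"
  proof -
    show "step b (a \<otimes> b) a" by (rule stepI[OF ab_b z'H])
    show "step b (a \<otimes> b \<otimes> a) (b \<otimes> a)"
      by (rule stepI[OF _ H(1)]) (use braid'[symmetric] in \<open>simp add: m_assoc\<close>)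
    show "step b b \<one>" by (rule stepI[OF _ H(2)]) simp
    show "step b (b \<otimes> a) (a \<otimes> b \<otimes> a)" by (rule stepI[OF _ H.one_closed]) (simp add: braid)
  qed (rule stepI[OF _ H.one_closed], simp add: m_assoc)+
  \<comment> \<open>Both directions are asked for because u s = h t also gives t s^-1 = h^-1 u,
    which is the step for the inverse generator.\<close>
  have "\<exists>u \<in> cosets6. step s t u \<and> step s u t"
    using s t a_steps b_steps unfolding cosets6_def by auto
  then obtain u where u: "u \<in> cosets6" "step s t u" "step s u t" by blast
  then show "\<exists>h \<in> H. \<exists>u \<in> cosets6. t \<otimes> s = h \<otimes> u" by (auto simp: step_def)
  obtain h where h: "h \<in> H" "u \<otimes> s = h \<otimes> t" using u by (auto simp: step_def)
  have "t \<in> carrier G" "u \<in> carrier G" "s \<in> carrier G" using t u s by (auto simp: cosets6_def)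
  then have "t \<otimes> inv s = inv h \<otimes> u"
    using h H.mem_carrier[OF h(1)] by (metis inv_closed inv_solve_left inv_solve_right m_assoc m_closed)
  then show "\<exists>h \<in> H. \<exists>u \<in> cosets6. t \<otimes> inv s = h \<otimes> u" using h u by blast
qed

end

interpretation B3: braid_pair "B 3" "sigma 3 1" "sigma 3 2"
  by unfold_locales (use sigma_braid[of 1 3] in simp_all)

lemma pure_gen3:
  "pure_gen 3 1 2 = sigma 3 1 \<otimes>\<^bsub>B 3\<^esub> sigma 3 1"
  "pure_gen 3 2 3 = sigma 3 2 \<otimes>\<^bsub>B 3\<^esub> sigma 3 2"
  "pure_gen 3 1 3 = sigma 3 2 \<otimes>\<^bsub>B 3\<^esub> (sigma 3 1 \<otimes>\<^bsub>B 3\<^esub> sigma 3 1) \<otimes>\<^bsub>B 3\<^esub> inv\<^bsub>B 3\<^esub> sigma 3 2"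
  using pure_gen_Suc[of 1 3] pure_gen_Suc[of 2 3] pure_gen_Suc2[of 1 3]
  by (simp_all add: eval_nat_numeral One_nat_def)

lemma pure_gen3_closed [simp]:
  "pure_gen 3 1 2 \<in> carrier (PB 3)" "pure_gen 3 2 3 \<in> carrier (PB 3)" "pure_gen 3 1 3 \<in> carrier (PB 3)"
  by (simp_all add: pure_gen_closed)

text \<open>Every braid is the product of an element of the subgroup \<open>H\<close> generated by
  the x_ij and one of the six representatives. If the braid is pure, so is the representative, and
  only the trivial representative fixes both 1 and 2.\<close>

lemma generate_PB3:
  "generate (PB 3) {pure_gen 3 1 2, pure_gen 3 2 3, pure_gen 3 1 3} = carrier (PB 3)" (is "generate _ ?A = _")
proof
  have A: "?A \<subseteq> carrier (PB 3)" by simp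
  show "generate (PB 3) ?A \<subseteq> carrier (PB 3)"
    using PB.generate_in_carrier[OF A] by blast
  define H where "H = generate (B 3) ?A"
  have gen: "generate (PB 3) ?A = H"
    unfolding H_def by (subst PB_eq) (rule B.generate_consistent[OF A PB_subgroup])
  have H: "subgroup H (B 3)" unfolding H_def
    using A by (intro B.generate_is_subgroup) auto
  have HA: "pure_gen 3 1 2 \<in> H" "pure_gen 3 2 3 \<in> H" "pure_gen 3 1 3 \<in> H"
    by (auto simp: H_def intro: generate.incl)
  note step = B3.cosets6_step[OF H HA[unfolded pure_gen3]]
  have c6: "B3.cosets6 \<subseteq> carrier (B 3)" by (auto simp: B3.cosets6_def)
  have all: "\<exists>h\<in>H. \<exists>t\<in>B3.cosets6. w = h \<otimes>\<^bsub>B 3\<^esub> t" if "w \<in> carrier (B 3)" for w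
    using that
  proof (induct w rule: B_induct)
    case one
    then show ?case using subgroup.one_closed[OF H] by (intro bexI[of _ "\<one>\<^bsub>B 3\<^esub>"]) (auto simp: B3.cosets6_def)
  next
    case (right_mult w i)
    then obtain h t where ht: "h \<in> H" "t \<in> B3.cosets6" "w = h \<otimes>\<^bsub>B 3\<^esub> t" by blast
    have "i = 1 \<or> i = 2" using right_mult(2) by auto
    then obtain k u where ku: "k \<in> H" "u \<in> B3.cosets6" "t \<otimes>\<^bsub>B 3\<^esub> sigma 3 i = k \<otimes>\<^bsub>B 3\<^esub> u"
      using step(1)[OF ht(2), of "sigma 3 i"] by blast
    have "w \<otimes>\<^bsub>B 3\<^esub> sigma 3 i = h \<otimes>\<^bsub>B 3\<^esub> k \<otimes>\<^bsub>B 3\<^esub> u"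
      using ht ku c6 subgroup.mem_carrier[OF H] right_mult(2) by (simp add: B.m_assoc subsetD)
    then show ?case using ht ku subgroup.m_closed[OF H] by blast
  next
    case (right_inv w i)
    then obtain h t where ht: "h \<in> H" "t \<in> B3.cosets6" "w = h \<otimes>\<^bsub>B 3\<^esub> t" by blast
    have "i = 1 \<or> i = 2" using right_inv(2) by auto
    then obtain k u where ku: "k \<in> H" "u \<in> B3.cosets6" "t \<otimes>\<^bsub>B 3\<^esub> inv\<^bsub>B 3\<^esub> sigma 3 i = k \<otimes>\<^bsub>B 3\<^esub> u"
      using step(2)[OF ht(2), of "sigma 3 i"] by blast
    have "w \<otimes>\<^bsub>B 3\<^esub> inv\<^bsub>B 3\<^esub> sigma 3 i = h \<otimes>\<^bsub>B 3\<^esub> k \<otimes>\<^bsub>B 3\<^esub> u"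
      using ht ku c6 subgroup.mem_carrier[OF H] right_inv(2) by (simp add: B.m_assoc subsetD)
    then show ?case using ht ku subgroup.m_closed[OF H] by blast
  qed
  have triv: "t = \<one>\<^bsub>B 3\<^esub>" if "t \<in> B3.cosets6" "braid_perm 3 t = id" for t
  proof (rule ccontr)
    assume "t \<noteq> \<one>\<^bsub>B 3\<^esub>"
    moreover have "braid_perm 3 t 1 = 1" "braid_perm 3 t 2 = 2" using that by auto
    ultimately show False using that(1)
      by (auto simp: B3.cosets6_def braid_perm_sigma sym_group_mult Transposition.transpose_def split: if_splits)
  qed
  have H_PB: "H \<subseteq> carrier (PB 3)"
    unfolding gen[symmetric] using PB.generate_in_carrier[OF A] by blast
  show "carrier (PB 3) \<subseteq> generate (PB 3) ?A"
    unfolding gen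
  proof (intro subsetI)
    fix w assume w: "w \<in> carrier (PB 3)"
    then obtain h t where ht: "h \<in> H" "t \<in> B3.cosets6" "w = h \<otimes>\<^bsub>B 3\<^esub> t" using all by blast
    have hP: "h \<in> carrier (PB 3)" using ht H_PB by blast
    have t: "t \<in> carrier (B 3)" using ht c6 by blast
    have "t = inv\<^bsub>B 3\<^esub> h \<otimes>\<^bsub>B 3\<^esub> w" using hP t by (simp add: ht(3))
    then have "t \<in> carrier (PB 3)" using hP w by simp
    then have "t = \<one>\<^bsub>B 3\<^esub>" using triv[OF ht(2)] unfolding carrier_PB by blast
    then show "w \<in> H" using ht hP by simp
  qed
qed

section \<open>Cabling\<close>

lemma hom_with_values_hom:
  assumes "group G" "group H" "h \<in> hom G H" "generate G (fst ` set vals) = carrier G"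
    and "\<And>g v. (g, v) \<in> set vals \<Longrightarrow> h g = v"
  shows "hom_with_values G H vals \<in> hom G H"
    and "(g, v) \<in> set vals \<Longrightarrow> hom_with_values G H vals g = v"
proof -
  have eq: "hom_with_values G H vals = restrict h (carrier G)"
    using assms by (rule hom_with_values_eq)
  interpret G: group G by fact
  show "hom_with_values G H vals \<in> hom G H"
    using assms(3) unfolding eq by (auto simp: hom_def Pi_iff)
  show "hom_with_values G H vals g = v" if "(g, v) \<in> set vals"
    using that assms(4,5) generate.incl[of g "fst ` set vals" G] unfolding eq by force
qed

lemma (in group) commute_inv:
  assumes "x \<in> carrier G" "y \<in> carrier G" "x \<otimes> y = y \<otimes> x"
  shows "inv x \<otimes> y = y \<otimes> inv x"
proof -
  have "inv x \<otimes> y = inv x \<otimes> (y \<otimes> x) \<otimes> inv x" using assms(1,2) by (simp add: m_assoc)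
  also have "\<dots> = inv x \<otimes> (x \<otimes> y) \<otimes> inv x" by (simp only: assms(3))
  finally show ?thesis using assms(1,2) by simp
qed

definition B3_map :: "('a, 'b) monoid_scheme \<Rightarrow> 'a \<Rightarrow> 'a \<Rightarrow> nat word set \<Rightarrow> 'a" where
  "B3_map G a b = hom_with_values (B 3) G [(sigma 3 1, a), (sigma 3 2, b)]"

lemma generate_B3: "generate (B 3) {sigma 3 1, sigma 3 2} = carrier (B 3)"
proof -
  have "{1..<3} = {1, 2::nat}" by auto
  then show ?thesis using generate_B[of 3] by simp
qed

lemma generate_B4: "generate (B 4) {sigma 4 1, sigma 4 2, sigma 4 3} = carrier (B 4)"
proof -
  have "{1..<4} = {1, 2, 3::nat}" by auto
  then show ?thesis using generate_B[of 4] by simp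
qed

lemma (in braid_pair) B3_map:
  "B3_map G a b \<in> hom (B 3) G" "B3_map G a b (sigma 3 1) = a" "B3_map G a b (sigma 3 2) = b"
proof -
  obtain h where h: "h \<in> hom (B 3) G" "h (sigma 3 1) = a" "h (sigma 3 2) = b"
    by (rule B3_hom[OF braid_pair_axioms])
  note props = hom_with_values_hom[OF group_B is_group h(1), of "[(sigma 3 1, a), (sigma 3 2, b)]"]
  show "B3_map G a b \<in> hom (B 3) G" "B3_map G a b (sigma 3 1) = a" "B3_map G a b (sigma 3 2) = b"
    unfolding B3_map_def by (rule props; use h generate_B3 in auto)+
qed

section \<open>Three consecutive braid generators\<close>

locale braid_triple = ab: braid_pair G a b + bc: braid_pair G b c for G (structure) and a b c +
  assumes ac: "a \<otimes> c = c \<otimes> a"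
begin

lemma ac': "z \<in> carrier G \<Longrightarrow> a \<otimes> (c \<otimes> z) = c \<otimes> (a \<otimes> z)"
  using ac by (simp flip: ab.m_assoc)

text \<open>For \<sigma>_1, \<sigma>_2, \<sigma>_3 the left-hand side is x_13 x_14, and the
  right-hand side is what doubling the third strand of x_13 produces. Both reduce to a^-1 b c c b
  a.\<close>

lemma pure_product:
  "b \<otimes> (a \<otimes> a) \<otimes> inv b \<otimes> (c \<otimes> b \<otimes> (a \<otimes> a) \<otimes> inv (c \<otimes> b))
    = b \<otimes> c \<otimes> (a \<otimes> (b \<otimes> b) \<otimes> a) \<otimes> inv (b \<otimes> c)"
proof -
  have bab: "b \<otimes> a \<otimes> inv b = inv a \<otimes> b \<otimes> a"
  proof -
    have "b \<otimes> a \<otimes> inv b = inv a \<otimes> (a \<otimes> b \<otimes> a) \<otimes> inv b" by (simp add: ab.m_assoc)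
    then show ?thesis unfolding ab.braid by (simp add: ab.m_assoc)
  qed
  have ca: "c \<otimes> inv a = inv a \<otimes> c" and ac2: "a \<otimes> inv c = inv c \<otimes> a"
    using ab.commute_inv[of a c] ab.commute_inv[of c a] ac by simp_all
  have ca': "c \<otimes> (inv a \<otimes> z) = inv a \<otimes> (c \<otimes> z)" and ac3: "a \<otimes> (inv c \<otimes> z) = inv c \<otimes> (a \<otimes> z)"
    if "z \<in> carrier G" for z
    using that ca ac2 by (simp_all flip: ab.m_assoc)
  let ?X = "b \<otimes> (a \<otimes> a) \<otimes> inv b"
  have X: "?X = inv a \<otimes> (b \<otimes> b) \<otimes> a" by (rule ab.inv_conj_square[symmetric])
  have "?X \<otimes> (c \<otimes> b \<otimes> (a \<otimes> a) \<otimes> inv (c \<otimes> b)) = ?X \<otimes> (c \<otimes> ?X \<otimes> inv c)"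
    by (simp add: ab.m_assoc ab.inv_mult_group)
  also have "\<dots> = inv a \<otimes> (b \<otimes> b) \<otimes> (c \<otimes> (b \<otimes> b) \<otimes> inv c) \<otimes> a"
    unfolding X by (simp add: ab.m_assoc ca' ac2)
  also have "\<dots> = inv a \<otimes> b \<otimes> c \<otimes> c \<otimes> b \<otimes> a"
    unfolding bc.inv_conj_square[symmetric] by (simp add: ab.m_assoc)
  finally have 1: "?X \<otimes> (c \<otimes> b \<otimes> (a \<otimes> a) \<otimes> inv (c \<otimes> b)) = inv a \<otimes> b \<otimes> c \<otimes> c \<otimes> b \<otimes> a" .
  have "b \<otimes> c \<otimes> (a \<otimes> (b \<otimes> b) \<otimes> a) \<otimes> inv (b \<otimes> c) = b \<otimes> a \<otimes> (c \<otimes> (b \<otimes> b) \<otimes> inv c) \<otimes> a \<otimes> inv b"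
    by (simp add: ab.m_assoc ab.inv_mult_group ac' ac3)
  also have "\<dots> = (b \<otimes> a \<otimes> inv b) \<otimes> c \<otimes> c \<otimes> (b \<otimes> a \<otimes> inv b)"
    unfolding bc.inv_conj_square[symmetric] by (simp add: ab.m_assoc)
  also have "\<dots> = inv a \<otimes> b \<otimes> c \<otimes> c \<otimes> b \<otimes> a"
    unfolding bab by (simp add: ab.m_assoc ca' ac')
  finally show ?thesis using 1 by simp
qed

text \<open>These are the braid relation between \<sigma>_1 and \<sigma>_2 after doubling the strand
  at position 1, 2 and 3 respectively.\<close>

lemma braid_abc:
  "a \<otimes> b \<otimes> c \<otimes> a \<otimes> b = b \<otimes> c \<otimes> a \<otimes> b \<otimes> c"
  "a \<otimes> b \<otimes> c \<otimes> b \<otimes> a = c \<otimes> b \<otimes> a \<otimes> b \<otimes> c"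
  "b \<otimes> a \<otimes> c \<otimes> b \<otimes> a = c \<otimes> b \<otimes> a \<otimes> c \<otimes> b"
proof -
  have "a \<otimes> (b \<otimes> (c \<otimes> (a \<otimes> b))) = a \<otimes> (b \<otimes> (a \<otimes> (c \<otimes> b)))" by (simp add: ac')
  also have "\<dots> = b \<otimes> (a \<otimes> (b \<otimes> (c \<otimes> b)))" by (simp add: ab.braid'')
  also have "\<dots> = b \<otimes> (a \<otimes> (c \<otimes> (b \<otimes> c)))" by (simp add: bc.braid')
  also have "\<dots> = b \<otimes> (c \<otimes> (a \<otimes> (b \<otimes> c)))" by (simp add: ac')
  finally show "a \<otimes> b \<otimes> c \<otimes> a \<otimes> b = b \<otimes> c \<otimes> a \<otimes> b \<otimes> c" by (simp add: ab.m_assoc)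
  have "a \<otimes> (b \<otimes> (c \<otimes> (b \<otimes> a))) = a \<otimes> (c \<otimes> (b \<otimes> (c \<otimes> a)))" by (simp add: bc.braid'')
  also have "\<dots> = c \<otimes> (a \<otimes> (b \<otimes> (a \<otimes> c)))" by (simp add: ac' ac)
  also have "\<dots> = c \<otimes> (b \<otimes> (a \<otimes> (b \<otimes> c)))" by (simp add: ab.braid'')
  finally show "a \<otimes> b \<otimes> c \<otimes> b \<otimes> a = c \<otimes> b \<otimes> a \<otimes> b \<otimes> c" by (simp add: ab.m_assoc)
  have "b \<otimes> (a \<otimes> (c \<otimes> (b \<otimes> a))) = b \<otimes> (c \<otimes> (a \<otimes> (b \<otimes> a)))" by (simp add: ac')
  also have "\<dots> = b \<otimes> (c \<otimes> (b \<otimes> (a \<otimes> b)))" by (simp add: ab.braid')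
  also have "\<dots> = c \<otimes> (b \<otimes> (c \<otimes> (a \<otimes> b)))" by (simp add: bc.braid'')
  also have "\<dots> = c \<otimes> (b \<otimes> (a \<otimes> (c \<otimes> b)))" by (simp add: ac')
  finally show "b \<otimes> a \<otimes> c \<otimes> b \<otimes> a = c \<otimes> b \<otimes> a \<otimes> c \<otimes> b" by (simp add: ab.m_assoc)
qed

end

interpretation B4: braid_triple "B 4" "sigma 4 1" "sigma 4 2" "sigma 4 3"
  by unfold_locales (use sigma_braid[of 1 4] sigma_braid[of 2 4] sigma_commute[of 1 4 3] in simp_all)

text \<open>The braid that is obtained from \<open>\<sigma>\<^sub>i\<close> by doubling the strand ending at position \<open>p\<close>.
  In the groupoid of braids with a marked strand, products act on positions from the right.\<close>

definition cable_sigma :: "nat \<Rightarrow> nat \<Rightarrow> nat word set" where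
  "cable_sigma p i =
    (if p = i then sigma 4 i \<otimes>\<^bsub>B 4\<^esub> sigma 4 (i + 1)
     else if p = i + 1 then sigma 4 (i + 1) \<otimes>\<^bsub>B 4\<^esub> sigma 4 i
     else if p < i then sigma 4 (i + 1) else sigma 4 i)"

abbreviation word_perm :: "nat word \<Rightarrow> nat \<Rightarrow> nat" where
  "word_perm \<equiv> word_eval (sym_group 3) (\<lambda>i. Transposition.transpose i (i + 1))"

text \<open>The position \<open>p\<close> is taken at the right end of the word; when a letter is
  reached, the letters to its right have carried it to \<open>q\<close>. An inverse letter undoes a
  crossing whose right end is where the strand leaves, hence the transposed position in that
  case.\<close>

fun cable_word :: "nat \<Rightarrow> nat word \<Rightarrow> nat word set" where
  "cable_word p [] = \<one>\<^bsub>B 4\<^esub>"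
| "cable_word p ((i, b) # w) =
    (let q = word_perm w p
     in if b then cable_sigma q i else inv\<^bsub>B 4\<^esub> cable_sigma (Transposition.transpose i (i + 1) q) i)
    \<otimes>\<^bsub>B 4\<^esub> cable_word p w"

definition cable :: "nat \<Rightarrow> nat word set \<Rightarrow> nat word set" where
  "cable p u = cable_word p (SOME w. w \<in> u)"

lemma in_13: "i \<in> {1..<3} \<longleftrightarrow> i = 1 \<or> i = (2::nat)" by auto

lemma cable_sigma_closed [simp]: "i \<in> {1..<3} \<Longrightarrow> cable_sigma p i \<in> carrier (B 4)"
  by (auto simp: cable_sigma_def in_13)

lemma cable_word_closed: "w \<in> lists ({1..<3} \<times> UNIV) \<Longrightarrow> cable_word p w \<in> carrier (B 4)"
  by (induct p w rule: cable_word.induct) (auto simp: Let_def)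

lemma word_perm_letters: "(\<lambda>i. Transposition.transpose i (i + 1)) \<in> {1..<3} \<rightarrow> carrier (sym_group 3)"
  by (auto simp: sym_group_carrier intro!: permutes_swap_id)

lemma word_perm_append:
  assumes "u \<in> lists ({1..<3} \<times> UNIV)" "v \<in> lists ({1..<3} \<times> UNIV)"
  shows "word_perm (u @ v) p = word_perm u (word_perm v p)"
  using group.word_eval_append[OF sym_group_is_group word_perm_letters assms] by (simp add: sym_group_mult)

lemma cable_word_append:
  assumes "u \<in> lists ({1..<3} \<times> UNIV)" "v \<in> lists ({1..<3} \<times> UNIV)"
  shows "cable_word p (u @ v) = cable_word (word_perm v p) u \<otimes>\<^bsub>B 4\<^esub> cable_word p v"
  using assms(1)
proof (induct u)
  case Nil
  then show ?case using assms cable_word_closed by simp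
next
  case (Cons l u)
  obtain i b where l: "l = (i, b)" by (cases l)
  have u: "u \<in> lists ({1..<3} \<times> UNIV)" and i: "i \<in> {1..<3}" using Cons(1,2) l by auto
  show ?case
    using Cons(3) word_perm_append[OF u assms(2)] i cable_word_closed[OF u] cable_word_closed[OF assms(2)]
    by (simp add: l Let_def B.m_assoc del: atLeastLessThan_iff)
qed

lemma transpose_simps:
  "Transposition.transpose (1::nat) 2 1 = 2" "Transposition.transpose (1::nat) 2 2 = 1"
  "Transposition.transpose (1::nat) 2 3 = 3" "Transposition.transpose (2::nat) 3 1 = 1"
  "Transposition.transpose (2::nat) 3 2 = 3" "Transposition.transpose (2::nat) 3 3 = 2"
  by (auto simp: Transposition.transpose_def)

lemma cable_sigma_simps:
  "cable_sigma 1 1 = sigma 4 1 \<otimes>\<^bsub>B 4\<^esub> sigma 4 2" "cable_sigma 2 1 = sigma 4 2 \<otimes>\<^bsub>B 4\<^esub> sigma 4 1"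
  "cable_sigma 3 1 = sigma 4 1" "cable_sigma 1 2 = sigma 4 3"
  "cable_sigma 2 2 = sigma 4 2 \<otimes>\<^bsub>B 4\<^esub> sigma 4 3" "cable_sigma 3 2 = sigma 4 3 \<otimes>\<^bsub>B 4\<^esub> sigma 4 2"
  by (simp_all add: cable_sigma_def)

lemma permutes3:
  "\<pi> \<in> carrier (sym_group 3) \<Longrightarrow> p \<in> {1, 2, 3} \<Longrightarrow> \<pi> p \<in> {1, 2, 3}"
proof -
  have 3: "{1, 2, 3} = {1..3::nat}" by auto
  show "\<pi> \<in> carrier (sym_group 3) \<Longrightarrow> p \<in> {1, 2, 3} \<Longrightarrow> \<pi> p \<in> {1, 2, 3}"
    unfolding sym_group_carrier 3 by (simp only: permutes_in_image)
qed

lemma braid_perm3_closed: "v \<in> carrier (B 3) \<Longrightarrow> p \<in> {1, 2, 3} \<Longrightarrow> braid_perm 3 v p \<in> {1, 2, 3}"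
  by (rule permutes3[OF perm.hom_closed])

lemma word_perm_eq:
  assumes "word_eq {1..<3} (braid_relations 3) u v"
  shows "word_perm u = word_perm v"
  using word_class_eqI[OF assms] word_eq_lists[OF assms] braid_perm_word[of _ 3] by metis

text \<open>Well-definedness of doubling on braids. For three strands every relator is the braid
  relation, settled by \<open>braid_abc\<close>; cancelling letters meet the same doubled crossing
  thanks to the transposed position in \<open>cable_word\<close>.\<close>

lemma cable_word_cong:
  assumes "word_eq {1..<3} (braid_relations 3) u v" "p \<in> {1, 2, 3}"
  shows "cable_word p u = cable_word p v"
  using assms
proof (induct arbitrary: p)
  case (append u u' v v')
  note l = word_eq_lists[OF append(1)] word_eq_lists[OF append(3)]
  have "word_perm v \<in> carrier (sym_group 3)"
    using l group.word_eval_closed[OF sym_group_is_group word_perm_letters] by blast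
  then have "word_perm v p \<in> {1, 2, 3}"
    using append(5) by (rule permutes3)
  then show ?case
    using append(2,4,5) word_perm_eq[OF append(3)] cable_word_append[OF l(1,3), of p] cable_word_append[OF l(2,4), of p]
    by (simp del: insert_iff)
next
  case (cancel a b)
  then show ?case
    by (cases b) (auto simp: Let_def sym_group_mult sym_group_one in_13 transpose_simps sym_group_carrier permutes_swap_id)
next
  case (relator u v)
  then have "u = [(1, True), (2, True), (1, True)]" "v = [(2, True), (1, True), (2, True)]"
    by (auto simp: braid_relations_def)
  then show ?case
    using relator(4) B4.braid_abc
    by (auto simp: Let_def sym_group_mult sym_group_one cable_sigma_simps transpose_simps B.m_assoc)
qed auto

lemma cable_class:
  assumes "w \<in> lists ({1..<3} \<times> UNIV)" "p \<in> {1, 2, 3}"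
  shows "cable p (word_class {1..<3} (braid_relations 3) w) = cable_word p w"
proof -
  let ?C = "word_class {1..<3} (braid_relations 3) w"
  have "(SOME u. u \<in> ?C) \<in> ?C"
    using word_class_self[OF assms(1)] by (rule someI)
  then show ?thesis
    using cable_word_cong[of w _ p] assms(2) by (simp add: cable_def word_class_def)
qed

lemma cable_closed [simp]: "u \<in> carrier (B 3) \<Longrightarrow> p \<in> {1, 2, 3} \<Longrightarrow> cable p u \<in> carrier (B 4)"
  using cable_class cable_word_closed by (metis B_def presented_groupE)

lemma cable_generator: "i \<in> {1..<3} \<Longrightarrow> p \<in> {1, 2, 3} \<Longrightarrow> cable p (sigma 3 i) = cable_sigma p i"
  by (simp add: sigma_def cable_class sym_group_one)

text \<open>The left factor has to be doubled at the place to which the right factor carries the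
  strand. Pure braids carry every position to itself, so on them the rule becomes
  multiplicativity.\<close>

lemma cable_mult:
  assumes "u \<in> carrier (B 3)" "v \<in> carrier (B 3)" "p \<in> {1, 2, 3}"
  shows "cable p (u \<otimes>\<^bsub>B 3\<^esub> v) = cable (braid_perm 3 v p) u \<otimes>\<^bsub>B 4\<^esub> cable p v"
proof -
  obtain x where x: "x \<in> lists ({1..<3} \<times> UNIV)" "u = word_class {1..<3} (braid_relations 3) x"
    using assms(1) unfolding B_def by (rule presented_groupE)
  obtain y where y: "y \<in> lists ({1..<3} \<times> UNIV)" "v = word_class {1..<3} (braid_relations 3) y"
    using assms(2) unfolding B_def by (rule presented_groupE)
  have q: "braid_perm 3 v p \<in> {1, 2, 3}"
    using assms(2,3) by (rule braid_perm3_closed)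
  have "u \<otimes>\<^bsub>B 3\<^esub> v = word_class {1..<3} (braid_relations 3) (x @ y)"
    unfolding x(2) y(2) B_def using x(1) y(1) by (rule word_class_mult)
  moreover have "x @ y \<in> lists ({1..<3} \<times> UNIV)" using x y by blast
  moreover have "braid_perm 3 v = word_perm y" unfolding y(2) by (rule braid_perm_word[OF y(1)])
  ultimately show ?thesis
    using cable_word_append[OF x(1) y(1), of p] q assms(3) x y by (simp add: cable_class del: insert_iff in_lists_times_UNIV append_in_lists_conv)
qed

lemma cable_generator': "cable p (sigma 3 1) = cable_sigma p 1" "cable p (sigma 3 2) = cable_sigma p 2"
  if "p \<in> {1, 2, 3}"
  using that cable_generator[of 1 p] cable_generator[of 2 p] by simp_all

lemma braid_perm3_sigma: "braid_perm 3 (sigma 3 1) = Transposition.transpose 1 2"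
   "braid_perm 3 (sigma 3 2) = Transposition.transpose 2 3"
  using braid_perm_sigma[of 1 3] braid_perm_sigma[of 2 3] by simp_all

lemma cable_one: "p \<in> {1, 2, 3} \<Longrightarrow> cable p \<one>\<^bsub>B 3\<^esub> = \<one>\<^bsub>B 4\<^esub>"
  using cable_class[of "[]" p] by (simp add: B_def word_class_one)

lemma cable_inv:
  assumes "u \<in> carrier (B 3)" "p \<in> {1, 2, 3}"
  shows "cable (braid_perm 3 u p) (inv\<^bsub>B 3\<^esub> u) = inv\<^bsub>B 4\<^esub> cable p u"
proof (rule B.inv_equality[symmetric])
  show "cable (braid_perm 3 u p) (inv\<^bsub>B 3\<^esub> u) \<otimes>\<^bsub>B 4\<^esub> cable p u = \<one>\<^bsub>B 4\<^esub>"
    using cable_mult[of "inv\<^bsub>B 3\<^esub> u" u p] assms by (simp add: cable_one)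
  show "cable p u \<in> carrier (B 4)" using assms by simp
  show "cable (braid_perm 3 u p) (inv\<^bsub>B 3\<^esub> u) \<in> carrier (B 4)"
    using assms by (intro cable_closed braid_perm3_closed) auto
qed

text \<open>A crossing of the two parallel strands slides through the cable.\<close>

lemma cable_slide:
  assumes "w \<in> carrier (B 3)" "p \<in> {1, 2, 3}"
  shows "sigma 4 (braid_perm 3 w p) \<otimes>\<^bsub>B 4\<^esub> cable p w = cable p w \<otimes>\<^bsub>B 4\<^esub> sigma 4 p"
proof -
  define P where "P w \<longleftrightarrow> (\<forall>p\<in>{1, 2, 3}. sigma 4 (braid_perm 3 w p) \<otimes>\<^bsub>B 4\<^esub> cable p w = cable p w \<otimes>\<^bsub>B 4\<^esub> sigma 4 p)" for w
  have s: "sigma 4 p \<in> carrier (B 4)" if "p \<in> {1, 2, 3}" for p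
    using that by auto
  have mult: "P (u \<otimes>\<^bsub>B 3\<^esub> v)" if "u \<in> carrier (B 3)" "v \<in> carrier (B 3)" "P u" "P v" for u v
    unfolding P_def
  proof
    fix p :: nat assume p: "p \<in> {1, 2, 3}"
    have Pu: "\<And>p. p \<in> {1, 2, 3} \<Longrightarrow> sigma 4 (braid_perm 3 u p) \<otimes>\<^bsub>B 4\<^esub> cable p u = cable p u \<otimes>\<^bsub>B 4\<^esub> sigma 4 p"
      and Pv: "\<And>p. p \<in> {1, 2, 3} \<Longrightarrow> sigma 4 (braid_perm 3 v p) \<otimes>\<^bsub>B 4\<^esub> cable p v = cable p v \<otimes>\<^bsub>B 4\<^esub> sigma 4 p"
      using that(3,4) unfolding P_def by blast+
    let ?q = "braid_perm 3 v p"
    have q: "?q \<in> {1, 2, 3}" "braid_perm 3 u ?q \<in> {1, 2, 3}"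
      using braid_perm3_closed p that(1,2) by blast+
    have "sigma 4 (braid_perm 3 u ?q) \<otimes>\<^bsub>B 4\<^esub> (cable ?q u \<otimes>\<^bsub>B 4\<^esub> cable p v)
      = cable ?q u \<otimes>\<^bsub>B 4\<^esub> (sigma 4 ?q \<otimes>\<^bsub>B 4\<^esub> cable p v)"
      using Pu[OF q(1)] q p s that(1,2) by (simp add: B.m_assoc[symmetric] del: insert_iff)
    also have "\<dots> = cable ?q u \<otimes>\<^bsub>B 4\<^esub> cable p v \<otimes>\<^bsub>B 4\<^esub> sigma 4 p"
      using Pv[OF p] q p s that(1,2) by (simp add: B.m_assoc del: insert_iff)
    finally show "sigma 4 (braid_perm 3 (u \<otimes>\<^bsub>B 3\<^esub> v) p) \<otimes>\<^bsub>B 4\<^esub> cable p (u \<otimes>\<^bsub>B 3\<^esub> v)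
      = cable p (u \<otimes>\<^bsub>B 3\<^esub> v) \<otimes>\<^bsub>B 4\<^esub> sigma 4 p"
      using p that by (simp add: cable_mult sym_group_mult del: insert_iff)
  qed
  have gen: "P (sigma 3 i)" if "i \<in> {1..<3}" for i
  proof -
    have "i = 1 \<or> i = 2" using that by auto
    then show ?thesis
      using B4.ab.braid' B4.bc.braid' B4.ac
      by (elim disjE)
        (simp_all add: P_def cable_generator' braid_perm3_sigma transpose_simps cable_sigma_simps B.m_assoc)
  qed
  have inv: "P (inv\<^bsub>B 3\<^esub> u)" if u: "u \<in> carrier (B 3)" "P u" for u
    unfolding P_def
  proof
    fix q :: nat assume q: "q \<in> {1, 2, 3}"
    define p where "p = braid_perm 3 (inv\<^bsub>B 3\<^esub> u) q"
    have p: "p \<in> {1, 2, 3}" using q u unfolding p_def by (intro braid_perm3_closed) auto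
    have "(braid_perm 3 u \<otimes>\<^bsub>sym_group 3\<^esub> braid_perm 3 (inv\<^bsub>B 3\<^esub> u)) q = q"
      using u by (simp add: sym_group_one del: sym_group_inv_equality)
    then have up: "braid_perm 3 u p = q"
      by (simp add: p_def sym_group_mult del: perm.hom_inv)
    have "sigma 4 q \<otimes>\<^bsub>B 4\<^esub> cable p u = cable p u \<otimes>\<^bsub>B 4\<^esub> sigma 4 p"
      using u(2) p up by (auto simp: P_def)
    then have "sigma 4 p \<otimes>\<^bsub>B 4\<^esub> inv\<^bsub>B 4\<^esub> cable p u = inv\<^bsub>B 4\<^esub> cable p u \<otimes>\<^bsub>B 4\<^esub> sigma 4 q"
      using p q u s[OF p] s[OF q] cable_closed[OF u(1) p]
      by (metis B.inv_closed B.inv_solve_left B.inv_solve_right B.m_assoc B.m_closed)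
    then show "sigma 4 (braid_perm 3 (inv\<^bsub>B 3\<^esub> u) q) \<otimes>\<^bsub>B 4\<^esub> cable q (inv\<^bsub>B 3\<^esub> u) = cable q (inv\<^bsub>B 3\<^esub> u) \<otimes>\<^bsub>B 4\<^esub> sigma 4 q"
      using cable_inv[OF u(1) p] up p_def by simp
  qed
  have "P w" using assms(1)
  proof (induct w rule: B_induct)
    case one
    then show ?case using s by (auto simp: P_def cable_one sym_group_one)
  qed (auto intro!: mult gen inv)
  then show ?thesis using assms(2) by (auto simp: P_def)
qed


section \<open>The homomorphisms from \<open>PB 3\<close> to \<open>PB 4\<close>\<close>

lemma pure_gen4:
  "pure_gen 4 1 2 = sigma 4 1 \<otimes>\<^bsub>B 4\<^esub> sigma 4 1"
  "pure_gen 4 2 3 = sigma 4 2 \<otimes>\<^bsub>B 4\<^esub> sigma 4 2"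
  "pure_gen 4 3 4 = sigma 4 3 \<otimes>\<^bsub>B 4\<^esub> sigma 4 3"
  "pure_gen 4 1 3 = sigma 4 2 \<otimes>\<^bsub>B 4\<^esub> (sigma 4 1 \<otimes>\<^bsub>B 4\<^esub> sigma 4 1) \<otimes>\<^bsub>B 4\<^esub> inv\<^bsub>B 4\<^esub> sigma 4 2"
  "pure_gen 4 2 4 = sigma 4 3 \<otimes>\<^bsub>B 4\<^esub> (sigma 4 2 \<otimes>\<^bsub>B 4\<^esub> sigma 4 2) \<otimes>\<^bsub>B 4\<^esub> inv\<^bsub>B 4\<^esub> sigma 4 3"
  using pure_gen_Suc[of 1 4] pure_gen_Suc[of 2 4] pure_gen_Suc[of 3 4] pure_gen_Suc2[of 1 4] pure_gen_Suc2[of 2 4]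
  by (simp_all add: eval_nat_numeral One_nat_def)

lemma pure_gen4_14:
  "pure_gen 4 1 4 = sigma 4 3 \<otimes>\<^bsub>B 4\<^esub> sigma 4 2 \<otimes>\<^bsub>B 4\<^esub> (sigma 4 1 \<otimes>\<^bsub>B 4\<^esub> sigma 4 1)
    \<otimes>\<^bsub>B 4\<^esub> inv\<^bsub>B 4\<^esub> (sigma 4 3 \<otimes>\<^bsub>B 4\<^esub> sigma 4 2)"
proof -
  have "rev [1 + 1..<4] = [3, 2::nat]" by (simp add: upt_rec)
  then show ?thesis by (simp add: pure_gen_def numeral_2_eq_2 B.m_assoc)
qed

lemma pure_gen4_closed [simp]:
  "pure_gen 4 1 2 \<in> carrier (PB 4)" "pure_gen 4 2 3 \<in> carrier (PB 4)" "pure_gen 4 3 4 \<in> carrier (PB 4)"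
  "pure_gen 4 1 3 \<in> carrier (PB 4)" "pure_gen 4 2 4 \<in> carrier (PB 4)" "pure_gen 4 1 4 \<in> carrier (PB 4)"
  by (simp_all add: pure_gen_closed)

lemma PB_perm: "u \<in> carrier (PB n) \<Longrightarrow> braid_perm n u p = p"
  by (simp only: carrier_PB mem_Collect_eq id_apply)

lemma cable_PB_hom: "p \<in> {1, 2, 3} \<Longrightarrow> cable p \<in> hom (PB 3) (B 4)"
  by (rule homI) (simp_all add: cable_mult PB_perm)

lemma cable_squares:
  assumes "p \<in> {1, 2, 3}"
  shows "cable p (pure_gen 3 1 2) = cable_sigma (Transposition.transpose 1 2 p) 1 \<otimes>\<^bsub>B 4\<^esub> cable_sigma p 1"
    and "cable p (pure_gen 3 2 3) = cable_sigma (Transposition.transpose 2 3 p) 2 \<otimes>\<^bsub>B 4\<^esub> cable_sigma p 2"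
    and "cable p (pure_gen 3 1 3) = cable_sigma (Transposition.transpose 2 3 p) 2
      \<otimes>\<^bsub>B 4\<^esub> cable (Transposition.transpose 2 3 p) (pure_gen 3 1 2)
      \<otimes>\<^bsub>B 4\<^esub> inv\<^bsub>B 4\<^esub> cable_sigma (Transposition.transpose 2 3 p) 2"
proof -
  have t: "Transposition.transpose 1 2 p \<in> {1, 2, 3}" "Transposition.transpose 2 3 p \<in> {1, 2, 3}"
    using assms by (auto simp: transpose_simps)
  show "cable p (pure_gen 3 1 2) = cable_sigma (Transposition.transpose 1 2 p) 1 \<otimes>\<^bsub>B 4\<^esub> cable_sigma p 1"
    "cable p (pure_gen 3 2 3) = cable_sigma (Transposition.transpose 2 3 p) 2 \<otimes>\<^bsub>B 4\<^esub> cable_sigma p 2"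
    using assms t by (simp_all add: pure_gen3 cable_mult cable_generator' braid_perm3_sigma del: insert_iff)
  have "cable p (inv\<^bsub>B 3\<^esub> sigma 3 2) = inv\<^bsub>B 4\<^esub> cable_sigma (Transposition.transpose 2 3 p) 2"
    using cable_inv[of "sigma 3 2", OF _ t(2)] by (simp add: cable_generator'[OF t(2)] braid_perm3_sigma)
  moreover have "braid_perm 3 (inv\<^bsub>B 3\<^esub> sigma 3 2) p = Transposition.transpose 2 3 p"
  proof -
    have "Transposition.transpose 2 3 \<in> carrier (sym_group 3)"
      unfolding sym_group_carrier by (rule permutes_swap_id) auto
    then show ?thesis
      using braid_perm3_sigma(2) by (simp add: inv_transpose_eq)
  qed
  ultimately show "cable p (pure_gen 3 1 3) = cable_sigma (Transposition.transpose 2 3 p) 2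
      \<otimes>\<^bsub>B 4\<^esub> cable (Transposition.transpose 2 3 p) (pure_gen 3 1 2)
      \<otimes>\<^bsub>B 4\<^esub> inv\<^bsub>B 4\<^esub> cable_sigma (Transposition.transpose 2 3 p) 2"
    using assms t PB_perm[OF pure_gen3_closed(1)]
    by (simp add: pure_gen3(3) pure_gen3(1)[symmetric] cable_mult cable_generator'[OF t(2)] del: insert_iff)
qed

text \<open>These are the values prescribed for \<open>phi_12_3_4\<close>, \<open>phi_1_23_4\<close>
  and \<open>phi_1_2_34\<close>, so these three maps are doublings restricted to
  \<open>PB 3\<close>.\<close>

lemma cable_pure_gens:
  "cable 1 (pure_gen 3 1 2) = pure_gen 4 1 3 \<otimes>\<^bsub>B 4\<^esub> pure_gen 4 2 3"
  "cable 1 (pure_gen 3 2 3) = pure_gen 4 3 4"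
  "cable 1 (pure_gen 3 1 3) = pure_gen 4 1 4 \<otimes>\<^bsub>B 4\<^esub> pure_gen 4 2 4"
  "cable 2 (pure_gen 3 1 2) = pure_gen 4 1 2 \<otimes>\<^bsub>B 4\<^esub> pure_gen 4 1 3"
  "cable 2 (pure_gen 3 2 3) = pure_gen 4 2 4 \<otimes>\<^bsub>B 4\<^esub> pure_gen 4 3 4"
  "cable 2 (pure_gen 3 1 3) = pure_gen 4 1 4"
  "cable 3 (pure_gen 3 1 2) = pure_gen 4 1 2"
  "cable 3 (pure_gen 3 2 3) = pure_gen 4 2 3 \<otimes>\<^bsub>B 4\<^esub> pure_gen 4 2 4"
  "cable 3 (pure_gen 3 1 3) = pure_gen 4 1 3 \<otimes>\<^bsub>B 4\<^esub> pure_gen 4 1 4"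
proof -
  show "cable 2 (pure_gen 3 1 2) = pure_gen 4 1 2 \<otimes>\<^bsub>B 4\<^esub> pure_gen 4 1 3"
    unfolding pure_gen4 B4.ab.inv_conj_square[symmetric]
    by (simp add: cable_squares cable_sigma_simps transpose_simps B.m_assoc)
  show "cable 3 (pure_gen 3 2 3) = pure_gen 4 2 3 \<otimes>\<^bsub>B 4\<^esub> pure_gen 4 2 4"
    unfolding pure_gen4 B4.bc.inv_conj_square[symmetric]
    by (simp add: cable_squares cable_sigma_simps transpose_simps B.m_assoc)
  show "cable 3 (pure_gen 3 1 3) = pure_gen 4 1 3 \<otimes>\<^bsub>B 4\<^esub> pure_gen 4 1 4"
    unfolding pure_gen4 pure_gen4_14 B4.pure_product
    by (simp add: cable_squares cable_sigma_simps transpose_simps B.m_assoc B.inv_mult_group)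
qed (simp_all add: cable_squares cable_sigma_simps transpose_simps pure_gen4 pure_gen4_14 B.m_assoc B.inv_mult_group)


section \<open>The five face maps and their extensions\<close>

abbreviation incl34 :: "nat word set \<Rightarrow> nat word set" where
  "incl34 \<equiv> B3_map (B 4) (sigma 4 1) (sigma 4 2)"

abbreviation shift34 :: "nat word set \<Rightarrow> nat word set" where
  "shift34 \<equiv> B3_map (B 4) (sigma 4 2) (sigma 4 3)"

interpretation incl: group_hom "B 3" "B 4" incl34
  by (simp add: group_hom_def group_hom_axioms_def group_B B4.ab.B3_map)

interpretation shift: group_hom "B 3" "B 4" shift34
  by (simp add: group_hom_def group_hom_axioms_def group_B B4.bc.B3_map)

datatype face_kind = F123 | F234 | F12_3_4 | F1_23_4 | F1_2_34

text \<open>On \<open>B 3\<close>, only the first two extensions are homomorphisms; the others are multiplicative in the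
  twisted sense of \<open>cable_mult\<close>.\<close>

fun face_ext :: "face_kind \<Rightarrow> nat word set \<Rightarrow> nat word set" where
  "face_ext F123 = incl34"
| "face_ext F234 = shift34"
| "face_ext F12_3_4 = cable 1"
| "face_ext F1_23_4 = cable 2"
| "face_ext F1_2_34 = cable 3"

fun face :: "face_kind \<Rightarrow> nat word set \<Rightarrow> nat word set" where
  "face F123 = phi_123"
| "face F234 = phi_234"
| "face F12_3_4 = phi_12_3_4"
| "face F1_23_4 = phi_1_23_4"
| "face F1_2_34 = phi_1_2_34"

lemma face_ext_pure_gens:
  "incl34 (pure_gen 3 1 2) = pure_gen 4 1 2" "incl34 (pure_gen 3 2 3) = pure_gen 4 2 3"
  "incl34 (pure_gen 3 1 3) = pure_gen 4 1 3"
  "shift34 (pure_gen 3 1 2) = pure_gen 4 2 3" "shift34 (pure_gen 3 2 3) = pure_gen 4 3 4"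
  "shift34 (pure_gen 3 1 3) = pure_gen 4 2 4"
  by (simp_all add: pure_gen3 pure_gen4 B4.ab.B3_map B4.bc.B3_map)

lemma face_ext_hom_B4: "face_ext F \<in> hom (PB 3) (B 4)"
proof (cases F)
  case F123
  then show ?thesis by (simp add: hom_def Pi_iff)
next
  case F234
  then show ?thesis by (simp add: hom_def Pi_iff)
qed (simp_all add: cable_PB_hom)

lemma face_ext_PB:
  assumes "w \<in> carrier (PB 3)"
  shows "face_ext F w \<in> carrier (PB 4)"
proof -
  interpret h: group_hom "PB 3" "B 4" "face_ext F"
    by (simp add: group_hom_def group_hom_axioms_def group_B face_ext_hom_B4 PB.is_group)
  have "w \<in> generate (PB 3) {pure_gen 3 1 2, pure_gen 3 2 3, pure_gen 3 1 3}"
    using assms generate_PB3 by simp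
  then show ?thesis
  proof induct
    case one
    then show ?case using h.hom_one by simp
  next
    case (incl x)
    then show ?case by (cases F) (auto simp: cable_pure_gens face_ext_pure_gens)
  next
    case (inv x)
    then have "face_ext F x \<in> carrier (PB 4)" "x \<in> carrier (PB 3)"
      by (cases F; auto simp: cable_pure_gens face_ext_pure_gens)+
    then show ?case using h.hom_inv[of x] by simp
  next
    case (eng x y)
    then have "x \<in> carrier (PB 3)" "y \<in> carrier (PB 3)" using generate_PB3 by auto
    then show ?case using h.hom_mult[of x y] eng by simp
  qed
qed

lemma face_ext_hom: "face_ext F \<in> hom (PB 3) (PB 4)"
  using face_ext_hom_B4[of F] face_ext_PB[of _ F] by (auto simp: hom_def)

text \<open>Supplies existence for the five maps given by descriptions: the restricted extension is
  a homomorphism with the prescribed values, and these determine it because the x_ij generate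
  \<open>PB 3\<close>.\<close>

lemma face_eq: "w \<in> carrier (PB 3) \<Longrightarrow> face F w = face_ext F w"
proof -
  have "PB_hom u v w = restrict (face_ext F) (carrier (PB 3))"
    if "face_ext F (pure_gen 3 1 2) = u" "face_ext F (pure_gen 3 2 3) = v" "face_ext F (pure_gen 3 1 3) = w" for u v w
    unfolding PB_hom_def
    by (rule hom_with_values_eq[OF PB.is_group PB.is_group face_ext_hom])
      (use that generate_PB3 in auto)
  then have "face F = restrict (face_ext F) (carrier (PB 3))"
    by (cases F) (simp_all add: phi_123_def phi_234_def phi_12_3_4_def phi_1_23_4_def phi_1_2_34_def
        cable_pure_gens face_ext_pure_gens)
  then show "w \<in> carrier (PB 3) \<Longrightarrow> face F w = face_ext F w" by simp
qed

lemma face_hom: "face F \<in> hom (PB 3) (PB 4)"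
  using face_ext_hom[of F] by (simp add: hom_def Pi_iff face_eq)

interpretation face: group_hom "PB 3" "PB 4" "face F" for F
  by (simp add: group_hom_def group_hom_axioms_def PB.is_group face_hom)

lemma N_PB3_eq: "N_PB3 N = {w \<in> carrier (PB 3). \<forall>F. face F w \<in> N}"
proof -
  have "(\<forall>F. P F) \<longleftrightarrow> P F123 \<and> P F234 \<and> P F12_3_4 \<and> P F1_23_4 \<and> P F1_2_34" for P
    by (metis face_kind.exhaust)
  then show ?thesis by (simp add: N_PB3_def)
qed

section \<open>Normal subgroups of finite index\<close>

text \<open>Bounds an index by a finite invariant: a function determined by \<open>f\<close> takes
  no more values than \<open>f\<close> does.\<close>

lemma finite_image_factor:
  assumes "finite (f ` A)" "\<And>x y. x \<in> A \<Longrightarrow> y \<in> A \<Longrightarrow> f x = f y \<Longrightarrow> g x = g y"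
  shows "finite (g ` A)"
proof -
  have "g ` A \<subseteq> (\<lambda>z. g (SOME x. x \<in> A \<and> f x = z)) ` f ` A"
  proof
    fix y assume "y \<in> g ` A"
    then obtain x where x: "x \<in> A" "y = g x" by blast
    then have "(SOME x'. x' \<in> A \<and> f x' = f x) \<in> A \<and> f (SOME x'. x' \<in> A \<and> f x' = f x) = f x"
      by (intro someI[of "\<lambda>x'. x' \<in> A \<and> f x' = f x"]) auto
    then have "y = g (SOME x'. x' \<in> A \<and> f x' = f x)" using x assms(2) by metis
    then show "y \<in> (\<lambda>z. g (SOME x. x \<in> A \<and> f x = z)) ` f ` A" using x(1) by blast
  qed
  then show ?thesis using assms(1) finite_surj by blast
qed

lemma rcosets_image: "rcosets\<^bsub>G\<^esub> H = (\<lambda>x. H #>\<^bsub>G\<^esub> x) ` carrier G"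
  by (auto simp: RCOSETS_def)

lemma (in group) rcos_eq_iff:
  assumes "subgroup H G" "x \<in> carrier G" "y \<in> carrier G"
  shows "H #> x = H #> y \<longleftrightarrow> x \<otimes> inv y \<in> H"
proof
  interpret H: subgroup H G by fact
  assume "H #> x = H #> y"
  then obtain h where "h \<in> H" "x = h \<otimes> y"
    using rcos_self[OF assms(2,1)] by (auto simp: r_coset_def)
  then show "x \<otimes> inv y \<in> H" using assms by (simp add: m_assoc)
next
  assume *: "x \<otimes> inv y \<in> H"
  have "x = (x \<otimes> inv y) \<otimes> y" using assms by (simp add: m_assoc)
  then have "x \<in> H #> y" using * by (auto simp: r_coset_def)
  then show "H #> x = H #> y" using repr_independence[OF _ assms(3,1)] by simp
qed

lemma (in group) rcos_eq_self_iff: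
  "subgroup H G \<Longrightarrow> x \<in> carrier G \<Longrightarrow> H #> x = H \<longleftrightarrow> x \<in> H"
  using rcos_eq_iff[of H x \<one>] by (simp add: subgroup.subset)

lemma rcos_PB [simp]: "H #>\<^bsub>PB n\<^esub> x = H #>\<^bsub>B n\<^esub> x"
  by (simp add: r_coset_def)

lemma FIN_kernel:
  assumes "group G" "group Q" "h \<in> hom G Q" "finite (carrier Q)"
  shows "{x \<in> carrier G. h x = \<one>\<^bsub>Q\<^esub>} \<in> finite_index_normal G"
proof -
  interpret h: group_hom G Q h using assms by (simp add: group_hom_def group_hom_axioms_def)
  let ?K = "{x \<in> carrier G. h x = \<one>\<^bsub>Q\<^esub>}"
  have K: "?K \<lhd> G" using h.normal_kernel by (simp add: kernel_def)
  have "finite ((\<lambda>x. ?K #>\<^bsub>G\<^esub> x) ` carrier G)"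
  proof (rule finite_image_factor)
    show "finite (h ` carrier G)" using assms(4) h.hom_closed finite_subset by (metis image_subsetI)
    fix x y assume xy: "x \<in> carrier G" "y \<in> carrier G" "h x = h y"
    then show "?K #>\<^bsub>G\<^esub> x = ?K #>\<^bsub>G\<^esub> y"
      by (subst group.rcos_eq_iff[OF assms(1) normal_imp_subgroup[OF K]]) auto
  qed
  then show ?thesis using K by (simp add: finite_index_normal_def rcosets_image)
qed

lemma FIN_normal: "N \<in> finite_index_normal G \<Longrightarrow> N \<lhd> G"
  and FIN_subgroup: "N \<in> finite_index_normal G \<Longrightarrow> subgroup N G"
  and FIN_finite: "N \<in> finite_index_normal G \<Longrightarrow> finite (carrier (G Mod N))"
  and FIN_group: "N \<in> finite_index_normal G \<Longrightarrow> group (G Mod N)"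
  by (auto simp: finite_index_normal_def FactGroup_def intro: normal_imp_subgroup dest: normal.factorgroup_is_group)

lemma rcos_hom: "N \<lhd> G \<Longrightarrow> (\<lambda>x. N #>\<^bsub>G\<^esub> x) \<in> hom G (G Mod N)"
  by (rule normal.r_coset_hom_Mod)

lemma FIN_vimage:
  assumes "group G" "group H" "h \<in> hom G H" "N \<in> finite_index_normal H"
  shows "{x \<in> carrier G. h x \<in> N} \<in> finite_index_normal G"
proof -
  interpret G: group G by fact
  interpret H: group H by fact
  have "{x \<in> carrier G. (\<lambda>x. N #>\<^bsub>H\<^esub> h x) x = \<one>\<^bsub>H Mod N\<^esub>} \<in> finite_index_normal G"
    using assms hom_compose[OF assms(3) rcos_hom[OF FIN_normal[OF assms(4)]]]
    by (intro FIN_kernel FIN_group FIN_finite) (auto simp: comp_def)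
  moreover have "N #>\<^bsub>H\<^esub> h x = N \<longleftrightarrow> h x \<in> N" if "x \<in> carrier G" for x
    using that assms(3) by (intro H.rcos_eq_self_iff FIN_subgroup assms) (auto simp: hom_def)
  ultimately show ?thesis by (simp cong: conj_cong)
qed

lemma FIN_Int:
  assumes "group G" "N \<in> finite_index_normal G" "M \<in> finite_index_normal G"
  shows "N \<inter> M \<in> finite_index_normal G"
proof -
  interpret G: group G by fact
  have sub: "N \<subseteq> carrier G" using FIN_subgroup[OF assms(2)] by (rule subgroup.subset)
  have "{x \<in> carrier G. (\<lambda>x. (N #>\<^bsub>G\<^esub> x, M #>\<^bsub>G\<^esub> x)) x = \<one>\<^bsub>(G Mod N) \<times>\<times> (G Mod M)\<^esub>} \<in> finite_index_normal G"
    using assms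
    by (intro FIN_kernel DirProd_group FIN_group)
      (auto simp: hom_paired intro: rcos_hom FIN_normal FIN_finite)
  moreover have "{x \<in> carrier G. N #>\<^bsub>G\<^esub> x = N \<and> M #>\<^bsub>G\<^esub> x = M} = N \<inter> M"
    using sub G.rcos_eq_self_iff[OF FIN_subgroup[OF assms(2)]] G.rcos_eq_self_iff[OF FIN_subgroup[OF assms(3)]]
    by blast
  ultimately show ?thesis by simp
qed

lemma PB_FIN: "carrier (PB n) \<in> finite_index_normal (B n)"
proof -
  have "finite (carrier (sym_group n))" by (simp add: sym_group_def finite_permutations)
  then have "{x \<in> carrier (B n). braid_perm n x = \<one>\<^bsub>sym_group n\<^esub>} \<in> finite_index_normal (B n)"
    by (intro FIN_kernel group_B sym_group_is_group braid_perm_hom)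
  then show ?thesis by (simp only: carrier_PB sym_group_one)
qed

lemma PB_incl_hom: "(\<lambda>x. x) \<in> hom (PB n) (B n)"
  by (rule homI) simp_all

lemma FIN_PB:
  assumes "N \<in> finite_index_normal (B n)" "N \<subseteq> carrier (PB n)"
  shows "N \<in> finite_index_normal (PB n)"
proof -
  have "{x \<in> carrier (PB n). x \<in> N} = N" using assms by blast
  then show ?thesis using FIN_vimage[OF PB.is_group group_B PB_incl_hom assms(1)] by simp
qed

lemma NFI_D:
  assumes "N \<in> NFI_PB4"
  shows "N \<in> finite_index_normal (B 4)" "N \<lhd> B 4" "subgroup N (B 4)" "N \<subseteq> carrier (PB 4)"
    "N \<in> finite_index_normal (PB 4)" "N \<lhd> PB 4" "subgroup N (PB 4)"
  using assms by (auto simp: NFI_PB4_def intro: FIN_normal FIN_subgroup FIN_PB)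

section \<open>Normality and finite index of \<open>N_PB3 N\<close> in \<open>B 3\<close>\<close>

lemma cable_conj:
  assumes "u \<in> carrier (PB 3)" "s \<in> carrier (B 3)" "p \<in> {1, 2, 3}"
  shows "cable (braid_perm 3 s p) (s \<otimes>\<^bsub>B 3\<^esub> u \<otimes>\<^bsub>B 3\<^esub> inv\<^bsub>B 3\<^esub> s)
    = cable p s \<otimes>\<^bsub>B 4\<^esub> cable p u \<otimes>\<^bsub>B 4\<^esub> inv\<^bsub>B 4\<^esub> cable p s"
proof -
  have "braid_perm 3 (inv\<^bsub>B 3\<^esub> s) (braid_perm 3 s p) = (braid_perm 3 (inv\<^bsub>B 3\<^esub> s) \<otimes>\<^bsub>sym_group 3\<^esub> braid_perm 3 s) p"
    by (simp add: sym_group_mult del: perm.hom_inv)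
  also have "\<dots> = p"
    using assms(2) perm.H.l_inv[OF perm.hom_closed[OF assms(2)]]
    by (simp add: sym_group_one del: sym_group_inv_equality)
  finally have q: "braid_perm 3 (inv\<^bsub>B 3\<^esub> s) (braid_perm 3 s p) = p" .
  show ?thesis
    using assms q braid_perm3_closed[OF assms(2,3)] cable_inv[OF assms(2,3)]
    by (simp add: cable_mult PB_perm del: insert_iff perm.hom_inv)
qed

lemma subgroup_N_PB3:
  assumes "N \<in> NFI_PB4"
  shows "subgroup (N_PB3 N) (PB 3)"
proof (rule PB.subgroupI)
  note N = NFI_D(7)[OF assms]
  show "N_PB3 N \<subseteq> carrier (PB 3)" by (auto simp: N_PB3_eq)
  show "N_PB3 N \<noteq> {}" using face.hom_one subgroup.one_closed[OF N] by (auto simp: N_PB3_eq)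
  show "inv\<^bsub>PB 3\<^esub> a \<in> N_PB3 N" if "a \<in> N_PB3 N" for a
  proof -
    have "face F (inv\<^bsub>B 3\<^esub> a) \<in> N" for F
      using that face.hom_inv[of a F] subgroup.m_inv_closed[OF N, of "face F a"] by (simp add: N_PB3_eq)
    then show ?thesis using that by (simp add: N_PB3_eq)
  qed
  show "a \<otimes>\<^bsub>PB 3\<^esub> b \<in> N_PB3 N" if "a \<in> N_PB3 N" "b \<in> N_PB3 N" for a b
  proof -
    have "face F (a \<otimes>\<^bsub>B 3\<^esub> b) \<in> N" for F
      using that face.hom_mult[of a b F] subgroup.m_closed[OF N, of "face F a" "face F b"] by (simp add: N_PB3_eq)
    then show ?thesis using that by (simp add: N_PB3_eq)
  qed
qed

lemma N_PB3_D: "w \<in> N_PB3 N \<Longrightarrow> w \<in> carrier (PB 3)" "w \<in> N_PB3 N \<Longrightarrow> face F w \<in> N"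
  by (auto simp: N_PB3_eq)

lemma all_face_ext: "(\<forall>F. face_ext F w \<in> N) \<longleftrightarrow>
    incl34 w \<in> N \<and> shift34 w \<in> N \<and> (\<forall>p\<in>{1, 2, 3}. cable p w \<in> N)"
proof -
  have "(\<forall>F. P F) \<longleftrightarrow> P F123 \<and> P F234 \<and> P F12_3_4 \<and> P F1_23_4 \<and> P F1_2_34" for P
    by (metis face_kind.exhaust)
  then show ?thesis by simp
qed

lemma N_PB3_ext: "w \<in> N_PB3 N \<longleftrightarrow> w \<in> carrier (PB 3) \<and> incl34 w \<in> N \<and> shift34 w \<in> N
    \<and> (\<forall>p\<in>{1, 2, 3}. cable p w \<in> N)"
  unfolding all_face_ext[symmetric] by (auto simp: N_PB3_eq face_eq)

text \<open>Under conjugation by \<open>s\<close>, the doubling at \<open>p\<close> becomes a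
  conjugate of the doubling at the position that \<open>s\<close> carries to \<open>p\<close>. So
  the three conditions from doublings are permuted, and the other two come from homomorphisms on
  \<open>B 3\<close>. For the index, a coset is determined by the permutation and the classes modulo
  \<open>N\<close> of the five extended faces.\<close>

lemma N_PB3_FIN:
  assumes N: "N \<in> NFI_PB4"
  shows "N_PB3 N \<in> finite_index_normal (B 3)"
proof -
  note D = NFI_D[OF N]
  interpret N: normal N "B 4" by (rule D(2))
  let ?K = "N_PB3 N"
  have sub: "subgroup ?K (B 3)"
  proof -
    have "subgroup ?K ((B 3)\<lparr>carrier := carrier (PB 3)\<rparr>)"
      using subgroup_N_PB3[OF N] PB_eq by metis
    then show ?thesis using B.incl_subgroup[OF PB_subgroup] by blast
  qed
  have mem: "w \<otimes>\<^bsub>B 4\<^esub> inv\<^bsub>B 4\<^esub> v \<in> N \<longleftrightarrow> N #>\<^bsub>B 4\<^esub> w = N #>\<^bsub>B 4\<^esub> v"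
    if "w \<in> carrier (B 4)" "v \<in> carrier (B 4)" for w v
    using B.rcos_eq_iff[OF D(3) that] by simp
  have "?K \<lhd> B 3"
    unfolding B.normal_inv_iff
  proof (intro conjI sub ballI)
    fix s u assume s: "s \<in> carrier (B 3)" and u: "u \<in> ?K"
    have uP: "u \<in> carrier (PB 3)" using u by (rule N_PB3_D)
    have "cable p (s \<otimes>\<^bsub>B 3\<^esub> u \<otimes>\<^bsub>B 3\<^esub> inv\<^bsub>B 3\<^esub> s) \<in> N" if p: "p \<in> {1, 2, 3}" for p
    proof -
      define q where "q = braid_perm 3 (inv\<^bsub>B 3\<^esub> s) p"
      have q: "q \<in> {1, 2, 3}" unfolding q_def using s p by (intro braid_perm3_closed) auto
      have "braid_perm 3 s q = (braid_perm 3 s \<otimes>\<^bsub>sym_group 3\<^esub> braid_perm 3 (inv\<^bsub>B 3\<^esub> s)) p"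
        by (simp add: sym_group_mult q_def del: perm.hom_inv)
      also have "\<dots> = p"
        using s perm.H.r_inv[OF perm.hom_closed[OF s]] by (simp add: sym_group_one del: sym_group_inv_equality)
      finally have "cable p (s \<otimes>\<^bsub>B 3\<^esub> u \<otimes>\<^bsub>B 3\<^esub> inv\<^bsub>B 3\<^esub> s) = cable q s \<otimes>\<^bsub>B 4\<^esub> cable q u \<otimes>\<^bsub>B 4\<^esub> inv\<^bsub>B 4\<^esub> cable q s"
        using cable_conj[OF uP s q] by simp
      moreover have "cable q u \<in> N" using u q by (auto simp: N_PB3_ext)
      ultimately show ?thesis using N.inv_op_closed2 cable_closed[OF s q] by simp
    qed
    then show "s \<otimes>\<^bsub>B 3\<^esub> u \<otimes>\<^bsub>B 3\<^esub> inv\<^bsub>B 3\<^esub> s \<in> ?K"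
      using s u uP PB_conj_closed(1)[OF s uP] N.inv_op_closed2[OF incl.hom_closed[OF s]]
        N.inv_op_closed2[OF shift.hom_closed[OF s]]
      by (simp add: N_PB3_ext del: insert_iff ball_simps)
  qed
  moreover have "finite ((\<lambda>x. ?K #>\<^bsub>B 3\<^esub> x) ` carrier (B 3))"
  proof (rule finite_image_factor)
    let ?f = "\<lambda>x. (braid_perm 3 x, N #>\<^bsub>B 4\<^esub> incl34 x, N #>\<^bsub>B 4\<^esub> shift34 x,
      N #>\<^bsub>B 4\<^esub> cable 1 x, N #>\<^bsub>B 4\<^esub> cable 2 x, N #>\<^bsub>B 4\<^esub> cable 3 x)"
    let ?C = "carrier (B 4 Mod N)"
    have "?f ` carrier (B 3) \<subseteq> carrier (sym_group 3) \<times> ?C \<times> ?C \<times> ?C \<times> ?C \<times> ?C"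
      by (auto simp: carrier_FactGroup)
    moreover have "finite (carrier (sym_group 3))" by (simp add: sym_group_def finite_permutations)
    ultimately show "finite (?f ` carrier (B 3))"
      using FIN_finite[OF D(1)] by (meson finite_SigmaI finite_subset)
    fix x y assume x: "x \<in> carrier (B 3)" and y: "y \<in> carrier (B 3)" and eq: "?f x = ?f y"
    let ?z = "x \<otimes>\<^bsub>B 3\<^esub> inv\<^bsub>B 3\<^esub> y"
    have perm: "braid_perm 3 x = braid_perm 3 y" using eq by simp
    have c: "N #>\<^bsub>B 4\<^esub> cable p x = N #>\<^bsub>B 4\<^esub> cable p y" if "p \<in> {1, 2, 3}" for p using eq that by auto
    have "braid_perm 3 ?z = \<one>\<^bsub>sym_group 3\<^esub>"
      using x y perm perm.H.r_inv[OF perm.hom_closed[OF y]] by (simp del: sym_group_inv_equality)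
    then have z: "?z \<in> carrier (PB 3)" using x y unfolding carrier_PB mem_Collect_eq sym_group_one by blast
    have "cable p ?z \<in> N" if p: "p \<in> {1, 2, 3}" for p
    proof -
      define q where "q = braid_perm 3 (inv\<^bsub>B 3\<^esub> y) p"
      have q: "q \<in> {1, 2, 3}" unfolding q_def using y p by (intro braid_perm3_closed) auto
      have "braid_perm 3 y q = (braid_perm 3 y \<otimes>\<^bsub>sym_group 3\<^esub> braid_perm 3 (inv\<^bsub>B 3\<^esub> y)) p"
        by (simp add: sym_group_mult q_def del: perm.hom_inv)
      also have "\<dots> = p"
        using y perm.H.r_inv[OF perm.hom_closed[OF y]] by (simp add: sym_group_one del: sym_group_inv_equality)
      finally have "cable p (inv\<^bsub>B 3\<^esub> y) = inv\<^bsub>B 4\<^esub> cable q y"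
        using cable_inv[OF y q] by simp
      then have "cable p ?z = cable q x \<otimes>\<^bsub>B 4\<^esub> inv\<^bsub>B 4\<^esub> cable q y"
        using cable_mult[of x "inv\<^bsub>B 3\<^esub> y" p] x y p by (simp add: q_def del: perm.hom_inv insert_iff)
      then show ?thesis using c[OF q] mem cable_closed[OF x q] cable_closed[OF y q] by simp
    qed
    moreover have "incl34 ?z \<in> N" "shift34 ?z \<in> N"
      using eq x y mem by simp_all
    ultimately have "?z \<in> ?K" using z by (simp add: N_PB3_ext)
    then show "?K #>\<^bsub>B 3\<^esub> x = ?K #>\<^bsub>B 3\<^esub> y" using B.rcos_eq_iff[OF sub x y] by simp
  qed
  ultimately show ?thesis by (simp add: finite_index_normal_def rcosets_image)
qed

lemma N_PB3_facts:
  assumes "N \<in> NFI_PB4"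
  shows "N_PB3 N \<lhd> B 3" "subgroup (N_PB3 N) (B 3)" "N_PB3 N \<subseteq> carrier (PB 3)"
    "N_PB3 N \<in> finite_index_normal (PB 3)" "N_PB3 N \<lhd> PB 3"
  using N_PB3_FIN[OF assms] N_PB3_D(1)[of _ N]
  by (auto intro: FIN_normal FIN_subgroup intro!: FIN_PB)

lemma central_c_eq: "central_c = full_twist (B 3) (sigma 3 1) (sigma 3 2)"
  by (simp add: central_c_def full_twist_def pure_gen3)

lemma central_c_closed [simp]: "central_c \<in> carrier (PB 3)"
  unfolding central_c_def using pure_gen3_closed by (intro PB_mult_closed)

lemma N_ord_dvd_iff:
  assumes N: "N \<in> NFI_PB4"
  shows "int (N_ord N) dvd k \<longleftrightarrow>
    (\<forall>x \<in> {pure_gen 3 1 2, pure_gen 3 2 3, central_c}. x [^]\<^bsub>B 3\<^esub> k \<in> N_PB3 N)"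
proof -
  let ?Q = "PB 3 Mod N_PB3 N"
  note K = N_PB3_facts[OF N]
  interpret Q: group ?Q by (rule FIN_group[OF K(4)])
  interpret K: normal "N_PB3 N" "PB 3" by (rule K(5))
  have "int (Q.ord (N_PB3 N #>\<^bsub>PB 3\<^esub> x)) dvd k \<longleftrightarrow> x [^]\<^bsub>B 3\<^esub> k \<in> N_PB3 N"
    if x: "x \<in> carrier (PB 3)" for x
  proof -
    have "int (Q.ord (N_PB3 N #>\<^bsub>PB 3\<^esub> x)) dvd k \<longleftrightarrow> (N_PB3 N #>\<^bsub>PB 3\<^esub> x) [^]\<^bsub>?Q\<^esub> k = \<one>\<^bsub>?Q\<^esub>"
      using x by (subst Q.int_pow_eq_id) (auto simp: carrier_FactGroup)
    also have "\<dots> \<longleftrightarrow> N_PB3 N #>\<^bsub>PB 3\<^esub> (x [^]\<^bsub>PB 3\<^esub> k) = N_PB3 N"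
      using x by (subst K.FactGroup_int_pow) auto
    also have "\<dots> \<longleftrightarrow> x [^]\<^bsub>PB 3\<^esub> k \<in> N_PB3 N"
      using x by (intro PB.rcos_eq_self_iff K.is_subgroup) auto
    finally show ?thesis using x by simp
  qed
  moreover have "int (N_ord N) dvd k \<longleftrightarrow> (\<forall>x \<in> {pure_gen 3 1 2, pure_gen 3 2 3, central_c}.
      int (Q.ord (N_PB3 N #>\<^bsub>PB 3\<^esub> x)) dvd k)"
  proof -
    have 1: "int n dvd k \<longleftrightarrow> n dvd nat \<bar>k\<bar>" for n by simp
    show ?thesis unfolding N_ord_def 1 Lcm_dvd_iff by blast
  qed
  ultimately show ?thesis by simp
qed


text \<open>Entries of profinite integers are indexed by positive numbers, so this makes the entry
  at \<open>N_ord N\<close> meaningful.\<close>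

lemma N_ord_pos:
  assumes N: "N \<in> NFI_PB4"
  shows "N_ord N > 0"
proof -
  let ?Q = "PB 3 Mod N_PB3 N"
  note K = N_PB3_facts[OF N]
  interpret Q: group ?Q by (rule FIN_group[OF K(4)])
  interpret K: normal "N_PB3 N" "PB 3" by (rule K(5))
  have "x [^]\<^bsub>B 3\<^esub> int (order ?Q) \<in> N_PB3 N" if x: "x \<in> carrier (PB 3)" for x
  proof -
    have "N_PB3 N #>\<^bsub>PB 3\<^esub> (x [^]\<^bsub>PB 3\<^esub> int (order ?Q)) = (N_PB3 N #>\<^bsub>PB 3\<^esub> x) [^]\<^bsub>?Q\<^esub> int (order ?Q)"
      using x by (subst K.FactGroup_int_pow) auto
    also have "\<dots> = N_PB3 N"
      using x Q.pow_order_eq_1[of "N_PB3 N #>\<^bsub>PB 3\<^esub> x"] by (simp add: int_pow_int carrier_FactGroup)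
    finally have "x [^]\<^bsub>PB 3\<^esub> int (order ?Q) \<in> N_PB3 N"
      using x PB.rcos_eq_self_iff[OF K.is_subgroup, of "x [^]\<^bsub>PB 3\<^esub> int (order ?Q)"] by simp
    then show ?thesis using x by simp
  qed
  then have "int (N_ord N) dvd int (order ?Q)"
    unfolding N_ord_dvd_iff[OF N] using pure_gen3_closed central_c_closed by blast
  moreover have "order ?Q > 0" using FIN_finite[OF K(4)] Q.order_gt_0_iff_finite by blast
  ultimately show ?thesis by (auto intro: gr0I)
qed

section \<open>Full twists\<close>

lemma commute_all_B:
  assumes "z \<in> carrier (B n)" "\<And>i. i \<in> {1..<n} \<Longrightarrow> z \<otimes>\<^bsub>B n\<^esub> sigma n i = sigma n i \<otimes>\<^bsub>B n\<^esub> z" "w \<in> carrier (B n)"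
  shows "z \<otimes>\<^bsub>B n\<^esub> w = w \<otimes>\<^bsub>B n\<^esub> z"
  using assms(3)
proof (induct w rule: B_induct)
  case (right_mult w i)
  have "z \<otimes>\<^bsub>B n\<^esub> (w \<otimes>\<^bsub>B n\<^esub> sigma n i) = w \<otimes>\<^bsub>B n\<^esub> (z \<otimes>\<^bsub>B n\<^esub> sigma n i)"
    using right_mult assms(1) by (simp add: B.m_assoc flip: B.m_assoc[of z])
  then show ?case using right_mult assms by (simp add: B.m_assoc)
next
  case (right_inv w i)
  have "z \<otimes>\<^bsub>B n\<^esub> (w \<otimes>\<^bsub>B n\<^esub> inv\<^bsub>B n\<^esub> sigma n i) = w \<otimes>\<^bsub>B n\<^esub> (z \<otimes>\<^bsub>B n\<^esub> inv\<^bsub>B n\<^esub> sigma n i)"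
    using right_inv assms(1) by (simp add: B.m_assoc flip: B.m_assoc[of z])
  moreover have "z \<otimes>\<^bsub>B n\<^esub> inv\<^bsub>B n\<^esub> sigma n i = inv\<^bsub>B n\<^esub> sigma n i \<otimes>\<^bsub>B n\<^esub> z"
    using B.commute_inv[of "sigma n i" n z] right_inv(2) assms(1,2) by simp
  ultimately show ?case using right_inv assms(1) by (simp add: B.m_assoc)
qed (use assms in simp)

lemma central_c_commute: "w \<in> carrier (B 3) \<Longrightarrow> central_c \<otimes>\<^bsub>B 3\<^esub> w = w \<otimes>\<^bsub>B 3\<^esub> central_c"
proof (rule commute_all_B)
  show "central_c \<otimes>\<^bsub>B 3\<^esub> sigma 3 i = sigma 3 i \<otimes>\<^bsub>B 3\<^esub> central_c" if "i \<in> {1..<3}" for i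
  proof -
    have "i = 1 \<or> i = 2" using that by auto
    then show ?thesis using B3.full_twist_commute unfolding central_c_eq by auto
  qed
qed (auto intro: PB_in_B)

text \<open>A full twist on three neighbouring strands consists of a doubled strand winding around a
  single one and of a full twist inside the double. The four cases differ in which strands form the
  double.\<close>

lemma cable_full_twists:
  "cable 1 (pure_gen 3 1 2) \<otimes>\<^bsub>B 4\<^esub> pure_gen 4 1 2 = incl34 central_c"
  "cable 2 (pure_gen 3 1 2) \<otimes>\<^bsub>B 4\<^esub> pure_gen 4 2 3 = incl34 central_c"
  "cable 2 (pure_gen 3 2 3) \<otimes>\<^bsub>B 4\<^esub> pure_gen 4 2 3 = shift34 central_c"
  "cable 3 (pure_gen 3 2 3) \<otimes>\<^bsub>B 4\<^esub> pure_gen 4 3 4 = shift34 central_c"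
proof -
  have i: "incl34 central_c = full_twist (B 4) (sigma 4 1) (sigma 4 2)"
    "shift34 central_c = full_twist (B 4) (sigma 4 2) (sigma 4 3)"
    using B3.hom_full_twist[OF B4.ab.B3_map(1) group_B] B3.hom_full_twist[OF B4.bc.B3_map(1) group_B]
    by (simp_all add: central_c_eq B4.ab.B3_map B4.bc.B3_map)
  show "cable 1 (pure_gen 3 1 2) \<otimes>\<^bsub>B 4\<^esub> pure_gen 4 1 2 = incl34 central_c"
    "cable 2 (pure_gen 3 1 2) \<otimes>\<^bsub>B 4\<^esub> pure_gen 4 2 3 = incl34 central_c"
    "cable 2 (pure_gen 3 2 3) \<otimes>\<^bsub>B 4\<^esub> pure_gen 4 2 3 = shift34 central_c"
    "cable 3 (pure_gen 3 2 3) \<otimes>\<^bsub>B 4\<^esub> pure_gen 4 3 4 = shift34 central_c"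
    unfolding i B4.ab.full_twist_eqs[symmetric]
    using B4.ab.full_twist_eqs B4.bc.full_twist_eqs
    by (simp_all add: cable_squares cable_sigma_simps transpose_simps pure_gen4 B.m_assoc)
qed

text \<open>\<open>E\<close>, \<open>M\<close> and \<open>F\<close> will be the half twist of
  \<open>B 3\<close> with its first, second and third strand doubled. Each becomes the half twist E
  a of \<open>B 4\<close> after multiplication by one generator; computing in two ways gives its
  square and its exchange of \<open>a\<close> and \<open>c\<close>.\<close>

lemma (in group) half_twist_squares:
  assumes cl: "a \<in> carrier G" "b \<in> carrier G" "c \<in> carrier G" "E \<in> carrier G" "F \<in> carrier G" "M \<in> carrier G"
    and eqs: "c \<otimes> E = E \<otimes> a" "a \<otimes> F = E \<otimes> a" "F \<otimes> c = E \<otimes> a" "M \<otimes> b = E \<otimes> a" "b \<otimes> M = E \<otimes> a"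
  shows "F \<otimes> E \<otimes> (a \<otimes> a) = E \<otimes> a \<otimes> (E \<otimes> a)" (is ?P1)
    and "M \<otimes> M \<otimes> (b \<otimes> b) = E \<otimes> a \<otimes> (E \<otimes> a)" (is ?P2)
    and "E \<otimes> F \<otimes> (c \<otimes> c) = E \<otimes> a \<otimes> (E \<otimes> a)" (is ?P3)
    and "E \<otimes> a \<otimes> a = c \<otimes> (E \<otimes> a)" (is ?P4)
    and "E \<otimes> a \<otimes> b = b \<otimes> (E \<otimes> a)" (is ?P5)
    and "E \<otimes> a \<otimes> c = a \<otimes> (E \<otimes> a)" (is ?P6)
proof -
  note assoc = m_assoc m_closed cl
  have "F \<otimes> E \<otimes> (a \<otimes> a) = F \<otimes> (E \<otimes> a) \<otimes> a" by (simp only: assoc)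
  also have "\<dots> = F \<otimes> (c \<otimes> E) \<otimes> a" by (simp only: eqs)
  also have "\<dots> = F \<otimes> c \<otimes> (E \<otimes> a)" by (simp only: assoc)
  finally show ?P1 by (simp only: eqs)
  have "M \<otimes> M \<otimes> (b \<otimes> b) = M \<otimes> (M \<otimes> b) \<otimes> b" by (simp only: assoc)
  also have "\<dots> = M \<otimes> (b \<otimes> M) \<otimes> b" by (simp only: eqs)
  also have "\<dots> = M \<otimes> b \<otimes> (M \<otimes> b)" by (simp only: assoc)
  finally show ?P2 by (simp only: eqs)
  have "E \<otimes> F \<otimes> (c \<otimes> c) = E \<otimes> (F \<otimes> c) \<otimes> c" by (simp only: assoc)
  also have "\<dots> = E \<otimes> (a \<otimes> F) \<otimes> c" by (simp only: eqs)
  also have "\<dots> = E \<otimes> a \<otimes> (F \<otimes> c)" by (simp only: assoc)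
  finally show ?P3 by (simp only: eqs)
  have "E \<otimes> a \<otimes> a = c \<otimes> E \<otimes> a" by (simp only: eqs)
  then show ?P4 by (simp only: assoc)
  have "E \<otimes> a \<otimes> b = b \<otimes> M \<otimes> b" by (simp only: eqs)
  also have "\<dots> = b \<otimes> (M \<otimes> b)" by (simp only: assoc)
  finally show ?P5 by (simp only: eqs)
  have "E \<otimes> a \<otimes> c = a \<otimes> F \<otimes> c" by (simp only: eqs)
  also have "\<dots> = a \<otimes> (F \<otimes> c)" by (simp only: assoc)
  finally show ?P6 by (simp only: eqs)
qed

section \<open>The full twist on four strands\<close>

context braid_triple begin

abbreviation E where "E \<equiv> a \<otimes> (b \<otimes> (c \<otimes> (a \<otimes> b)))"
abbreviation F where "F \<equiv> b \<otimes> (a \<otimes> (c \<otimes> (b \<otimes> a)))"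
abbreviation M where "M \<equiv> a \<otimes> (b \<otimes> (c \<otimes> (b \<otimes> a)))"

lemma half_twists:
  "c \<otimes> E = E \<otimes> a" "a \<otimes> F = E \<otimes> a" "F \<otimes> c = E \<otimes> a" "M \<otimes> b = E \<otimes> a" "b \<otimes> M = E \<otimes> a"
proof -
  have "c \<otimes> E = a \<otimes> (c \<otimes> (b \<otimes> (c \<otimes> (a \<otimes> b))))" by (simp add: ac')
  also have "\<dots> = a \<otimes> (b \<otimes> (c \<otimes> (b \<otimes> (a \<otimes> b))))"
    by (simp add: bc.braid''[symmetric])
  also have "\<dots> = E \<otimes> a" by (simp add: ab.m_assoc ab.braid'[symmetric])
  finally show "c \<otimes> E = E \<otimes> a" .
  show 2: "a \<otimes> F = E \<otimes> a" by (simp add: ab.m_assoc ac')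
  have "F \<otimes> c = b \<otimes> (a \<otimes> (c \<otimes> (b \<otimes> (c \<otimes> a))))" by (simp add: ab.m_assoc ac)
  also have "\<dots> = b \<otimes> (a \<otimes> (b \<otimes> (c \<otimes> (b \<otimes> a))))" by (simp add: bc.braid''[symmetric])
  also have "\<dots> = a \<otimes> F" by (simp add: ab.braid''[symmetric])
  finally show "F \<otimes> c = E \<otimes> a" using 2 by simp
  show "M \<otimes> b = E \<otimes> a" by (simp add: ab.m_assoc ab.braid'[symmetric])
  show "b \<otimes> M = E \<otimes> a" unfolding 2[symmetric] by (simp add: ab.braid''[symmetric])
qed

lemmas full_twist4 = ab.half_twist_squares(1-3)
  [OF ab.a ab.b bc.b ab.m_closed[OF ab.a ab.m_closed[OF ab.b ab.m_closed[OF bc.b ab.m_closed[OF ab.a ab.b]]]]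
    ab.m_closed[OF ab.b ab.m_closed[OF ab.a ab.m_closed[OF bc.b ab.m_closed[OF ab.b ab.a]]]]
    ab.m_closed[OF ab.a ab.m_closed[OF ab.b ab.m_closed[OF bc.b ab.m_closed[OF ab.b ab.a]]]] half_twists]

end

text \<open>The full twist of \<open>B 3\<close> with its first strand doubled, times the full twist
  inside the double. By \<open>full_twist4_eqs\<close> doubling another strand gives the same
  element, and it is the square of the half twist of \<open>B 4\<close>, hence central.\<close>

definition full_twist4 :: "nat word set" where
  "full_twist4 = cable 1 central_c \<otimes>\<^bsub>B 4\<^esub> pure_gen 4 1 2"

lemma full_twist4_eqs:
  "cable 2 central_c \<otimes>\<^bsub>B 4\<^esub> pure_gen 4 2 3 = full_twist4"
  "cable 3 central_c \<otimes>\<^bsub>B 4\<^esub> pure_gen 4 3 4 = full_twist4"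
  "full_twist4 = B4.E \<otimes>\<^bsub>B 4\<^esub> sigma 4 1 \<otimes>\<^bsub>B 4\<^esub> (B4.E \<otimes>\<^bsub>B 4\<^esub> sigma 4 1)"
proof -
  have p: "braid_perm 3 (B3.D) p = Transposition.transpose 1 2 (Transposition.transpose 2 3 (Transposition.transpose 1 2 p))" for p
    by (simp add: sym_group_mult braid_perm3_sigma)
  have D: "B3.D \<in> carrier (B 3)" by simp
  have cD: "cable p B3.D = cable (Transposition.transpose 2 3 (Transposition.transpose 1 2 p)) (sigma 3 1)
      \<otimes>\<^bsub>B 4\<^esub> cable (Transposition.transpose 1 2 p) (sigma 3 2) \<otimes>\<^bsub>B 4\<^esub> cable p (sigma 3 1)"
    if "p \<in> {1, 2, 3}" for p
  proof -
    have "Transposition.transpose 1 2 p \<in> {1, 2, 3}" using that by (auto simp: transpose_simps)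
    then show ?thesis using that by (simp add: cable_mult braid_perm3_sigma del: insert_iff)
  qed
  have E: "cable 1 B3.D = B4.E" "cable 2 B3.D = B4.M" "cable 3 B3.D = B4.F"
    by (simp_all only: cD transpose_simps cable_generator' insertI1 insertI2)
      (simp_all add: cable_sigma_simps B.m_assoc)
  have c: "cable 1 central_c = B4.F \<otimes>\<^bsub>B 4\<^esub> B4.E" "cable 2 central_c = B4.M \<otimes>\<^bsub>B 4\<^esub> B4.M"
    "cable 3 central_c = B4.E \<otimes>\<^bsub>B 4\<^esub> B4.F"
    using cable_mult[OF D D] by (simp_all only: central_c_eq B3.full_twist_eq p E transpose_simps insertI1 insertI2)
  show 1: "full_twist4 = B4.E \<otimes>\<^bsub>B 4\<^esub> sigma 4 1 \<otimes>\<^bsub>B 4\<^esub> (B4.E \<otimes>\<^bsub>B 4\<^esub> sigma 4 1)"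
    unfolding full_twist4_def c pure_gen4 B4.full_twist4(1) ..
  show "cable 2 central_c \<otimes>\<^bsub>B 4\<^esub> pure_gen 4 2 3 = full_twist4"
    "cable 3 central_c \<otimes>\<^bsub>B 4\<^esub> pure_gen 4 3 4 = full_twist4"
    unfolding 1 c pure_gen4 B4.full_twist4(2,3) by simp_all
qed

lemma full_twist4_closed [simp]: "full_twist4 \<in> carrier (B 4)"
  by (simp add: full_twist4_eqs(3))

lemma full_twist4_commute: "w \<in> carrier (B 4) \<Longrightarrow> full_twist4 \<otimes>\<^bsub>B 4\<^esub> w = w \<otimes>\<^bsub>B 4\<^esub> full_twist4"
proof (rule commute_all_B[OF full_twist4_closed])
  let ?D = "B4.E \<otimes>\<^bsub>B 4\<^esub> sigma 4 1"
  have D: "?D \<in> carrier (B 4)" "B4.E \<in> carrier (B 4)" "B4.F \<in> carrier (B 4)" "B4.M \<in> carrier (B 4)" by simp_all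
  have s: "sigma 4 1 \<in> carrier (B 4)" "sigma 4 2 \<in> carrier (B 4)" "sigma 4 3 \<in> carrier (B 4)" by simp_all
  note 1 = B.half_twist_squares(4)[OF s D(2-4) B4.half_twists]
    and 2 = B.half_twist_squares(5)[OF s D(2-4) B4.half_twists]
    and 3 = B.half_twist_squares(6)[OF s D(2-4) B4.half_twists]
  show "full_twist4 \<otimes>\<^bsub>B 4\<^esub> sigma 4 i = sigma 4 i \<otimes>\<^bsub>B 4\<^esub> full_twist4" if "i \<in> {1..<4}" for i
  proof -
    have swap: "?D \<otimes>\<^bsub>B 4\<^esub> ?D \<otimes>\<^bsub>B 4\<^esub> x = x \<otimes>\<^bsub>B 4\<^esub> (?D \<otimes>\<^bsub>B 4\<^esub> ?D)"
      if "x \<in> carrier (B 4)" "y \<in> carrier (B 4)" "?D \<otimes>\<^bsub>B 4\<^esub> x = y \<otimes>\<^bsub>B 4\<^esub> ?D" "?D \<otimes>\<^bsub>B 4\<^esub> y = x \<otimes>\<^bsub>B 4\<^esub> ?D" for x y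
      using that D(1) by (metis B.m_assoc)
    have "i = 1 \<or> i = 2 \<or> i = 3" using that by auto
    then show ?thesis unfolding full_twist4_eqs(3)
      using swap[OF s(1,3) 1 3] swap[OF s(2,2) 2 2] swap[OF s(3,1) 3 1] by blast
  qed
qed

declare mult_FactGroup [simp del] one_FactGroup [simp del] face.simps [simp del]

section \<open>Pairs satisfying the hexagon and pentagon relations modulo \<open>N\<close>\<close>

text \<open>Condition (iv) and \<open>N_ord\<close> are phrased with c instead of x_13. Nothing is
  lost because x_13 = (x_23 x_12)^-1 c.\<close>

lemma generate_PB3': "generate (PB 3) {pure_gen 3 1 2, pure_gen 3 2 3, central_c} = carrier (PB 3)" (is "generate _ ?A = _")
proof
  have A: "?A \<subseteq> carrier (PB 3)" by simp
  show "generate (PB 3) ?A \<subseteq> carrier (PB 3)" using PB.generate_in_carrier[OF A] by blast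
  have S: "subgroup (generate (PB 3) ?A) (PB 3)" by (rule PB.generate_is_subgroup[OF A])
  have in_A: "x \<in> generate (PB 3) ?A" if "x \<in> ?A" for x using that by (rule generate.incl)
  have "pure_gen 3 1 3 = inv\<^bsub>PB 3\<^esub> (pure_gen 3 2 3 \<otimes>\<^bsub>PB 3\<^esub> pure_gen 3 1 2) \<otimes>\<^bsub>PB 3\<^esub> central_c"
    using pure_gen3_closed by (simp add: central_c_def B.m_assoc B.inv_mult_group)
  also have "\<dots> \<in> generate (PB 3) ?A"
    by (intro subgroup.m_closed[OF S] subgroup.m_inv_closed[OF S] in_A) simp_all
  finally have "{pure_gen 3 1 2, pure_gen 3 2 3, pure_gen 3 1 3} \<subseteq> generate (PB 3) ?A"
    using in_A by blast
  then show "carrier (PB 3) \<subseteq> generate (PB 3) ?A"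
    using PB.generate_subgroup_incl[OF _ S] generate_PB3 by blast
qed

lemma factor_hom:
  assumes "group G" "group H" "h \<in> hom G H" "N \<lhd> G" "\<And>x. x \<in> N \<Longrightarrow> h x = \<one>\<^bsub>H\<^esub>"
  obtains k where "k \<in> hom (G Mod N) H" "\<And>x. x \<in> carrier G \<Longrightarrow> k (N #>\<^bsub>G\<^esub> x) = h x"
proof -
  interpret G: group G by fact
  interpret h: group_hom G H h using assms by (simp add: group_hom_def group_hom_axioms_def)
  have "h x = h y" if "x \<in> carrier G" "y \<in> carrier G" "N #>\<^bsub>G\<^esub> x = N #>\<^bsub>G\<^esub> y" for x y
  proof -
    have "x \<otimes>\<^bsub>G\<^esub> inv\<^bsub>G\<^esub> y \<in> N"
      using G.rcos_eq_iff[OF normal_imp_subgroup[OF assms(4)] that(1,2)] that(3) by simp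
    then have "h x \<otimes>\<^bsub>H\<^esub> inv\<^bsub>H\<^esub> h y = \<one>\<^bsub>H\<^esub>" using assms(5) that by fastforce
    then show ?thesis using that h.H.inv_solve_right' by fastforce
  qed
  from FactGroup_universal[OF assms(3,4) this] show thesis using that by blast
qed

lemma (in braid_pair) braid_pair_hom:
  "h \<in> hom G H \<Longrightarrow> group H \<Longrightarrow> braid_pair H (h a) (h b)"
proof -
  assume h: "h \<in> hom G H" "group H"
  then interpret h: group_hom G H h by (simp add: group_hom_def group_hom_axioms_def is_group)
  have "h (a \<otimes> b \<otimes> a) = h (b \<otimes> a \<otimes> b)" by (simp only: braid)
  then show ?thesis using h by (auto simp: braid_pair_def braid_pair_axioms_def)
qed

context group begin

definition conj_by where "conj_by k x = inv k \<otimes> x \<otimes> k"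

lemma conj_by_closed [simp, intro]: "k \<in> carrier G \<Longrightarrow> x \<in> carrier G \<Longrightarrow> conj_by k x \<in> carrier G"
  by (simp add: conj_by_def)

lemma conj_by_hom: "k \<in> carrier G \<Longrightarrow> conj_by k \<in> hom G G"
  by (rule homI) (simp_all add: conj_by_def m_assoc)

lemma conj_by_mult:
  "k \<in> carrier G \<Longrightarrow> x \<in> carrier G \<Longrightarrow> y \<in> carrier G \<Longrightarrow> conj_by k (x \<otimes> y) = conj_by k x \<otimes> conj_by k y"
  by (simp add: conj_by_def m_assoc)

lemma conj_by_inv:
  "k \<in> carrier G \<Longrightarrow> x \<in> carrier G \<Longrightarrow> conj_by k (inv x) = inv conj_by k x"
  by (simp add: conj_by_def m_assoc inv_mult_group)

lemma conj_by_int_pow: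
  "k \<in> carrier G \<Longrightarrow> x \<in> carrier G \<Longrightarrow> conj_by k x [^] (i::int) = conj_by k (x [^] i)"
  by (simp add: conj_by_def conj_int_pow)

lemma conj_by_conj_by:
  "k \<in> carrier G \<Longrightarrow> l \<in> carrier G \<Longrightarrow> x \<in> carrier G \<Longrightarrow> conj_by k (conj_by l x) = conj_by (l \<otimes> k) x"
  by (simp add: conj_by_def m_assoc inv_mult_group)

lemma conj_by_one [simp]: "x \<in> carrier G \<Longrightarrow> conj_by \<one> x = x"
  by (simp add: conj_by_def)

lemma conj_by_commute:
  "k \<in> carrier G \<Longrightarrow> x \<in> carrier G \<Longrightarrow> x \<otimes> k = k \<otimes> x \<Longrightarrow> conj_by k x = x"
  by (simp add: conj_by_def m_assoc)

lemma conj_by_mult_commute: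
  assumes "k \<in> carrier G" "l \<in> carrier G" "x \<in> carrier G" "x \<otimes> l = l \<otimes> x"
  shows "conj_by (l \<otimes> k) x = conj_by k x"
  using assms conj_by_conj_by[of k l x] conj_by_commute[of l x] by simp

end

lemma (in group) int_pow_mult_commute:
  assumes "x \<in> carrier G" "y \<in> carrier G" "x \<otimes> y = y \<otimes> x"
  shows "(x \<otimes> y) [^] (k::int) = x [^] k \<otimes> y [^] k"
  using int_pow_mult_distrib[OF assms(3,1,2)] by simp

section \<open>The homomorphisms \<open>T4\<close> and \<open>T3\<close> attached to a pair\<close>

definition T4 :: "nat word set set \<Rightarrow> int \<Rightarrow> nat word set \<Rightarrow> nat word set \<Rightarrow> nat word set set" where
  "T4 N m g = hom_with_values (B 4) (B 4 Mod N)
    [(sigma 4 1, N #>\<^bsub>B 4\<^esub> (sigma 4 1 [^]\<^bsub>B 4\<^esub> (2 * m + 1))),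
     (sigma 4 2, N #>\<^bsub>B 4\<^esub> (inv\<^bsub>B 4\<^esub> face F123 g \<otimes>\<^bsub>B 4\<^esub> sigma 4 2 [^]\<^bsub>B 4\<^esub> (2 * m + 1) \<otimes>\<^bsub>B 4\<^esub> face F123 g)),
     (sigma 4 3, N #>\<^bsub>B 4\<^esub> (inv\<^bsub>B 4\<^esub> face F12_3_4 g \<otimes>\<^bsub>B 4\<^esub> sigma 4 3 [^]\<^bsub>B 4\<^esub> (2 * m + 1) \<otimes>\<^bsub>B 4\<^esub> face F12_3_4 g))]"

text \<open>The analogue on \<open>B 3\<close>. As in \<open>T4\<close>, \<open>g\<close> is any
  pure braid instead of the image of a free group element. The restriction to \<open>PB 3\<close> is
  the homomorphism of condition (iv).\<close>

definition T3 :: "nat word set set \<Rightarrow> int \<Rightarrow> nat word set \<Rightarrow> nat word set \<Rightarrow> nat word set set" where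
  "T3 N m g = B3_map (B 3 Mod N_PB3 N)
    (N_PB3 N #>\<^bsub>B 3\<^esub> (sigma 3 1 [^]\<^bsub>B 3\<^esub> (2 * m + 1)))
    (N_PB3 N #>\<^bsub>B 3\<^esub> (inv\<^bsub>B 3\<^esub> g \<otimes>\<^bsub>B 3\<^esub> sigma 3 2 [^]\<^bsub>B 3\<^esub> (2 * m + 1) \<otimes>\<^bsub>B 3\<^esub> g))"

definition T4_kernel :: "nat word set set \<Rightarrow> int \<Rightarrow> nat word set \<Rightarrow> nat word set set" where
  "T4_kernel N m g = {w \<in> carrier (PB 4). T4 N m g w = N}"

text \<open>Conditions (i) and (ii), which are what a profinite pair gives at each object.
  Conditions (iii) and (iv) are kept apart as \<open>unit_mod\<close> and
  \<open>T3_onto\<close>.\<close>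

locale gt_pair =
  fixes N :: "nat word set set" and m :: int and g :: "nat word set"
  assumes N: "N \<in> NFI_PB4" and g [simp, intro]: "g \<in> carrier (PB 3)"
    and hexagon: "hexagons (B 3 Mod N_PB3 N) (N_PB3 N #>\<^bsub>B 3\<^esub> sigma 3 1) (N_PB3 N #>\<^bsub>B 3\<^esub> sigma 3 2) m
      (N_PB3 N #>\<^bsub>B 3\<^esub> g)"
    and pentagon: "N #>\<^bsub>B 4\<^esub> (face F234 g \<otimes>\<^bsub>B 4\<^esub> face F1_23_4 g \<otimes>\<^bsub>B 4\<^esub> face F123 g)
      = N #>\<^bsub>B 4\<^esub> (face F1_2_34 g \<otimes>\<^bsub>B 4\<^esub> face F12_3_4 g)"
begin

abbreviation K where "K \<equiv> N_PB3 N"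
abbreviation Q3 where "Q3 \<equiv> B 3 Mod K"
abbreviation Q4 where "Q4 \<equiv> B 4 Mod N"
definition pi3 where "pi3 w = K #>\<^bsub>B 3\<^esub> w"
definition pi4 where "pi4 w = N #>\<^bsub>B 4\<^esub> w"

lemmas N_facts = NFI_D[OF N]
lemmas K_facts = N_PB3_facts[OF N]
lemmas K_FIN = N_PB3_FIN[OF N]

sublocale Q3: group Q3 by (rule FIN_group[OF K_FIN])
sublocale Q4: group Q4 by (rule FIN_group[OF N_facts(1)])

sublocale p3: group_hom "B 3" Q3 pi3
  using rcos_hom[OF K_facts(1)]
  by (auto simp: group_hom_def group_hom_axioms_def group_B pi3_def[abs_def] Q3.is_group)

sublocale p4: group_hom "B 4" Q4 pi4
  using rcos_hom[OF N_facts(2)]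
  by (auto simp: group_hom_def group_hom_axioms_def group_B pi4_def[abs_def] Q4.is_group)

lemma one_Q: "\<one>\<^bsub>Q3\<^esub> = K" "\<one>\<^bsub>Q4\<^esub> = N" by (simp_all add: one_FactGroup)

lemma pi3_eq_iff: "u \<in> carrier (B 3) \<Longrightarrow> v \<in> carrier (B 3) \<Longrightarrow> pi3 u = pi3 v \<longleftrightarrow> u \<otimes>\<^bsub>B 3\<^esub> inv\<^bsub>B 3\<^esub> v \<in> K"
  unfolding pi3_def by (rule B.rcos_eq_iff[OF K_facts(2)])

lemma pi4_eq_iff: "u \<in> carrier (B 4) \<Longrightarrow> v \<in> carrier (B 4) \<Longrightarrow> pi4 u = pi4 v \<longleftrightarrow> u \<otimes>\<^bsub>B 4\<^esub> inv\<^bsub>B 4\<^esub> v \<in> N"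
  unfolding pi4_def by (rule B.rcos_eq_iff[OF N_facts(3)])

lemma pi3_one_iff: "u \<in> carrier (B 3) \<Longrightarrow> pi3 u = K \<longleftrightarrow> u \<in> K"
  unfolding pi3_def by (rule B.rcos_eq_self_iff[OF K_facts(2)])

lemma pi4_one_iff: "u \<in> carrier (B 4) \<Longrightarrow> pi4 u = N \<longleftrightarrow> u \<in> N"
  unfolding pi4_def by (rule B.rcos_eq_self_iff[OF N_facts(3)])

lemma gB [simp, intro]: "g \<in> carrier (B 3)" by (rule PB_in_B[OF g])

lemma face_B [simp, intro]: "w \<in> carrier (PB 3) \<Longrightarrow> face F w \<in> carrier (B 4)"
  using face.hom_closed PB_in_B by blast

lemma face_PB [simp, intro]: "w \<in> carrier (PB 3) \<Longrightarrow> face F w \<in> carrier (PB 4)"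
  using face.hom_closed by blast

lemma face_mult: "u \<in> carrier (PB 3) \<Longrightarrow> v \<in> carrier (PB 3) \<Longrightarrow> face F (u \<otimes>\<^bsub>B 3\<^esub> v) = face F u \<otimes>\<^bsub>B 4\<^esub> face F v"
  using face.hom_mult by simp

lemma face_inv: "u \<in> carrier (PB 3) \<Longrightarrow> face F (inv\<^bsub>B 3\<^esub> u) = inv\<^bsub>B 4\<^esub> face F u"
  using face.hom_inv[of u F] by simp

lemma face_int_pow: "u \<in> carrier (PB 3) \<Longrightarrow> face F (u [^]\<^bsub>B 3\<^esub> (k::int)) = face F u [^]\<^bsub>B 4\<^esub> k"
  using face.hom_int_pow[of u F k] by simp

lemma face_cong:
  assumes "u \<in> carrier (PB 3)" "v \<in> carrier (PB 3)" "pi3 u = pi3 v"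
  shows "pi4 (face F u) = pi4 (face F v)"
proof -
  have "u \<otimes>\<^bsub>B 3\<^esub> inv\<^bsub>B 3\<^esub> v \<in> K" using assms by (simp add: pi3_eq_iff)
  then have "face F (u \<otimes>\<^bsub>B 3\<^esub> inv\<^bsub>B 3\<^esub> v) \<in> N" by (rule N_PB3_D)
  then show ?thesis using assms by (simp add: pi4_eq_iff face_mult face_inv)
qed

sublocale hp: hexagon_pair Q3 "pi3 (sigma 3 1)" "pi3 (sigma 3 2)" m "pi3 g"
proof -
  interpret bp: braid_pair Q3 "pi3 (sigma 3 1)" "pi3 (sigma 3 2)"
    by (rule B3.braid_pair_hom[OF p3.homh Q3.is_group])
  show "hexagon_pair Q3 (pi3 (sigma 3 1)) (pi3 (sigma 3 2)) m (pi3 g)"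
    by unfold_locales (use hexagon in \<open>simp_all add: pi3_def[symmetric]\<close>)
qed

abbreviation e where "e F \<equiv> pi4 (face F g)"
abbreviation mu where "mu \<equiv> 2 * m + 1"

lemma pent: "e F234 \<otimes>\<^bsub>Q4\<^esub> (e F1_23_4 \<otimes>\<^bsub>Q4\<^esub> e F123) = e F1_2_34 \<otimes>\<^bsub>Q4\<^esub> e F12_3_4"
proof -
  have "pi4 (face F234 g \<otimes>\<^bsub>B 4\<^esub> face F1_23_4 g \<otimes>\<^bsub>B 4\<^esub> face F123 g)
      = pi4 (face F1_2_34 g \<otimes>\<^bsub>B 4\<^esub> face F12_3_4 g)"
    unfolding pi4_def by (rule pentagon)
  then show ?thesis by (simp add: Q4.m_assoc)
qed

lemma hom34_factor:
  assumes "h \<in> hom (B 3) (B 4)" "\<And>x. x \<in> K \<Longrightarrow> h x \<in> N"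
  obtains k where "k \<in> hom Q3 Q4" "\<And>x. x \<in> carrier (B 3) \<Longrightarrow> k (pi3 x) = pi4 (h x)"
proof -
  have 1: "pi4 \<circ> h \<in> hom (B 3) Q4" by (rule hom_compose[OF assms(1) p4.homh])
  have 2: "(pi4 \<circ> h) x = \<one>\<^bsub>Q4\<^esub>" if "x \<in> K" for x
    using that assms K_facts(3) pi4_one_iff[of "h x"] by (auto simp: hom_def one_Q)
  obtain k where k: "k \<in> hom Q3 Q4" "\<And>x. x \<in> carrier (B 3) \<Longrightarrow> k (K #>\<^bsub>B 3\<^esub> x) = (pi4 \<circ> h) x"
    using factor_hom[OF group_B Q4.is_group 1 K_facts(1) 2] by blast
  show thesis by (rule that[of k]) (use k in \<open>auto simp: pi3_def\<close>)
qed

lemma incl_factor: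
  obtains k where "k \<in> hom Q3 Q4" "\<And>x. x \<in> carrier (B 3) \<Longrightarrow> k (pi3 x) = pi4 (incl34 x)"
  by (rule hom34_factor[OF incl.homh]) (auto simp: N_PB3_ext)

lemma shift_factor:
  obtains k where "k \<in> hom Q3 Q4" "\<And>x. x \<in> carrier (B 3) \<Longrightarrow> k (pi3 x) = pi4 (shift34 x)"
  by (rule hom34_factor[OF shift.homh]) (auto simp: N_PB3_ext)

definition A1 where "A1 = pi4 (sigma 4 1) [^]\<^bsub>Q4\<^esub> mu"
definition A2 where "A2 = Q4.conj_by (e F123) (pi4 (sigma 4 2) [^]\<^bsub>Q4\<^esub> mu)"
definition A3 where "A3 = Q4.conj_by (e F12_3_4) (pi4 (sigma 4 3) [^]\<^bsub>Q4\<^esub> mu)"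

abbreviation k234 where "k234 \<equiv> e F1_23_4 \<otimes>\<^bsub>Q4\<^esub> e F123"

lemma face_ext_g [simp]:
  "incl34 g = face F123 g" "shift34 g = face F234 g" "cable 1 g = face F12_3_4 g"
  "cable 2 g = face F1_23_4 g" "cable 3 g = face F1_2_34 g"
  using face_eq[OF g, of F123] face_eq[OF g, of F234] face_eq[OF g, of F12_3_4] face_eq[OF g, of F1_23_4]
    face_eq[OF g, of F1_2_34] by (simp_all)

lemma e_closed [simp, intro]: "e F \<in> carrier Q4"
  by simp

text \<open>The crossing of the two parallel strands slides along the cable and, the braid being
  pure, comes out at the place where it went in.\<close>

lemma cable_commute:
  assumes "u \<in> carrier (PB 3)" "p \<in> {1, 2, 3}"
  shows "sigma 4 p \<otimes>\<^bsub>B 4\<^esub> cable p u = cable p u \<otimes>\<^bsub>B 4\<^esub> sigma 4 p"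
  using cable_slide[OF PB_in_B[OF assms(1)] assms(2)] by (simp only: PB_perm[OF assms(1)])

lemma e_commute:
  "pi4 (sigma 4 1) \<otimes>\<^bsub>Q4\<^esub> e F12_3_4 = e F12_3_4 \<otimes>\<^bsub>Q4\<^esub> pi4 (sigma 4 1)"
  "pi4 (sigma 4 2) \<otimes>\<^bsub>Q4\<^esub> e F1_23_4 = e F1_23_4 \<otimes>\<^bsub>Q4\<^esub> pi4 (sigma 4 2)"
  "pi4 (sigma 4 3) \<otimes>\<^bsub>Q4\<^esub> e F1_2_34 = e F1_2_34 \<otimes>\<^bsub>Q4\<^esub> pi4 (sigma 4 3)"
  using cable_commute[OF g, of 1] cable_commute[OF g, of 2] cable_commute[OF g, of 3]
  by (simp_all del: p4.hom_mult add: p4.hom_mult[symmetric])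

text \<open>\<open>e F1_23_4\<close> comes from a braid in which strands 2 and 3 are parallel, so it
  commutes with \<sigma>_2 and can be inserted in the conjugating element.\<close>

lemma A2_alt: "A2 = Q4.conj_by k234 (pi4 (sigma 4 2) [^]\<^bsub>Q4\<^esub> mu)"
  unfolding A2_def
  by (rule Q4.conj_by_mult_commute[symmetric]) (auto simp: Q4.int_pow_commute e_commute)

text \<open>This is where the pentagon enters: it rewrites \<open>e F234\<close> times
  \<open>k234\<close> as \<open>e F1_2_34\<close> times \<open>e F12_3_4\<close>, and the first of
  these factors commutes with \<sigma>_3.\<close>

lemma A3_alt: "A3 = Q4.conj_by k234 (Q4.conj_by (e F234) (pi4 (sigma 4 3) [^]\<^bsub>Q4\<^esub> mu))"
proof -
  have "Q4.conj_by k234 (Q4.conj_by (e F234) (pi4 (sigma 4 3) [^]\<^bsub>Q4\<^esub> mu))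
      = Q4.conj_by (e F1_2_34 \<otimes>\<^bsub>Q4\<^esub> e F12_3_4) (pi4 (sigma 4 3) [^]\<^bsub>Q4\<^esub> mu)"
    by (subst Q4.conj_by_conj_by) (auto simp: pent)
  also have "\<dots> = A3"
    unfolding A3_def
    by (rule Q4.conj_by_mult_commute) (auto simp: Q4.int_pow_commute e_commute)
  finally show ?thesis by simp
qed

lemma A_closed [simp]: "A1 \<in> carrier Q4" "A2 \<in> carrier Q4" "A3 \<in> carrier Q4"
  by (simp_all add: A1_def A2_def A3_def)

lemma ab'_eq: "hp.a' = pi3 (sigma 3 1) [^]\<^bsub>Q3\<^esub> mu" "hp.b' = Q3.conj_by (pi3 g) (pi3 (sigma 3 2) [^]\<^bsub>Q3\<^esub> mu)"
  by (simp_all add: hp.a'_def hp.b'_def Q3.conj_by_def)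

lemma incl_factor_ab':
  assumes "k \<in> hom Q3 Q4" "\<And>x. x \<in> carrier (B 3) \<Longrightarrow> k (pi3 x) = pi4 (incl34 x)"
  shows "k hp.a' = A1" "k hp.b' = A2"
proof -
  interpret k: group_hom Q3 Q4 k using assms(1) by unfold_locales
  show "k hp.a' = A1" "k hp.b' = A2"
    by (simp_all add: ab'_eq A1_def A2_def Q3.conj_by_def Q4.conj_by_def k.hom_int_pow assms(2) B4.ab.B3_map)
qed

lemma shift_factor_ab':
  assumes "k \<in> hom Q3 Q4" "\<And>x. x \<in> carrier (B 3) \<Longrightarrow> k (pi3 x) = pi4 (shift34 x)"
  shows "Q4.conj_by k234 (k hp.a') = A2" "Q4.conj_by k234 (k hp.b') = A3"
proof -
  interpret k: group_hom Q3 Q4 k using assms(1) by unfold_locales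
  have "k hp.a' = pi4 (sigma 4 2) [^]\<^bsub>Q4\<^esub> mu" "k hp.b' = Q4.conj_by (e F234) (pi4 (sigma 4 3) [^]\<^bsub>Q4\<^esub> mu)"
    by (simp_all add: ab'_eq Q3.conj_by_def Q4.conj_by_def k.hom_int_pow assms(2) B4.bc.B3_map)
  then show "Q4.conj_by k234 (k hp.a') = A2" "Q4.conj_by k234 (k hp.b') = A3"
    by (simp_all only: A2_alt A3_alt)
qed

text \<open>The hexagon pair supplies both braid relations: for the first two elements through the
  inclusion of the first three strands, for the last two through the last three strands followed by
  conjugation by \<open>k234\<close>. The outer two commute because \<sigma>_1 commutes with
  \<sigma>_3 and with \<open>e F12_3_4\<close>.\<close>

sublocale A: braid_triple Q4 A1 A2 A3
proof (intro_locales)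
  obtain k where k: "k \<in> hom Q3 Q4" "\<And>x. x \<in> carrier (B 3) \<Longrightarrow> k (pi3 x) = pi4 (incl34 x)"
    using incl_factor by blast
  have "braid_pair Q4 A1 A2"
    using hp.pair'.braid_pair_hom[OF k(1) Q4.is_group] by (simp only: incl_factor_ab'[OF k])
  then show "braid_pair_axioms Q4 A1 A2" by (simp add: braid_pair_def)
  obtain l where l: "l \<in> hom Q3 Q4" "\<And>x. x \<in> carrier (B 3) \<Longrightarrow> l (pi3 x) = pi4 (shift34 x)"
    using shift_factor by blast
  have "braid_pair Q4 (Q4.conj_by k234 (l hp.a')) (Q4.conj_by k234 (l hp.b'))"
    using hp.pair'.braid_pair_hom[OF hom_compose[OF l(1) Q4.conj_by_hom[of k234]] Q4.is_group]
    by simp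
  then show "braid_pair_axioms Q4 A2 A3" by (simp add: shift_factor_ab'[OF l] braid_pair_def)
  have c: "pi4 (sigma 4 1) \<otimes>\<^bsub>Q4\<^esub> pi4 (sigma 4 3) = pi4 (sigma 4 3) \<otimes>\<^bsub>Q4\<^esub> pi4 (sigma 4 1)"
    using B4.ac by (simp del: p4.hom_mult add: p4.hom_mult[symmetric])
  have "pi4 (sigma 4 1) \<otimes>\<^bsub>Q4\<^esub> A3 = A3 \<otimes>\<^bsub>Q4\<^esub> pi4 (sigma 4 1)"
  proof -
    have "pi4 (sigma 4 1) = Q4.conj_by (e F12_3_4) (pi4 (sigma 4 1))"
      using e_commute(1) by (intro Q4.conj_by_commute[symmetric]) (auto)
    moreover have "pi4 (sigma 4 1) \<otimes>\<^bsub>Q4\<^esub> pi4 (sigma 4 3) [^]\<^bsub>Q4\<^esub> mu = pi4 (sigma 4 3) [^]\<^bsub>Q4\<^esub> mu \<otimes>\<^bsub>Q4\<^esub> pi4 (sigma 4 1)"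
      using c by (intro Q4.int_pow_commute[symmetric]) auto
    ultimately show ?thesis unfolding A3_def
      using Q4.conj_by_mult[of "e F12_3_4" "pi4 (sigma 4 1)" "pi4 (sigma 4 3) [^]\<^bsub>Q4\<^esub> mu"]
        Q4.conj_by_mult[of "e F12_3_4" "pi4 (sigma 4 3) [^]\<^bsub>Q4\<^esub> mu" "pi4 (sigma 4 1)"]
      by (simp)
  qed
  then show "braid_triple_axioms Q4 A1 A3"
    unfolding braid_triple_axioms_def A1_def by (intro Q4.int_pow_commute) auto
qed

lemma T4_hom: "T4 N m g \<in> hom (B 4) Q4"
  and T4_sigma: "T4 N m g (sigma 4 1) = A1" "T4 N m g (sigma 4 2) = A2" "T4 N m g (sigma 4 3) = A3"
proof -
  have vals: "N #>\<^bsub>B 4\<^esub> (sigma 4 1 [^]\<^bsub>B 4\<^esub> mu) = A1"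
    "N #>\<^bsub>B 4\<^esub> (inv\<^bsub>B 4\<^esub> face F123 g \<otimes>\<^bsub>B 4\<^esub> sigma 4 2 [^]\<^bsub>B 4\<^esub> mu \<otimes>\<^bsub>B 4\<^esub> face F123 g) = A2"
    "N #>\<^bsub>B 4\<^esub> (inv\<^bsub>B 4\<^esub> face F12_3_4 g \<otimes>\<^bsub>B 4\<^esub> sigma 4 3 [^]\<^bsub>B 4\<^esub> mu \<otimes>\<^bsub>B 4\<^esub> face F12_3_4 g) = A3"
    by (simp_all add: pi4_def[symmetric] A1_def A2_def A3_def Q4.conj_by_def p4.hom_int_pow)
  obtain h where h: "h \<in> hom (B 4) Q4" "h (sigma 4 1) = A1" "h (sigma 4 2) = A2" "h (sigma 4 3) = A3"
    by (rule Q4.B4_hom[OF A.ab.braid_pair_axioms A.bc.braid_pair_axioms A.ac])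
  note props = hom_with_values_hom[OF group_B Q4.is_group h(1),
      of "[(sigma 4 1, A1), (sigma 4 2, A2), (sigma 4 3, A3)]"]
  show "T4 N m g \<in> hom (B 4) Q4" "T4 N m g (sigma 4 1) = A1" "T4 N m g (sigma 4 2) = A2" "T4 N m g (sigma 4 3) = A3"
    unfolding T4_def vals by (rule props; use h generate_B4 in auto)+
qed

section \<open>Powers and conjugation under \<open>T4\<close>\<close>

sublocale T4: group_hom "B 4" Q4 "T4 N m g"
  using T4_hom by unfold_locales

lemma T3_hom: "T3 N m g \<in> hom (B 3) Q3"
  and T3_sigma: "T3 N m g (sigma 3 1) = hp.a'" "T3 N m g (sigma 3 2) = hp.b'"
proof -
  have vals: "N_PB3 N #>\<^bsub>B 3\<^esub> (sigma 3 1 [^]\<^bsub>B 3\<^esub> mu) = hp.a'"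
    "N_PB3 N #>\<^bsub>B 3\<^esub> (inv\<^bsub>B 3\<^esub> g \<otimes>\<^bsub>B 3\<^esub> sigma 3 2 [^]\<^bsub>B 3\<^esub> mu \<otimes>\<^bsub>B 3\<^esub> g) = hp.b'"
    by (simp_all add: pi3_def[symmetric] ab'_eq Q3.conj_by_def p3.hom_int_pow)
  show "T3 N m g \<in> hom (B 3) Q3" "T3 N m g (sigma 3 1) = hp.a'" "T3 N m g (sigma 3 2) = hp.b'"
    unfolding T3_def vals by (rule hp.pair'.B3_map)+
qed

sublocale T3: group_hom "B 3" Q3 "T3 N m g"
  using T3_hom by unfold_locales

text \<open>The property says that \<open>T4\<close> raises \<open>v\<close> to the power 2m+1 up to
  conjugation by \<open>k\<close>. It passes to products and quotients of commuting elements, which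
  is enough to get from full twists to the faces of the generators of \<open>PB 3\<close>.\<close>

definition T4_power where
  "T4_power k v \<longleftrightarrow> k \<in> carrier Q4 \<and> v \<in> carrier (B 4) \<and> T4 N m g v = Q4.conj_by k (pi4 v [^]\<^bsub>Q4\<^esub> mu)"

lemma T4_power_mult:
  assumes "T4_power k v" "T4_power k z" "v \<otimes>\<^bsub>B 4\<^esub> z = z \<otimes>\<^bsub>B 4\<^esub> v"
  shows "T4_power k (v \<otimes>\<^bsub>B 4\<^esub> z)"
proof -
  have "pi4 v \<otimes>\<^bsub>Q4\<^esub> pi4 z = pi4 z \<otimes>\<^bsub>Q4\<^esub> pi4 v"
    using assms by (simp add: T4_power_def flip: p4.hom_mult)
  then show ?thesis
    using assms by (simp add: T4_power_def Q4.int_pow_mult_commute Q4.conj_by_mult)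
qed

lemma T4_power_inv: "T4_power k z \<Longrightarrow> T4_power k (inv\<^bsub>B 4\<^esub> z)"
  by (simp add: T4_power_def Q4.int_pow_inv Q4.conj_by_inv)

lemma T4_power_div:
  assumes "v = u \<otimes>\<^bsub>B 4\<^esub> z" "u \<in> carrier (B 4)" "T4_power k v" "T4_power k z" "v \<otimes>\<^bsub>B 4\<^esub> z = z \<otimes>\<^bsub>B 4\<^esub> v"
  shows "T4_power k u"
proof -
  have z: "z \<in> carrier (B 4)" "v \<in> carrier (B 4)" using assms by (auto simp: T4_power_def)
  have "u = v \<otimes>\<^bsub>B 4\<^esub> inv\<^bsub>B 4\<^esub> z" using assms(1,2) z by (simp add: B.m_assoc)
  moreover have "v \<otimes>\<^bsub>B 4\<^esub> inv\<^bsub>B 4\<^esub> z = inv\<^bsub>B 4\<^esub> z \<otimes>\<^bsub>B 4\<^esub> v"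
    using B.commute_inv[of z 4 v] z assms(5) by simp
  ultimately show ?thesis using T4_power_mult[OF assms(3) T4_power_inv[OF assms(4)]] by simp
qed

text \<open>Used to bring the conjugating elements into the form required by each face: a factor
  that commutes with \<open>v\<close> modulo \<open>N\<close> cannot be seen by
  \<open>v\<close>.\<close>

lemma T4_power_change:
  assumes "T4_power k v" "l \<in> carrier Q4" "pi4 v \<otimes>\<^bsub>Q4\<^esub> l = l \<otimes>\<^bsub>Q4\<^esub> pi4 v"
  shows "T4_power (l \<otimes>\<^bsub>Q4\<^esub> k) v"
  using assms by (simp add: T4_power_def Q4.conj_by_mult_commute Q4.int_pow_commute)

lemma T4_power_change_one:
  assumes "T4_power \<one>\<^bsub>Q4\<^esub> v" "l \<in> carrier Q4" "pi4 v \<otimes>\<^bsub>Q4\<^esub> l = l \<otimes>\<^bsub>Q4\<^esub> pi4 v"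
  shows "T4_power l v"
  using T4_power_change[OF assms] assms(2) by simp

lemma pi4_commute:
  "u \<in> carrier (B 4) \<Longrightarrow> v \<in> carrier (B 4) \<Longrightarrow> u \<otimes>\<^bsub>B 4\<^esub> v = v \<otimes>\<^bsub>B 4\<^esub> u \<Longrightarrow>
    pi4 u \<otimes>\<^bsub>Q4\<^esub> pi4 v = pi4 v \<otimes>\<^bsub>Q4\<^esub> pi4 u"
  by (simp flip: p4.hom_mult)

lemma T4_power_sigma:
  "T4_power \<one>\<^bsub>Q4\<^esub> (sigma 4 1)" "T4_power (e F123) (sigma 4 2)" "T4_power (e F12_3_4) (sigma 4 3)"
  by (simp_all add: T4_power_def T4_sigma A1_def A2_def A3_def)

lemma T4_power_x:
  "T4_power \<one>\<^bsub>Q4\<^esub> (pure_gen 4 1 2)" "T4_power (e F123) (pure_gen 4 2 3)" "T4_power (e F12_3_4) (pure_gen 4 3 4)"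
proof -
  have "T4_power k (v \<otimes>\<^bsub>B 4\<^esub> v)" if "T4_power k v" for k v
    using T4_power_mult[of k v v] that by simp
  then show "T4_power \<one>\<^bsub>Q4\<^esub> (pure_gen 4 1 2)" "T4_power (e F123) (pure_gen 4 2 3)" "T4_power (e F12_3_4) (pure_gen 4 3 4)"
    by (simp_all add: pure_gen4 T4_power_sigma)
qed

lemma central_c_B [simp]: "central_c \<in> carrier (B 3)"
  by (intro PB_in_B central_c_closed)

lemma hp_c: "hp.c = pi3 central_c"
  using B3.hom_full_twist[OF p3.homh Q3.is_group] by (simp add: central_c_eq)

text \<open>\<open>A1\<close> and \<open>A2\<close> are the image of the pair \<open>hp.a'\<close>,
  \<open>hp.b'\<close>, whose full twist is a power of the original one by
  \<open>full_twist'\<close>.\<close>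

lemma T4_power_incl_c: "T4_power \<one>\<^bsub>Q4\<^esub> (incl34 central_c)"
proof -
  obtain k where k: "k \<in> hom Q3 Q4" "\<And>x. x \<in> carrier (B 3) \<Longrightarrow> k (pi3 x) = pi4 (incl34 x)"
    using incl_factor by blast
  interpret k: group_hom Q3 Q4 k using k(1) by unfold_locales
  have "T4 N m g (incl34 central_c) = full_twist Q4 A1 A2"
    using B3.hom_full_twist[OF incl.homh group_B] B4.ab.hom_full_twist[OF T4_hom Q4.is_group]
    by (simp add: central_c_eq B4.ab.B3_map T4_sigma)
  also have "\<dots> = k (hp.c [^]\<^bsub>Q3\<^esub> mu)"
    using hp.pair'.hom_full_twist[OF k(1) Q4.is_group] by (simp add: incl_factor_ab'[OF k] hp.full_twist')
  also have "\<dots> = pi4 (incl34 central_c) [^]\<^bsub>Q4\<^esub> mu"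
    by (simp add: hp_c k.hom_int_pow k(2))
  finally show ?thesis by (simp add: T4_power_def)
qed

lemma T4_power_shift_c: "T4_power k234 (shift34 central_c)"
proof -
  obtain k where k: "k \<in> hom Q3 Q4" "\<And>x. x \<in> carrier (B 3) \<Longrightarrow> k (pi3 x) = pi4 (shift34 x)"
    using shift_factor by blast
  interpret k: group_hom Q3 Q4 k using k(1) by unfold_locales
  have "T4 N m g (shift34 central_c) = full_twist Q4 A2 A3"
    using B3.hom_full_twist[OF shift.homh group_B] B4.bc.hom_full_twist[OF T4_hom Q4.is_group]
    by (simp add: central_c_eq B4.bc.B3_map T4_sigma)
  also have "\<dots> = Q4.conj_by k234 (k (hp.c [^]\<^bsub>Q3\<^esub> mu))"
    using hp.pair'.hom_full_twist[OF hom_compose[OF k(1) Q4.conj_by_hom[of k234]] Q4.is_group]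
    by (simp add: shift_factor_ab'[OF k] hp.full_twist')
  also have "\<dots> = Q4.conj_by k234 (pi4 (shift34 central_c) [^]\<^bsub>Q4\<^esub> mu)"
    by (simp add: hp_c k.hom_int_pow k(2))
  finally show ?thesis by (simp add: T4_power_def)
qed

lemma incl_c_commute: "w \<in> carrier (B 3) \<Longrightarrow> incl34 central_c \<otimes>\<^bsub>B 4\<^esub> incl34 w = incl34 w \<otimes>\<^bsub>B 4\<^esub> incl34 central_c"
  and shift_c_commute: "w \<in> carrier (B 3) \<Longrightarrow> shift34 central_c \<otimes>\<^bsub>B 4\<^esub> shift34 w = shift34 w \<otimes>\<^bsub>B 4\<^esub> shift34 central_c"
  using central_c_commute[of w] by (simp_all flip: incl.hom_mult shift.hom_mult)

lemma incl_c_x: "incl34 central_c \<otimes>\<^bsub>B 4\<^esub> pure_gen 4 1 2 = pure_gen 4 1 2 \<otimes>\<^bsub>B 4\<^esub> incl34 central_c"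
  "incl34 central_c \<otimes>\<^bsub>B 4\<^esub> pure_gen 4 2 3 = pure_gen 4 2 3 \<otimes>\<^bsub>B 4\<^esub> incl34 central_c"
  "shift34 central_c \<otimes>\<^bsub>B 4\<^esub> pure_gen 4 2 3 = pure_gen 4 2 3 \<otimes>\<^bsub>B 4\<^esub> shift34 central_c"
  "shift34 central_c \<otimes>\<^bsub>B 4\<^esub> pure_gen 4 3 4 = pure_gen 4 3 4 \<otimes>\<^bsub>B 4\<^esub> shift34 central_c"
  using incl_c_commute[of "pure_gen 3 1 2"] incl_c_commute[of "pure_gen 3 2 3"]
    shift_c_commute[of "pure_gen 3 1 2"] shift_c_commute[of "pure_gen 3 2 3"]
  by (simp_all add: face_ext_pure_gens PB_in_B)

lemma pure_gen4_B [simp]: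
  "pure_gen 4 1 2 \<in> carrier (B 4)" "pure_gen 4 2 3 \<in> carrier (B 4)" "pure_gen 4 3 4 \<in> carrier (B 4)"
  by (simp_all add: PB_in_B)

lemma pure_gen3_B [simp]: "pure_gen 3 1 2 \<in> carrier (B 3)" "pure_gen 3 2 3 \<in> carrier (B 3)"
  by (simp_all add: PB_in_B)

text \<open>The full twist on the first three strands is divided by x_12, with which it
  commutes.\<close>

lemma T4_power_cable1_x12: "T4_power \<one>\<^bsub>Q4\<^esub> (cable 1 (pure_gen 3 1 2))"
  by (rule T4_power_div[OF cable_full_twists(1)[symmetric] _ T4_power_incl_c T4_power_x(1) incl_c_x(1)]) simp

lemma T3_x12: "T3 N m g (pure_gen 3 1 2) = pi3 (pure_gen 3 1 2 [^]\<^bsub>B 3\<^esub> mu)"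
  and T3_x23: "T3 N m g (pure_gen 3 2 3) = pi3 (inv\<^bsub>B 3\<^esub> g \<otimes>\<^bsub>B 3\<^esub> pure_gen 3 2 3 [^]\<^bsub>B 3\<^esub> mu \<otimes>\<^bsub>B 3\<^esub> g)"
  and T3_c: "T3 N m g central_c = pi3 (central_c [^]\<^bsub>B 3\<^esub> mu)"
proof -
  show "T3 N m g (pure_gen 3 1 2) = pi3 (pure_gen 3 1 2 [^]\<^bsub>B 3\<^esub> mu)"
    by (simp add: pure_gen3 T3_sigma ab'_eq p3.hom_int_pow B.int_pow_mult_commute)
  have "Q3.conj_by (pi3 g) (pi3 (sigma 3 2) [^]\<^bsub>Q3\<^esub> mu) \<otimes>\<^bsub>Q3\<^esub> Q3.conj_by (pi3 g) (pi3 (sigma 3 2) [^]\<^bsub>Q3\<^esub> mu)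
     = Q3.conj_by (pi3 g) (pi3 (pure_gen 3 2 3 [^]\<^bsub>B 3\<^esub> mu))"
    by (simp add: pure_gen3 p3.hom_int_pow B.int_pow_mult_commute flip: Q3.conj_by_mult)
  then show "T3 N m g (pure_gen 3 2 3) = pi3 (inv\<^bsub>B 3\<^esub> g \<otimes>\<^bsub>B 3\<^esub> pure_gen 3 2 3 [^]\<^bsub>B 3\<^esub> mu \<otimes>\<^bsub>B 3\<^esub> g)"
    by (simp add: pure_gen3(2)[THEN arg_cong, of "T3 N m g"] T3_sigma ab'_eq) (simp add: Q3.conj_by_def)
  have "T3 N m g central_c = full_twist Q3 hp.a' hp.b'"
    using B3.hom_full_twist[OF T3_hom Q3.is_group] by (simp add: central_c_eq T3_sigma)
  then show "T3 N m g central_c = pi3 (central_c [^]\<^bsub>B 3\<^esub> mu)"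
    by (simp add: hp.full_twist' hp_c p3.hom_int_pow)
qed

end

text \<open>\<sigma>_2 is not pure, but it fixes position 1, so \<open>cable 1\<close> is
  multiplicative on a subgroup that contains it. This makes powers of \<sigma>_2 accessible to
  \<open>cable 1\<close>.\<close>

lemma stabilizer_subgroup: "subgroup {w \<in> carrier (B 3). braid_perm 3 w 1 = 1} (B 3)"
proof (rule B.subgroupI)
  show "{w \<in> carrier (B 3). braid_perm 3 w 1 = 1} \<noteq> {}"
    using perm.hom_one[of 3] by (auto simp: sym_group_one intro!: exI[of _ "\<one>\<^bsub>B 3\<^esub>"])
  show "inv\<^bsub>B 3\<^esub> w \<in> {w \<in> carrier (B 3). braid_perm 3 w 1 = 1}" if "w \<in> {w \<in> carrier (B 3). braid_perm 3 w 1 = 1}" for w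
  proof -
    have w: "w \<in> carrier (B 3)" "braid_perm 3 w 1 = 1" using that by auto
    have "(braid_perm 3 (inv\<^bsub>B 3\<^esub> w) \<otimes>\<^bsub>sym_group 3\<^esub> braid_perm 3 w) 1 = 1"
      using w(1) perm.H.l_inv[OF perm.hom_closed[OF w(1)]] by (simp add: sym_group_one del: sym_group_inv_equality)
    then show ?thesis using w by (simp add: sym_group_mult del: perm.hom_inv)
  qed
qed (auto simp: sym_group_mult)

lemma cable1_int_pow:
  assumes "w \<in> carrier (B 3)" "braid_perm 3 w 1 = 1"
  shows "cable 1 (w [^]\<^bsub>B 3\<^esub> (k::int)) = cable 1 w [^]\<^bsub>B 4\<^esub> k" "braid_perm 3 (w [^]\<^bsub>B 3\<^esub> k) 1 = 1"
proof -
  let ?S = "{w \<in> carrier (B 3). braid_perm 3 w 1 = 1}"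
  interpret S: group "(B 3)\<lparr>carrier := ?S\<rparr>" by (rule B.subgroup_imp_group[OF stabilizer_subgroup])
  interpret h: group_hom "(B 3)\<lparr>carrier := ?S\<rparr>" "B 4" "cable 1"
    by unfold_locales (auto intro!: homI simp: cable_mult)
  have w: "w \<in> ?S" using assms by simp
  have eq: "w [^]\<^bsub>B 3\<^esub> k = w [^]\<^bsub>(B 3)\<lparr>carrier := ?S\<rparr>\<^esub> k"
    by (rule B.int_pow_consistent[OF stabilizer_subgroup w])
  show "cable 1 (w [^]\<^bsub>B 3\<^esub> k) = cable 1 w [^]\<^bsub>B 4\<^esub> k"
    unfolding eq using w by (intro h.hom_int_pow) simp
  have "w [^]\<^bsub>(B 3)\<lparr>carrier := ?S\<rparr>\<^esub> k \<in> ?S" using w S.int_pow_closed[of w k] by simp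
  then show "braid_perm 3 (w [^]\<^bsub>B 3\<^esub> k) 1 = 1" unfolding eq by simp
qed


context gt_pair begin

text \<open>In c = \<sigma>_2 x_12 \<sigma>_2 x_12 the effect of \<open>T4\<close> on each doubled
  factor is known: \<sigma>_2 doubles to \<sigma>_3, and x_12 is covered by
  \<open>T4_power_cable1_x12\<close>. The result is \<open>cable 1\<close> of a word
  \<open>w\<close>. Modulo \<open>N_PB3 N\<close> this word is the full twist of
  \<open>hp.a'\<close> and \<open>hp.b'\<close>, that is c^(2m+1).\<close>

lemma T4_power_cable1_c: "T4_power \<one>\<^bsub>Q4\<^esub> (cable 1 central_c)"
proof -
  let ?s = "sigma 3 2" and ?x = "pure_gen 3 1 2"
  define y where "y = inv\<^bsub>B 3\<^esub> g \<otimes>\<^bsub>B 3\<^esub> ?s [^]\<^bsub>B 3\<^esub> mu \<otimes>\<^bsub>B 3\<^esub> g"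
  define w where "w = y \<otimes>\<^bsub>B 3\<^esub> ?x [^]\<^bsub>B 3\<^esub> mu \<otimes>\<^bsub>B 3\<^esub> y \<otimes>\<^bsub>B 3\<^esub> ?x [^]\<^bsub>B 3\<^esub> mu"
  have s1: "braid_perm 3 ?s 1 = 1" by (simp add: braid_perm3_sigma transpose_simps)
  have cs: "cable 1 ?s = sigma 4 3" by (simp add: cable_generator' cable_sigma_simps)
  note sp = cable1_int_pow[OF _ s1, of mu, unfolded cs]
  have ginv: "inv\<^bsub>B 3\<^esub> g \<in> carrier (PB 3)" by simp
  have xP: "?x [^]\<^bsub>B 3\<^esub> mu \<in> carrier (PB 3)" by simp
  have yB: "y \<in> carrier (B 3)" and wB: "w \<in> carrier (B 3)" by (simp_all add: y_def w_def)
  have y1: "braid_perm 3 y 1 = 1"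
    using sp(2) PB_perm[OF ginv] by (simp add: y_def sym_group_mult PB_perm[OF g] del: perm.hom_inv)
  have cx: "cable 1 (?x [^]\<^bsub>B 3\<^esub> mu) = cable 1 ?x [^]\<^bsub>B 4\<^esub> mu"
    by (rule cable1_int_pow(1)) (simp_all add: PB_perm)
  have cginv: "cable 1 (inv\<^bsub>B 3\<^esub> g) = inv\<^bsub>B 4\<^esub> face F12_3_4 g"
    using cable_inv[OF gB, of 1] by (simp add: PB_perm)
  have cy: "cable 1 y = inv\<^bsub>B 4\<^esub> face F12_3_4 g \<otimes>\<^bsub>B 4\<^esub> sigma 4 3 [^]\<^bsub>B 4\<^esub> mu \<otimes>\<^bsub>B 4\<^esub> face F12_3_4 g"
    using sp by (simp add: y_def cable_mult PB_perm cginv)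
  have cw: "cable 1 w = cable 1 y \<otimes>\<^bsub>B 4\<^esub> cable 1 ?x [^]\<^bsub>B 4\<^esub> mu \<otimes>\<^bsub>B 4\<^esub> cable 1 y \<otimes>\<^bsub>B 4\<^esub> cable 1 ?x [^]\<^bsub>B 4\<^esub> mu"
    using y1 yB by (simp add: w_def cable_mult cx PB_perm[OF xP] sym_group_mult)
  have "central_c = ?s \<otimes>\<^bsub>B 3\<^esub> ?x \<otimes>\<^bsub>B 3\<^esub> ?s \<otimes>\<^bsub>B 3\<^esub> ?x"
    using B3.full_twist_eqs(1) by (simp add: central_c_eq pure_gen3)
  then have "cable 1 central_c = cable 1 (?s \<otimes>\<^bsub>B 3\<^esub> ?x \<otimes>\<^bsub>B 3\<^esub> ?s \<otimes>\<^bsub>B 3\<^esub> ?x)"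
    by (rule arg_cong)
  then have "cable 1 central_c = sigma 4 3 \<otimes>\<^bsub>B 4\<^esub> cable 1 ?x \<otimes>\<^bsub>B 4\<^esub> sigma 4 3 \<otimes>\<^bsub>B 4\<^esub> cable 1 ?x"
    using s1 cs by (simp add: cable_mult PB_perm sym_group_mult)
  then have "T4 N m g (cable 1 central_c) = A3 \<otimes>\<^bsub>Q4\<^esub> pi4 (cable 1 ?x) [^]\<^bsub>Q4\<^esub> mu
      \<otimes>\<^bsub>Q4\<^esub> A3 \<otimes>\<^bsub>Q4\<^esub> pi4 (cable 1 ?x) [^]\<^bsub>Q4\<^esub> mu"
    using T4_power_cable1_x12 by (simp add: T4_sigma T4_power_def)
  also have "A3 = pi4 (cable 1 y)"
    unfolding cy by (simp add: A3_def Q4.conj_by_def p4.hom_int_pow)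
  also have "pi4 (cable 1 y) \<otimes>\<^bsub>Q4\<^esub> pi4 (cable 1 ?x) [^]\<^bsub>Q4\<^esub> mu
      \<otimes>\<^bsub>Q4\<^esub> pi4 (cable 1 y) \<otimes>\<^bsub>Q4\<^esub> pi4 (cable 1 ?x) [^]\<^bsub>Q4\<^esub> mu = pi4 (cable 1 w)"
    using yB by (simp add: cw p4.hom_int_pow)
  finally have 1: "T4 N m g (cable 1 central_c) = pi4 (cable 1 w)" .
  have py: "pi3 y = hp.b'"
    by (simp add: y_def ab'_eq Q3.conj_by_def p3.hom_int_pow)
  have px: "pi3 (?x [^]\<^bsub>B 3\<^esub> mu) = hp.a' \<otimes>\<^bsub>Q3\<^esub> hp.a'"
    by (simp add: T3_x12[symmetric]) (simp add: pure_gen3 T3_sigma)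
  have "pi3 w = hp.b' \<otimes>\<^bsub>Q3\<^esub> (hp.a' \<otimes>\<^bsub>Q3\<^esub> hp.a') \<otimes>\<^bsub>Q3\<^esub> hp.b' \<otimes>\<^bsub>Q3\<^esub> (hp.a' \<otimes>\<^bsub>Q3\<^esub> hp.a')"
    using yB by (simp add: w_def py px)
  also have "\<dots> = pi3 (central_c [^]\<^bsub>B 3\<^esub> mu)"
    unfolding hp.pair'.full_twist_eqs(1) by (simp add: hp.full_twist' hp_c p3.hom_int_pow)
  finally have T4_power: "pi3 w = pi3 (central_c [^]\<^bsub>B 3\<^esub> mu)" .
  have cP: "central_c [^]\<^bsub>B 3\<^esub> mu \<in> carrier (PB 3)" by simp
  have "w \<otimes>\<^bsub>B 3\<^esub> inv\<^bsub>B 3\<^esub> (central_c [^]\<^bsub>B 3\<^esub> mu) \<in> carrier (PB 3)"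
    using T4_power pi3_eq_iff[OF wB PB_in_B[OF cP]] K_facts(3) by blast
  then have "w \<otimes>\<^bsub>B 3\<^esub> inv\<^bsub>B 3\<^esub> (central_c [^]\<^bsub>B 3\<^esub> mu) \<otimes>\<^bsub>B 3\<^esub> (central_c [^]\<^bsub>B 3\<^esub> mu) \<in> carrier (PB 3)"
    using cP by (rule PB_mult_closed)
  \<comment> \<open>Face maps respect classes of pure braids. The word \<open>w\<close> contains
    powers of \<sigma>_2; its purity follows from that of c^(2m+1) because \<open>N_PB3 N\<close>
    consists of pure braids.\<close>
  then have wP: "w \<in> carrier (PB 3)" using wB by (simp add: B.m_assoc)
  have "pi4 (cable 1 w) = pi4 (face F12_3_4 (central_c [^]\<^bsub>B 3\<^esub> mu))"
    using face_cong[OF wP cP T4_power, of F12_3_4] face_eq[OF wP, of F12_3_4] by simp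
  also have "\<dots> = pi4 (cable 1 central_c) [^]\<^bsub>Q4\<^esub> mu"
    using face_eq[OF central_c_closed, of F12_3_4] by (simp add: face_int_pow p4.hom_int_pow)
  finally show ?thesis using 1 by (simp add: T4_power_def)
qed

text \<open>A central element does not notice the conjugating element, so any \<open>k\<close> is
  allowed; the power comes from the two commuting factors in \<open>full_twist4_def\<close>.\<close>

lemma T4_power_full_twist4: "k \<in> carrier Q4 \<Longrightarrow> T4_power k full_twist4"
proof -
  assume k: "k \<in> carrier Q4"
  then obtain w where w: "w \<in> carrier (B 4)" "k = pi4 w" by (auto simp: carrier_FactGroup pi4_def)
  have "sigma 4 1 \<otimes>\<^bsub>B 4\<^esub> cable 1 central_c = cable 1 central_c \<otimes>\<^bsub>B 4\<^esub> sigma 4 1"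
    by (rule cable_commute) simp_all
  then have "cable 1 central_c \<otimes>\<^bsub>B 4\<^esub> pure_gen 4 1 2 = pure_gen 4 1 2 \<otimes>\<^bsub>B 4\<^esub> cable 1 central_c"
    using B.m_assoc[of "sigma 4 1" 4 "sigma 4 1" "cable 1 central_c"]
      B.m_assoc[of "sigma 4 1" 4 "cable 1 central_c" "sigma 4 1"]
      B.m_assoc[of "cable 1 central_c" 4 "sigma 4 1" "sigma 4 1"]
    by (simp add: pure_gen4)
  then have 1: "T4_power \<one>\<^bsub>Q4\<^esub> full_twist4"
    unfolding full_twist4_def by (rule T4_power_mult[OF T4_power_cable1_c T4_power_x(1)])
  have "pi4 full_twist4 \<otimes>\<^bsub>Q4\<^esub> k = k \<otimes>\<^bsub>Q4\<^esub> pi4 full_twist4"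
    unfolding w(2) using full_twist4_commute[OF w(1)] w(1) by (intro pi4_commute) simp_all
  then show "T4_power k full_twist4"
    by (rule T4_power_change_one[OF 1 k])
qed

text \<open>For each face, this is the product of the factors standing to the right of its own
  factor in the pentagon.\<close>

definition conjugator :: "face_kind \<Rightarrow> nat word set set" where
  "conjugator F = (case F of F123 \<Rightarrow> \<one>\<^bsub>Q4\<^esub> | F234 \<Rightarrow> k234 | F12_3_4 \<Rightarrow> \<one>\<^bsub>Q4\<^esub> | F1_23_4 \<Rightarrow> e F123 | F1_2_34 \<Rightarrow> e F12_3_4)"

lemma conjugator_closed [simp, intro]: "conjugator F \<in> carrier Q4"
  by (cases F) (simp_all add: conjugator_def)

text \<open>Where the doubled strand is linked with others, the face is a full twist on three or
  four strands divided by the full twist inside the double. The face of x_23 carries the extra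
  factor \<open>e F\<close> because \<open>T3\<close> conjugates x_23 by \<open>g\<close>.\<close>

lemma T4_power_faces:
  "T4_power (conjugator F) (face F (pure_gen 3 1 2))" (is ?P1)
  "T4_power (e F \<otimes>\<^bsub>Q4\<^esub> conjugator F) (face F (pure_gen 3 2 3))" (is ?P2)
  "T4_power (conjugator F) (face F central_c)" (is ?P3)
proof -
  have sq: "pi4 (v \<otimes>\<^bsub>B 4\<^esub> v) \<otimes>\<^bsub>Q4\<^esub> l = l \<otimes>\<^bsub>Q4\<^esub> pi4 (v \<otimes>\<^bsub>B 4\<^esub> v)"
    if "v \<in> carrier (B 4)" "l \<in> carrier Q4" "pi4 v \<otimes>\<^bsub>Q4\<^esub> l = l \<otimes>\<^bsub>Q4\<^esub> pi4 v" for v l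
  proof -
    have "pi4 v \<otimes>\<^bsub>Q4\<^esub> pi4 v \<otimes>\<^bsub>Q4\<^esub> l = pi4 v \<otimes>\<^bsub>Q4\<^esub> (l \<otimes>\<^bsub>Q4\<^esub> pi4 v)"
      using that(1,2) by (simp only: that(3)[symmetric] Q4.m_assoc p4.hom_closed)
    also have "\<dots> = pi4 v \<otimes>\<^bsub>Q4\<^esub> l \<otimes>\<^bsub>Q4\<^esub> pi4 v"
      using that(1,2) by (simp only: Q4.m_assoc p4.hom_closed)
    also have "\<dots> = l \<otimes>\<^bsub>Q4\<^esub> (pi4 v \<otimes>\<^bsub>Q4\<^esub> pi4 v)"
      using that(1,2) by (simp only: that(3) Q4.m_assoc p4.hom_closed)
    finally show ?thesis using that(1) by simp
  qed
  have x12_e: "pi4 (pure_gen 4 1 2) \<otimes>\<^bsub>Q4\<^esub> e F12_3_4 = e F12_3_4 \<otimes>\<^bsub>Q4\<^esub> pi4 (pure_gen 4 1 2)"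
    and x23_e: "pi4 (pure_gen 4 2 3) \<otimes>\<^bsub>Q4\<^esub> e F1_23_4 = e F1_23_4 \<otimes>\<^bsub>Q4\<^esub> pi4 (pure_gen 4 2 3)"
    and x34_e: "pi4 (pure_gen 4 3 4) \<otimes>\<^bsub>Q4\<^esub> e F1_2_34 = e F1_2_34 \<otimes>\<^bsub>Q4\<^esub> pi4 (pure_gen 4 3 4)"
    unfolding pure_gen4 by (rule sq[OF _ _ e_commute(1)] sq[OF _ _ e_commute(2)] sq[OF _ _ e_commute(3)]; simp)+
  have c_e: "pi4 (incl34 central_c) \<otimes>\<^bsub>Q4\<^esub> e F123 = e F123 \<otimes>\<^bsub>Q4\<^esub> pi4 (incl34 central_c)"
    "pi4 (shift34 central_c) \<otimes>\<^bsub>Q4\<^esub> e F234 = e F234 \<otimes>\<^bsub>Q4\<^esub> pi4 (shift34 central_c)"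
    using incl_c_commute[OF gB] shift_c_commute[OF gB] by (simp_all flip: p4.hom_mult)
  have k12: "T4_power (e F1_2_34 \<otimes>\<^bsub>Q4\<^esub> e F12_3_4) (pure_gen 4 3 4)"
    by (rule T4_power_change[OF T4_power_x(3) _ x34_e]) simp
  have k23: "T4_power k234 (pure_gen 4 2 3)"
    by (rule T4_power_change[OF T4_power_x(2) _ x23_e]) simp
  have kc: "T4_power (e F1_2_34 \<otimes>\<^bsub>Q4\<^esub> e F12_3_4) (shift34 central_c)"
    unfolding pent[symmetric] by (rule T4_power_change[OF T4_power_shift_c _ c_e(2)]) simp
  have cl: "cable p w \<in> carrier (B 4)" if "p \<in> {1, 2, 3}" "w \<in> carrier (PB 3)" for p w
    using that PB_in_B by simp
  have F: "face F (pure_gen 3 1 2) = face_ext F (pure_gen 3 1 2)"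
    "face F (pure_gen 3 2 3) = face_ext F (pure_gen 3 2 3)" "face F central_c = face_ext F central_c"
    by (simp_all add: face_eq)
  have t4: "full_twist4 \<otimes>\<^bsub>B 4\<^esub> x = x \<otimes>\<^bsub>B 4\<^esub> full_twist4" if "x \<in> carrier (B 4)" for x
    using that by (rule full_twist4_commute)
  have "?P1 \<and> ?P2 \<and> ?P3"
  proof (cases F)
    case F123
    then show ?thesis unfolding F using T4_power_x T4_power_incl_c by (simp add: face_ext_pure_gens conjugator_def)
  next
    case F234
    then show ?thesis unfolding F using k23 k12 T4_power_shift_c by (simp add: face_ext_pure_gens conjugator_def pent)
  next
    case F12_3_4
    then show ?thesis unfolding F using T4_power_cable1_x12 T4_power_x(3) T4_power_cable1_c by (simp add: cable_pure_gens(2) conjugator_def)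
  next
    case F1_23_4
    have "T4_power (e F123) (cable 2 (pure_gen 3 1 2))"
      by (rule T4_power_div[OF cable_full_twists(2)[symmetric] _ T4_power_change_one[OF T4_power_incl_c _ c_e(1)] T4_power_x(2) incl_c_x(2)])
        (simp_all add: cl)
    moreover have "T4_power k234 (cable 2 (pure_gen 3 2 3))"
      by (rule T4_power_div[OF cable_full_twists(3)[symmetric] _ T4_power_shift_c k23 incl_c_x(3)]) (simp add: cl)
    moreover have "T4_power (e F123) (cable 2 central_c)"
      by (rule T4_power_div[OF full_twist4_eqs(1)[symmetric] _ T4_power_full_twist4 T4_power_x(2) t4]) (simp_all add: cl)
    ultimately show ?thesis unfolding F using F1_23_4 by (simp add: conjugator_def)
  next
    case F1_2_34
    have "T4_power (e F12_3_4) (cable 3 (pure_gen 3 1 2))"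
      unfolding cable_pure_gens by (rule T4_power_change_one[OF T4_power_x(1) _ x12_e]) simp
    moreover have "T4_power (e F1_2_34 \<otimes>\<^bsub>Q4\<^esub> e F12_3_4) (cable 3 (pure_gen 3 2 3))"
      by (rule T4_power_div[OF cable_full_twists(4)[symmetric] _ kc k12 incl_c_x(4)]) (simp add: cl)
    moreover have "T4_power (e F12_3_4) (cable 3 central_c)"
      by (rule T4_power_div[OF full_twist4_eqs(2)[symmetric] _ T4_power_full_twist4 T4_power_x(3) t4]) (simp_all add: cl)
    ultimately show ?thesis unfolding F using F1_2_34 by (simp add: conjugator_def)
  qed
  then show ?P1 ?P2 ?P3 by auto
qed

lemma T3_PB:
  assumes "w \<in> carrier (PB 3)"
  obtains w' where "w' \<in> carrier (PB 3)" "T3 N m g w = pi3 w'"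
proof -
  have "\<exists>w'\<in>carrier (PB 3). T3 N m g (pure_gen 3 1 2) = pi3 w'"
    "\<exists>w'\<in>carrier (PB 3). T3 N m g (pure_gen 3 2 3) = pi3 w'"
    "\<exists>w'\<in>carrier (PB 3). T3 N m g central_c = pi3 w'"
    using T3_x12 T3_x23 T3_c PB_int_pow_closed[OF pure_gen3_closed(1)] PB_int_pow_closed[OF central_c_closed]
      PB_conj_closed(2)[OF gB PB_int_pow_closed[OF pure_gen3_closed(2)]] by blast+
  then have gen: "\<exists>w'\<in>carrier (PB 3). T3 N m g x = pi3 w'" if "x \<in> {pure_gen 3 1 2, pure_gen 3 2 3, central_c}" for x
    using that by blast
  have "w \<in> generate (PB 3) {pure_gen 3 1 2, pure_gen 3 2 3, central_c}"
    using assms generate_PB3' by simp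
  then have "w \<in> carrier (PB 3) \<and> (\<exists>w'\<in>carrier (PB 3). T3 N m g w = pi3 w')"
  proof induct
    case one
    then show ?case by (intro conjI bexI[of _ "\<one>\<^bsub>B 3\<^esub>"]) auto
  next
    case (incl x)
    then show ?case using gen[OF incl] by auto
  next
    case (inv x)
    then have x: "x \<in> carrier (PB 3)" by auto
    obtain w' where "w' \<in> carrier (PB 3)" "T3 N m g x = pi3 w'" using gen[OF inv] by blast
    then show ?case using x PB_in_B[OF x] by (auto intro!: bexI[of _ "inv\<^bsub>B 3\<^esub> w'"])
  next
    case (eng u v)
    then obtain u' v' where "u' \<in> carrier (PB 3)" "T3 N m g u = pi3 u'" "v' \<in> carrier (PB 3)" "T3 N m g v = pi3 v'"
      by blast
    then show ?case using eng by (auto intro!: bexI[of _ "u' \<otimes>\<^bsub>B 3\<^esub> v'"])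
  qed
  then show thesis using that by blast
qed

text \<open>The square formed by \<open>T3\<close>, \<open>T4\<close> and a face map commutes up to conjugation; this identifies
  \<open>N_PB3\<close> of the kernel of \<open>T4\<close> with the kernel of \<open>T3\<close>.\<close>

lemma T4_face:
  assumes "w \<in> carrier (PB 3)" "w' \<in> carrier (PB 3)" "T3 N m g w = pi3 w'"
  shows "T4 N m g (face F w) = Q4.conj_by (conjugator F) (pi4 (face F w'))"
proof -
  let ?P = "\<lambda>w. \<forall>w'\<in>carrier (PB 3). T3 N m g w = pi3 w' \<longrightarrow>
    T4 N m g (face F w) = Q4.conj_by (conjugator F) (pi4 (face F w'))"
  have gen: "?P x" if x: "x \<in> {pure_gen 3 1 2, pure_gen 3 2 3, central_c}" for x
  proof (intro ballI impI)
    fix w' assume w': "w' \<in> carrier (PB 3)" "T3 N m g x = pi3 w'"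
    consider "x = pure_gen 3 1 2" | "x = pure_gen 3 2 3" | "x = central_c" using x by blast
    then show "T4 N m g (face F x) = Q4.conj_by (conjugator F) (pi4 (face F w'))"
    proof cases
      case 1
      have "pi4 (face F w') = pi4 (face F (pure_gen 3 1 2 [^]\<^bsub>B 3\<^esub> mu))"
        using w' 1 by (intro face_cong) (simp_all add: T3_x12)
      then show ?thesis using T4_power_faces(1)[of F] 1 by (simp add: T4_power_def face_int_pow p4.hom_int_pow)
    next
      case 2
      have "pi4 (face F w') = pi4 (face F (inv\<^bsub>B 3\<^esub> g \<otimes>\<^bsub>B 3\<^esub> pure_gen 3 2 3 [^]\<^bsub>B 3\<^esub> mu \<otimes>\<^bsub>B 3\<^esub> g))"
        using w' 2 by (intro face_cong) (simp_all add: T3_x23)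
      also have "\<dots> = Q4.conj_by (e F) (pi4 (face F (pure_gen 3 2 3)) [^]\<^bsub>Q4\<^esub> mu)"
        by (simp add: face_mult face_inv face_int_pow p4.hom_int_pow Q4.conj_by_def)
      finally show ?thesis using T4_power_faces(2)[of F] 2 by (simp add: T4_power_def Q4.conj_by_conj_by)
    next
      case 3
      have "pi4 (face F w') = pi4 (face F (central_c [^]\<^bsub>B 3\<^esub> mu))"
        using w' 3 by (intro face_cong) (simp_all add: T3_c)
      then show ?thesis using T4_power_faces(3)[of F] 3 by (simp add: T4_power_def face_int_pow p4.hom_int_pow)
    qed
  qed
  have gen_PB: "x \<in> carrier (PB 3)" if "x \<in> {pure_gen 3 1 2, pure_gen 3 2 3, central_c}" for x
    using that by auto
  have "w \<in> generate (PB 3) {pure_gen 3 1 2, pure_gen 3 2 3, central_c}"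
    using assms generate_PB3' by simp
  then have "?P w"
  proof induct
    case one
    show ?case
    proof (intro ballI impI)
      fix w' assume w': "w' \<in> carrier (PB 3)" "T3 N m g \<one>\<^bsub>PB 3\<^esub> = pi3 w'"
      then have "pi4 (face F w') = pi4 (face F \<one>\<^bsub>PB 3\<^esub>)" by (intro face_cong) auto
      then show "T4 N m g (face F \<one>\<^bsub>PB 3\<^esub>) = Q4.conj_by (conjugator F) (pi4 (face F w'))"
        unfolding face.hom_one by (simp add: Q4.conj_by_def)
    qed
  next
    case (incl x)
    then show ?case by (rule gen)
  next
    case (inv x)
    have x: "x \<in> carrier (PB 3)" using gen_PB inv by blast
    show ?case
    proof (intro ballI impI)
      fix w' assume w': "w' \<in> carrier (PB 3)" "T3 N m g (inv\<^bsub>PB 3\<^esub> x) = pi3 w'"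
      then have "inv\<^bsub>Q3\<^esub> T3 N m g x = pi3 w'" using x PB_in_B[OF x] by simp
      then have "T3 N m g x = pi3 (inv\<^bsub>B 3\<^esub> w')"
        using w' PB_in_B[OF x] Q3.inv_inv[of "T3 N m g x"] by simp
      then have "T4 N m g (face F x) = Q4.conj_by (conjugator F) (pi4 (face F (inv\<^bsub>B 3\<^esub> w')))"
        using gen[OF inv] w' by blast
      then show "T4 N m g (face F (inv\<^bsub>PB 3\<^esub> x)) = Q4.conj_by (conjugator F) (pi4 (face F w'))"
        using x w' by (simp add: face_inv Q4.conj_by_inv)
    qed
  next
    case (eng u v)
    have uv: "u \<in> carrier (PB 3)" "v \<in> carrier (PB 3)" using eng generate_PB3' by auto
    obtain u' where u': "u' \<in> carrier (PB 3)" "T3 N m g u = pi3 u'" using uv T3_PB by blast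
    obtain v' where v': "v' \<in> carrier (PB 3)" "T3 N m g v = pi3 v'" using uv T3_PB by blast
    show ?case
    proof (intro ballI impI)
      fix w' assume w': "w' \<in> carrier (PB 3)" "T3 N m g (u \<otimes>\<^bsub>PB 3\<^esub> v) = pi3 w'"
      have "pi4 (face F w') = pi4 (face F (u' \<otimes>\<^bsub>B 3\<^esub> v'))"
        using w' u' v' uv by (intro face_cong) simp_all
      moreover have "T4 N m g (face F u) = Q4.conj_by (conjugator F) (pi4 (face F u'))"
        "T4 N m g (face F v) = Q4.conj_by (conjugator F) (pi4 (face F v'))"
        using eng(2,4) u' v' by blast+
      ultimately show "T4 N m g (face F (u \<otimes>\<^bsub>PB 3\<^esub> v)) = Q4.conj_by (conjugator F) (pi4 (face F w'))"
        using uv u' v' by (simp add: face_mult Q4.conj_by_mult)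
    qed
  qed
  then show ?thesis using assms by blast
qed

section \<open>The kernel of \<open>T4\<close> on pure braids\<close>

lemma conj_by_eq_one_iff:
  "k \<in> carrier Q4 \<Longrightarrow> x \<in> carrier Q4 \<Longrightarrow> Q4.conj_by k x = \<one>\<^bsub>Q4\<^esub> \<longleftrightarrow> x = \<one>\<^bsub>Q4\<^esub>"
  by (metis Q4.conj_by_conj_by Q4.conj_by_one Q4.conj_by_commute Q4.inv_closed Q4.l_one Q4.one_closed Q4.r_inv Q4.r_one)

text \<open>The exponent 2m+1 is odd, while \<sigma>_i^2 and the conjugating faces are pure. So the
  image of each generator has the permutation of that generator.\<close>

lemma T4_perm:
  assumes "w \<in> carrier (B 4)" "u \<in> carrier (B 4)" "T4 N m g w = pi4 u"
  shows "braid_perm 4 w = braid_perm 4 u"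
proof -
  have "braid_perm 4 x = \<one>\<^bsub>sym_group 4\<^esub>" if "x \<in> N" for x
    using that N_facts(4) unfolding carrier_PB sym_group_one by blast
  then obtain P where P: "P \<in> hom Q4 (sym_group 4)" "\<And>x. x \<in> carrier (B 4) \<Longrightarrow> P (N #>\<^bsub>B 4\<^esub> x) = braid_perm 4 x"
    using factor_hom[OF group_B sym_group_is_group braid_perm_hom N_facts(2)] by blast
  note P2 = P(2)[folded pi4_def]
  interpret P: group_hom Q4 "sym_group 4" P using P(1) by unfold_locales
  have Pe: "P (e F) = \<one>\<^bsub>sym_group 4\<^esub>" for F
    using face_PB[OF g, of F] by (simp add: P2) (simp add: fun_eq_iff PB_perm sym_group_one)
  have Pc: "P (Q4.conj_by (e F) x) = P x" if "x \<in> carrier Q4" for F x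
    using that by (simp add: Q4.conj_by_def Pe)
  have Ps: "P (pi4 (sigma 4 i) [^]\<^bsub>Q4\<^esub> mu) = braid_perm 4 (sigma 4 i)" if i: "i \<in> {1..<4}" for i
  proof -
    have s: "sigma 4 i \<in> carrier (B 4)" using i by (rule sigma_closed)
    have "(sigma 4 i \<otimes>\<^bsub>B 4\<^esub> sigma 4 i) [^]\<^bsub>B 4\<^esub> m \<in> carrier (PB 4)"
      using sigma_square_PB[OF i] by (rule PB_int_pow_closed)
    then have "braid_perm 4 ((sigma 4 i \<otimes>\<^bsub>B 4\<^esub> sigma 4 i) [^]\<^bsub>B 4\<^esub> m) = id"
      by (simp add: fun_eq_iff PB_perm)
    moreover have "sigma 4 i [^]\<^bsub>B 4\<^esub> mu = (sigma 4 i \<otimes>\<^bsub>B 4\<^esub> sigma 4 i) [^]\<^bsub>B 4\<^esub> m \<otimes>\<^bsub>B 4\<^esub> sigma 4 i"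
      using B.int_pow_mult[of "sigma 4 i" 4 "2 * m" 1] s by (simp add: B.square_int_pow)
    ultimately show ?thesis
      using s by (simp add: p4.hom_int_pow[symmetric] P2 sym_group_mult)
  qed
  have "(P \<circ> T4 N m g) w = braid_perm 4 w"
  proof (rule hom_eq_on_generate[OF group_B sym_group_is_group])
    show "P \<circ> T4 N m g \<in> hom (B 4) (sym_group 4)" by (rule hom_compose[OF T4_hom P(1)])
    show "braid_perm 4 \<in> hom (B 4) (sym_group 4)" by (rule braid_perm_hom)
    show "w \<in> generate (B 4) {sigma 4 1, sigma 4 2, sigma 4 3}" using assms generate_B4 by simp
    show "(P \<circ> T4 N m g) x = braid_perm 4 x" if "x \<in> {sigma 4 1, sigma 4 2, sigma 4 3}" for x
      using that Ps[of 1] Ps[of 2] Ps[of 3] by (auto simp: T4_sigma A1_def A2_def A3_def Pc)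
  qed simp
  then show ?thesis using assms by (simp add: P2)
qed

lemma T4_surj:
  assumes "w \<in> carrier (B 4)"
  obtains u where "u \<in> carrier (B 4)" "T4 N m g w = pi4 u"
  using T4.hom_closed[OF assms] by (auto simp: carrier_FactGroup pi4_def)

lemma T4_PB:
  assumes "w \<in> carrier (PB 4)"
  obtains u where "u \<in> carrier (PB 4)" "T4 N m g w = pi4 u"
proof -
  obtain u where u: "u \<in> carrier (B 4)" "T4 N m g w = pi4 u"
    using T4_surj[OF PB_in_B[OF assms]] by blast
  then have "braid_perm 4 u = id"
    using T4_perm[of w u] assms unfolding carrier_PB by auto
  then have "u \<in> carrier (PB 4)" using u unfolding carrier_PB by blast
  then show thesis using that u by blast
qed

abbreviation N' where "N' \<equiv> T4_kernel N m g"

text \<open>\<open>T4\<close> is defined on all of \<open>B 4\<close>, so its kernel on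
  \<open>PB 4\<close> is an intersection of two normal subgroups of finite index in
  \<open>B 4\<close>.\<close>

lemma T4_kernel_NFI: "N' \<in> NFI_PB4"
proof -
  have "{w \<in> carrier (B 4). T4 N m g w = \<one>\<^bsub>Q4\<^esub>} \<in> finite_index_normal (B 4)"
    by (rule FIN_kernel[OF group_B Q4.is_group T4_hom FIN_finite[OF N_facts(1)]])
  then have "{w \<in> carrier (B 4). T4 N m g w = \<one>\<^bsub>Q4\<^esub>} \<inter> carrier (PB 4) \<in> finite_index_normal (B 4)"
    by (rule FIN_Int[OF group_B _ PB_FIN])
  moreover have "{w \<in> carrier (B 4). T4 N m g w = \<one>\<^bsub>Q4\<^esub>} \<inter> carrier (PB 4) = N'"
    using PB_in_B by (auto simp: T4_kernel_def one_Q)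
  ultimately show ?thesis by (simp add: NFI_PB4_def T4_kernel_def)
qed

text \<open>Conjugation does not affect triviality. By \<open>T4_face\<close>, all faces of
  \<open>w\<close> are killed by \<open>T4\<close> iff all faces of a pure lift of
  \<open>T3 N m g w\<close> lie in \<open>N\<close>, that is, iff this lift lies in
  \<open>N_PB3 N\<close>.\<close>

lemma N_PB3_T4_kernel: "N_PB3 N' = {w \<in> carrier (PB 3). T3 N m g w = K}"
proof -
  have "(\<forall>F. face F w \<in> N') \<longleftrightarrow> T3 N m g w = K" if w: "w \<in> carrier (PB 3)" for w
  proof -
    obtain w' where w': "w' \<in> carrier (PB 3)" "T3 N m g w = pi3 w'" using T3_PB[OF w] .
    have "T3 N m g w = K \<longleftrightarrow> w' \<in> K" using w' pi3_one_iff[OF PB_in_B[OF w'(1)]] by simp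
    also have "\<dots> \<longleftrightarrow> (\<forall>F. face F w' \<in> N)" using w'(1) by (simp add: N_PB3_eq)
    also have "\<dots> \<longleftrightarrow> (\<forall>F. T4 N m g (face F w) = \<one>\<^bsub>Q4\<^esub>)"
      using w w' pi4_one_iff[OF face_B[OF w'(1)]] by (simp add: T4_face[OF w w'] conj_by_eq_one_iff) (simp add: one_Q)
    also have "\<dots> \<longleftrightarrow> (\<forall>F. face F w \<in> N')" using face_PB[OF w] by (simp add: T4_kernel_def one_Q)
    finally show ?thesis by simp
  qed
  then show ?thesis by (auto simp: N_PB3_eq)
qed

end

section \<open>Composition of pairs\<close>

text \<open>Hypothesis \<open>2\<close> is the pentagon of a second pair after application of
  \<open>T4\<close>. Its conjugating elements are the factors to the right in hypothesis
  \<open>1\<close>, so they cancel when the two relations are multiplied.\<close>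

lemma (in group) pentagon_mult:
  assumes cl: "p \<in> carrier G" "q \<in> carrier G" "r \<in> carrier G" "s \<in> carrier G" "t \<in> carrier G"
    "p' \<in> carrier G" "q' \<in> carrier G" "r' \<in> carrier G" "s' \<in> carrier G" "t' \<in> carrier G"
    and 1: "p \<otimes> (q \<otimes> r) = s \<otimes> t"
    and 2: "conj_by (q \<otimes> r) p' \<otimes> conj_by r q' \<otimes> r' = conj_by t s' \<otimes> t'"
  shows "p \<otimes> p' \<otimes> (q \<otimes> q') \<otimes> (r \<otimes> r') = s \<otimes> s' \<otimes> (t \<otimes> t')"
proof -
  have "p \<otimes> p' \<otimes> (q \<otimes> q') \<otimes> (r \<otimes> r') = p \<otimes> (q \<otimes> r) \<otimes> (conj_by (q \<otimes> r) p' \<otimes> conj_by r q' \<otimes> r')"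
    using cl by (simp add: conj_by_def m_assoc inv_mult_group)
  also have "\<dots> = s \<otimes> t \<otimes> (conj_by t s' \<otimes> t')"
    by (simp only: 1 2)
  also have "\<dots> = s \<otimes> s' \<otimes> (t \<otimes> t')"
    using cl by (simp add: conj_by_def m_assoc)
  finally show ?thesis .
qed

text \<open>\<open>e'\<close> is any pure representative of the value of \<open>T3\<close> at
  \<open>h\<close>. It stands for the element E_1(f_2) of the composition formula;
  \<open>gt_pair_comp_emb\<close> makes this substitution.\<close>

locale gt_pair_comp = gt_pair +
  P2: gt_pair "T4_kernel N m g" n h for n h +
  fixes e'
  assumes e' [simp, intro]: "e' \<in> carrier (PB 3)" and T3_h: "T3 N m g h = pi3 e'"
begin

abbreviation l where "l \<equiv> 2 * m * n + m + n"

lemma T3_factor: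
  obtains k where "k \<in> hom (B 3 Mod N_PB3 N') Q3" "\<And>x. x \<in> carrier (B 3) \<Longrightarrow> k (P2.pi3 x) = T3 N m g x"
proof -
  have "T3 N m g x = \<one>\<^bsub>Q3\<^esub>" if "x \<in> N_PB3 N'" for x
    using that by (simp add: N_PB3_T4_kernel one_Q)
  from factor_hom[OF group_B Q3.is_group T3_hom P2.K_facts(1) this] show thesis
    using that unfolding P2.pi3_def by blast
qed

lemma T4_factor:
  obtains k where "k \<in> hom (B 4 Mod N') Q4" "\<And>x. x \<in> carrier (B 4) \<Longrightarrow> k (P2.pi4 x) = T4 N m g x"
proof -
  have "T4 N m g x = \<one>\<^bsub>Q4\<^esub>" if "x \<in> N'" for x
    using that by (simp add: T4_kernel_def one_Q)
  from factor_hom[OF group_B Q4.is_group T4_hom P2.N_facts(2) this] show thesis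
    using that unfolding P2.pi4_def by blast
qed

abbreviation e2 where "e2 F \<equiv> pi4 (face F e')"

lemma T4_face_h: "T4 N m g (face F h) = Q4.conj_by (conjugator F) (e2 F)"
  by (rule T4_face[OF P2.g e' T3_h])

text \<open>The relations of the second pair hold in quotients attached to the source. The maps that
  \<open>T3\<close> and \<open>T4\<close> induce on these quotients turn them into relations for
  \<open>hp.a'\<close>, \<open>hp.b'\<close> and for conjugated faces, and
  \<open>hexagons_compose\<close> and \<open>pentagon_mult\<close> combine these with the relations
  of the first pair.\<close>

lemma gt_pair_compose: "gt_pair N l (g \<otimes>\<^bsub>B 3\<^esub> e')"
proof
  show "N \<in> NFI_PB4" by (rule N)
  show "g \<otimes>\<^bsub>B 3\<^esub> e' \<in> carrier (PB 3)" by simp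
  obtain k where k: "k \<in> hom (B 3 Mod N_PB3 N') Q3" "\<And>x. x \<in> carrier (B 3) \<Longrightarrow> k (P2.pi3 x) = T3 N m g x"
    using T3_factor by blast
  have "hexagons Q3 (k (P2.pi3 (sigma 3 1))) (k (P2.pi3 (sigma 3 2))) n (k (P2.pi3 h))"
    using P2.hexagon by (intro hexagons_hom[OF k(1) P2.Q3.is_group Q3.is_group]) (simp_all add: P2.pi3_def[symmetric])
  then have "hexagons Q3 hp.a' hp.b' n (pi3 e')"
    by (simp add: k(2) T3_sigma T3_h)
  then have "hexagons Q3 (pi3 (sigma 3 1)) (pi3 (sigma 3 2)) l (pi3 g \<otimes>\<^bsub>Q3\<^esub> pi3 e')"
    by (intro hp.hexagons_compose) simp_all
  then show "hexagons Q3 (K #>\<^bsub>B 3\<^esub> sigma 3 1) (K #>\<^bsub>B 3\<^esub> sigma 3 2) l (K #>\<^bsub>B 3\<^esub> (g \<otimes>\<^bsub>B 3\<^esub> e'))"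
    by (simp add: pi3_def[symmetric])
  obtain k4 where k4: "k4 \<in> hom (B 4 Mod N') Q4" "\<And>x. x \<in> carrier (B 4) \<Longrightarrow> k4 (P2.pi4 x) = T4 N m g x"
    using T4_factor by blast
  have "k4 (P2.pi4 (face F234 h \<otimes>\<^bsub>B 4\<^esub> face F1_23_4 h \<otimes>\<^bsub>B 4\<^esub> face F123 h))
      = k4 (P2.pi4 (face F1_2_34 h \<otimes>\<^bsub>B 4\<^esub> face F12_3_4 h))"
    using P2.pentagon by (simp only: P2.pi4_def)
  then have "Q4.conj_by k234 (e2 F234) \<otimes>\<^bsub>Q4\<^esub> Q4.conj_by (e F123) (e2 F1_23_4) \<otimes>\<^bsub>Q4\<^esub> e2 F123
      = Q4.conj_by (e F12_3_4) (e2 F1_2_34) \<otimes>\<^bsub>Q4\<^esub> e2 F12_3_4"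
    by (simp add: k4(2) T4_face_h conjugator_def del: P2.p4.hom_mult)
  from Q4.pentagon_mult[OF _ _ _ _ _ _ _ _ _ _ pent this]
  have "pi4 (face F234 (g \<otimes>\<^bsub>B 3\<^esub> e') \<otimes>\<^bsub>B 4\<^esub> face F1_23_4 (g \<otimes>\<^bsub>B 3\<^esub> e') \<otimes>\<^bsub>B 4\<^esub> face F123 (g \<otimes>\<^bsub>B 3\<^esub> e'))
    = pi4 (face F1_2_34 (g \<otimes>\<^bsub>B 3\<^esub> e') \<otimes>\<^bsub>B 4\<^esub> face F12_3_4 (g \<otimes>\<^bsub>B 3\<^esub> e'))"
    by (simp add: face_mult)
  then show "N #>\<^bsub>B 4\<^esub> (face F234 (g \<otimes>\<^bsub>B 3\<^esub> e') \<otimes>\<^bsub>B 4\<^esub> face F1_23_4 (g \<otimes>\<^bsub>B 3\<^esub> e') \<otimes>\<^bsub>B 4\<^esub> face F123 (g \<otimes>\<^bsub>B 3\<^esub> e'))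
    = N #>\<^bsub>B 4\<^esub> (face F1_2_34 (g \<otimes>\<^bsub>B 3\<^esub> e') \<otimes>\<^bsub>B 4\<^esub> face F12_3_4 (g \<otimes>\<^bsub>B 3\<^esub> e'))"
    by (simp only: pi4_def)
qed

sublocale C: gt_pair N l "g \<otimes>\<^bsub>B 3\<^esub> e'"
  by (rule gt_pair_compose)

lemma mu_mult: "(2 * m + 1) * (2 * n + 1) = 2 * l + 1"
  by (simp add: algebra_simps)

lemma T3_compose:
  assumes "w \<in> carrier (B 3)" "u \<in> carrier (B 3)" "T3 N' n h w = P2.pi3 u"
  shows "T3 N l (g \<otimes>\<^bsub>B 3\<^esub> e') w = T3 N m g u"
proof -
  obtain k where k: "k \<in> hom (B 3 Mod N_PB3 N') Q3" "\<And>x. x \<in> carrier (B 3) \<Longrightarrow> k (P2.pi3 x) = T3 N m g x"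
    using T3_factor by blast
  interpret k: group_hom "B 3 Mod N_PB3 N'" Q3 k using k(1) by unfold_locales
  have "(k \<circ> T3 N' n h) w = T3 N l (g \<otimes>\<^bsub>B 3\<^esub> e') w"
  proof (rule hom_eq_on_generate[OF group_B Q3.is_group])
    show "k \<circ> T3 N' n h \<in> hom (B 3) Q3" by (rule hom_compose[OF P2.T3_hom k(1)])
    show "T3 N l (g \<otimes>\<^bsub>B 3\<^esub> e') \<in> hom (B 3) Q3" by (rule C.T3_hom)
    show "w \<in> generate (B 3) {sigma 3 1, sigma 3 2}" using assms generate_B3 by simp
    show "(k \<circ> T3 N' n h) x = T3 N l (g \<otimes>\<^bsub>B 3\<^esub> e') x" if "x \<in> {sigma 3 1, sigma 3 2}" for x
    proof -
      have "k P2.hp.a' = hp.a' [^]\<^bsub>Q3\<^esub> (2 * n + 1)"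
        by (simp only: P2.ab'_eq k.hom_int_pow P2.p3.hom_closed B3.a k(2) T3_sigma)
      also have "\<dots> = C.hp.a'"
        by (simp only: C.ab'_eq ab'_eq Q3.int_pow_pow mu_mult p3.hom_closed B3.a)
      finally have 1: "k P2.hp.a' = C.hp.a'" .
      have "k P2.hp.b' = Q3.conj_by (pi3 e') (hp.b' [^]\<^bsub>Q3\<^esub> (2 * n + 1))"
        by (simp only: P2.ab'_eq P2.Q3.conj_by_def Q3.conj_by_def k.hom_int_pow k.hom_mult k.hom_inv P2.Q3.int_pow_closed
            P2.Q3.m_closed P2.Q3.inv_closed P2.p3.hom_closed B3.b P2.gB k(2) T3_sigma T3_h)
      also have "\<dots> = Q3.conj_by (pi3 g \<otimes>\<^bsub>Q3\<^esub> pi3 e') (pi3 (sigma 3 2) [^]\<^bsub>Q3\<^esub> ((2 * m + 1) * (2 * n + 1)))"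
        by (simp only: ab'_eq Q3.conj_by_int_pow Q3.conj_by_conj_by Q3.int_pow_pow Q3.int_pow_closed p3.hom_closed
            B3.b gB PB_in_B[OF e'])
      also have "\<dots> = C.hp.b'"
        unfolding C.ab'_eq(2) by (simp only: mu_mult p3.hom_mult gB PB_in_B[OF e'])
      finally have 2: "k P2.hp.b' = C.hp.b'" .
      show ?thesis using that 1 2 by (auto simp: P2.T3_sigma C.T3_sigma)
    qed
  qed simp
  then show ?thesis using assms by (simp add: k(2))
qed

lemma T4_compose:
  assumes "w \<in> carrier (B 4)" "u \<in> carrier (B 4)" "T4 N' n h w = P2.pi4 u"
  shows "T4 N l (g \<otimes>\<^bsub>B 3\<^esub> e') w = T4 N m g u"
proof -
  obtain k where k: "k \<in> hom (B 4 Mod N') Q4" "\<And>x. x \<in> carrier (B 4) \<Longrightarrow> k (P2.pi4 x) = T4 N m g x"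
    using T4_factor by blast
  interpret k: group_hom "B 4 Mod N'" Q4 k using k(1) by unfold_locales
  have "(k \<circ> T4 N' n h) w = T4 N l (g \<otimes>\<^bsub>B 3\<^esub> e') w"
  proof (rule hom_eq_on_generate[OF group_B Q4.is_group])
    show "k \<circ> T4 N' n h \<in> hom (B 4) Q4" by (rule hom_compose[OF P2.T4_hom k(1)])
    show "T4 N l (g \<otimes>\<^bsub>B 3\<^esub> e') \<in> hom (B 4) Q4" by (rule C.T4_hom)
    show "w \<in> generate (B 4) {sigma 4 1, sigma 4 2, sigma 4 3}" using assms generate_B4 by simp
    show "(k \<circ> T4 N' n h) x = T4 N l (g \<otimes>\<^bsub>B 3\<^esub> e') x" if "x \<in> {sigma 4 1, sigma 4 2, sigma 4 3}" for x
    proof -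
      have "k P2.A1 = A1 [^]\<^bsub>Q4\<^esub> (2 * n + 1)"
        by (simp only: P2.A1_def k.hom_int_pow P2.p4.hom_closed B4.ab.a k(2) T4_sigma)
      also have "\<dots> = C.A1"
        by (simp only: C.A1_def A1_def Q4.int_pow_pow mu_mult p4.hom_closed B4.ab.a)
      finally have 1: "k P2.A1 = C.A1" .
      \<comment> \<open>The only faces in the definition of \<open>T4\<close> are
        \<open>F123\<close> and \<open>F12_3_4\<close>, both with trivial conjugator. Hence
        \<open>T4\<close> takes the face of \<open>h\<close> to the face of \<open>e'\<close> itself
        and not merely to a conjugate.\<close>
      have step: "k (P2.Q4.conj_by (P2.e F) (P2.pi4 s [^]\<^bsub>P2.Q4\<^esub> (2 * n + 1)))
          = Q4.conj_by (C.e F) (pi4 s [^]\<^bsub>Q4\<^esub> (2 * l + 1))"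
        if s: "s \<in> carrier (B 4)" and T: "T4 N m g s = Q4.conj_by (e F) (pi4 s [^]\<^bsub>Q4\<^esub> (2 * m + 1))"
          and F: "conjugator F = \<one>\<^bsub>Q4\<^esub>" for s F
      proof -
        have eF: "T4 N m g (face F h) = e2 F"
          unfolding T4_face_h F using face_B[OF e'] by simp
        have "k (P2.Q4.conj_by (P2.e F) (P2.pi4 s [^]\<^bsub>P2.Q4\<^esub> (2 * n + 1)))
          = Q4.conj_by (e2 F) (T4 N m g s [^]\<^bsub>Q4\<^esub> (2 * n + 1))"
          by (simp only: P2.Q4.conj_by_def Q4.conj_by_def k.hom_int_pow k.hom_mult k.hom_inv P2.Q4.int_pow_closed
            P2.Q4.m_closed P2.Q4.inv_closed P2.p4.hom_closed s face_B[OF P2.g] k(2) eF)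
        also have "\<dots> = Q4.conj_by (e F \<otimes>\<^bsub>Q4\<^esub> e2 F) (pi4 s [^]\<^bsub>Q4\<^esub> ((2 * m + 1) * (2 * n + 1)))"
          by (simp only: T Q4.conj_by_int_pow Q4.conj_by_conj_by Q4.int_pow_pow Q4.int_pow_closed p4.hom_closed
            s face_B[OF g] face_B[OF e'])
        also have "\<dots> = Q4.conj_by (C.e F) (pi4 s [^]\<^bsub>Q4\<^esub> (2 * l + 1))"
          by (simp only: mu_mult p4.hom_mult face_mult[OF g e'] face_B[OF g] face_B[OF e'])
        finally show ?thesis .
      qed
      have 2: "k P2.A2 = C.A2"
        unfolding P2.A2_def C.A2_def
        by (rule step) (simp_all only: T4_sigma A2_def conjugator_def face_kind.case B4.ab.b)
      have 3: "k P2.A3 = C.A3"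
        unfolding P2.A3_def C.A3_def
        by (rule step) (simp_all only: T4_sigma A3_def conjugator_def face_kind.case B4.bc.b)
      show ?thesis using that 1 2 3 by (auto simp: P2.T4_sigma C.T4_sigma)
    qed
  qed simp
  then show ?thesis using assms by (simp add: k(2))
qed

text \<open>By \<open>T4_PB\<close> the inner value at a pure braid has a pure representative
  \<open>u\<close>, and each of the two conditions says that \<open>u\<close> lies in the source of
  the first pair. This becomes the action law.\<close>

lemma T4_kernel_compose: "T4_kernel N l (g \<otimes>\<^bsub>B 3\<^esub> e') = T4_kernel N' n h"
proof -
  have "T4 N l (g \<otimes>\<^bsub>B 3\<^esub> e') w = N \<longleftrightarrow> T4 N' n h w = N'" if w: "w \<in> carrier (PB 4)" for w
  proof -
    obtain u where u: "u \<in> carrier (PB 4)" "T4 N' n h w = P2.pi4 u" using P2.T4_PB[OF w] by blast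
    have "T4 N l (g \<otimes>\<^bsub>B 3\<^esub> e') w = T4 N m g u"
      by (rule T4_compose) (use u w in \<open>auto intro: PB_in_B\<close>)
    also have "\<dots> = N \<longleftrightarrow> u \<in> N'" using u by (simp add: T4_kernel_def)
    also have "\<dots> \<longleftrightarrow> T4 N' n h w = N'" using u P2.pi4_one_iff[OF PB_in_B[OF u(1)]] by simp
    finally show ?thesis .
  qed
  then show ?thesis by (auto simp: T4_kernel_def[of N l] T4_kernel_def[of N' n])
qed

end


section \<open>Dependence on residues and cosets\<close>

lemma (in group) odd_power: "a \<in> carrier G \<Longrightarrow> a [^] (2 * m + 1 :: int) = (a \<otimes> a) [^] m \<otimes> a"
  using int_pow_mult[of a "2 * m" 1] by (simp add: square_int_pow)

lemma (in group) odd_power': "a \<in> carrier G \<Longrightarrow> a [^] (2 * m + 1 :: int) = a \<otimes> (a \<otimes> a) [^] m"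
  using int_pow_mult[of a 1 "2 * m"] by (simp add: square_int_pow add.commute)

text \<open>In this form \<open>m\<close> occurs only as an exponent of a^2, b^2 and the full twist,
  which correspond to x_12, x_23 and c, the elements whose orders define
  \<open>N_ord\<close>.\<close>

lemma (in group) hexagons_iff:
  assumes "a \<in> carrier G" "b \<in> carrier G" "g \<in> carrier G"
  shows "hexagons G a b m g \<longleftrightarrow>
    a \<otimes> (a \<otimes> a) [^] m \<otimes> inv g \<otimes> b \<otimes> (b \<otimes> b) [^] m \<otimes> g
      = inv g \<otimes> a \<otimes> b \<otimes> (a \<otimes> a) [^] (- m) \<otimes> full_twist G a b [^] m \<and>
    inv g \<otimes> b \<otimes> (b \<otimes> b) [^] m \<otimes> g \<otimes> a \<otimes> (a \<otimes> a) [^] m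
      = b \<otimes> a \<otimes> (b \<otimes> b) [^] (- m) \<otimes> full_twist G a b [^] m \<otimes> g"
proof -
  have c: "full_twist G a b \<in> carrier G" using assms by (simp add: full_twist_def)
  have 1: "a [^] (- 2 * m) = (a \<otimes> a) [^] (- m)" "b [^] (- 2 * m) = (b \<otimes> b) [^] (- m)"
    using assms by (simp_all add: square_int_pow)
  show ?thesis unfolding hexagons_def 1 odd_power'[OF assms(1)] odd_power'[OF assms(2)]
    using assms c by (simp add: m_assoc)
qed

context gt_pair begin

lemma pi3_pow_cong:
  assumes "[m = m'] (mod int (N_ord N))" "x \<in> {pure_gen 3 1 2, pure_gen 3 2 3, central_c}"
  shows "pi3 x [^]\<^bsub>Q3\<^esub> m = pi3 x [^]\<^bsub>Q3\<^esub> m'"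
proof -
  have x: "x \<in> carrier (B 3)" using assms(2) by auto
  have "x [^]\<^bsub>B 3\<^esub> (m - m') \<in> K"
    using assms N_ord_dvd_iff[OF N, of "m - m'"] by (auto simp: cong_iff_dvd_diff)
  then have "pi3 (x [^]\<^bsub>B 3\<^esub> (m - m')) = \<one>\<^bsub>Q3\<^esub>"
    using pi3_one_iff x by (simp add: one_Q)
  then have "pi3 x [^]\<^bsub>Q3\<^esub> m \<otimes>\<^bsub>Q3\<^esub> inv\<^bsub>Q3\<^esub> (pi3 x [^]\<^bsub>Q3\<^esub> m') = \<one>\<^bsub>Q3\<^esub>"
    using x by (simp add: p3.hom_int_pow Q3.int_pow_diff)
  then show ?thesis using Q3.inv_solve_right'[of "\<one>\<^bsub>Q3\<^esub>"] x by simp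
qed

lemma face_pow_cong:
  assumes "[m = m'] (mod int (N_ord N))" "x \<in> {pure_gen 3 1 2, pure_gen 3 2 3, central_c}"
  shows "pi4 (face F x) [^]\<^bsub>Q4\<^esub> m = pi4 (face F x) [^]\<^bsub>Q4\<^esub> m'"
proof -
  have x: "x \<in> carrier (PB 3)" using assms(2) by auto
  have "pi4 (face F (x [^]\<^bsub>B 3\<^esub> m)) = pi4 (face F (x [^]\<^bsub>B 3\<^esub> m'))"
    using x pi3_pow_cong[OF assms] PB_in_B[OF x] by (intro face_cong) (simp_all add: p3.hom_int_pow)
  then show ?thesis using x by (simp add: face_int_pow p4.hom_int_pow)
qed

text \<open>The integer enters the hexagons as in \<open>hexagons_iff\<close> and the homomorphisms
  through \<sigma>_i^(2m+1) = (\<sigma>_i^2)^m \<sigma>_i. In \<open>B 4\<close> the squares are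
  faces: \<sigma>_1^2 and \<sigma>_2^2 of x_12 and x_23 under \<open>F123\<close>, and \<sigma>_3^2
  of x_23 under \<open>F234\<close>.\<close>

lemma gt_pair_cong:
  assumes m: "[m = m'] (mod int (N_ord N))" and g': "g' \<in> carrier (PB 3)" "N_PB3 N #>\<^bsub>B 3\<^esub> g = N_PB3 N #>\<^bsub>B 3\<^esub> g'"
  shows "gt_pair N m' g'" "T4 N m' g' = T4 N m g" "T3 N m' g' = T3 N m g"
proof -
  have pg: "pi3 g' = pi3 g" using g'(2) by (simp add: pi3_def)
  have g'B: "g' \<in> carrier (B 3)" using g' by (simp add: PB_in_B)
  have ef: "pi4 (face F g') = e F" for F by (rule face_cong[OF g'(1) g pg])
  have p3: "(pi3 (sigma 3 1) \<otimes>\<^bsub>Q3\<^esub> pi3 (sigma 3 1)) [^]\<^bsub>Q3\<^esub> m = (pi3 (sigma 3 1) \<otimes>\<^bsub>Q3\<^esub> pi3 (sigma 3 1)) [^]\<^bsub>Q3\<^esub> m'"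
    "(pi3 (sigma 3 2) \<otimes>\<^bsub>Q3\<^esub> pi3 (sigma 3 2)) [^]\<^bsub>Q3\<^esub> m = (pi3 (sigma 3 2) \<otimes>\<^bsub>Q3\<^esub> pi3 (sigma 3 2)) [^]\<^bsub>Q3\<^esub> m'"
    "hp.c [^]\<^bsub>Q3\<^esub> m = hp.c [^]\<^bsub>Q3\<^esub> m'"
    using pi3_pow_cong[OF m, of "pure_gen 3 1 2"] pi3_pow_cong[OF m, of "pure_gen 3 2 3"] pi3_pow_cong[OF m, of central_c]
    by (simp_all add: pure_gen3 hp_c)
  have hx: "hexagons Q3 (pi3 (sigma 3 1)) (pi3 (sigma 3 2)) m' (pi3 g)"
    using hp.hex by (simp add: Q3.hexagons_iff Q3.int_pow_neg p3)
  show "gt_pair N m' g'"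
  proof
    show "hexagons Q3 (K #>\<^bsub>B 3\<^esub> sigma 3 1) (K #>\<^bsub>B 3\<^esub> sigma 3 2) m' (K #>\<^bsub>B 3\<^esub> g')"
      using hx by (simp add: pi3_def[symmetric] pg)
    have "pi4 (face F234 g' \<otimes>\<^bsub>B 4\<^esub> face F1_23_4 g' \<otimes>\<^bsub>B 4\<^esub> face F123 g') = pi4 (face F1_2_34 g' \<otimes>\<^bsub>B 4\<^esub> face F12_3_4 g')"
      using g'(1) pent by (simp add: ef Q4.m_assoc)
    then show "N #>\<^bsub>B 4\<^esub> (face F234 g' \<otimes>\<^bsub>B 4\<^esub> face F1_23_4 g' \<otimes>\<^bsub>B 4\<^esub> face F123 g')
        = N #>\<^bsub>B 4\<^esub> (face F1_2_34 g' \<otimes>\<^bsub>B 4\<^esub> face F12_3_4 g')"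
      by (simp only: pi4_def)
  qed (use N g' in auto)
  have odd3: "pi3 (sigma 3 i) [^]\<^bsub>Q3\<^esub> (2 * m' + 1) = pi3 (sigma 3 i) [^]\<^bsub>Q3\<^esub> mu" if "i = 1 \<or> i = 2" for i
    using that p3 by (auto simp: Q3.odd_power)
  have "N_PB3 N #>\<^bsub>B 3\<^esub> (sigma 3 1 [^]\<^bsub>B 3\<^esub> (2 * m' + 1)) = N_PB3 N #>\<^bsub>B 3\<^esub> (sigma 3 1 [^]\<^bsub>B 3\<^esub> mu)"
    "N_PB3 N #>\<^bsub>B 3\<^esub> (inv\<^bsub>B 3\<^esub> g' \<otimes>\<^bsub>B 3\<^esub> sigma 3 2 [^]\<^bsub>B 3\<^esub> (2 * m' + 1) \<otimes>\<^bsub>B 3\<^esub> g')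
      = N_PB3 N #>\<^bsub>B 3\<^esub> (inv\<^bsub>B 3\<^esub> g \<otimes>\<^bsub>B 3\<^esub> sigma 3 2 [^]\<^bsub>B 3\<^esub> mu \<otimes>\<^bsub>B 3\<^esub> g)"
    using odd3[of 1] odd3[of 2] g'B by (simp_all add: pi3_def[symmetric] p3.hom_int_pow pg)
  then show "T3 N m' g' = T3 N m g" by (simp only: T3_def)
  have p4: "(pi4 (sigma 4 1) \<otimes>\<^bsub>Q4\<^esub> pi4 (sigma 4 1)) [^]\<^bsub>Q4\<^esub> m = (pi4 (sigma 4 1) \<otimes>\<^bsub>Q4\<^esub> pi4 (sigma 4 1)) [^]\<^bsub>Q4\<^esub> m'"
    "(pi4 (sigma 4 2) \<otimes>\<^bsub>Q4\<^esub> pi4 (sigma 4 2)) [^]\<^bsub>Q4\<^esub> m = (pi4 (sigma 4 2) \<otimes>\<^bsub>Q4\<^esub> pi4 (sigma 4 2)) [^]\<^bsub>Q4\<^esub> m'"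
    "(pi4 (sigma 4 3) \<otimes>\<^bsub>Q4\<^esub> pi4 (sigma 4 3)) [^]\<^bsub>Q4\<^esub> m = (pi4 (sigma 4 3) \<otimes>\<^bsub>Q4\<^esub> pi4 (sigma 4 3)) [^]\<^bsub>Q4\<^esub> m'"
    using face_pow_cong[OF m, of "pure_gen 3 1 2" F123] face_pow_cong[OF m, of "pure_gen 3 2 3" F123]
      face_pow_cong[OF m, of "pure_gen 3 2 3" F234]
    by (simp_all add: face_eq face_ext_pure_gens pure_gen4)
  have odd4: "pi4 (sigma 4 i) [^]\<^bsub>Q4\<^esub> (2 * m' + 1) = pi4 (sigma 4 i) [^]\<^bsub>Q4\<^esub> mu" if "i = 1 \<or> i = 2 \<or> i = 3" for i
    using that p4 by (auto simp: Q4.odd_power)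
  have "N #>\<^bsub>B 4\<^esub> (sigma 4 1 [^]\<^bsub>B 4\<^esub> (2 * m' + 1)) = N #>\<^bsub>B 4\<^esub> (sigma 4 1 [^]\<^bsub>B 4\<^esub> mu)"
    "N #>\<^bsub>B 4\<^esub> (inv\<^bsub>B 4\<^esub> face F123 g' \<otimes>\<^bsub>B 4\<^esub> sigma 4 2 [^]\<^bsub>B 4\<^esub> (2 * m' + 1) \<otimes>\<^bsub>B 4\<^esub> face F123 g')
      = N #>\<^bsub>B 4\<^esub> (inv\<^bsub>B 4\<^esub> face F123 g \<otimes>\<^bsub>B 4\<^esub> sigma 4 2 [^]\<^bsub>B 4\<^esub> mu \<otimes>\<^bsub>B 4\<^esub> face F123 g)"
    "N #>\<^bsub>B 4\<^esub> (inv\<^bsub>B 4\<^esub> face F12_3_4 g' \<otimes>\<^bsub>B 4\<^esub> sigma 4 3 [^]\<^bsub>B 4\<^esub> (2 * m' + 1) \<otimes>\<^bsub>B 4\<^esub> face F12_3_4 g')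
      = N #>\<^bsub>B 4\<^esub> (inv\<^bsub>B 4\<^esub> face F12_3_4 g \<otimes>\<^bsub>B 4\<^esub> sigma 4 3 [^]\<^bsub>B 4\<^esub> mu \<otimes>\<^bsub>B 4\<^esub> face F12_3_4 g)"
    using odd4[of 1] odd4[of 2] odd4[of 3] g'(1) by (simp_all add: pi4_def[symmetric] p4.hom_int_pow ef)
  then show "T4 N m' g' = T4 N m g" by (simp only: T4_def)
qed

text \<open>\<open>T3\<close> raises x_12, x_23 and c to the power 2m+1 up to conjugation and kills
  their powers with exponent \<open>N_ord N'\<close>. In a composite the second integer is given
  modulo \<open>N_ord N'\<close> only, and this makes its product with 2m+1 well defined modulo
  \<open>N_ord N\<close>.\<close>

lemma N_ord_dvd: "int (N_ord N) dvd (2 * m + 1) * int (N_ord N')"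
  unfolding N_ord_dvd_iff[OF N]
proof
  fix x assume x: "x \<in> {pure_gen 3 1 2, pure_gen 3 2 3, central_c}"
  let ?n = "int (N_ord N')"
  have xB: "x \<in> carrier (B 3)" using x by auto
  have "x [^]\<^bsub>B 3\<^esub> ?n \<in> N_PB3 N'"
    using x N_ord_dvd_iff[OF T4_kernel_NFI, of ?n] by auto
  then have "T3 N m g x [^]\<^bsub>Q3\<^esub> ?n = \<one>\<^bsub>Q3\<^esub>"
    using xB by (simp add: N_PB3_T4_kernel T3.hom_int_pow one_Q)
  moreover have "T3 N m g x = pi3 (x [^]\<^bsub>B 3\<^esub> mu) \<or> T3 N m g x = Q3.conj_by (pi3 g) (pi3 (x [^]\<^bsub>B 3\<^esub> mu))"
    using x T3_x12 T3_x23 T3_c by (auto simp: Q3.conj_by_def)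
  ultimately have "pi3 (x [^]\<^bsub>B 3\<^esub> mu) [^]\<^bsub>Q3\<^esub> ?n = \<one>\<^bsub>Q3\<^esub>"
  proof (elim disjE)
    assume 1: "T3 N m g x [^]\<^bsub>Q3\<^esub> ?n = \<one>\<^bsub>Q3\<^esub>" and "T3 N m g x = Q3.conj_by (pi3 g) (pi3 (x [^]\<^bsub>B 3\<^esub> mu))"
    then have "Q3.conj_by (pi3 g) (pi3 (x [^]\<^bsub>B 3\<^esub> mu) [^]\<^bsub>Q3\<^esub> ?n) = \<one>\<^bsub>Q3\<^esub>"
      using xB by (simp add: Q3.conj_by_int_pow)
    then have "Q3.conj_by (inv\<^bsub>Q3\<^esub> pi3 g) (Q3.conj_by (pi3 g) (pi3 (x [^]\<^bsub>B 3\<^esub> mu) [^]\<^bsub>Q3\<^esub> ?n)) = \<one>\<^bsub>Q3\<^esub>"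
      using xB by (simp add: Q3.conj_by_def del: p3.hom_inv)
    then show ?thesis using xB by (subst (asm) Q3.conj_by_conj_by) (simp_all del: p3.hom_inv add: p3.hom_int_pow)
  qed simp
  then show "x [^]\<^bsub>B 3\<^esub> (mu * ?n) \<in> K"
    using xB pi3_one_iff[of "x [^]\<^bsub>B 3\<^esub> (mu * ?n)"] by (simp add: p3.hom_int_pow Q3.int_pow_pow one_Q)
qed

end

section \<open>The free group of rank two\<close>

lemma group_F2: "group F2"
  unfolding F2_def by (rule group_presented_group)

interpretation F2: group F2 by (rule group_F2)

lemma F2_gens [simp, intro]: "F2_x \<in> carrier F2" "F2_y \<in> carrier F2"
  unfolding F2_def F2_x_def F2_y_def by (rule word_class_carrier; simp)+

lemma generate_F2: "generate F2 {F2_x, F2_y} = carrier F2"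
  using generate_presented_group[of "{1, 2::nat}" "{}"] by (simp add: F2_def F2_x_def F2_y_def)

lemma F2_map:
  assumes "group G" "a \<in> carrier G" "b \<in> carrier G"
  defines "h \<equiv> hom_with_values F2 G [(F2_x, a), (F2_y, b)]"
  shows "h \<in> hom F2 G" "h F2_x = a" "h F2_y = b"
proof -
  interpret group G by fact
  define v where "v i = (if i = 1 then a else b)" for i :: nat
  have v: "v \<in> {1, 2} \<rightarrow> carrier G" using assms by (simp add: v_def)
  obtain k where k: "k \<in> hom F2 G" "\<And>i. i \<in> {1, 2} \<Longrightarrow> k (word_class {1, 2} {} [(i, True)]) = v i"
  proof -
    have R: "word_eval G v r = word_eval G v s" if "(r, s) \<in> {}" for r s using that by simp
    from presented_group_hom[OF v R] obtain h where
      "h \<in> hom (presented_group {1, 2} {}) G" "\<And>a. a \<in> {1, 2} \<Longrightarrow> h (word_class {1, 2} {} [(a, True)]) = v a"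
      by blast
    then show thesis by (intro that) (simp_all add: F2_def)
  qed
  have k': "k F2_x = a" "k F2_y = b"
    using k(2)[of 1] k(2)[of 2] by (simp_all add: F2_x_def F2_y_def v_def)
  note props = hom_with_values_hom[OF group_F2 is_group k(1), of "[(F2_x, a), (F2_y, b)]"]
  show "h \<in> hom F2 G" "h F2_x = a" "h F2_y = b"
    unfolding h_def by (rule props; use k' generate_F2 in auto)+
qed

lemma F2_hom_eq:
  assumes "group G" "h \<in> hom F2 G" "k \<in> hom F2 G" "h F2_x = k F2_x" "h F2_y = k F2_y" "w \<in> carrier F2"
  shows "h w = k w"
  by (rule hom_eq_on_generate[OF group_F2 assms(1-3), of "{F2_x, F2_y}"]) (use assms generate_F2 in auto)

lemma F2_emb: "F2_emb \<in> hom F2 (PB 3)" "F2_emb F2_x = pure_gen 3 1 2" "F2_emb F2_y = pure_gen 3 2 3"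
  unfolding F2_emb_def using F2_map[OF PB.is_group[of 3] pure_gen3_closed(1,2)] by auto

interpretation emb: group_hom F2 "PB 3" F2_emb
  by (simp add: group_hom_def group_hom_axioms_def group_F2 PB.is_group F2_emb)

lemma emb_PB [simp, intro]: "f \<in> carrier F2 \<Longrightarrow> F2_emb f \<in> carrier (PB 3)"
  by (rule emb.hom_closed)

lemma emb_B [simp, intro]: "f \<in> carrier F2 \<Longrightarrow> F2_emb f \<in> carrier (B 3)"
  using emb_PB PB_in_B by blast

lemma emb_mult: "f \<in> carrier F2 \<Longrightarrow> g \<in> carrier F2 \<Longrightarrow> F2_emb (f \<otimes>\<^bsub>F2\<^esub> g) = F2_emb f \<otimes>\<^bsub>B 3\<^esub> F2_emb g"
  using emb.hom_mult by simp

lemma F2_endo: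
  assumes "f \<in> carrier F2"
  shows "F2_endo m f \<in> hom F2 F2" "F2_endo m f F2_x = F2_x [^]\<^bsub>F2\<^esub> (2 * m + 1)"
    "F2_endo m f F2_y = inv\<^bsub>F2\<^esub> f \<otimes>\<^bsub>F2\<^esub> F2_y [^]\<^bsub>F2\<^esub> (2 * m + 1) \<otimes>\<^bsub>F2\<^esub> f"
  unfolding F2_endo_def using assms by (simp_all add: F2_map[OF group_F2])

lemma F2_endo_closed [simp, intro]: "f \<in> carrier F2 \<Longrightarrow> w \<in> carrier F2 \<Longrightarrow> F2_endo m f w \<in> carrier F2"
  using F2_endo(1) by (auto simp: hom_def)

lemma F2_endo_mult: "f \<in> carrier F2 \<Longrightarrow> u \<in> carrier F2 \<Longrightarrow> v \<in> carrier F2 \<Longrightarrow>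
    F2_endo m f (u \<otimes>\<^bsub>F2\<^esub> v) = F2_endo m f u \<otimes>\<^bsub>F2\<^esub> F2_endo m f v"
  using F2_endo(1) by (auto simp: hom_def)

lemma F2_endo_one: "f \<in> carrier F2 \<Longrightarrow> F2_endo m f \<one>\<^bsub>F2\<^esub> = \<one>\<^bsub>F2\<^esub>"
  using hom_one[OF F2_endo(1) group_F2 group_F2] .

lemma F2_endo_id: "w \<in> carrier F2 \<Longrightarrow> F2_endo 0 \<one>\<^bsub>F2\<^esub> w = w"
  using F2_hom_eq[OF group_F2 F2_endo(1), of "\<one>\<^bsub>F2\<^esub>" "\<lambda>w. w" 0 w]
  by (simp add: F2_endo hom_def)

lemma F2_endo_comp:
  assumes f: "f1 \<in> carrier F2" "f2 \<in> carrier F2" and w: "w \<in> carrier F2"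
  shows "F2_endo (2 * m1 * m2 + m1 + m2) (f1 \<otimes>\<^bsub>F2\<^esub> F2_endo m1 f1 f2) w = F2_endo m1 f1 (F2_endo m2 f2 w)"
proof -
  have f': "f1 \<otimes>\<^bsub>F2\<^esub> F2_endo m1 f1 f2 \<in> carrier F2" using f by simp
  interpret E: group_hom F2 F2 "F2_endo m1 f1"
    using F2_endo(1)[OF f(1)] by unfold_locales
  have k: "2 * (2 * m1 * m2 + m1 + m2) + 1 = (2 * m1 + 1) * (2 * m2 + 1)" by (simp add: algebra_simps)
  have pow: "x [^]\<^bsub>F2\<^esub> (2 * (2 * m1 * m2 + m1 + m2) + 1) = (x [^]\<^bsub>F2\<^esub> (2 * m1 + 1)) [^]\<^bsub>F2\<^esub> (2 * m2 + 1)"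
    if "x \<in> carrier F2" for x
    unfolding k using that by (simp only: F2.int_pow_pow)
  have "F2_endo (2 * m1 * m2 + m1 + m2) (f1 \<otimes>\<^bsub>F2\<^esub> F2_endo m1 f1 f2) w = (F2_endo m1 f1 \<circ> F2_endo m2 f2) w"
  proof (rule F2_hom_eq[OF group_F2 F2_endo(1)[OF f'] _ _ _ w])
    show "F2_endo m1 f1 \<circ> F2_endo m2 f2 \<in> hom F2 F2"
      by (rule hom_compose[OF F2_endo(1)[OF f(2)] F2_endo(1)[OF f(1)]])
    show "F2_endo (2 * m1 * m2 + m1 + m2) (f1 \<otimes>\<^bsub>F2\<^esub> F2_endo m1 f1 f2) F2_x = (F2_endo m1 f1 \<circ> F2_endo m2 f2) F2_x"
      unfolding F2_endo(2)[OF f'] pow[OF F2_gens(1)] using f by (simp add: F2_endo E.hom_int_pow)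
    show "F2_endo (2 * m1 * m2 + m1 + m2) (f1 \<otimes>\<^bsub>F2\<^esub> F2_endo m1 f1 f2) F2_y = (F2_endo m1 f1 \<circ> F2_endo m2 f2) F2_y"
      unfolding F2_endo(3)[OF f'] pow[OF F2_gens(2)] using f
      by (simp add: F2_endo E.hom_int_pow F2.conj_int_pow F2.inv_mult_group) (simp add: F2.m_assoc)
  qed
  then show ?thesis by simp
qed

section \<open>The category of GT-shadows\<close>

definition T3_onto :: "nat word set set \<Rightarrow> int \<Rightarrow> nat word set \<Rightarrow> bool" where
  "T3_onto N m g \<longleftrightarrow> (\<forall>u\<in>carrier (PB 3). \<exists>w\<in>carrier (PB 3). T3 N m g w = N_PB3 N #>\<^bsub>B 3\<^esub> u)"

definition unit_mod :: "nat word set set \<Rightarrow> int \<Rightarrow> bool" where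
  "unit_mod N m \<longleftrightarrow> (\<exists>k. [(2 * m + 1) * k = 1] (mod int (N_ord N)))"

lemma set_mult_PB: "set_mult (PB n) = set_mult (B n)"
  by (simp add: set_mult_def fun_eq_iff)

text \<open>Condition (iv) asks for some homomorphism with three prescribed values; since x_12, x_23
  and c generate \<open>PB 3\<close>, the only candidate is \<open>T3\<close>.\<close>

lemma (in gt_pair) T3_epi:
  assumes "h \<in> hom (PB 3) (PB 3 Mod K)"
    "h (pure_gen 3 1 2) = K #>\<^bsub>B 3\<^esub> (pure_gen 3 1 2 [^]\<^bsub>B 3\<^esub> mu)"
    "h (pure_gen 3 2 3) = K #>\<^bsub>B 3\<^esub> (inv\<^bsub>B 3\<^esub> g \<otimes>\<^bsub>B 3\<^esub> pure_gen 3 2 3 [^]\<^bsub>B 3\<^esub> mu \<otimes>\<^bsub>B 3\<^esub> g)"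
    "h central_c = K #>\<^bsub>B 3\<^esub> (central_c [^]\<^bsub>B 3\<^esub> mu)"
    "w \<in> carrier (PB 3)"
  shows "h w = T3 N m g w"
proof (rule hom_eq_on_generate[OF PB.is_group Q3.is_group])
  show "h \<in> hom (PB 3) Q3"
    using assms(1) by (force simp: hom_def mult_FactGroup set_mult_PB carrier_FactGroup)
  show "T3 N m g \<in> hom (PB 3) Q3"
    using T3_hom by (simp add: hom_def Pi_iff PB_in_B)
  show "w \<in> generate (PB 3) {pure_gen 3 1 2, pure_gen 3 2 3, central_c}" using assms generate_PB3' by simp
  show "h x = T3 N m g x" if "x \<in> {pure_gen 3 1 2, pure_gen 3 2 3, central_c}" for x
    using that assms(2-4) T3_x12 T3_x23 T3_c by (auto simp: pi3_def simp del: p3.hom_mult)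
qed auto

lemma (in gt_pair) T3_hom_PB: "T3 N m g \<in> hom (PB 3) (PB 3 Mod K)"
proof (rule homI)
  show "T3 N m g w \<in> carrier (PB 3 Mod K)" if "w \<in> carrier (PB 3)" for w
    using T3_PB[OF that] by (auto simp: carrier_FactGroup pi3_def)
  show "T3 N m g (u \<otimes>\<^bsub>PB 3\<^esub> v) = T3 N m g u \<otimes>\<^bsub>PB 3 Mod K\<^esub> T3 N m g v"
    if "u \<in> carrier (PB 3)" "v \<in> carrier (PB 3)" for u v
    using that T3.hom_mult[of u v] by (simp add: PB_in_B mult_FactGroup set_mult_PB)
qed

lemma hexagons_mod_iff:
  assumes "K \<lhd> B 3" "f \<in> carrier F2"
  shows "hexagons_mod K m f \<longleftrightarrow>
    hexagons (B 3 Mod K) (K #>\<^bsub>B 3\<^esub> sigma 3 1) (K #>\<^bsub>B 3\<^esub> sigma 3 2) m (K #>\<^bsub>B 3\<^esub> F2_emb f)"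
proof -
  define p where "p w = K #>\<^bsub>B 3\<^esub> w" for w
  have Q: "group (B 3 Mod K)" using assms(1) by (rule normal.factorgroup_is_group)
  interpret p: group_hom "B 3" "B 3 Mod K" p
    using rcos_hom[OF assms(1)] Q by (auto simp: group_hom_def group_hom_axioms_def group_B p_def[abs_def])
  have c: "p central_c = full_twist (B 3 Mod K) (p (sigma 3 1)) (p (sigma 3 2))"
    using B3.hom_full_twist[OF p.homh Q] by (simp add: central_c_eq)
  have cB: "central_c \<in> carrier (B 3)" by (intro PB_in_B central_c_closed)
  show ?thesis
    unfolding hexagons_mod_def Let_def p_def[symmetric] pure_gen3
    using assms(2) cB by (subst p.H.hexagons_iff) (simp_all add: p.hom_int_pow c)
qed

lemma pentagon_mod_iff:
  "pentagon_mod N f \<longleftrightarrow> N #>\<^bsub>B 4\<^esub> (face F234 (F2_emb f) \<otimes>\<^bsub>B 4\<^esub> face F1_23_4 (F2_emb f) \<otimes>\<^bsub>B 4\<^esub> face F123 (F2_emb f))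
      = N #>\<^bsub>B 4\<^esub> (face F1_2_34 (F2_emb f) \<otimes>\<^bsub>B 4\<^esub> face F12_3_4 (F2_emb f))"
  by (simp add: pentagon_mod_def Let_def face.simps)

lemma gt_pair_iff:
  assumes "N \<in> NFI_PB4" "f \<in> carrier F2"
  shows "gt_pair N m (F2_emb f) \<longleftrightarrow> hexagons_mod (N_PB3 N) m f \<and> pentagon_mod N f"
  using assms hexagons_mod_iff[OF N_PB3_facts(1)[OF assms(1)] assms(2)]
  by (auto simp: gt_pair_def pentagon_mod_iff)

lemma is_GT_pair_iff:
  assumes "N \<in> NFI_PB4" "f \<in> carrier F2"
  shows "is_GT_pair N m f \<longleftrightarrow> gt_pair N m (F2_emb f) \<and> unit_mod N m \<and> T3_onto N m (F2_emb f)"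
proof -
  let ?g = "F2_emb f" and ?K = "N_PB3 N"
  let ?P = "\<lambda>h. h (pure_gen 3 1 2) = ?K #>\<^bsub>B 3\<^esub> (pure_gen 3 1 2 [^]\<^bsub>B 3\<^esub> (2 * m + 1)) \<and>
    h (pure_gen 3 2 3) = ?K #>\<^bsub>B 3\<^esub> (inv\<^bsub>B 3\<^esub> ?g \<otimes>\<^bsub>B 3\<^esub> pure_gen 3 2 3 [^]\<^bsub>B 3\<^esub> (2 * m + 1) \<otimes>\<^bsub>B 3\<^esub> ?g) \<and>
    h central_c = ?K #>\<^bsub>B 3\<^esub> (central_c [^]\<^bsub>B 3\<^esub> (2 * m + 1))"
  have iv: "(\<exists>h\<in>epi (PB 3) (PB 3 Mod ?K). ?P h) \<longleftrightarrow> T3_onto N m ?g" if "gt_pair N m ?g"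
  proof -
    interpret gt_pair N m ?g by fact
    have P: "?P (T3 N m ?g)" using T3_x12 T3_x23 T3_c by (simp add: pi3_def)
    have onto: "T3_onto N m ?g \<longleftrightarrow> T3 N m ?g ` carrier (PB 3) = carrier (PB 3 Mod ?K)"
    proof -
      have "T3_onto N m ?g \<longleftrightarrow> (\<lambda>u. ?K #>\<^bsub>B 3\<^esub> u) ` carrier (PB 3) \<subseteq> T3 N m ?g ` carrier (PB 3)"
      proof -
        have "(\<exists>w\<in>carrier (PB 3). T3 N m ?g w = y) \<longleftrightarrow> y \<in> T3 N m ?g ` carrier (PB 3)" for y by blast
        then show ?thesis unfolding T3_onto_def by blast
      qed
      then show ?thesis using hom_carrier[OF T3_hom_PB] by (auto simp only: carrier_FactGroup rcos_PB)
    qed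
    show ?thesis
    proof
      assume "\<exists>h\<in>epi (PB 3) (PB 3 Mod ?K). ?P h"
      then obtain h where h: "h \<in> hom (PB 3) (PB 3 Mod ?K)" "h ` carrier (PB 3) = carrier (PB 3 Mod ?K)" "?P h"
        by (auto simp: epi_def)
      have "h w = T3 N m ?g w" if "w \<in> carrier (PB 3)" for w
        using h that by (intro T3_epi) auto
      then show "T3_onto N m ?g" using h(2) unfolding onto by (metis (no_types, lifting) image_cong)
    next
      assume "T3_onto N m ?g"
      then show "\<exists>h\<in>epi (PB 3) (PB 3 Mod ?K). ?P h"
        using P T3_hom_PB unfolding onto epi_def by blast
    qed
  qed
  have "is_GT_pair N m f \<longleftrightarrow> gt_pair N m ?g \<and> unit_mod N m \<and> (\<exists>h\<in>epi (PB 3) (PB 3 Mod ?K). ?P h)"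
    using assms(2) unfolding is_GT_pair_def Let_def gt_pair_iff[OF assms] unit_mod_def
    by simp
  then show ?thesis using iv by blast
qed

section \<open>Shadows, their sources and their composition\<close>

lemma shadow_eq_iff:
  "shadow N m f = shadow N m' f' \<longleftrightarrow>
    [m = m'] (mod int (N_ord N)) \<and> N_PB3 N #>\<^bsub>B 3\<^esub> F2_emb f = N_PB3 N #>\<^bsub>B 3\<^esub> F2_emb f'"
proof -
  have "{k. [k = m] (mod int (N_ord N))} = {k. [k = m'] (mod int (N_ord N))} \<longleftrightarrow> [m = m'] (mod int (N_ord N))"
    by (auto intro: cong_trans cong_sym)
  then show ?thesis by (simp add: shadow_def)
qed

lemma GT_E:
  assumes "N \<in> NFI_PB4" "s \<in> GT N"
  obtains m f where "s = shadow N m f" "f \<in> carrier F2" "gt_pair N m (F2_emb f)" "unit_mod N m" "T3_onto N m (F2_emb f)"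
  using assms is_GT_pair_iff by (auto simp: GT_def)

lemma GT_I:
  assumes "N \<in> NFI_PB4" "f \<in> carrier F2" "gt_pair N m (F2_emb f)" "unit_mod N m" "T3_onto N m (F2_emb f)"
  shows "shadow N m f \<in> GT N"
  unfolding GT_def using assms is_GT_pair_iff[OF assms(1,2), of m] by blast

lemma T_PB4_eq: "T_PB4 N m f = restrict (T4 N m (F2_emb f)) (carrier (PB 4))"
  by (simp add: T_PB4_def T_B4_def T4_def Let_def face.simps)

lemma shadow_cong:
  assumes "gt_pair N m (F2_emb f)" "f' \<in> carrier F2" "shadow N m f = shadow N m' f'"
  shows "gt_pair N m' (F2_emb f')" "T4 N m' (F2_emb f') = T4 N m (F2_emb f)" "T3 N m' (F2_emb f') = T3 N m (F2_emb f)"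
  using gt_pair.gt_pair_cong[OF assms(1), of m' "F2_emb f'"] assms(2,3) by (auto simp: shadow_eq_iff)

text \<open>The description in \<open>shadow_PB4\<close> has a value because, by
  \<open>shadow_cong\<close>, \<open>T4\<close> depends only on the classes of \<open>m\<close> and
  \<open>f\<close>.\<close>

lemma shadow_source_eq:
  assumes "gt_pair N m (F2_emb f)" "f \<in> carrier F2"
  shows "shadow_source N (shadow N m f) = T4_kernel N m (F2_emb f)"
proof -
  have "shadow_PB4 N (shadow N m f) = T_PB4 N m f"
    unfolding shadow_PB4_def
  proof (rule the_equality)
    show "\<forall>m'. \<forall>f'\<in>carrier F2. shadow N m f = shadow N m' f' \<longrightarrow> T_PB4 N m f = T_PB4 N m' f'"
      using shadow_cong(2)[OF assms(1)] by (simp add: T_PB4_eq)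
    show "h = T_PB4 N m f" if "\<forall>m'. \<forall>f'\<in>carrier F2. shadow N m f = shadow N m' f' \<longrightarrow> h = T_PB4 N m' f'" for h
      using that assms(2) by blast
  qed
  then show ?thesis
    by (auto simp: shadow_source_def kernel_def T_PB4_eq T4_kernel_def one_FactGroup)
qed

text \<open>Connects the composition formula with the kernels: the endomorphism of F_2 in that
  formula has at x and y the values of \<open>T3\<close> at x_12 and x_23.\<close>

lemma (in gt_pair) T3_emb:
  assumes "g = F2_emb f" "f \<in> carrier F2" "w \<in> carrier F2"
  shows "T3 N m g (F2_emb w) = pi3 (F2_emb (F2_endo m f w))"
proof -
  have "(T3 N m g \<circ> F2_emb) w = ((pi3 \<circ> F2_emb) \<circ> F2_endo m f) w"
  proof (rule F2_hom_eq[OF Q3.is_group _ _ _ _ assms(3)])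
    have "T3 N m g \<in> hom (PB 3) Q3" "pi3 \<in> hom (PB 3) Q3"
      using T3_hom p3.homh by (simp_all add: hom_def Pi_iff PB_in_B)
    then show "T3 N m g \<circ> F2_emb \<in> hom F2 Q3" "(pi3 \<circ> F2_emb) \<circ> F2_endo m f \<in> hom F2 Q3"
      using F2_emb(1) F2_endo(1)[OF assms(2)] by (blast intro: hom_compose)+
    show "(T3 N m g \<circ> F2_emb) F2_x = ((pi3 \<circ> F2_emb) \<circ> F2_endo m f) F2_x"
      using assms(2) by (simp add: F2_emb F2_endo T3_x12 emb.hom_int_pow)
    show "(T3 N m g \<circ> F2_emb) F2_y = ((pi3 \<circ> F2_emb) \<circ> F2_endo m f) F2_y"
      using assms(2) by (simp add: F2_emb F2_endo T3_x23[unfolded assms(1)] emb.hom_int_pow assms(1))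
  qed
  then show ?thesis by simp
qed

lemma gt_pair_comp_emb:
  assumes "gt_pair N1 m1 (F2_emb f1)" "f1 \<in> carrier F2" "f2 \<in> carrier F2"
    "gt_pair (T4_kernel N1 m1 (F2_emb f1)) m2 (F2_emb f2)"
  shows "gt_pair_comp N1 m1 (F2_emb f1) m2 (F2_emb f2) (F2_emb (F2_endo m1 f1 f2))"
proof -
  interpret gt_pair N1 m1 "F2_emb f1" by fact
  show ?thesis
    using assms T3_emb[OF HOL.refl assms(2,3)] by (simp add: gt_pair_comp_def gt_pair_comp_axioms_def)
qed

text \<open>The content is independence of the representatives. Two choices of \<open>f2\<close>
  differ by an element of \<open>N_PB3 N2\<close>, which \<open>T3\<close> kills; the integers are
  handled by \<open>N_ord_dvd\<close>.\<close>

lemma shadow_comp_eq: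
  assumes 1: "gt_pair N1 m1 (F2_emb f1)" and f: "f1 \<in> carrier F2" "f2 \<in> carrier F2"
    and N2: "N2 = T4_kernel N1 m1 (F2_emb f1)" and 2: "gt_pair N2 m2 (F2_emb f2)"
  shows "shadow_comp N2 N1 (shadow N1 m1 f1) (shadow N2 m2 f2)
    = shadow N1 (2 * m1 * m2 + m1 + m2) (f1 \<otimes>\<^bsub>F2\<^esub> F2_endo m1 f1 f2)"
proof -
  interpret gt_pair N1 m1 "F2_emb f1" by fact
  interpret P2: gt_pair N2 m2 "F2_emb f2" by fact
  have key: "shadow N1 (2 * m1 * m2 + m1 + m2) (f1 \<otimes>\<^bsub>F2\<^esub> F2_endo m1 f1 f2)
      = shadow N1 (2 * m1' * m2' + m1' + m2') (f1' \<otimes>\<^bsub>F2\<^esub> F2_endo m1' f1' f2')"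
    if f': "f1' \<in> carrier F2" "f2' \<in> carrier F2"
      and s1: "shadow N1 m1 f1 = shadow N1 m1' f1'" and s2: "shadow N2 m2 f2 = shadow N2 m2' f2'" for m1' m2' f1' f2'
  proof -
    interpret P1': gt_pair N1 m1' "F2_emb f1'" by (rule shadow_cong(1)[OF 1 f'(1) s1])
    have "int (N_ord N1) dvd m1 - m1'" "int (N_ord N2) dvd m2 - m2'"
      using s1 s2 by (auto simp: shadow_eq_iff cong_iff_dvd_diff)
    moreover have "int (N_ord N1) dvd (2 * m1 + 1) * int (N_ord N2)"
      using N_ord_dvd by (simp add: N2)
    \<comment> \<open>This is the difference of the two composite integers, split so that
      \<open>N_ord_dvd\<close> applies to the first summand and the congruence of \<open>m1\<close>
      and \<open>m1'\<close> to the second.\<close>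
    ultimately have "int (N_ord N1) dvd (2 * m1 + 1) * (m2 - m2') + (2 * m2' + 1) * (m1 - m1')"
      by (meson dvd_add dvd_mult dvd_trans mult_dvd_mono dvd_refl)
    then have m: "[2 * m1 * m2 + m1 + m2 = 2 * m1' * m2' + m1' + m2'] (mod int (N_ord N1))"
      by (simp add: cong_iff_dvd_diff algebra_simps)
    have "T3 N1 m1 (F2_emb f1) (F2_emb f2) = T3 N1 m1 (F2_emb f1) (F2_emb f2')"
    proof -
      have "P2.pi3 (F2_emb f2) = P2.pi3 (F2_emb f2')"
        using s2 by (simp add: shadow_eq_iff P2.pi3_def)
      then have "F2_emb f2 \<otimes>\<^bsub>B 3\<^esub> inv\<^bsub>B 3\<^esub> F2_emb f2' \<in> N_PB3 N2"
        using f f' by (simp add: P2.pi3_eq_iff)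
      then have "T3 N1 m1 (F2_emb f1) (F2_emb f2 \<otimes>\<^bsub>B 3\<^esub> inv\<^bsub>B 3\<^esub> F2_emb f2') = \<one>\<^bsub>Q3\<^esub>"
        by (simp add: N2 N_PB3_T4_kernel one_Q)
      then show ?thesis
        using f f' Q3.inv_solve_right'[of "\<one>\<^bsub>Q3\<^esub>"] by simp
    qed
    also have "\<dots> = T3 N1 m1' (F2_emb f1') (F2_emb f2')"
      by (simp only: shadow_cong(3)[OF 1 f'(1) s1])
    finally have "pi3 (F2_emb (F2_endo m1 f1 f2)) = pi3 (F2_emb (F2_endo m1' f1' f2'))"
      using f f' by (simp add: T3_emb[OF HOL.refl f] P1'.T3_emb[OF HOL.refl f'])
    moreover have "pi3 (F2_emb f1) = pi3 (F2_emb f1')" using s1 by (simp add: shadow_eq_iff pi3_def)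
    ultimately have "pi3 (F2_emb (f1 \<otimes>\<^bsub>F2\<^esub> F2_endo m1 f1 f2)) = pi3 (F2_emb (f1' \<otimes>\<^bsub>F2\<^esub> F2_endo m1' f1' f2'))"
      using f f' by (simp add: emb_mult)
    then show ?thesis using m by (simp add: shadow_eq_iff pi3_def)
  qed
  show ?thesis unfolding shadow_comp_def
  proof (rule the_equality)
    show "\<forall>m1' m2'. \<forall>f1'\<in>carrier F2. \<forall>f2'\<in>carrier F2. shadow N1 m1 f1 = shadow N1 m1' f1' \<longrightarrow>
       shadow N2 m2 f2 = shadow N2 m2' f2' \<longrightarrow>
       shadow N1 (2 * m1 * m2 + m1 + m2) (f1 \<otimes>\<^bsub>F2\<^esub> F2_endo m1 f1 f2)
       = shadow N1 (2 * m1' * m2' + m1' + m2') (f1' \<otimes>\<^bsub>F2\<^esub> F2_endo m1' f1' f2')"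
      using key by blast
    show "t = shadow N1 (2 * m1 * m2 + m1 + m2) (f1 \<otimes>\<^bsub>F2\<^esub> F2_endo m1 f1 f2)"
      if "\<forall>m1' m2'. \<forall>f1'\<in>carrier F2. \<forall>f2'\<in>carrier F2. shadow N1 m1 f1 = shadow N1 m1' f1' \<longrightarrow>
       shadow N2 m2 f2 = shadow N2 m2' f2' \<longrightarrow>
       t = shadow N1 (2 * m1' * m2' + m1' + m2') (f1' \<otimes>\<^bsub>F2\<^esub> F2_endo m1' f1' f2')" for t
      using that f by blast
  qed
qed


lemma gt_pair_id: "N \<in> NFI_PB4 \<Longrightarrow> gt_pair N 0 \<one>\<^bsub>B 3\<^esub>"
proof
  assume N: "N \<in> NFI_PB4"
  interpret Q: group "B 3 Mod N_PB3 N" by (rule FIN_group[OF N_PB3_FIN[OF N]])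
  have 1: "N_PB3 N #>\<^bsub>B 3\<^esub> \<one>\<^bsub>B 3\<^esub> = \<one>\<^bsub>B 3 Mod N_PB3 N\<^esub>"
    using B.coset_mult_one[OF subgroup.subset[OF N_PB3_facts(2)[OF N]]] by (simp add: one_FactGroup)
  have c: "N_PB3 N #>\<^bsub>B 3\<^esub> s \<in> carrier (B 3 Mod N_PB3 N)" if "s \<in> carrier (B 3)" for s
    using that by (auto simp: carrier_FactGroup)
  have ft: "full_twist (B 3 Mod N_PB3 N) x y \<in> carrier (B 3 Mod N_PB3 N)"
    if "x \<in> carrier (B 3 Mod N_PB3 N)" "y \<in> carrier (B 3 Mod N_PB3 N)" for x y
    using that by (simp add: full_twist_def)
  show "hexagons (B 3 Mod N_PB3 N) (N_PB3 N #>\<^bsub>B 3\<^esub> sigma 3 1) (N_PB3 N #>\<^bsub>B 3\<^esub> sigma 3 2) 0 (N_PB3 N #>\<^bsub>B 3\<^esub> \<one>\<^bsub>B 3\<^esub>)"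
    using c[of "sigma 3 1"] c[of "sigma 3 2"] unfolding 1 by (simp add: hexagons_def ft)
  have f: "face F \<one>\<^bsub>B 3\<^esub> = \<one>\<^bsub>B 4\<^esub>" for F using face.hom_one[of F] by simp
  show "N #>\<^bsub>B 4\<^esub> (face F234 \<one>\<^bsub>B 3\<^esub> \<otimes>\<^bsub>B 4\<^esub> face F1_23_4 \<one>\<^bsub>B 3\<^esub> \<otimes>\<^bsub>B 4\<^esub> face F123 \<one>\<^bsub>B 3\<^esub>)
      = N #>\<^bsub>B 4\<^esub> (face F1_2_34 \<one>\<^bsub>B 3\<^esub> \<otimes>\<^bsub>B 4\<^esub> face F12_3_4 \<one>\<^bsub>B 3\<^esub>)"
    by (simp add: f)
qed auto

lemma
  assumes N: "N \<in> NFI_PB4"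
  shows T3_id: "w \<in> carrier (B 3) \<Longrightarrow> T3 N 0 \<one>\<^bsub>B 3\<^esub> w = N_PB3 N #>\<^bsub>B 3\<^esub> w"
    and T4_kernel_id: "T4_kernel N 0 \<one>\<^bsub>B 3\<^esub> = N"
proof -
  interpret gt_pair N 0 "\<one>\<^bsub>B 3\<^esub>" by (rule gt_pair_id[OF N])
  have f: "face F \<one>\<^bsub>B 3\<^esub> = \<one>\<^bsub>B 4\<^esub>" for F using face.hom_one[of F] by simp
  have T3: "T3 N 0 \<one>\<^bsub>B 3\<^esub> w = pi3 w" if "w \<in> carrier (B 3)" for w
  proof (rule hom_eq_on_generate[OF group_B Q3.is_group T3_hom p3.homh])
    show "w \<in> generate (B 3) {sigma 3 1, sigma 3 2}" using that generate_B3 by simp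
    show "T3 N 0 \<one>\<^bsub>B 3\<^esub> x = pi3 x" if "x \<in> {sigma 3 1, sigma 3 2}" for x
      using that by (auto simp: T3_sigma ab'_eq simp del: p3.hom_one) (simp_all add: p3.hom_one)
  qed simp
  then show "w \<in> carrier (B 3) \<Longrightarrow> T3 N 0 \<one>\<^bsub>B 3\<^esub> w = N_PB3 N #>\<^bsub>B 3\<^esub> w" by (simp add: pi3_def)
  have T4: "T4 N 0 \<one>\<^bsub>B 3\<^esub> w = pi4 w" if "w \<in> carrier (B 4)" for w
  proof (rule hom_eq_on_generate[OF group_B Q4.is_group T4_hom p4.homh])
    show "w \<in> generate (B 4) {sigma 4 1, sigma 4 2, sigma 4 3}" using that generate_B4 by simp
    have "A1 = pi4 (sigma 4 1)" "A2 = pi4 (sigma 4 2)" "A3 = pi4 (sigma 4 3)"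
      by (simp_all add: A1_def A2_def A3_def f)
    then show "T4 N 0 \<one>\<^bsub>B 3\<^esub> x = pi4 x" if "x \<in> {sigma 4 1, sigma 4 2, sigma 4 3}" for x
      using that by (auto simp: T4_sigma)
  qed simp
  show "T4_kernel N 0 \<one>\<^bsub>B 3\<^esub> = N"
  proof -
    have "T4 N 0 \<one>\<^bsub>B 3\<^esub> w = N \<longleftrightarrow> w \<in> N" if "w \<in> carrier (PB 4)" for w
      using PB_in_B[OF that] by (simp add: T4 pi4_one_iff)
    then show ?thesis using N_facts(4) unfolding T4_kernel_def by blast
  qed
qed

lemma emb_one: "F2_emb \<one>\<^bsub>F2\<^esub> = \<one>\<^bsub>B 3\<^esub>"
  using emb.hom_one by simp

lemma T3_onto_id: "N \<in> NFI_PB4 \<Longrightarrow> T3_onto N 0 \<one>\<^bsub>B 3\<^esub>"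
  using T3_id PB_in_B unfolding T3_onto_def by blast

lemma unit_mod_id: "unit_mod N 0"
  unfolding unit_mod_def by (intro exI[of _ 1]) simp

lemma unit_mod_compose:
  assumes 1: "gt_pair N m g" "unit_mod N m" and 2: "unit_mod (T4_kernel N m g) n"
  shows "unit_mod N (2 * m * n + m + n)"
proof -
  interpret gt_pair N m g by fact
  let ?M = "int (N_ord N)"
  obtain k where k: "[(2 * m + 1) * k = 1] (mod ?M)" using 1 by (auto simp: unit_mod_def)
  obtain j where j: "[(2 * n + 1) * j = 1] (mod int (N_ord N'))" using 2 by (auto simp: unit_mod_def)
  have "coprime (2 * m + 1) ?M" using k coprime_iff_invertible_int by blast
  \<comment> \<open>In \<open>N_ord_dvd\<close> the factor 2m+1 can be cancelled, being invertible
    modulo \<open>N_ord N\<close>. An inverse of 2n+1 modulo \<open>N_ord N'\<close> is then also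
    one modulo \<open>N_ord N\<close>.\<close>
  then have "?M dvd int (N_ord N')" using N_ord_dvd by (simp add: coprime_commute coprime_dvd_mult_right_iff)
  then have "[(2 * n + 1) * j = 1] (mod ?M)" using j by (rule cong_dvd_modulus[rotated])
  from cong_mult[OF k this] have "[(2 * m + 1) * (2 * n + 1) * (k * j) = 1] (mod ?M)"
    by (simp add: algebra_simps)
  moreover have "(2 * m + 1) * (2 * n + 1) = 2 * (2 * m * n + m + n) + 1" by (simp add: algebra_simps)
  ultimately show ?thesis unfolding unit_mod_def by metis
qed

lemma (in gt_pair_comp) T3_onto_compose:
  assumes "T3_onto N m g" "T3_onto N' n h"
  shows "T3_onto N l (g \<otimes>\<^bsub>B 3\<^esub> e')"
  unfolding T3_onto_def
proof
  fix u assume "u \<in> carrier (PB 3)"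
  then obtain v where v: "v \<in> carrier (PB 3)" "T3 N m g v = K #>\<^bsub>B 3\<^esub> u"
    using assms(1) by (auto simp: T3_onto_def)
  then obtain w where w: "w \<in> carrier (PB 3)" "T3 N' n h w = P2.pi3 v"
    using assms(2) by (auto simp: T3_onto_def P2.pi3_def)
  then have "T3 N l (g \<otimes>\<^bsub>B 3\<^esub> e') w = K #>\<^bsub>B 3\<^esub> u"
    using T3_compose[of w v] v by (simp add: PB_in_B)
  then show "\<exists>w\<in>carrier (PB 3). T3 N l (g \<otimes>\<^bsub>B 3\<^esub> e') w = K #>\<^bsub>B 3\<^esub> u" using w by blast
qed

lemma Hom_GTSh_E:
  assumes "N1 \<in> NFI_PB4" "s \<in> Hom GTSh N2 N1"
  obtains m f where "s = shadow N1 m f" "f \<in> carrier F2" "gt_pair N1 m (F2_emb f)" "unit_mod N1 m"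
    "T3_onto N1 m (F2_emb f)" "N2 = T4_kernel N1 m (F2_emb f)"
proof -
  have s: "s \<in> GT N1" "shadow_source N1 s = N2" using assms(2) by (auto simp: GTSh_def)
  from GT_E[OF assms(1) s(1)] obtain m f where mf: "s = shadow N1 m f" "f \<in> carrier F2" "gt_pair N1 m (F2_emb f)"
    "unit_mod N1 m" "T3_onto N1 m (F2_emb f)" .
  moreover have "N2 = T4_kernel N1 m (F2_emb f)" using shadow_source_eq[OF mf(3,2)] s mf by simp
  ultimately show thesis by (rule that)
qed

lemma Hom_GTSh_I:
  assumes "N \<in> NFI_PB4" "f \<in> carrier F2" "gt_pair N m (F2_emb f)" "unit_mod N m" "T3_onto N m (F2_emb f)"
  shows "shadow N m f \<in> Hom GTSh (T4_kernel N m (F2_emb f)) N"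
  using GT_I[OF assms] shadow_source_eq[OF assms(3,2)] by (simp add: GTSh_def)

lemma Comp_GTSh: "Comp GTSh N3 N2 N1 s1 s2 = shadow_comp N2 N1 s1 s2"
  and Id_GTSh: "Id GTSh N = shadow N 0 \<one>\<^bsub>F2\<^esub>" and Obj_GTSh: "Obj GTSh = NFI_PB4"
  by (simp_all add: GTSh_def)

lemma gt_pair_id': "N \<in> NFI_PB4 \<Longrightarrow> gt_pair N 0 (F2_emb \<one>\<^bsub>F2\<^esub>)"
  by (simp add: emb_one gt_pair_id)

lemma comp_closed:
  assumes "N1 \<in> NFI_PB4" and 1: "f1 \<in> carrier F2" "gt_pair N1 m1 (F2_emb f1)" "unit_mod N1 m1" "T3_onto N1 m1 (F2_emb f1)"
    and 2: "f2 \<in> carrier F2" "gt_pair (T4_kernel N1 m1 (F2_emb f1)) m2 (F2_emb f2)"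
      "unit_mod (T4_kernel N1 m1 (F2_emb f1)) m2" "T3_onto (T4_kernel N1 m1 (F2_emb f1)) m2 (F2_emb f2)"
  defines "f \<equiv> f1 \<otimes>\<^bsub>F2\<^esub> F2_endo m1 f1 f2" and "m \<equiv> 2 * m1 * m2 + m1 + m2"
  shows "f \<in> carrier F2" "gt_pair N1 m (F2_emb f)" "unit_mod N1 m" "T3_onto N1 m (F2_emb f)"
    "T4_kernel N1 m (F2_emb f) = T4_kernel (T4_kernel N1 m1 (F2_emb f1)) m2 (F2_emb f2)"
proof -
  interpret gt_pair_comp N1 m1 "F2_emb f1" m2 "F2_emb f2" "F2_emb (F2_endo m1 f1 f2)"
    by (rule gt_pair_comp_emb[OF 1(2,1) 2(1,2)])
  have f: "F2_emb f = F2_emb f1 \<otimes>\<^bsub>B 3\<^esub> F2_emb (F2_endo m1 f1 f2)"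
    using 1 2 by (simp add: f_def emb_mult)
  show "f \<in> carrier F2" using 1 2 by (simp add: f_def)
  show "gt_pair N1 m (F2_emb f)" unfolding f m_def by (rule gt_pair_compose)
  show "unit_mod N1 m" unfolding m_def by (rule unit_mod_compose[OF 1(2,3) 2(3)])
  show "T3_onto N1 m (F2_emb f)" unfolding f m_def by (rule T3_onto_compose[OF 1(4) 2(4)])
  show "T4_kernel N1 m (F2_emb f) = T4_kernel (T4_kernel N1 m1 (F2_emb f1)) m2 (F2_emb f2)"
    unfolding f m_def by (rule T4_kernel_compose)
qed

theorem category_GTSh: "category GTSh"
proof
  fix N :: "nat word set set" assume "N \<in> Obj GTSh"
  then have N: "N \<in> NFI_PB4" by (simp add: Obj_GTSh)
  show "Id GTSh N \<in> Hom GTSh N N"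
    using Hom_GTSh_I[OF N _ gt_pair_id'[OF N] unit_mod_id] T3_onto_id[OF N] T4_kernel_id[OF N]
    by (simp add: Id_GTSh emb_one)
next
  fix a b c f g assume "a \<in> Obj GTSh" "b \<in> Obj GTSh" "c \<in> Obj GTSh" and fg: "f \<in> Hom GTSh a b" "g \<in> Hom GTSh b c"
  then have N: "a \<in> NFI_PB4" "b \<in> NFI_PB4" "c \<in> NFI_PB4" by (auto simp: Obj_GTSh)
  obtain m1 f1 where 1: "g = shadow c m1 f1" "f1 \<in> carrier F2" "gt_pair c m1 (F2_emb f1)" "unit_mod c m1"
    "T3_onto c m1 (F2_emb f1)" "b = T4_kernel c m1 (F2_emb f1)" using Hom_GTSh_E[OF N(3) fg(2)] .
  obtain m2 f2 where 2: "f = shadow b m2 f2" "f2 \<in> carrier F2" "gt_pair b m2 (F2_emb f2)" "unit_mod b m2"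
    "T3_onto b m2 (F2_emb f2)" "a = T4_kernel b m2 (F2_emb f2)" using Hom_GTSh_E[OF N(2) fg(1)] .
  note cc = comp_closed[OF N(3) 1(2-5) 2(2-5)[unfolded 1(6)]]
  show "Comp GTSh a b c g f \<in> Hom GTSh a c"
    unfolding Comp_GTSh 1(1) 2(1) shadow_comp_eq[OF 1(3,2) 2(2) 1(6) 2(3)]
    using Hom_GTSh_I[OF N(3) cc(1-4)] cc(5) 1(6) 2(6) by simp
next
  fix a b f assume "a \<in> Obj GTSh" "b \<in> Obj GTSh" and f: "f \<in> Hom GTSh a b"
  then have N: "a \<in> NFI_PB4" "b \<in> NFI_PB4" by (auto simp: Obj_GTSh)
  obtain m1 f1 where 1: "f = shadow b m1 f1" "f1 \<in> carrier F2" "gt_pair b m1 (F2_emb f1)" "unit_mod b m1"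
    "T3_onto b m1 (F2_emb f1)" "a = T4_kernel b m1 (F2_emb f1)" using Hom_GTSh_E[OF N(2) f] .
  show "Comp GTSh a a b f (Id GTSh a) = f"
    unfolding Comp_GTSh Id_GTSh 1(1) shadow_comp_eq[OF 1(3,2) F2.one_closed 1(6) gt_pair_id'[OF N(1)]]
    using 1(2) by (simp add: F2_endo_one)
  have "b = T4_kernel b 0 (F2_emb \<one>\<^bsub>F2\<^esub>)" by (simp add: emb_one T4_kernel_id[OF N(2)])
  from shadow_comp_eq[OF gt_pair_id'[OF N(2)] F2.one_closed 1(2) this 1(3)]
  show "Comp GTSh a b b (Id GTSh b) f = f"
    unfolding Comp_GTSh Id_GTSh 1(1) using 1(2) by (simp add: F2_endo_id)
next
  fix a b c d f g h
  assume "a \<in> Obj GTSh" "b \<in> Obj GTSh" "c \<in> Obj GTSh" "d \<in> Obj GTSh"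
    and fgh: "f \<in> Hom GTSh a b" "g \<in> Hom GTSh b c" "h \<in> Hom GTSh c d"
  then have N: "a \<in> NFI_PB4" "b \<in> NFI_PB4" "c \<in> NFI_PB4" "d \<in> NFI_PB4" by (auto simp: Obj_GTSh)
  obtain m1 f1 where 1: "h = shadow d m1 f1" "f1 \<in> carrier F2" "gt_pair d m1 (F2_emb f1)" "unit_mod d m1"
    "T3_onto d m1 (F2_emb f1)" "c = T4_kernel d m1 (F2_emb f1)" using Hom_GTSh_E[OF N(4) fgh(3)] .
  obtain m2 f2 where 2: "g = shadow c m2 f2" "f2 \<in> carrier F2" "gt_pair c m2 (F2_emb f2)" "unit_mod c m2"
    "T3_onto c m2 (F2_emb f2)" "b = T4_kernel c m2 (F2_emb f2)" using Hom_GTSh_E[OF N(3) fgh(2)] .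
  obtain m3 f3 where 3: "f = shadow b m3 f3" "f3 \<in> carrier F2" "gt_pair b m3 (F2_emb f3)" "unit_mod b m3"
    "T3_onto b m3 (F2_emb f3)" "a = T4_kernel b m3 (F2_emb f3)" using Hom_GTSh_E[OF N(2) fgh(1)] .
  note c12 = comp_closed[OF N(4) 1(2-5) 2(2-5)[unfolded 1(6)]]
  note c23 = comp_closed[OF N(3) 2(2-5) 3(2-5)[unfolded 2(6)]]
  have b: "b = T4_kernel d (2 * m1 * m2 + m1 + m2) (F2_emb (f1 \<otimes>\<^bsub>F2\<^esub> F2_endo m1 f1 f2))"
    using c12(5) 1(6) 2(6) by simp
  show "Comp GTSh a c d h (Comp GTSh a b c g f) = Comp GTSh a b d (Comp GTSh b c d h g) f"
    unfolding Comp_GTSh 1(1) 2(1) 3(1)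
      shadow_comp_eq[OF 1(3,2) 2(2) 1(6) 2(3)] shadow_comp_eq[OF 2(3,2) 3(2) 2(6) 3(3)]
      shadow_comp_eq[OF 1(3,2) c23(1) 1(6) c23(2)] shadow_comp_eq[OF c12(2,1) 3(2) b 3(3)]
  proof -
    have "2 * m1 * (2 * m2 * m3 + m2 + m3) + m1 + (2 * m2 * m3 + m2 + m3)
      = 2 * (2 * m1 * m2 + m1 + m2) * m3 + (2 * m1 * m2 + m1 + m2) + m3"
      by (simp add: algebra_simps)
    moreover have "f1 \<otimes>\<^bsub>F2\<^esub> F2_endo m1 f1 (f2 \<otimes>\<^bsub>F2\<^esub> F2_endo m2 f2 f3)
      = f1 \<otimes>\<^bsub>F2\<^esub> F2_endo m1 f1 f2 \<otimes>\<^bsub>F2\<^esub> F2_endo (2 * m1 * m2 + m1 + m2) (f1 \<otimes>\<^bsub>F2\<^esub> F2_endo m1 f1 f2) f3"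
      using 1(2) 2(2) 3(2) by (simp only: F2_endo_comp F2_endo_mult F2.m_assoc F2_endo_closed F2.m_closed)
    ultimately show "shadow d (2 * m1 * (2 * m2 * m3 + m2 + m3) + m1 + (2 * m2 * m3 + m2 + m3))
        (f1 \<otimes>\<^bsub>F2\<^esub> F2_endo m1 f1 (f2 \<otimes>\<^bsub>F2\<^esub> F2_endo m2 f2 f3))
      = shadow d (2 * (2 * m1 * m2 + m1 + m2) * m3 + (2 * m1 * m2 + m1 + m2) + m3)
        (f1 \<otimes>\<^bsub>F2\<^esub> F2_endo m1 f1 f2 \<otimes>\<^bsub>F2\<^esub> F2_endo (2 * m1 * m2 + m1 + m2) (f1 \<otimes>\<^bsub>F2\<^esub> F2_endo m1 f1 f2) f3)"
      by (simp only:)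
  qed
qed

section \<open>Profinite completions\<close>

locale completion = group G for G (structure)
begin

abbreviation hat where "hat \<equiv> profinite_completion G"

lemma carrier_hat: "carrier hat = {g \<in> (\<Pi>\<^sub>E N\<in>finite_index_normal G. carrier (G Mod N)).
    \<forall>N \<in> finite_index_normal G. \<forall>M \<in> finite_index_normal G. N \<subseteq> M \<longrightarrow> g N \<subseteq> g M}"
  and one_hat: "\<one>\<^bsub>hat\<^esub> = (\<lambda>N\<in>finite_index_normal G. \<one>\<^bsub>G Mod N\<^esub>)"
  and mult_hat: "g \<otimes>\<^bsub>hat\<^esub> h = (\<lambda>N\<in>finite_index_normal G. g N \<otimes>\<^bsub>G Mod N\<^esub> h N)"
  by (simp_all add: profinite_completion_def Let_def)

lemma mult_hat_apply: "N \<in> finite_index_normal G \<Longrightarrow> (g \<otimes>\<^bsub>hat\<^esub> h) N = g N \<otimes>\<^bsub>G Mod N\<^esub> h N"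
  by (simp add: mult_hat)

lemma hat_apply_closed: "g \<in> carrier hat \<Longrightarrow> N \<in> finite_index_normal G \<Longrightarrow> g N \<in> carrier (G Mod N)"
  by (auto simp: carrier_hat PiE_iff)

lemma hat_coset:
  assumes "g \<in> carrier hat" "N \<in> finite_index_normal G"
  obtains w where "w \<in> carrier G" "g N = N #> w"
  using assms by (auto simp: carrier_hat carrier_FactGroup PiE_iff)

lemma coset_mono_eq:
  assumes "N \<in> finite_index_normal G" "M \<in> finite_index_normal G" "w \<in> carrier G" "v \<in> carrier G" "N #> w \<subseteq> M #> v"
  shows "M #> v = M #> w"
  using repr_independence[of w M v] assms FIN_subgroup rcos_self by blast

lemma hat_compat:
  assumes "g \<in> carrier hat" "N \<in> finite_index_normal G" "M \<in> finite_index_normal G" "N \<subseteq> M"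
    "w \<in> carrier G" "g N = N #> w"
  shows "g M = M #> w"
proof -
  obtain v where "v \<in> carrier G" "g M = M #> v" using hat_coset assms by blast
  moreover have "g N \<subseteq> g M" using assms(1-4) unfolding carrier_hat by blast
  ultimately show ?thesis using coset_mono_eq[of N M w v] assms by simp
qed

lemma coset_mono: "N \<subseteq> M \<Longrightarrow> N #> w \<subseteq> M #> w"
  by (auto simp: r_coset_def)

text \<open>Compatibility of coordinates is checked by naming one group element that represents both
  of them.\<close>

lemma hatI:
  assumes "g \<in> extensional (finite_index_normal G)"
    and "\<And>N. N \<in> finite_index_normal G \<Longrightarrow> g N \<in> carrier (G Mod N)"
    and "\<And>N M. N \<in> finite_index_normal G \<Longrightarrow> M \<in> finite_index_normal G \<Longrightarrow> N \<subseteq> M \<Longrightarrow>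
      \<exists>w\<in>carrier G. g N = N #> w \<and> g M = M #> w"
  shows "g \<in> carrier hat"
proof -
  have "g N \<subseteq> g M" if "N \<in> finite_index_normal G" "M \<in> finite_index_normal G" "N \<subseteq> M" for N M
    using assms(3)[OF that] coset_mono[OF that(3)] by auto
  then show ?thesis using assms(1,2) by (auto simp: carrier_hat PiE_iff)
qed

lemma hat_eqI:
  assumes "g \<in> carrier hat" "h \<in> carrier hat" "\<And>N. N \<in> finite_index_normal G \<Longrightarrow> g N = h N"
  shows "g = h"
  by (rule extensionalityI[of _ "finite_index_normal G"]) (use assms in \<open>auto simp: carrier_hat PiE_iff\<close>)

lemma coset_mult: "N \<in> finite_index_normal G \<Longrightarrow> u \<in> carrier G \<Longrightarrow> v \<in> carrier G \<Longrightarrow>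
    (N #> u) \<otimes>\<^bsub>G Mod N\<^esub> (N #> v) = N #> (u \<otimes> v)"
  using hom_mult[OF rcos_hom[OF FIN_normal]] by metis

lemma coset_carrier: "u \<in> carrier G \<Longrightarrow> N #> u \<in> carrier (G Mod N)"
  by (auto simp: carrier_FactGroup)

lemma coset_hom: "N \<in> finite_index_normal G \<Longrightarrow> group_hom G (G Mod N) (\<lambda>u. N #> u)"
  by (simp add: group_hom_def group_hom_axioms_def is_group FIN_group rcos_hom FIN_normal)

lemma coset_inv: "N \<in> finite_index_normal G \<Longrightarrow> u \<in> carrier G \<Longrightarrow> inv\<^bsub>G Mod N\<^esub> (N #> u) = N #> inv u"
  using group_hom.hom_inv[OF coset_hom] by metis

lemma coset_int_pow: "N \<in> finite_index_normal G \<Longrightarrow> u \<in> carrier G \<Longrightarrow> (N #> u) [^]\<^bsub>G Mod N\<^esub> (k::int) = N #> (u [^] k)"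
  using group_hom.hom_int_pow[OF coset_hom] by metis

lemma coset_one: "N \<in> finite_index_normal G \<Longrightarrow> N #> \<one> = \<one>\<^bsub>G Mod N\<^esub>"
  using coset_mult_one[OF subgroup.subset[OF FIN_subgroup]] by (simp add: one_FactGroup)

lemma hat_mult_closed:
  assumes "g \<in> carrier hat" "h \<in> carrier hat"
  shows "g \<otimes>\<^bsub>hat\<^esub> h \<in> carrier hat"
proof (rule hatI)
  show "g \<otimes>\<^bsub>hat\<^esub> h \<in> extensional (finite_index_normal G)" by (simp add: mult_hat)
  show "(g \<otimes>\<^bsub>hat\<^esub> h) N \<in> carrier (G Mod N)" if N: "N \<in> finite_index_normal G" for N
    using hat_coset[OF assms(1) N] hat_coset[OF assms(2) N] N
    by (metis coset_carrier coset_mult m_closed mult_hat_apply)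
  fix N M assume NM: "N \<in> finite_index_normal G" "M \<in> finite_index_normal G" "N \<subseteq> M"
  obtain u where u: "u \<in> carrier G" "g N = N #> u" by (rule hat_coset[OF assms(1) NM(1)])
  obtain v where v: "v \<in> carrier G" "h N = N #> v" by (rule hat_coset[OF assms(2) NM(1)])
  show "\<exists>w\<in>carrier G. (g \<otimes>\<^bsub>hat\<^esub> h) N = N #> w \<and> (g \<otimes>\<^bsub>hat\<^esub> h) M = M #> w"
    using hat_compat[OF assms(1) NM u] hat_compat[OF assms(2) NM v] u v NM
    by (intro bexI[of _ "u \<otimes> v"]) (simp_all add: mult_hat_apply coset_mult)
qed

lemma hat_one_closed: "\<one>\<^bsub>hat\<^esub> \<in> carrier hat"
proof (rule hatI)
  fix N M assume "N \<in> finite_index_normal G" "M \<in> finite_index_normal G"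
  then show "\<exists>w\<in>carrier G. \<one>\<^bsub>hat\<^esub> N = N #> w \<and> \<one>\<^bsub>hat\<^esub> M = M #> w"
    by (intro bexI[of _ \<one>]) (simp_all add: one_hat coset_one)
qed (simp_all add: one_hat FIN_group group.is_monoid monoid.one_closed)

lemma hat_inv_ex:
  assumes "g \<in> carrier hat"
  defines "h \<equiv> \<lambda>N\<in>finite_index_normal G. inv\<^bsub>G Mod N\<^esub> g N"
  shows "h \<in> carrier hat" "h \<otimes>\<^bsub>hat\<^esub> g = \<one>\<^bsub>hat\<^esub>"
proof -
  show "h \<in> carrier hat"
  proof (rule hatI)
    show "h N \<in> carrier (G Mod N)" if N: "N \<in> finite_index_normal G" for N
      using N group.inv_closed[OF FIN_group[OF N] hat_apply_closed[OF assms(1) N]] by (simp add: h_def)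
    fix N M assume NM: "N \<in> finite_index_normal G" "M \<in> finite_index_normal G" "N \<subseteq> M"
    obtain u where u: "u \<in> carrier G" "g N = N #> u" by (rule hat_coset[OF assms(1) NM(1)])
    show "\<exists>w\<in>carrier G. h N = N #> w \<and> h M = M #> w"
      using hat_compat[OF assms(1) NM u] u NM
      by (intro bexI[of _ "inv u"]) (simp_all add: h_def coset_inv)
  qed (simp add: h_def)
  then show "h \<otimes>\<^bsub>hat\<^esub> g = \<one>\<^bsub>hat\<^esub>"
  proof (intro hat_eqI hat_mult_closed hat_one_closed assms(1))
    fix N assume N: "N \<in> finite_index_normal G"
    obtain u where u: "u \<in> carrier G" "g N = N #> u" by (rule hat_coset[OF assms(1) N])
    then show "(h \<otimes>\<^bsub>hat\<^esub> g) N = \<one>\<^bsub>hat\<^esub> N"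
      using N by (simp add: mult_hat_apply h_def coset_inv coset_mult one_hat coset_one)
  qed
qed

lemma group_hat: "group hat"
proof (rule groupI)
  fix x y z assume xyz: "x \<in> carrier hat" "y \<in> carrier hat" "z \<in> carrier hat"
  show "x \<otimes>\<^bsub>hat\<^esub> y \<otimes>\<^bsub>hat\<^esub> z = x \<otimes>\<^bsub>hat\<^esub> (y \<otimes>\<^bsub>hat\<^esub> z)"
  proof (rule hat_eqI)
    fix N assume N: "N \<in> finite_index_normal G"
    then show "(x \<otimes>\<^bsub>hat\<^esub> y \<otimes>\<^bsub>hat\<^esub> z) N = (x \<otimes>\<^bsub>hat\<^esub> (y \<otimes>\<^bsub>hat\<^esub> z)) N"
      using xyz monoid.m_assoc[OF group.is_monoid[OF FIN_group[OF N]]] by (simp add: mult_hat_apply hat_apply_closed)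
  qed (use xyz in \<open>simp_all add: hat_mult_closed\<close>)
next
  fix x assume x: "x \<in> carrier hat"
  show "\<one>\<^bsub>hat\<^esub> \<otimes>\<^bsub>hat\<^esub> x = x"
  proof (rule hat_eqI[OF hat_mult_closed[OF hat_one_closed x] x])
    fix N assume N: "N \<in> finite_index_normal G"
    then have "x N \<in> carrier (G Mod N)" by (rule hat_apply_closed[OF x])
    then show "(\<one>\<^bsub>hat\<^esub> \<otimes>\<^bsub>hat\<^esub> x) N = x N"
      using N FIN_group[THEN group.is_monoid, THEN monoid.l_one, OF N] by (simp add: mult_hat_apply one_hat)
  qed
  show "\<exists>y\<in>carrier hat. y \<otimes>\<^bsub>hat\<^esub> x = \<one>\<^bsub>hat\<^esub>" using hat_inv_ex[OF x] by blast
qed (auto intro: hat_mult_closed hat_one_closed)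

sublocale H: group hat by (rule group_hat)

lemma hat_eval_hom: "N \<in> finite_index_normal G \<Longrightarrow> group_hom hat (G Mod N) (\<lambda>g. g N)"
  by (auto simp: group_hom_def group_hom_axioms_def group_hat FIN_group carrier_hat mult_hat_apply intro!: homI)

lemma hat_inv_apply: "N \<in> finite_index_normal G \<Longrightarrow> g \<in> carrier hat \<Longrightarrow> (inv\<^bsub>hat\<^esub> g) N = inv\<^bsub>G Mod N\<^esub> g N"
  using group_hom.hom_inv[OF hat_eval_hom] by metis

lemma to_completion_apply: "N \<in> finite_index_normal G \<Longrightarrow> to_completion G w N = N #> w"
  by (simp add: to_completion_def)

lemma to_completion_closed: "w \<in> carrier G \<Longrightarrow> to_completion G w \<in> carrier hat"
  by (rule hatI) (auto simp: to_completion_def coset_carrier)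

lemma to_completion_hom: "to_completion G \<in> hom G hat"
proof (rule homI)
  fix u v assume uv: "u \<in> carrier G" "v \<in> carrier G"
  show "to_completion G (u \<otimes> v) = to_completion G u \<otimes>\<^bsub>hat\<^esub> to_completion G v"
    by (rule hat_eqI)
      (use uv in \<open>auto simp: to_completion_closed hat_mult_closed to_completion_apply mult_hat_apply coset_mult\<close>)
qed (rule to_completion_closed)

lemma coset_pow_cong:
  assumes "N \<in> finite_index_normal G" "w \<in> carrier G" "[k = k'] (mod int (order (G Mod N)))"
  shows "N #> w [^] k = N #> w [^] k'"
proof -
  interpret Q: group "G Mod N" by (rule FIN_group[OF assms(1)])
  have "(N #> w) [^]\<^bsub>G Mod N\<^esub> k = (N #> w) [^]\<^bsub>G Mod N\<^esub> k'"
  proof (subst Q.int_pow_eq[OF coset_carrier[OF assms(2)]])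
    have "int (Q.ord (N #> w)) dvd int (order (G Mod N))"
      using Q.ord_dvd_group_order[OF coset_carrier[OF assms(2)]] by simp
    then show "int (Q.ord (N #> w)) dvd k' - k"
      using assms(3) by (meson cong_iff_dvd_diff cong_sym dvd_trans)
  qed
  then show ?thesis using assms by (simp add: coset_int_pow)
qed

lemma order_pos: "N \<in> finite_index_normal G \<Longrightarrow> order (G Mod N) \<ge> 1"
  using FIN_finite[of N G] group.is_monoid[OF FIN_group, of N G] monoid.order_gt_0_iff_finite[of "G Mod N"]
  by (simp add: Suc_le_eq One_nat_def)

lemma FIN_carrier: "carrier G \<in> finite_index_normal G"
proof -
  have "{x \<in> carrier G. (\<lambda>x. ()) x = \<one>\<^bsub>\<lparr>carrier = {()}, mult = (\<lambda>_ _. ()), one = ()\<rparr>\<^esub>} \<in> finite_index_normal G"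
    by (rule FIN_kernel) (auto intro!: groupI homI is_group)
  then show ?thesis by simp
qed

text \<open>The intersection with the carrier covers the empty family, where it gives the whole
  group.\<close>

lemma FIN_INT:
  assumes "finite I" "\<And>i. i \<in> I \<Longrightarrow> X i \<in> finite_index_normal G"
  shows "carrier G \<inter> (\<Inter>i\<in>I. X i) \<in> finite_index_normal G"
  using assms
proof induct
  case (insert i I)
  have "carrier G \<inter> (\<Inter>i\<in>insert i I. X i) = X i \<inter> (carrier G \<inter> (\<Inter>i\<in>I. X i))" by blast
  then show ?case using insert FIN_Int[OF is_group, of "X i"] by simp
qed (simp add: FIN_carrier)

text \<open>A basic open set restricts finitely many coordinates. A representative of
  \<open>g\<close> at the intersection of the corresponding subgroups approximates \<open>g\<close>
  at all of them at once.\<close>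

lemma hat_dense:
  assumes U: "openin (profinite_topology G) U" and g: "g \<in> U"
  obtains w where "w \<in> carrier G" "to_completion G w \<in> U"
proof -
  let ?F = "finite_index_normal G" and ?T = "\<lambda>N. discrete_topology (carrier (G Mod N))"
  obtain V where V: "openin (product_topology ?T ?F) V" "U = V \<inter> carrier hat"
    using U by (auto simp: profinite_topology_def openin_subtopology)
  then obtain X where X: "finite {i \<in> ?F. X i \<noteq> topspace (?T i)}" "g \<in> Pi\<^sub>E ?F X" "Pi\<^sub>E ?F X \<subseteq> V"
    using g V by (auto simp: openin_product_topology_alt)
  let ?I = "{i \<in> ?F. X i \<noteq> topspace (?T i)}"
  let ?M = "carrier G \<inter> (\<Inter>i\<in>?I. i)"
  have M: "?M \<in> ?F" by (rule FIN_INT[OF X(1)]) auto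
  have gh: "g \<in> carrier hat" using g V by blast
  obtain w where w: "w \<in> carrier G" "g ?M = ?M #> w" by (rule hat_coset[OF gh M])
  have "to_completion G w i \<in> X i" if i: "i \<in> ?F" for i
  proof (cases "i \<in> ?I")
    case True
    then have "g i = i #> w" using hat_compat[OF gh M i _ w] by blast
    then show ?thesis using PiE_mem[OF X(2) i] i by (simp add: to_completion_apply)
  next
    case False
    then show ?thesis using i w by (simp add: to_completion_apply coset_carrier)
  qed
  then have "to_completion G w \<in> Pi\<^sub>E ?F X" by (auto simp: to_completion_def)
  then show thesis using that w X(3) V(2) to_completion_closed by blast
qed

lemma topspace_profinite [simp]: "topspace (profinite_topology G) = carrier hat"
proof -
  have "carrier hat \<subseteq> (\<Pi>\<^sub>E N\<in>finite_index_normal G. carrier (G Mod N))" by (simp add: carrier_hat)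
  then show ?thesis by (simp add: profinite_topology_def Int_absorb1)
qed

lemma eval_continuous:
  "N \<in> finite_index_normal G \<Longrightarrow> continuous_map (profinite_topology G) (discrete_topology (carrier (G Mod N))) (\<lambda>g. g N)"
  unfolding profinite_topology_def by (intro continuous_map_from_subtopology continuous_map_product_projection)

end

section \<open>Maps induced on completions\<close>

locale completion_hom = G: completion G + H: completion H for G H +
  fixes h assumes h: "h \<in> hom G H"
begin

lemma vimage_FIN: "M \<in> finite_index_normal H \<Longrightarrow> {a \<in> carrier G. h a \<in> M} \<in> finite_index_normal G"
  by (rule FIN_vimage[OF G.is_group H.is_group h])

text \<open>The union in \<open>completion_map\<close> runs over a coset of the preimage of
  \<open>M\<close>, and on such a coset the class of \<open>h a\<close> modulo \<open>M\<close> is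
  constant.\<close>

lemma completion_map_apply:
  assumes M: "M \<in> finite_index_normal H" and w: "w \<in> carrier G" "g {a \<in> carrier G. h a \<in> M} = {a \<in> carrier G. h a \<in> M} #>\<^bsub>G\<^esub> w"
  shows "completion_map G H h g M = M #>\<^bsub>H\<^esub> h w"
proof -
  let ?L = "{a \<in> carrier G. h a \<in> M}"
  interpret h: group_hom G H h using h by unfold_locales
  have "M #>\<^bsub>H\<^esub> h a = M #>\<^bsub>H\<^esub> h w" if a: "a \<in> ?L #>\<^bsub>G\<^esub> w" for a
  proof -
    obtain l where l: "l \<in> ?L" "a = l \<otimes>\<^bsub>G\<^esub> w" using a by (auto simp: r_coset_def)
    then show ?thesis using w by (subst H.rcos_eq_iff[OF FIN_subgroup[OF M]]) (auto simp: H.m_assoc)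
  qed
  moreover have "w \<in> ?L #>\<^bsub>G\<^esub> w" by (rule G.rcos_self[OF w(1) FIN_subgroup[OF vimage_FIN[OF M]]])
  ultimately have "(\<Union>a\<in>?L #>\<^bsub>G\<^esub> w. M #>\<^bsub>H\<^esub> h a) = M #>\<^bsub>H\<^esub> h w" by blast
  then show ?thesis using M w by (simp add: completion_map_def)
qed

lemma completion_map_closed:
  assumes g: "g \<in> carrier G.hat"
  shows "completion_map G H h g \<in> carrier H.hat"
proof (rule H.hatI)
  show "completion_map G H h g \<in> extensional (finite_index_normal H)" by (simp add: completion_map_def)
  have hc: "h w \<in> carrier H" if "w \<in> carrier G" for w using that h by (auto simp: hom_def)
  show "completion_map G H h g M \<in> carrier (H Mod M)" if M: "M \<in> finite_index_normal H" for M
  proof -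
    obtain w where w: "w \<in> carrier G" "g {a \<in> carrier G. h a \<in> M} = {a \<in> carrier G. h a \<in> M} #>\<^bsub>G\<^esub> w"
      by (rule G.hat_coset[OF g vimage_FIN[OF M]])
    show ?thesis using completion_map_apply[of M w g] M w hc[OF w(1)] H.coset_carrier by simp
  qed
  fix N M assume NM: "N \<in> finite_index_normal H" "M \<in> finite_index_normal H" "N \<subseteq> M"
  obtain w where w: "w \<in> carrier G" "g {a \<in> carrier G. h a \<in> N} = {a \<in> carrier G. h a \<in> N} #>\<^bsub>G\<^esub> w"
    by (rule G.hat_coset[OF g vimage_FIN[OF NM(1)]])
  have "g {a \<in> carrier G. h a \<in> M} = {a \<in> carrier G. h a \<in> M} #>\<^bsub>G\<^esub> w"
    using G.hat_compat[of g "{a \<in> carrier G. h a \<in> N}" "{a \<in> carrier G. h a \<in> M}" w] g vimage_FIN NM w by blast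
  then show "\<exists>w\<in>carrier H. completion_map G H h g N = N #>\<^bsub>H\<^esub> w \<and> completion_map G H h g M = M #>\<^bsub>H\<^esub> w"
    using completion_map_apply[of N w g] completion_map_apply[of M w g] NM(1,2) w hc[OF w(1)] by blast
qed

text \<open>A representative found at any level inside the preimage of \<open>M\<close> will do, so
  one level can serve several maps, for instance all five faces.\<close>

lemma completion_map_deep:
  assumes g: "g \<in> carrier G.hat" and M: "M \<in> finite_index_normal H"
    and L: "L \<in> finite_index_normal G" "L \<subseteq> {a \<in> carrier G. h a \<in> M}" and w: "w \<in> carrier G" "g L = L #>\<^bsub>G\<^esub> w"
  shows "completion_map G H h g M = M #>\<^bsub>H\<^esub> h w"
  using completion_map_apply[of M w g] G.hat_compat[of g L "{a \<in> carrier G. h a \<in> M}" w] g M L w vimage_FIN by blast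

end

section \<open>Profinite integers\<close>

lemma Zhat_mod:
  assumes "a \<in> Zhat" "m \<ge> 1" "n \<ge> 1" "m dvd n"
  shows "[a n = a m] (mod int m)"
proof -
  have "a n mod int m = a m" using assms by (auto simp: Zhat_def)
  then show ?thesis by (metis cong_mod_left cong_refl)
qed

lemma Zhat_of_residues:
  assumes "\<And>m n. m \<ge> 1 \<Longrightarrow> n \<ge> 1 \<Longrightarrow> m dvd n \<Longrightarrow> [a n = a m] (mod int m)"
  shows "Zhat_of_residues a \<in> Zhat"
proof -
  have "a n mod int n mod int m = a m mod int m" if "m \<ge> 1" "n \<ge> 1" "m dvd n" for m n
    using assms[OF that] that(3) by (simp add: mod_mod_cancel cong_def)
  then show ?thesis by (auto simp: Zhat_def Zhat_of_residues_def carrier_integer_mod_group)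
qed

lemma Zhat_of_residues_cong: "n \<ge> 1 \<Longrightarrow> [Zhat_of_residues a n = a n] (mod int n)"
  by (simp add: Zhat_of_residues_def cong_def)

lemma Zhat_eqI:
  assumes "a \<in> Zhat" "b \<in> Zhat" "\<And>n. n \<ge> 1 \<Longrightarrow> [a n = b n] (mod int n)"
  shows "a = b"
proof (rule extensionalityI[of _ "{1..}"])
  show "a \<in> extensional {1..}" "b \<in> extensional {1..}" using assms by (auto simp: Zhat_def PiE_iff)
  fix n :: nat assume n: "n \<in> {1..}"
  then have "a n mod int n = a n" "b n mod int n = b n" using assms(1,2) by (auto simp: Zhat_def)
  then show "a n = b n" using assms(3)[of n] n by (simp add: cong_def)
qed

section \<open>The endomorphism of the completed free group attached to a pair\<close>

interpretation cF2: completion F2 by unfold_locales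
interpretation cB: completion "B n" for n by unfold_locales
interpretation cPB: completion "PB n" for n by unfold_locales

abbreviation F2_hat where "F2_hat \<equiv> profinite_completion F2"
abbreviation FIN_F2 where "FIN_F2 \<equiv> finite_index_normal F2"
abbreviation ordF where "ordF L \<equiv> order (F2 Mod L)"
abbreviation endo_vimage where "endo_vimage k f L \<equiv> {a \<in> carrier F2. F2_endo k f a \<in> L}"

lemma completion_hom_endo: "f \<in> carrier F2 \<Longrightarrow> completion_hom F2 F2 (F2_endo k f)"
  by (simp add: completion_hom_def completion_hom_axioms_def completion_def group_F2 F2_endo)

lemma endo_vimage_FIN: "f \<in> carrier F2 \<Longrightarrow> L \<in> FIN_F2 \<Longrightarrow> endo_vimage k f L \<in> FIN_F2"
  by (rule FIN_vimage[OF group_F2 group_F2 F2_endo(1)])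

text \<open>Modulo \<open>L\<close> only the class of \<open>f\<close> and the exponent modulo the
  order of the quotient are visible. This is what lets profinite data define an endomorphism level
  by level.\<close>

lemma F2_endo_coset_cong:
  assumes L: "L \<in> FIN_F2" and f: "f \<in> carrier F2" "f' \<in> carrier F2" "L #>\<^bsub>F2\<^esub> f = L #>\<^bsub>F2\<^esub> f'"
    and k: "[k = k'] (mod int (ordF L))" and w: "w \<in> carrier F2"
  shows "L #>\<^bsub>F2\<^esub> F2_endo k f w = L #>\<^bsub>F2\<^esub> F2_endo k' f' w"
proof (rule F2_hom_eq[OF FIN_group[OF L] _ _ _ _ w])
  interpret Q: group_hom F2 "F2 Mod L" "\<lambda>u. L #>\<^bsub>F2\<^esub> u" by (rule cF2.coset_hom[OF L])
  have k': "[2 * k + 1 = 2 * k' + 1] (mod int (ordF L))" using k by (intro cong_add cong_mult cong_refl)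
  show "(\<lambda>w. L #>\<^bsub>F2\<^esub> F2_endo k f w) \<in> hom F2 (F2 Mod L)" "(\<lambda>w. L #>\<^bsub>F2\<^esub> F2_endo k' f' w) \<in> hom F2 (F2 Mod L)"
    using hom_compose[OF F2_endo(1)[OF f(1)] Q.homh] hom_compose[OF F2_endo(1)[OF f(2)] Q.homh] by (simp_all add: comp_def)
  show "L #>\<^bsub>F2\<^esub> F2_endo k f F2_x = L #>\<^bsub>F2\<^esub> F2_endo k' f' F2_x"
    using f by (simp add: F2_endo cF2.coset_pow_cong[OF L _ k'])
  show "L #>\<^bsub>F2\<^esub> F2_endo k f F2_y = L #>\<^bsub>F2\<^esub> F2_endo k' f' F2_y"
    using f by (simp add: F2_endo cF2.coset_pow_cong[OF L _ k'])
qed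

lemma endo_vimage_cong:
  assumes "L \<in> FIN_F2" "f \<in> carrier F2" "f' \<in> carrier F2" "L #>\<^bsub>F2\<^esub> f = L #>\<^bsub>F2\<^esub> f'" "[k = k'] (mod int (ordF L))"
  shows "endo_vimage k f L = endo_vimage k' f' L"
proof -
  have "F2_endo k f w \<in> L \<longleftrightarrow> F2_endo k' f' w \<in> L" if w: "w \<in> carrier F2" for w
    using F2_endo_coset_cong[OF assms w] F2.rcos_eq_self_iff[OF FIN_subgroup[OF assms(1)]] assms w
    by (metis F2_endo_closed)
  then show ?thesis by blast
qed

text \<open>An explicit candidate for \<open>hat_endo\<close>: at level \<open>L\<close> the
  profinite pair is replaced by an integer and a free group element that represent it there.\<close>

definition endo_hat :: "hat_pair \<Rightarrow> (nat word set set \<Rightarrow> nat word set set) \<Rightarrow> nat word set set \<Rightarrow> nat word set set" where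
  "endo_hat T g = (\<lambda>L\<in>FIN_F2.
    completion_map F2 F2 (F2_endo (fst T (ordF L)) (SOME f. f \<in> snd T L)) g L)"

definition represents :: "hat_pair \<Rightarrow> nat word set set \<Rightarrow> int \<Rightarrow> nat word set \<Rightarrow> bool" where
  "represents T L k f \<longleftrightarrow> f \<in> carrier F2 \<and> snd T L = L #>\<^bsub>F2\<^esub> f \<and> [k = fst T (ordF L)] (mod int (ordF L))"

abbreviation pairs_hat where "pairs_hat \<equiv> Zhat \<times> carrier F2_hat"

lemma represents_ex:
  assumes T: "T \<in> pairs_hat" and L: "L \<in> FIN_F2"
  obtains f where "represents T L (fst T (ordF L)) f"
proof -
  have "snd T \<in> carrier F2_hat" using T by auto
  then obtain f where "f \<in> carrier F2" "snd T L = L #>\<^bsub>F2\<^esub> f" using L by (rule cF2.hat_coset)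
  then show thesis using that by (simp add: represents_def)
qed

lemma mult_ge_one: "(a::nat) \<ge> 1 \<Longrightarrow> b \<ge> 1 \<Longrightarrow> a * b \<ge> 1"
  using mult_le_mono[of 1 a 1 b] by simp

lemma represents_mono:
  assumes T: "T \<in> pairs_hat" and LM: "L \<in> FIN_F2" "M \<in> FIN_F2" "L \<subseteq> M"
  obtains k f where "represents T L k f" "represents T M k f"
proof -
  have T': "snd T \<in> carrier F2_hat" "fst T \<in> Zhat" using T by auto
  obtain f where f: "f \<in> carrier F2" "snd T L = L #>\<^bsub>F2\<^esub> f" using T'(1) LM(1) by (rule cF2.hat_coset)
  \<comment> \<open>At a common multiple of the two orders, the profinite integer has an entry with
    the right residue for both levels.\<close>
  let ?n = "ordF L * ordF M"
  have pos: "ordF L \<ge> 1" "ordF M \<ge> 1" "?n \<ge> 1" using LM cF2.order_pos mult_ge_one by blast+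
  have "[fst T ?n = fst T (ordF L)] (mod int (ordF L))" "[fst T ?n = fst T (ordF M)] (mod int (ordF M))"
    using pos by (auto intro!: Zhat_mod[OF T'(2)])
  moreover have "snd T M = M #>\<^bsub>F2\<^esub> f" by (rule cF2.hat_compat[OF T'(1) LM f])
  ultimately show thesis using that[of "fst T ?n" f] f by (simp add: represents_def)
qed

lemma endo_hat_apply:
  assumes L: "L \<in> FIN_F2" and T: "represents T L k f"
    and w: "w \<in> carrier F2" "g (endo_vimage k f L) = endo_vimage k f L #>\<^bsub>F2\<^esub> w"
  shows "endo_hat T g L = L #>\<^bsub>F2\<^esub> F2_endo k f w"
proof -
  let ?k = "fst T (ordF L)" and ?f = "SOME f. f \<in> snd T L"
  have f: "f \<in> carrier F2" "snd T L = L #>\<^bsub>F2\<^esub> f" "[k = ?k] (mod int (ordF L))"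
    using T by (auto simp: represents_def)
  have "f \<in> snd T L" using F2.rcos_self[OF f(1) FIN_subgroup[OF L]] f(2) by simp
  then have "?f \<in> L #>\<^bsub>F2\<^esub> f" using f(2) someI[of "\<lambda>f. f \<in> snd T L" f] by simp
  then have f': "?f \<in> carrier F2" "L #>\<^bsub>F2\<^esub> f = L #>\<^bsub>F2\<^esub> ?f"
    using F2.repr_independence[OF _ f(1) FIN_subgroup[OF L], of ?f]
      F2.r_coset_subset_G[OF subgroup.subset[OF FIN_subgroup[OF L]] f(1)] by blast+
  note * = L f(1) f' f(3)
  have "endo_hat T g L = completion_map F2 F2 (F2_endo ?k ?f) g L" using L by (simp add: endo_hat_def)
  also have "\<dots> = L #>\<^bsub>F2\<^esub> F2_endo ?k ?f w"
    by (rule completion_hom.completion_map_apply[OF completion_hom_endo[OF f'(1)] L w(1)])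
      (use w(2) endo_vimage_cong[OF *] in simp)
  also have "\<dots> = L #>\<^bsub>F2\<^esub> F2_endo k f w" by (rule F2_endo_coset_cong[OF * w(1), symmetric])
  finally show ?thesis .
qed

lemma endo_hat_closed:
  assumes T: "T \<in> pairs_hat" and g: "g \<in> carrier F2_hat"
  shows "endo_hat T g \<in> carrier F2_hat"
proof (rule cF2.hatI)
  have *: "\<exists>w\<in>carrier F2. endo_hat T g N = N #>\<^bsub>F2\<^esub> w \<and> endo_hat T g M = M #>\<^bsub>F2\<^esub> w"
    if NM: "N \<in> FIN_F2" "M \<in> FIN_F2" "N \<subseteq> M" for N M
  proof -
    obtain k f where kf: "represents T N k f" "represents T M k f" using represents_mono[OF T NM] by blast
    then have f: "f \<in> carrier F2" by (simp add: represents_def)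
    obtain w where w: "w \<in> carrier F2" "g (endo_vimage k f N) = endo_vimage k f N #>\<^bsub>F2\<^esub> w"
      by (rule cF2.hat_coset[OF g endo_vimage_FIN[OF f NM(1)]])
    have "endo_vimage k f N \<subseteq> endo_vimage k f M" using NM(3) by blast
    then have "g (endo_vimage k f M) = endo_vimage k f M #>\<^bsub>F2\<^esub> w"
      using cF2.hat_compat[OF g endo_vimage_FIN[OF f NM(1)] endo_vimage_FIN[OF f NM(2)] _ w] by blast
    then show ?thesis
      using endo_hat_apply[of N T k f w g] endo_hat_apply[of M T k f w g] NM kf w f by blast
  qed
  show "\<And>N M. N \<in> FIN_F2 \<Longrightarrow> M \<in> FIN_F2 \<Longrightarrow> N \<subseteq> M \<Longrightarrow>
      \<exists>w\<in>carrier F2. endo_hat T g N = N #>\<^bsub>F2\<^esub> w \<and> endo_hat T g M = M #>\<^bsub>F2\<^esub> w" by (rule *)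
  show "endo_hat T g N \<in> carrier (F2 Mod N)" if "N \<in> FIN_F2" for N
    using *[OF that that] cF2.coset_carrier by fastforce
qed (simp add: endo_hat_def)

lemma endo_hat_mult:
  assumes T: "T \<in> pairs_hat" and g: "g \<in> carrier F2_hat" "h \<in> carrier F2_hat"
  shows "endo_hat T (g \<otimes>\<^bsub>F2_hat\<^esub> h) = endo_hat T g \<otimes>\<^bsub>F2_hat\<^esub> endo_hat T h"
proof (rule cF2.hat_eqI)
  fix L assume L: "L \<in> FIN_F2"
  obtain f where T': "represents T L (fst T (ordF L)) f" using represents_ex[OF T L] .
  then have f: "f \<in> carrier F2" by (simp add: represents_def)
  let ?k = "fst T (ordF L)"
  let ?L = "endo_vimage ?k f L"
  note L' = endo_vimage_FIN[OF f L]
  obtain u where u: "u \<in> carrier F2" "g ?L = ?L #>\<^bsub>F2\<^esub> u" by (rule cF2.hat_coset[OF g(1) L'])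
  obtain v where v: "v \<in> carrier F2" "h ?L = ?L #>\<^bsub>F2\<^esub> v" by (rule cF2.hat_coset[OF g(2) L'])
  have "(g \<otimes>\<^bsub>F2_hat\<^esub> h) ?L = ?L #>\<^bsub>F2\<^esub> (u \<otimes>\<^bsub>F2\<^esub> v)"
    using u v L' by (simp add: cF2.mult_hat_apply cF2.coset_mult)
  then have "endo_hat T (g \<otimes>\<^bsub>F2_hat\<^esub> h) L = L #>\<^bsub>F2\<^esub> F2_endo ?k f (u \<otimes>\<^bsub>F2\<^esub> v)"
    using endo_hat_apply[OF L T', of "u \<otimes>\<^bsub>F2\<^esub> v" "g \<otimes>\<^bsub>F2_hat\<^esub> h"] u v by blast
  moreover have "endo_hat T g L = L #>\<^bsub>F2\<^esub> F2_endo ?k f u" "endo_hat T h L = L #>\<^bsub>F2\<^esub> F2_endo ?k f v"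
    using endo_hat_apply[OF L T', of u g] endo_hat_apply[OF L T', of v h] u v by blast+
  ultimately show "endo_hat T (g \<otimes>\<^bsub>F2_hat\<^esub> h) L = (endo_hat T g \<otimes>\<^bsub>F2_hat\<^esub> endo_hat T h) L"
    using L f u v by (simp add: cF2.mult_hat_apply cF2.coset_mult F2_endo_mult)
qed (use T g in \<open>simp_all add: endo_hat_closed cF2.hat_mult_closed\<close>)

text \<open>Each coordinate of the image depends on one coordinate of the argument, namely the one
  at the preimage of \<open>L\<close> under an approximating endomorphism. So it factors through a
  map of discrete spaces.\<close>

lemma endo_hat_continuous:
  assumes T: "T \<in> pairs_hat"
  shows "continuous_map (profinite_topology F2) (profinite_topology F2) (endo_hat T)"
  unfolding profinite_topology_def[of F2] continuous_map_in_subtopology continuous_map_componentwise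
  unfolding profinite_topology_def[symmetric] cF2.topspace_profinite
proof (intro conjI ballI)
  show "endo_hat T ` carrier F2_hat \<subseteq> extensional FIN_F2" by (auto simp: endo_hat_def)
  show "endo_hat T \<in> carrier F2_hat \<rightarrow> carrier F2_hat" using endo_hat_closed[OF T] by blast
  fix L assume L: "L \<in> FIN_F2"
  obtain f where T': "represents T L (fst T (ordF L)) f" using represents_ex[OF T L] .
  then have f: "f \<in> carrier F2" by (simp add: represents_def)
  let ?k = "fst T (ordF L)"
  let ?L = "endo_vimage ?k f L"
  let ?\<phi> = "\<lambda>C. L #>\<^bsub>F2\<^esub> F2_endo ?k f (SOME w. w \<in> carrier F2 \<and> C = ?L #>\<^bsub>F2\<^esub> w)"
  have \<phi>: "?\<phi> \<in> carrier (F2 Mod ?L) \<rightarrow> carrier (F2 Mod L)" 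
    "\<And>g. g \<in> carrier F2_hat \<Longrightarrow> ?\<phi> (g ?L) = endo_hat T g L"
  proof -
    have *: "(SOME w. w \<in> carrier F2 \<and> C = ?L #>\<^bsub>F2\<^esub> w) \<in> carrier F2 \<and> C = ?L #>\<^bsub>F2\<^esub> (SOME w. w \<in> carrier F2 \<and> C = ?L #>\<^bsub>F2\<^esub> w)"
      if "C \<in> carrier (F2 Mod ?L)" for C
      by (rule someI_ex) (use that in \<open>auto simp: carrier_FactGroup\<close>)
    show "?\<phi> \<in> carrier (F2 Mod ?L) \<rightarrow> carrier (F2 Mod L)" using * f by (intro Pi_I cF2.coset_carrier F2_endo_closed) blast+
    fix g assume "g \<in> carrier F2_hat"
    then have "g ?L \<in> carrier (F2 Mod ?L)" by (rule cF2.hat_apply_closed[OF _ endo_vimage_FIN[OF f L]])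
    from *[OF this] show "?\<phi> (g ?L) = endo_hat T g L"
      by (intro endo_hat_apply[OF L T', symmetric]) blast+
  qed
  have "continuous_map (profinite_topology F2) (discrete_topology (carrier (F2 Mod L))) (?\<phi> \<circ> (\<lambda>g. g ?L))"
    by (rule continuous_map_compose[OF cF2.eval_continuous[OF endo_vimage_FIN[OF f L]]]) (use \<phi>(1) in simp)
  then show "continuous_map (profinite_topology F2) (discrete_topology (carrier (F2 Mod L))) (\<lambda>g. endo_hat T g L)"
    by (rule continuous_map_eq) (simp add: \<phi>(2))
qed

lemma completion_pow_apply:
  assumes "group G" "N \<in> finite_index_normal G" "w \<in> carrier G" "g N = N #>\<^bsub>G\<^esub> w"
  shows "completion_pow G g a N = N #>\<^bsub>G\<^esub> (w [^]\<^bsub>G\<^esub> a (order (G Mod N)))"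
proof -
  interpret completion G using assms(1) by (simp add: completion_def)
  show ?thesis using assms by (simp add: completion_pow_def coset_int_pow)
qed

lemma completion_pow_closed:
  assumes "group G" "w \<in> carrier G" and a: "\<And>m n. m \<ge> 1 \<Longrightarrow> n \<ge> 1 \<Longrightarrow> m dvd n \<Longrightarrow> [a n = a m] (mod int m)"
  shows "completion_pow G (to_completion G w) a \<in> carrier (profinite_completion G)"
proof -
  interpret completion G using assms(1) by (simp add: completion_def)
  have ap: "completion_pow G (to_completion G w) a N = N #>\<^bsub>G\<^esub> (w [^]\<^bsub>G\<^esub> a (order (G Mod N)))" if "N \<in> finite_index_normal G" for N
    by (rule completion_pow_apply) (use that assms to_completion_apply in auto)
  show ?thesis
  proof (rule hatI)
    show "completion_pow G (to_completion G w) a \<in> extensional (finite_index_normal G)" by (simp add: completion_pow_def)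
    show "completion_pow G (to_completion G w) a N \<in> carrier (G Mod N)" if "N \<in> finite_index_normal G" for N
      using ap[OF that] assms(2) coset_carrier by simp
    fix N M assume NM: "N \<in> finite_index_normal G" "M \<in> finite_index_normal G" "N \<subseteq> M"
    let ?n = "order (G Mod N) * order (G Mod M)"
    have pos: "order (G Mod N) \<ge> 1" "order (G Mod M) \<ge> 1" "?n \<ge> 1" using NM order_pos mult_ge_one by blast+
    have "[a (order (G Mod N)) = a ?n] (mod int (order (G Mod N)))" "[a (order (G Mod M)) = a ?n] (mod int (order (G Mod M)))"
      using pos by (auto intro!: cong_sym[OF a])
    then have "completion_pow G (to_completion G w) a N = N #>\<^bsub>G\<^esub> w [^]\<^bsub>G\<^esub> a ?n" "completion_pow G (to_completion G w) a M = M #>\<^bsub>G\<^esub> w [^]\<^bsub>G\<^esub> a ?n"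
      using ap coset_pow_cong[of _ w] NM assms(2) by metis+
    then show "\<exists>v\<in>carrier G. completion_pow G (to_completion G w) a N = N #>\<^bsub>G\<^esub> v \<and> completion_pow G (to_completion G w) a M = M #>\<^bsub>G\<^esub> v"
      using assms(2) by blast
  qed
qed

text \<open>Near \<open>g\<close> both maps have constant coordinate at \<open>L\<close>, so by
  density some element of F_2 has the same coordinates as \<open>g\<close> under both. On F_2 the
  maps agree because they agree at x and y.\<close>

lemma hat_hom_eq:
  assumes "E \<in> hom F2_hat F2_hat" "E' \<in> hom F2_hat F2_hat"
    and c: "continuous_map (profinite_topology F2) (profinite_topology F2) E"
      "continuous_map (profinite_topology F2) (profinite_topology F2) E'"
    and xy: "E (to_completion F2 F2_x) = E' (to_completion F2 F2_x)" "E (to_completion F2 F2_y) = E' (to_completion F2 F2_y)"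
    and g: "g \<in> carrier F2_hat"
  shows "E g = E' g"
proof (rule cF2.hat_eqI)
  show cl: "E g \<in> carrier F2_hat" "E' g \<in> carrier F2_hat" using assms by (auto simp: hom_def)
  fix L assume L: "L \<in> FIN_F2"
  note D = cF2.eval_continuous[OF L]
  have "openin (profinite_topology F2) {h \<in> carrier F2_hat. E h L = E g L}"
    using openin_continuous_map_preimage[OF continuous_map_compose[OF c(1) D], of "{E g L}"]
      cF2.hat_apply_closed[OF cl(1) L] by simp
  moreover have "openin (profinite_topology F2) {h \<in> carrier F2_hat. E' h L = E' g L}"
    using openin_continuous_map_preimage[OF continuous_map_compose[OF c(2) D], of "{E' g L}"]
      cF2.hat_apply_closed[OF cl(2) L] by simp
  ultimately have "openin (profinite_topology F2) ({h \<in> carrier F2_hat. E h L = E g L} \<inter> {h \<in> carrier F2_hat. E' h L = E' g L})"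
    by (rule openin_Int)
  then obtain w where w: "w \<in> carrier F2" "to_completion F2 w \<in> {h \<in> carrier F2_hat. E h L = E g L} \<inter> {h \<in> carrier F2_hat. E' h L = E' g L}"
    using cF2.hat_dense[of _ g] g by blast
  then have w': "E (to_completion F2 w) L = E g L" "E' (to_completion F2 w) L = E' g L" by blast+
  have "(E \<circ> to_completion F2) w = (E' \<circ> to_completion F2) w"
    by (rule F2_hom_eq[OF cF2.group_hat hom_compose[OF cF2.to_completion_hom] hom_compose[OF cF2.to_completion_hom]])
      (use assms w in auto)
  then show "E g L = E' g L" using w' by simp
qed

text \<open>\<open>endo_hat\<close> provides existence for the description in
  \<open>hat_endo\<close>, and \<open>hat_hom_eq\<close> provides uniqueness.\<close>

lemma hat_endo_eq:
  assumes T: "T \<in> pairs_hat"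
  shows "hat_endo T = restrict (endo_hat T) (carrier F2_hat)"
proof -
  let ?x = "to_completion F2 F2_x" and ?y = "to_completion F2 F2_y"
  let ?a = "Zhat_of_residues (\<lambda>n. 2 * fst T n + 1)"
  let ?E = "restrict (endo_hat T) (carrier F2_hat)"
  let ?P = "\<lambda>E. E \<in> hom F2_hat F2_hat \<and> E \<in> extensional (carrier F2_hat) \<and>
          continuous_map (profinite_topology F2) (profinite_topology F2) E \<and>
          E ?x = completion_pow F2 ?x ?a \<and>
          E ?y = inv\<^bsub>F2_hat\<^esub> snd T \<otimes>\<^bsub>F2_hat\<^esub> completion_pow F2 ?y ?a \<otimes>\<^bsub>F2_hat\<^esub> snd T"
  have T': "snd T \<in> carrier F2_hat" "fst T \<in> Zhat" using T by auto
  have xy: "?x \<in> carrier F2_hat" "?y \<in> carrier F2_hat" by (simp_all add: cF2.to_completion_closed)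
  have a: "[?a n = ?a m] (mod int m)" if "m \<ge> 1" "n \<ge> 1" "m dvd n" for m n
  proof -
    have "?a \<in> Zhat" by (rule Zhat_of_residues) (intro cong_add cong_mult cong_refl Zhat_mod[OF T'(2)])
    then show ?thesis using that by (rule Zhat_mod)
  qed
  have pow: "completion_pow F2 (to_completion F2 w) ?a L = L #>\<^bsub>F2\<^esub> (w [^]\<^bsub>F2\<^esub> (2 * fst T (ordF L) + 1))"
    if "w \<in> carrier F2" "L \<in> FIN_F2" for w L
  proof -
    have "[?a (ordF L) = 2 * fst T (ordF L) + 1] (mod int (ordF L))"
      by (rule Zhat_of_residues_cong) (rule cF2.order_pos[OF that(2)])
    then show ?thesis
      using completion_pow_apply[OF group_F2 that(2,1), of "to_completion F2 w" ?a] cF2.to_completion_apply[OF that(2)]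
        cF2.coset_pow_cong[OF that(2,1)] by simp
  qed
  have "?E \<in> hom F2_hat F2_hat"
    by (rule homI) (use T in \<open>simp_all add: endo_hat_closed endo_hat_mult cF2.hat_mult_closed\<close>)
  moreover have "continuous_map (profinite_topology F2) (profinite_topology F2) ?E"
    by (subst restrict_continuous_map) (simp_all add: endo_hat_continuous[OF T])
  moreover have "?E ?x = completion_pow F2 ?x ?a"
  proof (rule cF2.hat_eqI)
    fix L assume L: "L \<in> FIN_F2"
    obtain f where f: "represents T L (fst T (ordF L)) f" using represents_ex[OF T L] .
    then have "f \<in> carrier F2" by (simp add: represents_def)
    then show "?E ?x L = completion_pow F2 ?x ?a L"
      using endo_hat_apply[OF L f F2_gens(1), of ?x] cF2.to_completion_apply[OF endo_vimage_FIN[OF _ L]] pow[OF _ L] xy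
      by (simp add: F2_endo)
  qed (use xy T a in \<open>simp_all add: endo_hat_closed completion_pow_closed[OF group_F2]\<close>)
  moreover have "?E ?y = inv\<^bsub>F2_hat\<^esub> snd T \<otimes>\<^bsub>F2_hat\<^esub> completion_pow F2 ?y ?a \<otimes>\<^bsub>F2_hat\<^esub> snd T"
  proof (rule cF2.hat_eqI)
    fix L assume L: "L \<in> FIN_F2"
    obtain f where f: "represents T L (fst T (ordF L)) f" using represents_ex[OF T L] .
    then have f': "f \<in> carrier F2" "snd T L = L #>\<^bsub>F2\<^esub> f" by (simp_all add: represents_def)
    then have "?E ?y L = L #>\<^bsub>F2\<^esub> F2_endo (fst T (ordF L)) f F2_y"
      using endo_hat_apply[OF L f F2_gens(2), of ?y] cF2.to_completion_apply[OF endo_vimage_FIN[OF _ L]] xy by simp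
    also have "\<dots> = (inv\<^bsub>F2_hat\<^esub> snd T \<otimes>\<^bsub>F2_hat\<^esub> completion_pow F2 ?y ?a \<otimes>\<^bsub>F2_hat\<^esub> snd T) L"
      using f' L T'(1) by (simp add: F2_endo cF2.mult_hat_apply cF2.hat_inv_apply pow cF2.coset_mult cF2.coset_inv)
    finally show "?E ?y L = (inv\<^bsub>F2_hat\<^esub> snd T \<otimes>\<^bsub>F2_hat\<^esub> completion_pow F2 ?y ?a \<otimes>\<^bsub>F2_hat\<^esub> snd T) L" .
  qed (use xy T T' a in \<open>simp_all add: endo_hat_closed completion_pow_closed[OF group_F2] cF2.hat_mult_closed\<close>)
  ultimately have P: "?P ?E" by simp
  have "(THE E. ?P E) = ?E"
  proof (rule the_equality[where P = ?P, OF P])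
    fix E assume E: "?P E"
    show "E = ?E"
    proof (rule extensionalityI[of _ "carrier F2_hat"])
      show "E x = ?E x" if "x \<in> carrier F2_hat" for x
      proof (rule hat_hom_eq[OF _ _ _ _ _ _ that])
        show "E (to_completion F2 F2_x) = ?E (to_completion F2 F2_x)" "E (to_completion F2 F2_y) = ?E (to_completion F2 F2_y)"
          using P[THEN conjunct2, THEN conjunct2, THEN conjunct2] E[THEN conjunct2, THEN conjunct2, THEN conjunct2] by metis+
      qed (use P E in blast)+
    qed (use E in simp_all)
  qed
  then show ?thesis by (simp add: hat_endo_def Let_def)
qed

lemma hat_endo_closed: "T \<in> pairs_hat \<Longrightarrow> g \<in> carrier F2_hat \<Longrightarrow> hat_endo T g \<in> carrier F2_hat"
  by (simp add: hat_endo_eq endo_hat_closed)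

lemma hat_endo_mult: "T \<in> pairs_hat \<Longrightarrow> g \<in> carrier F2_hat \<Longrightarrow> h \<in> carrier F2_hat \<Longrightarrow>
    hat_endo T (g \<otimes>\<^bsub>F2_hat\<^esub> h) = hat_endo T g \<otimes>\<^bsub>F2_hat\<^esub> hat_endo T h"
  by (simp add: hat_endo_eq endo_hat_mult cF2.hat_mult_closed)

lemma hat_endo_apply:
  assumes "T \<in> pairs_hat" "g \<in> carrier F2_hat" "L \<in> FIN_F2" "represents T L k f" "w \<in> carrier F2"
    "g (endo_vimage k f L) = endo_vimage k f L #>\<^bsub>F2\<^esub> w"
  shows "hat_endo T g L = L #>\<^bsub>F2\<^esub> F2_endo k f w"
  using assms endo_hat_apply by (simp add: hat_endo_eq)

section \<open>Multiplication of profinite pairs\<close>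

definition pair_mult :: "hat_pair \<Rightarrow> hat_pair \<Rightarrow> hat_pair" where
  "pair_mult T1 T2 = (Zhat_of_residues (\<lambda>n. 2 * fst T1 n * fst T2 n + fst T1 n + fst T2 n),
         snd T1 \<otimes>\<^bsub>F2_hat\<^esub> hat_endo T1 (snd T2))"

definition pair_one :: hat_pair where
  "pair_one = (Zhat_of_residues (\<lambda>n. 0), \<one>\<^bsub>F2_hat\<^esub>)"

lemma pair_mult_closed:
  assumes "T1 \<in> pairs_hat" "T2 \<in> pairs_hat"
  shows "pair_mult T1 T2 \<in> pairs_hat"
proof -
  have Z: "fst T1 \<in> Zhat" "fst T2 \<in> Zhat" using assms by auto
  have "fst (pair_mult T1 T2) \<in> Zhat" unfolding pair_mult_def fst_conv
    by (rule Zhat_of_residues) (intro cong_add cong_mult cong_refl Zhat_mod[OF Z(1)] Zhat_mod[OF Z(2)])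
  moreover have "snd (pair_mult T1 T2) \<in> carrier F2_hat"
    using assms by (auto simp: pair_mult_def intro!: cF2.hat_mult_closed hat_endo_closed)
  ultimately show ?thesis by (simp add: mem_Times_iff)
qed

lemma pair_one_closed: "pair_one \<in> pairs_hat"
  by (auto simp: pair_one_def cF2.hat_one_closed intro!: Zhat_of_residues)

lemma fst_pair_mult: "n \<ge> 1 \<Longrightarrow> [fst (pair_mult T1 T2) n = 2 * fst T1 n * fst T2 n + fst T1 n + fst T2 n] (mod int n)"
  unfolding pair_mult_def fst_conv by (rule Zhat_of_residues_cong)

lemma fst_pair_one: "n \<ge> 1 \<Longrightarrow> [fst pair_one n = 0] (mod int n)"
  unfolding pair_one_def fst_conv by (rule Zhat_of_residues_cong)

lemma represents_pair_mult:
  assumes T: "T1 \<in> pairs_hat" "T2 \<in> pairs_hat" and L: "L \<in> FIN_F2"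
  obtains k1 f1 k2 f2 where "represents T1 L k1 f1" "represents T2 (endo_vimage k1 f1 L) k2 f2"
    "represents (pair_mult T1 T2) L (2 * k1 * k2 + k1 + k2) (f1 \<otimes>\<^bsub>F2\<^esub> F2_endo k1 f1 f2)"
proof -
  have T': "snd T2 \<in> carrier F2_hat" "fst T2 \<in> Zhat" using T by auto
  let ?k1 = "fst T1 (ordF L)"
  obtain f1 where r1: "represents T1 L ?k1 f1" using represents_ex[OF T(1) L] .
  then have f1: "f1 \<in> carrier F2" "snd T1 L = L #>\<^bsub>F2\<^esub> f1" by (simp_all add: represents_def)
  let ?L = "endo_vimage ?k1 f1 L"
  note L' = endo_vimage_FIN[OF f1(1) L]
  obtain f2 where f2: "f2 \<in> carrier F2" "snd T2 ?L = ?L #>\<^bsub>F2\<^esub> f2" using T'(1) L' by (rule cF2.hat_coset)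
  \<comment> \<open>The second exponent must be right modulo the order at \<open>?L\<close>, where
    the second pair is read, and modulo the order at \<open>L\<close>, where the composite is
    read.\<close>
  let ?n = "ordF L * ordF ?L"
  let ?k2 = "fst T2 ?n"
  have pos: "ordF L \<ge> 1" "ordF ?L \<ge> 1" "?n \<ge> 1" using cF2.order_pos[OF L'] cF2.order_pos[OF L] mult_ge_one by blast+
  have k2: "[?k2 = fst T2 (ordF L)] (mod int (ordF L))" "[?k2 = fst T2 (ordF ?L)] (mod int (ordF ?L))"
    using pos by (auto intro!: Zhat_mod[OF T'(2)])
  then have r2: "represents T2 ?L ?k2 f2" using f2 by (simp add: represents_def)
  have "hat_endo T1 (snd T2) L = L #>\<^bsub>F2\<^esub> F2_endo ?k1 f1 f2" by (rule hat_endo_apply[OF T(1) T'(1) L r1 f2])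
  then have s: "snd (pair_mult T1 T2) L = L #>\<^bsub>F2\<^esub> (f1 \<otimes>\<^bsub>F2\<^esub> F2_endo ?k1 f1 f2)"
    using L f1 f2 by (simp add: pair_mult_def cF2.mult_hat_apply cF2.coset_mult)
  have "[2 * ?k1 * ?k2 + ?k1 + ?k2 = fst (pair_mult T1 T2) (ordF L)] (mod int (ordF L))"
    by (rule cong_trans[OF _ cong_sym[OF fst_pair_mult[OF pos(1)]]]) (intro cong_add cong_mult cong_refl k2(1))
  then show thesis using that[OF r1 r2] s f1 f2 by (simp add: represents_def)
qed

text \<open>At each level this is \<open>F2_endo_comp\<close>, since the preimage of
  \<open>L\<close> under the composite is the preimage of its preimage.\<close>

lemma hat_endo_comp:
  assumes T: "T1 \<in> pairs_hat" "T2 \<in> pairs_hat" and g: "g \<in> carrier F2_hat"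
  shows "hat_endo (pair_mult T1 T2) g = hat_endo T1 (hat_endo T2 g)"
proof (rule cF2.hat_eqI)
  fix L assume L: "L \<in> FIN_F2"
  obtain k1 f1 k2 f2 where r: "represents T1 L k1 f1" "represents T2 (endo_vimage k1 f1 L) k2 f2"
    "represents (pair_mult T1 T2) L (2 * k1 * k2 + k1 + k2) (f1 \<otimes>\<^bsub>F2\<^esub> F2_endo k1 f1 f2)"
    using represents_pair_mult[OF T L] .
  then have f: "f1 \<in> carrier F2" "f2 \<in> carrier F2" by (simp_all add: represents_def)
  note L1 = endo_vimage_FIN[OF f(1) L, of k1]
  let ?L2 = "endo_vimage k2 f2 (endo_vimage k1 f1 L)"
  have eq: "endo_vimage (2 * k1 * k2 + k1 + k2) (f1 \<otimes>\<^bsub>F2\<^esub> F2_endo k1 f1 f2) L = ?L2"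
    using f by (auto simp: F2_endo_comp)
  obtain w where w: "w \<in> carrier F2" "g ?L2 = ?L2 #>\<^bsub>F2\<^esub> w" by (rule cF2.hat_coset[OF g endo_vimage_FIN[OF f(2) L1]])
  have "hat_endo T2 g (endo_vimage k1 f1 L) = endo_vimage k1 f1 L #>\<^bsub>F2\<^esub> F2_endo k2 f2 w"
    by (rule hat_endo_apply[OF T(2) g L1 r(2) w])
  then have "hat_endo T1 (hat_endo T2 g) L = L #>\<^bsub>F2\<^esub> F2_endo k1 f1 (F2_endo k2 f2 w)"
    by (rule hat_endo_apply[OF T(1) hat_endo_closed[OF T(2) g] L r(1) F2_endo_closed[OF f(2) w(1)]])
  also have "\<dots> = hat_endo (pair_mult T1 T2) g L"
    using hat_endo_apply[OF pair_mult_closed[OF T] g L r(3) w(1)] w(2) f by (simp add: eq F2_endo_comp w(1))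
  finally show "hat_endo (pair_mult T1 T2) g L = hat_endo T1 (hat_endo T2 g) L" by simp
qed (simp_all add: T g hat_endo_closed pair_mult_closed)

lemma represents_pair_one: "L \<in> FIN_F2 \<Longrightarrow> represents pair_one L 0 \<one>\<^bsub>F2\<^esub>"
  using cong_sym[OF fst_pair_one[OF cF2.order_pos]] by (simp add: represents_def pair_one_def cF2.one_hat cF2.coset_one)

lemma hat_endo_one:
  assumes g: "g \<in> carrier F2_hat"
  shows "hat_endo pair_one g = g"
proof (rule cF2.hat_eqI)
  fix L assume L: "L \<in> FIN_F2"
  have eq: "endo_vimage 0 \<one>\<^bsub>F2\<^esub> L = L"
    using subgroup.subset[OF FIN_subgroup[OF L]] by (auto simp: F2_endo_id)
  obtain w where w: "w \<in> carrier F2" "g L = L #>\<^bsub>F2\<^esub> w" by (rule cF2.hat_coset[OF g L])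
  show "hat_endo pair_one g L = g L"
    using hat_endo_apply[OF pair_one_closed g L represents_pair_one[OF L] w(1)] w by (simp add: eq F2_endo_id)
qed (simp_all add: g hat_endo_closed pair_one_closed)

lemma pair_mult_assoc:
  assumes T: "T1 \<in> pairs_hat" "T2 \<in> pairs_hat" "U \<in> pairs_hat"
  shows "pair_mult (pair_mult T1 T2) U = pair_mult T1 (pair_mult T2 U)"
proof (rule prod_eqI)
  have c: "pair_mult (pair_mult T1 T2) U \<in> pairs_hat" "pair_mult T1 (pair_mult T2 U) \<in> pairs_hat"
    using T by (simp_all add: pair_mult_closed del: mem_Sigma_iff)
  then have Z: "fst (pair_mult (pair_mult T1 T2) U) \<in> Zhat" "fst (pair_mult T1 (pair_mult T2 U)) \<in> Zhat"
    unfolding mem_Times_iff by blast+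
  show "fst (pair_mult (pair_mult T1 T2) U) = fst (pair_mult T1 (pair_mult T2 U))"
  proof (rule Zhat_eqI[OF Z])
    fix n :: nat assume n: "n \<ge> 1"
    let ?a = "fst T1 n" and ?b = "fst T2 n" and ?c = "fst U n"
    let ?ab = "2 * ?a * ?b + ?a + ?b" and ?bc = "2 * ?b * ?c + ?b + ?c"
    have 1: "[fst (pair_mult (pair_mult T1 T2) U) n = 2 * ?ab * ?c + ?ab + ?c] (mod int n)"
      by (rule cong_trans[OF fst_pair_mult[OF n]]) (intro cong_add cong_mult cong_refl fst_pair_mult[OF n])
    have 2: "[fst (pair_mult T1 (pair_mult T2 U)) n = 2 * ?a * ?bc + ?a + ?bc] (mod int n)"
      by (rule cong_trans[OF fst_pair_mult[OF n]]) (intro cong_add cong_mult cong_refl fst_pair_mult[OF n])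
    have 3: "2 * ?ab * ?c + ?ab + ?c = 2 * ?a * ?bc + ?a + ?bc" by (simp add: algebra_simps)
    show "[fst (pair_mult (pair_mult T1 T2) U) n = fst (pair_mult T1 (pair_mult T2 U)) n] (mod int n)"
      by (rule cong_trans[OF 1[unfolded 3] cong_sym[OF 2]])
  qed
  have s: "snd T1 \<in> carrier F2_hat" "snd T2 \<in> carrier F2_hat" "snd U \<in> carrier F2_hat" using T by auto
  note cl = hat_endo_closed[OF T(1) s(2)] hat_endo_closed[OF T(2) s(3)]
  have sm: "snd (pair_mult U V) = snd U \<otimes>\<^bsub>F2_hat\<^esub> hat_endo U (snd V)" for U V by (simp add: pair_mult_def)
  show "snd (pair_mult (pair_mult T1 T2) U) = snd (pair_mult T1 (pair_mult T2 U))"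
    using cF2.H.m_assoc[OF s(1) cl(1) hat_endo_closed[OF T(1) cl(2)]]
    by (simp only: sm hat_endo_comp[OF T(1,2) s(3)] hat_endo_mult[OF T(1) s(2) cl(2)])
qed

lemma pair_mult_one:
  assumes "T \<in> pairs_hat"
  shows "pair_mult T pair_one = T" "pair_mult pair_one T = T"
proof -
  have s: "snd T \<in> carrier F2_hat" and Z: "fst T \<in> Zhat" using assms by auto
  have c: "fst (pair_mult T pair_one) \<in> Zhat" "fst (pair_mult pair_one T) \<in> Zhat"
    using pair_mult_closed[OF assms pair_one_closed] pair_mult_closed[OF pair_one_closed assms]
    unfolding mem_Times_iff by blast+
  have "fst (pair_mult T pair_one) = fst T"
  proof (rule Zhat_eqI[OF c(1) Z])
    fix n :: nat assume n: "n \<ge> 1"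
    have "[fst (pair_mult T pair_one) n = 2 * fst T n * 0 + fst T n + 0] (mod int n)"
      by (rule cong_trans[OF fst_pair_mult[OF n]]) (intro cong_add cong_mult cong_refl fst_pair_one[OF n])
    then show "[fst (pair_mult T pair_one) n = fst T n] (mod int n)" by simp
  qed
  moreover have "fst (pair_mult pair_one T) = fst T"
  proof (rule Zhat_eqI[OF c(2) Z])
    fix n :: nat assume n: "n \<ge> 1"
    have "[fst (pair_mult pair_one T) n = 2 * 0 * fst T n + 0 + fst T n] (mod int n)"
      by (rule cong_trans[OF fst_pair_mult[OF n]]) (intro cong_add cong_mult cong_refl fst_pair_one[OF n])
    then show "[fst (pair_mult pair_one T) n = fst T n] (mod int n)" by simp
  qed
  moreover have "hat_endo T \<one>\<^bsub>F2_hat\<^esub> = \<one>\<^bsub>F2_hat\<^esub>"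
    using cF2.H.l_cancel_one[of "hat_endo T \<one>\<^bsub>F2_hat\<^esub>" "hat_endo T \<one>\<^bsub>F2_hat\<^esub>"] assms
      hat_endo_mult[OF assms, of "\<one>\<^bsub>F2_hat\<^esub>" "\<one>\<^bsub>F2_hat\<^esub>"] hat_endo_closed[OF assms, of "\<one>\<^bsub>F2_hat\<^esub>"] by simp
  then have "snd (pair_mult T pair_one) = snd T" using s by (simp add: pair_mult_def pair_one_def)
  moreover have "snd (pair_mult pair_one T) = snd T"
    using s hat_endo_one[OF s] cF2.H.l_one[OF s] unfolding pair_mult_def snd_conv by (simp add: pair_one_def)
  ultimately show "pair_mult T pair_one = T" "pair_mult pair_one T = T" by (simp_all add: prod_eq_iff)
qed

section \<open>Reduction of profinite pairs\<close>

lemma emb_hom_B: "F2_emb \<in> hom F2 (B 3)"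
  using F2_emb(1) by (auto simp: hom_def)

interpretation embB: completion_hom F2 "B 3" F2_emb
  by unfold_locales (rule emb_hom_B)

interpretation embP: completion_hom F2 "PB 3" F2_emb
  by unfold_locales (rule F2_emb(1))

interpretation cface: completion_hom "PB 3" "PB 4" "face F" for F
  by unfold_locales (rule face_hom)

abbreviation emb_hat where "emb_hat \<equiv> completion_map F2 (B 3) F2_emb"
abbreviation emb_hat_PB where "emb_hat_PB \<equiv> completion_map F2 (PB 3) F2_emb"

text \<open>The level of F_2 at which a class determines all five faces modulo \<open>M\<close>. For
  an object it is the preimage of its \<open>N_PB3\<close>, hence also the level at which a pair is
  reduced.\<close>

definition face_level :: "nat word set set \<Rightarrow> nat word set set" where
  "face_level M = {a \<in> carrier F2. \<forall>F. face F (F2_emb a) \<in> M}"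

lemma UNIV_face_kind: "(UNIV :: face_kind set) = {F123, F234, F12_3_4, F1_23_4, F1_2_34}"
  using face_kind.exhaust by blast

lemma face_level_FIN:
  assumes "M \<in> finite_index_normal (PB 4)"
  shows "face_level M \<in> FIN_F2"
proof -
  have eq: "face_level M = carrier F2 \<inter> (\<Inter>F\<in>UNIV. {a \<in> carrier F2. F2_emb a \<in> {w \<in> carrier (PB 3). face F w \<in> M}})"
    by (auto simp: face_level_def)
  have "{a \<in> carrier F2. F2_emb a \<in> {w \<in> carrier (PB 3). face F w \<in> M}} \<in> FIN_F2" for F
    by (rule embP.vimage_FIN[OF cface.vimage_FIN[OF assms]])
  then show ?thesis unfolding eq by (intro cF2.FIN_INT) (simp_all add: UNIV_face_kind)
qed

lemma face_level_eq: "face_level N = {a \<in> carrier F2. F2_emb a \<in> N_PB3 N}"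
  by (auto simp: face_level_def N_PB3_eq)

lemma face_level_coset_iff:
  assumes N: "N \<in> NFI_PB4" and u: "u \<in> carrier F2" "v \<in> carrier F2"
  shows "face_level N #>\<^bsub>F2\<^esub> u = face_level N #>\<^bsub>F2\<^esub> v \<longleftrightarrow> N_PB3 N #>\<^bsub>B 3\<^esub> F2_emb u = N_PB3 N #>\<^bsub>B 3\<^esub> F2_emb v"
proof -
  have "F2_emb (u \<otimes>\<^bsub>F2\<^esub> inv\<^bsub>F2\<^esub> v) = F2_emb u \<otimes>\<^bsub>B 3\<^esub> inv\<^bsub>B 3\<^esub> F2_emb v" using u by (simp add: emb_mult)
  then show ?thesis
    using u F2.rcos_eq_iff[OF FIN_subgroup[OF face_level_FIN[OF NFI_D(5)[OF N]]] u] B.rcos_eq_iff[OF N_PB3_facts(2)[OF N], of "F2_emb u" "F2_emb v"]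
    by (simp add: face_level_eq)
qed

lemma emb_hat_level:
  assumes "K \<in> finite_index_normal (B 3)" "f \<in> carrier F2" "g {a \<in> carrier F2. F2_emb a \<in> K} = {a \<in> carrier F2. F2_emb a \<in> K} #>\<^bsub>F2\<^esub> f"
  shows "emb_hat g K = K #>\<^bsub>B 3\<^esub> F2_emb f"
  using embB.completion_map_apply[of K f g] assms by blast

lemma emb_hat_PB_level:
  assumes "K \<in> finite_index_normal (PB 3)" "f \<in> carrier F2" "g {a \<in> carrier F2. F2_emb a \<in> K} = {a \<in> carrier F2. F2_emb a \<in> K} #>\<^bsub>F2\<^esub> f"
  shows "emb_hat_PB g K = K #>\<^bsub>B 3\<^esub> F2_emb f"
  using embP.completion_map_apply[of K f g] assms rcos_PB by metis

text \<open>Trades the coset in \<open>PB 3\<close> for the coordinate of the profinite element at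
  \<open>face_level N\<close>, the form in which different levels are compared below.\<close>

lemma reduction_eq_iff:
  assumes T: "T \<in> pairs_hat" and N: "N \<in> NFI_PB4" and f: "f \<in> carrier F2"
  shows "reduction N T = shadow N m f \<longleftrightarrow>
    [m = fst T (N_ord N)] (mod int (N_ord N)) \<and> snd T (face_level N) = face_level N #>\<^bsub>F2\<^esub> f"
proof -
  let ?L = "face_level N"
  have T': "snd T \<in> carrier F2_hat" using T by auto
  note L = face_level_FIN[OF NFI_D(5)[OF N]]
  obtain f0 where f0: "f0 \<in> carrier F2" "snd T ?L = ?L #>\<^bsub>F2\<^esub> f0" by (rule cF2.hat_coset[OF T' L])
  have "emb_hat_PB (snd T) (N_PB3 N) = N_PB3 N #>\<^bsub>B 3\<^esub> F2_emb f0"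
    using emb_hat_PB_level[OF N_PB3_facts(4)[OF N] f0(1)] f0(2) unfolding face_level_eq by blast
  moreover have "{k. [k = fst T (N_ord N)] (mod int (N_ord N))} = {k. [k = m] (mod int (N_ord N))}
      \<longleftrightarrow> [m = fst T (N_ord N)] (mod int (N_ord N))"
    by (auto intro: cong_sym cong_trans)
  ultimately show ?thesis
    using face_level_coset_iff[OF N f0(1) f] f0(2) unfolding reduction_def shadow_def by auto
qed

lemma reduction_ex:
  assumes T: "T \<in> pairs_hat" and N: "N \<in> NFI_PB4"
  obtains f where "f \<in> carrier F2" "reduction N T = shadow N (fst T (N_ord N)) f"
proof -
  have "snd T \<in> carrier F2_hat" using T by auto
  then obtain f where "f \<in> carrier F2" "snd T (face_level N) = face_level N #>\<^bsub>F2\<^esub> f"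
    using face_level_FIN[OF NFI_D(5)[OF N]] by (rule cF2.hat_coset)
  then show thesis using that reduction_eq_iff[OF T N] by simp
qed

subsection \<open>The hexagon and pentagon relations in the completions\<close>

lemma hexagons_mod_cosets:
  assumes K: "K \<in> finite_index_normal (B 3)" and f: "f \<in> carrier F2"
  defines "G \<equiv> B 3 Mod K" and "q \<equiv> \<lambda>w. K #>\<^bsub>B 3\<^esub> w"
  shows "hexagons_mod K m f \<longleftrightarrow>
    q (sigma 3 1) \<otimes>\<^bsub>G\<^esub> q (pure_gen 3 1 2 [^]\<^bsub>B 3\<^esub> m) \<otimes>\<^bsub>G\<^esub> inv\<^bsub>G\<^esub> q (F2_emb f) \<otimes>\<^bsub>G\<^esub> q (sigma 3 2)
        \<otimes>\<^bsub>G\<^esub> q (pure_gen 3 2 3 [^]\<^bsub>B 3\<^esub> m) \<otimes>\<^bsub>G\<^esub> q (F2_emb f)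
      = inv\<^bsub>G\<^esub> q (F2_emb f) \<otimes>\<^bsub>G\<^esub> q (sigma 3 1) \<otimes>\<^bsub>G\<^esub> q (sigma 3 2)
        \<otimes>\<^bsub>G\<^esub> inv\<^bsub>G\<^esub> q (pure_gen 3 1 2 [^]\<^bsub>B 3\<^esub> m) \<otimes>\<^bsub>G\<^esub> q (central_c [^]\<^bsub>B 3\<^esub> m) \<and>
    inv\<^bsub>G\<^esub> q (F2_emb f) \<otimes>\<^bsub>G\<^esub> q (sigma 3 2) \<otimes>\<^bsub>G\<^esub> q (pure_gen 3 2 3 [^]\<^bsub>B 3\<^esub> m) \<otimes>\<^bsub>G\<^esub> q (F2_emb f)
        \<otimes>\<^bsub>G\<^esub> q (sigma 3 1) \<otimes>\<^bsub>G\<^esub> q (pure_gen 3 1 2 [^]\<^bsub>B 3\<^esub> m)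
      = q (sigma 3 2) \<otimes>\<^bsub>G\<^esub> q (sigma 3 1) \<otimes>\<^bsub>G\<^esub> inv\<^bsub>G\<^esub> q (pure_gen 3 2 3 [^]\<^bsub>B 3\<^esub> m)
        \<otimes>\<^bsub>G\<^esub> q (central_c [^]\<^bsub>B 3\<^esub> m) \<otimes>\<^bsub>G\<^esub> q (F2_emb f)"
proof -
  have x: "pure_gen 3 1 2 \<in> carrier (B 3)" "pure_gen 3 2 3 \<in> carrier (B 3)" "central_c \<in> carrier (B 3)"
    using pure_gen3_closed central_c_closed by blast+
  have s: "sigma 3 1 \<in> carrier (B 3)" "sigma 3 2 \<in> carrier (B 3)" by auto
  show ?thesis
    unfolding G_def q_def hexagons_mod_def Let_def
    using x s emb_B[OF f] by (simp add: cB.coset_mult[OF K] cB.coset_inv[OF K] B.int_pow_neg)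
qed

lemma hexagons_level:
  assumes K: "K \<in> finite_index_normal (B 3)" and f: "f \<in> carrier F2" "emb_hat (snd T) K = K #>\<^bsub>B 3\<^esub> F2_emb f"
    and k: "[k = fst T (order (B 3 Mod K))] (mod int (order (B 3 Mod K)))"
  defines "G \<equiv> profinite_completion (B 3)" and "q \<equiv> to_completion (B 3)" and "g \<equiv> emb_hat (snd T)"
    and "p \<equiv> \<lambda>w. completion_pow (B 3) (to_completion (B 3) w) (fst T)"
  assumes T: "T \<in> pairs_hat"
  shows "hexagons_mod K k f \<longleftrightarrow>
    (q (sigma 3 1) \<otimes>\<^bsub>G\<^esub> p (pure_gen 3 1 2) \<otimes>\<^bsub>G\<^esub> inv\<^bsub>G\<^esub> g \<otimes>\<^bsub>G\<^esub> q (sigma 3 2) \<otimes>\<^bsub>G\<^esub> p (pure_gen 3 2 3) \<otimes>\<^bsub>G\<^esub> g) K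
      = (inv\<^bsub>G\<^esub> g \<otimes>\<^bsub>G\<^esub> q (sigma 3 1) \<otimes>\<^bsub>G\<^esub> q (sigma 3 2) \<otimes>\<^bsub>G\<^esub> inv\<^bsub>G\<^esub> p (pure_gen 3 1 2) \<otimes>\<^bsub>G\<^esub> p central_c) K \<and>
    (inv\<^bsub>G\<^esub> g \<otimes>\<^bsub>G\<^esub> q (sigma 3 2) \<otimes>\<^bsub>G\<^esub> p (pure_gen 3 2 3) \<otimes>\<^bsub>G\<^esub> g \<otimes>\<^bsub>G\<^esub> q (sigma 3 1) \<otimes>\<^bsub>G\<^esub> p (pure_gen 3 1 2)) K
      = (q (sigma 3 2) \<otimes>\<^bsub>G\<^esub> q (sigma 3 1) \<otimes>\<^bsub>G\<^esub> inv\<^bsub>G\<^esub> p (pure_gen 3 2 3) \<otimes>\<^bsub>G\<^esub> p central_c \<otimes>\<^bsub>G\<^esub> g) K"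
proof -
  have x: "pure_gen 3 1 2 \<in> carrier (B 3)" "pure_gen 3 2 3 \<in> carrier (B 3)" "central_c \<in> carrier (B 3)"
    using pure_gen3_closed central_c_closed by blast+
  have T': "fst T \<in> Zhat" "snd T \<in> carrier F2_hat" using T by auto
  have g: "g \<in> carrier G" unfolding g_def G_def by (rule embB.completion_map_closed[OF T'(2)])
  have p: "p w \<in> carrier G" if "w \<in> carrier (B 3)" for w
    unfolding p_def G_def by (rule completion_pow_closed[OF group_B that]) (rule Zhat_mod[OF T'(1)])
  have pK: "p w K = K #>\<^bsub>B 3\<^esub> (w [^]\<^bsub>B 3\<^esub> k)" if "w \<in> carrier (B 3)" for w
    using completion_pow_apply[OF group_B K that, of "to_completion (B 3) w" "fst T"] cB.to_completion_apply[OF K, of w]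
      cB.coset_pow_cong[OF K that k] unfolding p_def by metis
  have qK: "q w K = K #>\<^bsub>B 3\<^esub> w" for w unfolding q_def by (rule cB.to_completion_apply[OF K])
  have gK: "g K = K #>\<^bsub>B 3\<^esub> F2_emb f" using f(2) by (simp add: g_def)
  note pG = p[OF x(1)] p[OF x(2)] p[OF x(3)]
  show ?thesis
    unfolding hexagons_mod_cosets[OF K f(1)]
    using g pG unfolding G_def
    by (simp only: cB.mult_hat_apply[OF K] cB.hat_inv_apply[OF K] pK[OF x(1)] pK[OF x(2)] pK[OF x(3)] qK gK)
qed

text \<open>A relation in the completion is the family of its coordinates, each of which is a
  relation between cosets by \<open>hexagons_level\<close>. The first part needs one approximation
  per level and serves to establish the relations; the second holds for every representative and
  serves to use them.\<close>

lemma hexagons_hat_iff: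
  assumes T: "T \<in> pairs_hat"
  shows "hexagons_hat T \<longleftrightarrow> (\<forall>K\<in>finite_index_normal (B 3). \<exists>k f. f \<in> carrier F2 \<and> emb_hat (snd T) K = K #>\<^bsub>B 3\<^esub> F2_emb f
     \<and> [k = fst T (order (B 3 Mod K))] (mod int (order (B 3 Mod K))) \<and> hexagons_mod K k f)" (is "_ \<longleftrightarrow> (\<forall>K\<in>_. ?P K)")
    and "hexagons_hat T \<Longrightarrow> K \<in> finite_index_normal (B 3) \<Longrightarrow> f \<in> carrier F2 \<Longrightarrow> emb_hat (snd T) K = K #>\<^bsub>B 3\<^esub> F2_emb f
     \<Longrightarrow> hexagons_mod K (fst T (order (B 3 Mod K))) f"
proof -
  have T': "fst T \<in> Zhat" "snd T \<in> carrier F2_hat" using T by auto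
  show *: "hexagons_hat T \<Longrightarrow> K \<in> finite_index_normal (B 3) \<Longrightarrow> f \<in> carrier F2 \<Longrightarrow> emb_hat (snd T) K = K #>\<^bsub>B 3\<^esub> F2_emb f
     \<Longrightarrow> hexagons_mod K (fst T (order (B 3 Mod K))) f" for K f
    by (subst hexagons_level[OF _ _ _ cong_refl T]) (simp_all only: hexagons_hat_def Let_def simp_thms)
  have x: "pure_gen 3 1 2 \<in> carrier (B 3)" "pure_gen 3 2 3 \<in> carrier (B 3)" "central_c \<in> carrier (B 3)"
    using pure_gen3_closed central_c_closed by blast+
  have p: "completion_pow (B 3) (to_completion (B 3) w) (fst T) \<in> carrier (profinite_completion (B 3))" if "w \<in> carrier (B 3)" for w
    by (rule completion_pow_closed[OF group_B that]) (rule Zhat_mod[OF T'(1)])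
  note cl = p[OF x(1)] p[OF x(2)] p[OF x(3)] embB.completion_map_closed[OF T'(2)]
    cB.to_completion_closed[of "sigma 3 1" 3] cB.to_completion_closed[of "sigma 3 2" 3]
  show "hexagons_hat T \<longleftrightarrow> (\<forall>K\<in>finite_index_normal (B 3). ?P K)"
  proof
    assume hex: "hexagons_hat T"
    show "\<forall>K\<in>finite_index_normal (B 3). ?P K"
    proof
      fix K assume K: "K \<in> finite_index_normal (B 3)"
      obtain f where f: "f \<in> carrier F2" "snd T {a \<in> carrier F2. F2_emb a \<in> K} = {a \<in> carrier F2. F2_emb a \<in> K} #>\<^bsub>F2\<^esub> f"
        by (rule cF2.hat_coset[OF T'(2) embB.vimage_FIN[OF K]])
      have "emb_hat (snd T) K = K #>\<^bsub>B 3\<^esub> F2_emb f" using emb_hat_level[of K f "snd T"] K f by blast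
      then show "?P K" using *[OF hex K f(1)] f(1) cong_refl by blast
    qed
  next
    assume R: "\<forall>K\<in>finite_index_normal (B 3). ?P K"
    show "hexagons_hat T"
      unfolding hexagons_hat_def Let_def
    proof (intro conjI)
    qed (rule cB.hat_eqI; use cl in \<open>simp add: cB.H.m_closed\<close>; use R hexagons_level[OF _ _ _ _ T] in blast)+
  qed
qed

lemma pentagon_level:
  assumes M: "M \<in> finite_index_normal (PB 4)" and f: "f \<in> carrier F2" "g (face_level M) = face_level M #>\<^bsub>F2\<^esub> f"
    and g: "g \<in> carrier F2_hat"
  shows "completion_map (PB 3) (PB 4) (face F) (emb_hat_PB g) M = M #>\<^bsub>B 4\<^esub> face F (F2_emb f)"
proof -
  let ?L = "{w \<in> carrier (PB 3). face F w \<in> M}"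
  have "emb_hat_PB g ?L = ?L #>\<^bsub>PB 3\<^esub> F2_emb f"
    by (rule embP.completion_map_deep[OF g cface.vimage_FIN[OF M] face_level_FIN[OF M] _ f]) (auto simp: face_level_def)
  then show ?thesis
    using cface.completion_map_apply[of M "F2_emb f" "emb_hat_PB g" F] M f(1) emb_PB rcos_PB by metis
qed

text \<open>By \<open>pentagon_level\<close> the class of \<open>f\<close> at
  \<open>face_level M\<close> fixes all five coordinates at \<open>M\<close>, so one representative
  and all representatives give the same condition.\<close>

lemma pentagon_hat_iff:
  assumes T: "T \<in> pairs_hat"
  shows "pentagon_hat T \<longleftrightarrow> (\<forall>M\<in>finite_index_normal (PB 4). \<forall>f\<in>carrier F2. snd T (face_level M) = face_level M #>\<^bsub>F2\<^esub> f
     \<longrightarrow> pentagon_mod M f)"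
proof -
  let ?G = "profinite_completion (PB 4)"
  let ?e = "\<lambda>F. completion_map (PB 3) (PB 4) (face F) (emb_hat_PB (snd T))"
  have T': "snd T \<in> carrier F2_hat" using T by auto
  have e: "?e F \<in> carrier ?G" for F
    by (rule cface.completion_map_closed[OF embP.completion_map_closed[OF T']])
  have "pentagon_hat T \<longleftrightarrow> ?e F234 \<otimes>\<^bsub>?G\<^esub> ?e F1_23_4 \<otimes>\<^bsub>?G\<^esub> ?e F123 = ?e F1_2_34 \<otimes>\<^bsub>?G\<^esub> ?e F12_3_4"
    by (simp add: pentagon_hat_def Let_def face.simps)
  also have "\<dots> \<longleftrightarrow> (\<forall>M\<in>finite_index_normal (PB 4).
      (?e F234 \<otimes>\<^bsub>?G\<^esub> ?e F1_23_4 \<otimes>\<^bsub>?G\<^esub> ?e F123) M = (?e F1_2_34 \<otimes>\<^bsub>?G\<^esub> ?e F12_3_4) M)"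
  proof
    assume *: "\<forall>M\<in>finite_index_normal (PB 4).
      (?e F234 \<otimes>\<^bsub>?G\<^esub> ?e F1_23_4 \<otimes>\<^bsub>?G\<^esub> ?e F123) M = (?e F1_2_34 \<otimes>\<^bsub>?G\<^esub> ?e F12_3_4) M"
    show "?e F234 \<otimes>\<^bsub>?G\<^esub> ?e F1_23_4 \<otimes>\<^bsub>?G\<^esub> ?e F123 = ?e F1_2_34 \<otimes>\<^bsub>?G\<^esub> ?e F12_3_4"
      by (rule cPB.hat_eqI) (use * e in \<open>auto intro!: cPB.hat_mult_closed\<close>)
  qed (rule ballI, rule fun_cong)
  also have "\<dots> \<longleftrightarrow> (\<forall>M\<in>finite_index_normal (PB 4). \<forall>f\<in>carrier F2. snd T (face_level M) = face_level M #>\<^bsub>F2\<^esub> f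
     \<longrightarrow> pentagon_mod M f)"
  proof (rule ball_cong[OF HOL.refl])
    fix M assume M: "M \<in> finite_index_normal (PB 4)"
    have *: "pentagon_mod M f \<longleftrightarrow> (?e F234 \<otimes>\<^bsub>?G\<^esub> ?e F1_23_4 \<otimes>\<^bsub>?G\<^esub> ?e F123) M = (?e F1_2_34 \<otimes>\<^bsub>?G\<^esub> ?e F12_3_4) M"
      if f: "f \<in> carrier F2" "snd T (face_level M) = face_level M #>\<^bsub>F2\<^esub> f" for f
    proof -
      have c: "face F (F2_emb f) \<in> carrier (PB 4)" for F using f(1) by simp
      have e: "?e F M = M #>\<^bsub>PB 4\<^esub> face F (F2_emb f)" for F using pentagon_level[OF M f T'] by simp
      have m: "(M #>\<^bsub>PB 4\<^esub> u) \<otimes>\<^bsub>PB 4 Mod M\<^esub> (M #>\<^bsub>PB 4\<^esub> v) = M #>\<^bsub>PB 4\<^esub> (u \<otimes>\<^bsub>B 4\<^esub> v)"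
        if "u \<in> carrier (PB 4)" "v \<in> carrier (PB 4)" for u v
        using cPB.coset_mult[OF M that] by simp
      show ?thesis
        by (simp add: pentagon_mod_iff cPB.mult_hat_apply[OF M] e m c del: rcos_PB) simp
    qed
    obtain f where "f \<in> carrier F2" "snd T (face_level M) = face_level M #>\<^bsub>F2\<^esub> f"
      by (rule cF2.hat_coset[OF T' face_level_FIN[OF M]])
    then show "(?e F234 \<otimes>\<^bsub>?G\<^esub> ?e F1_23_4 \<otimes>\<^bsub>?G\<^esub> ?e F123) M = (?e F1_2_34 \<otimes>\<^bsub>?G\<^esub> ?e F12_3_4) M \<longleftrightarrow>
      (\<forall>f\<in>carrier F2. snd T (face_level M) = face_level M #>\<^bsub>F2\<^esub> f \<longrightarrow> pentagon_mod M f)"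
      using * by blast
  qed
  finally show ?thesis .
qed

subsection \<open>Cofinality of the kernels\<close>

lemma (in group) coset_eq_mono:
  assumes "subgroup N G" "subgroup K G" "N \<subseteq> K" "u \<in> carrier G" "v \<in> carrier G" "N #> u = N #> v"
  shows "K #> u = K #> v"
  using assms rcos_eq_iff by blast

text \<open>\<open>M\<close> has finitely many cosets in the whole group. The elements acting
  trivially on them by right multiplication form the core of \<open>M\<close>, the intersection of
  its conjugates.\<close>

lemma (in group) finite_index_core:
  assumes H: "H \<in> finite_index_normal G" and M: "M \<in> finite_index_normal (G\<lparr>carrier := H\<rparr>)"
  obtains N where "N \<in> finite_index_normal G" "N \<subseteq> M"
proof -
  have sH: "subgroup H G" by (rule FIN_subgroup[OF H])
  have sM: "subgroup M G" by (rule incl_subgroup[OF sH FIN_subgroup[OF M]])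
  have MH: "M \<subseteq> H" using subgroup.subset[OF FIN_subgroup[OF M]] by simp
  have fin: "finite (rcosets M)"
  proof (rule finite_subset)
    let ?t = "\<lambda>C. SOME t. t \<in> carrier G \<and> C = H #> t"
    \<comment> \<open>A coset of \<open>M\<close> in the whole group is a coset of \<open>M\<close>
      in \<open>H\<close> translated by a fixed representative of a coset of \<open>H\<close>, and
      both range over finite sets.\<close>
    show "rcosets M \<subseteq> (\<lambda>(C, t). C #> t) ` ((rcosets\<^bsub>G\<lparr>carrier := H\<rparr>\<^esub> M) \<times> ?t ` (rcosets H))"
    proof
      fix D assume "D \<in> rcosets M"
      then obtain x where x: "x \<in> carrier G" "D = M #> x" by (auto simp: rcosets_image)
      let ?s = "?t (H #> x)"
      have t: "?s \<in> carrier G \<and> H #> x = H #> ?s" by (rule someI_ex) (use x in blast)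
      then have h: "x \<otimes> inv ?s \<in> H" using rcos_eq_iff[OF sH x(1), of ?s] by blast
      then have "D = (M #> (x \<otimes> inv ?s)) #> ?s"
        using x t coset_mult_assoc[OF subgroup.subset[OF sM], of "x \<otimes> inv ?s" ?s] by (simp add: m_assoc)
      moreover have "M #> (x \<otimes> inv ?s) \<in> rcosets\<^bsub>G\<lparr>carrier := H\<rparr>\<^esub> M"
        using h by (auto simp: rcosets_image r_coset_def)
      moreover have "?s \<in> ?t ` (rcosets H)" using x by (auto simp: rcosets_image)
      ultimately show "D \<in> (\<lambda>(C, t). C #> t) ` ((rcosets\<^bsub>G\<lparr>carrier := H\<rparr>\<^esub> M) \<times> ?t ` (rcosets H))"
        by (intro image_eqI[of _ _ "(M #> (x \<otimes> inv ?s), ?s)"]) simp_all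
    qed
    show "finite ((\<lambda>(C, t). C #> t) ` ((rcosets\<^bsub>G\<lparr>carrier := H\<rparr>\<^esub> M) \<times> ?t ` (rcosets H)))"
      using H M by (auto simp: finite_index_normal_def)
  qed
  let ?N = "{w \<in> carrier G. \<forall>x\<in>carrier G. x \<otimes> w \<otimes> inv x \<in> M}"
  have sub: "subgroup ?N G"
  proof (rule subgroupI)
    show "?N \<noteq> {}" using subgroup.one_closed[OF sM] by (auto intro!: exI[of _ \<one>])
    fix a assume a: "a \<in> ?N"
    have "x \<otimes> inv a \<otimes> inv x \<in> M" if x: "x \<in> carrier G" for x
    proof -
      have "inv (x \<otimes> a \<otimes> inv x) \<in> M" using a x subgroup.m_inv_closed[OF sM] by blast
      then show ?thesis using a x by (simp add: inv_mult_group m_assoc)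
    qed
    then show "inv a \<in> ?N" using a by simp
    fix b assume b: "b \<in> ?N"
    have "x \<otimes> (a \<otimes> b) \<otimes> inv x \<in> M" if x: "x \<in> carrier G" for x
    proof -
      have "(x \<otimes> a \<otimes> inv x) \<otimes> (x \<otimes> b \<otimes> inv x) \<in> M" using a b x subgroup.m_closed[OF sM] by blast
      then show ?thesis using a b x by (simp add: m_assoc)
    qed
    then show "a \<otimes> b \<in> ?N" using a b by simp
  qed auto
  have "?N \<lhd> G"
  proof (rule normal_invI[OF sub])
    fix y w assume y: "y \<in> carrier G" and w: "w \<in> ?N"
    have "x \<otimes> (y \<otimes> w \<otimes> inv y) \<otimes> inv x \<in> M" if x: "x \<in> carrier G" for x
    proof -
      have "(x \<otimes> y) \<otimes> w \<otimes> inv (x \<otimes> y) \<in> M" using w x y by blast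
      then show ?thesis using w x y by (simp add: inv_mult_group m_assoc)
    qed
    then show "y \<otimes> w \<otimes> inv y \<in> ?N" using w y by simp
  qed
  moreover have "finite (rcosets ?N)"
    unfolding rcosets_image
  proof (rule finite_image_factor)
    let ?f = "\<lambda>x. \<lambda>C\<in>rcosets M. C #> x"
    have "?f ` carrier G \<subseteq> (\<Pi>\<^sub>E C\<in>rcosets M. rcosets M)"
    proof (intro image_subsetI restrict_PiE_iff[THEN iffD2] ballI)
      fix x C assume x: "x \<in> carrier G" and "C \<in> rcosets M"
      then obtain z where z: "z \<in> carrier G" "C = M #> z" unfolding rcosets_image by blast
      then have "C #> x = M #> (z \<otimes> x)" using coset_mult_assoc[OF subgroup.subset[OF sM] z(1) x] by simp
      then show "C #> x \<in> rcosets M" using x z unfolding rcosets_image by blast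
    qed
    then show "finite (?f ` carrier G)" by (rule finite_subset) (intro finite_PiE fin)
    fix x y assume x: "x \<in> carrier G" "y \<in> carrier G" and eq: "?f x = ?f y"
    have "z \<otimes> (x \<otimes> inv y) \<otimes> inv z \<in> M" if z: "z \<in> carrier G" for z
    proof -
      have "M #> z \<in> rcosets M" using z by (auto simp: rcosets_image)
      then have "M #> z #> x = M #> z #> y" using fun_cong[OF eq, of "M #> z"] by simp
      then have "M #> (z \<otimes> x) = M #> (z \<otimes> y)"
        using coset_mult_assoc[OF subgroup.subset[OF sM]] x z by simp
      then have "(z \<otimes> x) \<otimes> inv (z \<otimes> y) \<in> M" using rcos_eq_iff[OF sM, of "z \<otimes> x" "z \<otimes> y"] x z by simp
      then show ?thesis using x z by (simp add: inv_mult_group m_assoc)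
    qed
    then show "?N #> x = ?N #> y" using rcos_eq_iff[OF sub x] x by simp
  qed
  ultimately have "?N \<in> finite_index_normal G" by (simp add: finite_index_normal_def)
  moreover have "?N \<subseteq> M"
  proof
    fix w assume "w \<in> ?N"
    then have "w \<in> carrier G" "\<one> \<otimes> w \<otimes> inv \<one> \<in> M" by blast+
    then show "w \<in> M" by simp
  qed
  ultimately show thesis by (rule that)
qed

lemma NFI_cofinal_PB4:
  assumes "M \<in> finite_index_normal (PB 4)"
  obtains N where "N \<in> NFI_PB4" "N \<subseteq> M"
proof -
  have "M \<in> finite_index_normal ((B 4)\<lparr>carrier := carrier (PB 4)\<rparr>)" using assms by (subst PB_eq[symmetric])
  then obtain N where N: "N \<in> finite_index_normal (B 4)" "N \<subseteq> M"
    using B.finite_index_core[OF PB_FIN] by blast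
  moreover have "N \<subseteq> carrier (PB 4)" using N(2) subgroup.subset[OF FIN_subgroup[OF assms]] by blast
  ultimately show thesis using that by (simp add: NFI_PB4_def)
qed

text \<open>The homomorphism \<open>B 4 \<rightarrow> B 3\<close> that sends \<open>\<sigma>\<^sub>1, \<sigma>\<^sub>2, \<sigma>\<^sub>3\<close> to \<open>\<sigma>\<^sub>1, \<sigma>\<^sub>2, \<sigma>\<^sub>1\<close> is a left inverse
  of the inclusion of \<open>B 3\<close>.\<close>

lemma NFI_cofinal_B3:
  assumes K: "K \<in> finite_index_normal (B 3)"
  obtains N where "N \<in> NFI_PB4" "N_PB3 N \<subseteq> K"
proof -
  have bp: "braid_pair (B 3) (sigma 3 2) (sigma 3 1)"
    by unfold_locales (auto simp: B3.braid)
  obtain r where r: "r \<in> hom (B 4) (B 3)" "r (sigma 4 1) = sigma 3 1" "r (sigma 4 2) = sigma 3 2" "r (sigma 4 3) = sigma 3 1"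
    using B.B4_hom[OF B3.braid_pair_axioms bp] by blast
  have ri: "r (incl34 w) = w" if w: "w \<in> carrier (B 3)" for w
  proof (rule hom_eq_on_generate[of "B 3" "B 3" "\<lambda>w. r (incl34 w)" "\<lambda>w. w" "{sigma 3 1, sigma 3 2}"])
    show "(\<lambda>w. r (incl34 w)) \<in> hom (B 3) (B 3)"
      using hom_compose[OF incl.homh r(1)] by (simp add: comp_def)
    show "(\<lambda>w. w) \<in> hom (B 3) (B 3)" by (simp add: hom_def)
  qed (use w r B4.ab.B3_map generate_B3 in auto)
  let ?N = "{w \<in> carrier (B 4). r w \<in> K} \<inter> carrier (PB 4)"
  have "?N \<in> NFI_PB4"
    using FIN_Int[OF group_B FIN_vimage[OF group_B group_B r(1) K] PB_FIN] by (simp add: NFI_PB4_def)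
  \<comment> \<open>The face on the first three strands decides: it puts \<open>incl34 w\<close>
    into \<open>?N\<close>, and \<open>r\<close> takes this element back to
    \<open>w\<close>.\<close>
  moreover have "N_PB3 ?N \<subseteq> K"
  proof
    fix w assume w: "w \<in> N_PB3 ?N"
    then have "w \<in> carrier (PB 3)" "incl34 w \<in> ?N" using N_PB3_ext[of w ?N] by simp_all
    then show "w \<in> K" using ri[of w] by auto
  qed
  ultimately show thesis by (rule that)
qed

subsection \<open>Profinite pairs and their reductions\<close>

text \<open>Conditions (i) and (ii) tested at the objects only, where pairs can be composed. Closure
  of the profinite monoid under multiplication is proved in this form.\<close>

definition weak_hat :: "hat_pair \<Rightarrow> bool" where
  "weak_hat T \<longleftrightarrow> (\<forall>N\<in>NFI_PB4. \<forall>m. \<forall>f\<in>carrier F2. reduction N T = shadow N m f \<longrightarrow> gt_pair N m (F2_emb f))"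

text \<open>Powers in the completion use residues modulo the order of the quotient, shadows use
  residues modulo \<open>N_ord\<close>. This divisibility compares the two.\<close>

lemma N_ord_dvd_order:
  assumes N: "N \<in> NFI_PB4"
  shows "N_ord N dvd order (B 3 Mod N_PB3 N)"
proof -
  note K = N_PB3_FIN[OF N]
  have "x [^]\<^bsub>B 3\<^esub> int (order (B 3 Mod N_PB3 N)) \<in> N_PB3 N" if x: "x \<in> carrier (B 3)" for x
  proof -
    have "N_PB3 N #>\<^bsub>B 3\<^esub> (x [^]\<^bsub>B 3\<^esub> int (order (B 3 Mod N_PB3 N))) = N_PB3 N #>\<^bsub>B 3\<^esub> (x [^]\<^bsub>B 3\<^esub> (0::int))"
      by (rule cB.coset_pow_cong[OF K x]) (simp add: cong_def)
    then show ?thesis using x B.rcos_eq_iff[OF FIN_subgroup[OF K], of "x [^]\<^bsub>B 3\<^esub> int (order (B 3 Mod N_PB3 N))" "\<one>\<^bsub>B 3\<^esub>"] by simp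
  qed
  then have "int (N_ord N) dvd int (order (B 3 Mod N_PB3 N))"
    unfolding N_ord_dvd_iff[OF N] using PB_in_B[OF pure_gen3_closed(1)] PB_in_B[OF pure_gen3_closed(2)] PB_in_B[OF central_c_closed]
    by blast
  then show ?thesis by simp
qed

lemma weak_hat_iff:
  assumes T: "T \<in> pairs_hat"
  shows "hexagons_hat T \<and> pentagon_hat T \<longleftrightarrow> weak_hat T"
proof
  have T': "fst T \<in> Zhat" "snd T \<in> carrier F2_hat" using T by auto
  assume hp: "hexagons_hat T \<and> pentagon_hat T"
  show "weak_hat T"
    unfolding weak_hat_def
  proof (intro ballI allI impI)
    fix N m f assume N: "N \<in> NFI_PB4" and f: "f \<in> carrier F2" and "reduction N T = shadow N m f"
    then have m: "[m = fst T (N_ord N)] (mod int (N_ord N))" and fN: "snd T (face_level N) = face_level N #>\<^bsub>F2\<^esub> f"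
      using reduction_eq_iff[OF T N f] by blast+
    note K = N_PB3_FIN[OF N]
    have "emb_hat (snd T) (N_PB3 N) = N_PB3 N #>\<^bsub>B 3\<^esub> F2_emb f"
      using emb_hat_level[OF K f] fN unfolding face_level_eq by blast
    then have "hexagons_mod (N_PB3 N) (fst T (order (B 3 Mod N_PB3 N))) f"
      using hexagons_hat_iff(2)[OF T _ K f] hp by blast
    moreover have "pentagon_mod N f" using hp fN f NFI_D(5)[OF N] unfolding pentagon_hat_iff[OF T] by blast
    ultimately have gp: "gt_pair N (fst T (order (B 3 Mod N_PB3 N))) (F2_emb f)" using gt_pair_iff[OF N f] by blast
    have "N_ord N \<ge> 1" using N_ord_pos[OF N] by simp
    then have "[fst T (order (B 3 Mod N_PB3 N)) = fst T (N_ord N)] (mod int (N_ord N))"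
      by (rule Zhat_mod[OF T'(1) _ cB.order_pos[OF K] N_ord_dvd_order[OF N]])
    then have "[fst T (order (B 3 Mod N_PB3 N)) = m] (mod int (N_ord N))" using m cong_sym cong_trans by blast
    then show "gt_pair N m (F2_emb f)" by (rule gt_pair.gt_pair_cong(1)[OF gp]) (use f in auto)
  qed
next
  have T': "fst T \<in> Zhat" "snd T \<in> carrier F2_hat" using T by auto
  assume w: "weak_hat T"
  have "hexagons_hat T"
    unfolding hexagons_hat_iff(1)[OF T]
  proof
    fix K assume K: "K \<in> finite_index_normal (B 3)"
    obtain N where N: "N \<in> NFI_PB4" "N_PB3 N \<subseteq> K" by (rule NFI_cofinal_B3[OF K])
    \<comment> \<open>At this common multiple one integer serves both the object \<open>N\<close>,
      where the relation is known, and the quotient by \<open>K\<close>, where it is wanted.\<close>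
    let ?n = "N_ord N * order (B 3 Mod K)"
    have pos: "N_ord N \<ge> 1" "order (B 3 Mod K) \<ge> 1" using N_ord_pos[OF N(1)] cB.order_pos[OF K] by simp_all
    have m: "[fst T ?n = fst T (N_ord N)] (mod int (N_ord N))" "[fst T ?n = fst T (order (B 3 Mod K))] (mod int (order (B 3 Mod K)))"
      using pos mult_ge_one[OF pos] by (auto intro!: Zhat_mod[OF T'(1)])
    obtain f where f: "f \<in> carrier F2" "snd T (face_level N) = face_level N #>\<^bsub>F2\<^esub> f"
      by (rule cF2.hat_coset[OF T'(2) face_level_FIN[OF NFI_D(5)[OF N(1)]]])
    have "reduction N T = shadow N (fst T ?n) f" using reduction_eq_iff[OF T N(1) f(1)] f(2) m(1) by blast
    then have "hexagons_mod (N_PB3 N) (fst T ?n) f"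
      using w N(1) f(1) gt_pair_iff[OF N(1) f(1)] unfolding weak_hat_def by blast
    moreover have x: "pure_gen 3 1 2 \<in> carrier (B 3)" "pure_gen 3 2 3 \<in> carrier (B 3)" "central_c \<in> carrier (B 3)"
      using pure_gen3_closed central_c_closed by blast+
    ultimately have "hexagons_mod K (fst T ?n) f"
      unfolding hexagons_mod_def Let_def
      using emb_B[OF f(1)] by (auto intro!: B.coset_eq_mono[OF N_PB3_facts(2)[OF N(1)] FIN_subgroup[OF K] N(2)] del: equalityI)
    moreover have "emb_hat (snd T) K = K #>\<^bsub>B 3\<^esub> F2_emb f"
      by (rule embB.completion_map_deep[OF T'(2) K face_level_FIN[OF NFI_D(5)[OF N(1)]] _ f]) (use N(2) in \<open>auto simp: face_level_eq\<close>)
    ultimately show "\<exists>k f. f \<in> carrier F2 \<and> emb_hat (snd T) K = K #>\<^bsub>B 3\<^esub> F2_emb f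
     \<and> [k = fst T (order (B 3 Mod K))] (mod int (order (B 3 Mod K))) \<and> hexagons_mod K k f"
      using f(1) m(2) by blast
  qed
  moreover have "pentagon_hat T"
    unfolding pentagon_hat_iff[OF T]
  proof (intro ballI impI)
    fix M f assume M: "M \<in> finite_index_normal (PB 4)" and f: "f \<in> carrier F2" "snd T (face_level M) = face_level M #>\<^bsub>F2\<^esub> f"
    obtain N where N: "N \<in> NFI_PB4" "N \<subseteq> M" by (rule NFI_cofinal_PB4[OF M])
    obtain f' where f': "f' \<in> carrier F2" "reduction N T = shadow N (fst T (N_ord N)) f'" by (rule reduction_ex[OF T N(1)])
    then have "pentagon_mod N f'" using w N(1) gt_pair_iff[OF N(1)] unfolding weak_hat_def by blast
    have fN: "snd T (face_level N) = face_level N #>\<^bsub>F2\<^esub> f'" using reduction_eq_iff[OF T N(1) f'(1)] f'(2) by blast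
    have "face_level N \<subseteq> face_level M" using N(2) by (auto simp: face_level_def)
    then have eq: "face_level M #>\<^bsub>F2\<^esub> f = face_level M #>\<^bsub>F2\<^esub> f'"
      using cF2.hat_compat[OF T'(2) face_level_FIN[OF NFI_D(5)[OF N(1)]] face_level_FIN[OF M] _ f'(1) fN] f(2) by simp
    have "M #>\<^bsub>PB 4\<^esub> face F (F2_emb f) = M #>\<^bsub>PB 4\<^esub> face F (F2_emb f')" for F
    proof -
      have "f \<otimes>\<^bsub>F2\<^esub> inv\<^bsub>F2\<^esub> f' \<in> face_level M"
        using eq F2.rcos_eq_iff[OF FIN_subgroup[OF face_level_FIN[OF M]] f(1) f'(1)] by blast
      then have "face F (F2_emb (f \<otimes>\<^bsub>F2\<^esub> inv\<^bsub>F2\<^esub> f')) \<in> M" by (simp add: face_level_def)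
      moreover have "face F (F2_emb (f \<otimes>\<^bsub>F2\<^esub> inv\<^bsub>F2\<^esub> f')) = face F (F2_emb f) \<otimes>\<^bsub>PB 4\<^esub> inv\<^bsub>PB 4\<^esub> face F (F2_emb f')"
        using f f' emb_PB face.hom_mult face.hom_inv emb.hom_mult emb.hom_inv by (metis F2.inv_closed emb.hom_closed)
      ultimately show ?thesis
        using PB.rcos_eq_iff[OF FIN_subgroup[OF M], of "face F (F2_emb f)" "face F (F2_emb f')"] f(1) f'(1) by simp
    qed
    note face_eq = this
    have c: "face F (F2_emb f) \<in> carrier (PB 4)" "face F (F2_emb f') \<in> carrier (PB 4)" for F using f f' by auto
    have "pentagon_mod M f'"
    proof -
      have "subgroup N (PB 4)" "subgroup M (PB 4)" using NFI_D(7)[OF N(1)] FIN_subgroup[OF M] .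
      then show ?thesis
        using \<open>pentagon_mod N f'\<close> c PB.coset_eq_mono[OF _ _ N(2)] unfolding pentagon_mod_iff by (auto simp flip: rcos_PB del: equalityI)
    qed
    then show "pentagon_mod M f"
      using cPB.coset_mult[OF M] c face_eq unfolding pentagon_mod_def Let_def face.simps[symmetric] 
      by (metis PB.m_closed)
  qed
  ultimately show "hexagons_hat T \<and> pentagon_hat T" by blast
qed

lemma weak_hat_gt_pair:
  "weak_hat T \<Longrightarrow> N \<in> NFI_PB4 \<Longrightarrow> f \<in> carrier F2 \<Longrightarrow> reduction N T = shadow N m f \<Longrightarrow> gt_pair N m (F2_emb f)"
  by (simp add: weak_hat_def)

text \<open>The two sides read their data at different moduli: \<open>hat_endo\<close> at the order
  of the quotient of F_2 by \<open>face_level N1\<close>, the shadow at \<open>N_ord N1\<close>.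
  Auxiliary integers with the right residues for two moduli mediate between them.\<close>

lemma reduction_pair_mult:
  assumes T: "T1 \<in> pairs_hat" "T2 \<in> pairs_hat" and N1: "N1 \<in> NFI_PB4"
    and f: "f1 \<in> carrier F2" "f2 \<in> carrier F2"
    and r1: "reduction N1 T1 = shadow N1 m1 f1" and gp: "gt_pair N1 m1 (F2_emb f1)"
    and N2: "N2 = T4_kernel N1 m1 (F2_emb f1)" and r2: "reduction N2 T2 = shadow N2 m2 f2"
  shows "reduction N1 (pair_mult T1 T2) = shadow N1 (2 * m1 * m2 + m1 + m2) (f1 \<otimes>\<^bsub>F2\<^esub> F2_endo m1 f1 f2)"
proof -
  interpret gt_pair N1 m1 "F2_emb f1" by (rule gp)
  have N2': "N2 \<in> NFI_PB4" using T4_kernel_NFI N2 by simp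
  have T': "fst T1 \<in> Zhat" "snd T1 \<in> carrier F2_hat" "fst T2 \<in> Zhat" "snd T2 \<in> carrier F2_hat" using T by auto
  let ?L = "face_level N1"
  note L = face_level_FIN[OF NFI_D(5)[OF N1]]
  have m1: "[m1 = fst T1 (N_ord N1)] (mod int (N_ord N1))" "snd T1 ?L = ?L #>\<^bsub>F2\<^esub> f1"
    using r1 reduction_eq_iff[OF T(1) N1 f(1)] by blast+
  have m2: "[m2 = fst T2 (N_ord N2)] (mod int (N_ord N2))" "snd T2 (face_level N2) = face_level N2 #>\<^bsub>F2\<^esub> f2"
    using r2 reduction_eq_iff[OF T(2) N2' f(2)] by blast+
  have pos: "N_ord N1 \<ge> 1" "N_ord N2 \<ge> 1" "ordF ?L \<ge> 1" using N_ord_pos[OF N1] N_ord_pos[OF N2'] cF2.order_pos[OF L] by simp_all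
  \<comment> \<open>Represents the second profinite integer modulo \<open>N_ord N1\<close> and
    \<open>N_ord N2\<close> alike. It agrees with \<open>m2\<close> modulo \<open>N_ord N2\<close>,
    which by \<open>N_ord_dvd\<close> suffices after multiplication by
    \<open>2 * m1 + 1\<close>.\<close>
  let ?b = "fst T2 (N_ord N1 * N_ord N2)"
  have b: "[?b = fst T2 (N_ord N1)] (mod int (N_ord N1))" "[?b = fst T2 (N_ord N2)] (mod int (N_ord N2))"
    using pos mult_ge_one[OF pos(1,2)] by (auto intro!: Zhat_mod[OF T'(3)])
  have "int (N_ord N2) dvd m2 - ?b" using cong_trans[OF m2(1) cong_sym[OF b(2)]] by (simp add: cong_iff_dvd_diff)
  then have "(2 * m1 + 1) * int (N_ord N2) dvd (2 * m1 + 1) * (m2 - ?b)" by (rule mult_dvd_mono[OF dvd_refl])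
  then have "int (N_ord N1) dvd (2 * m1 + 1) * (m2 - ?b)" using N_ord_dvd N2 dvd_trans by blast
  moreover have "(2 * m1 + 1) * (m2 - ?b) = (2 * m1 * m2 + m1 + m2) - (2 * m1 * ?b + m1 + ?b)" by (simp add: algebra_simps)
  ultimately have "[2 * m1 * m2 + m1 + m2 = 2 * m1 * ?b + m1 + ?b] (mod int (N_ord N1))"
    by (simp add: cong_iff_dvd_diff)
  also have "[2 * m1 * ?b + m1 + ?b = 2 * fst T1 (N_ord N1) * fst T2 (N_ord N1) + fst T1 (N_ord N1) + fst T2 (N_ord N1)] (mod int (N_ord N1))"
    by (intro cong_add cong_mult cong_refl m1(1) b(1))
  also have "[2 * fst T1 (N_ord N1) * fst T2 (N_ord N1) + fst T1 (N_ord N1) + fst T2 (N_ord N1) = fst (pair_mult T1 T2) (N_ord N1)] (mod int (N_ord N1))"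
    by (rule cong_sym[OF fst_pair_mult[OF pos(1)]])
  finally have A: "[2 * m1 * m2 + m1 + m2 = fst (pair_mult T1 T2) (N_ord N1)] (mod int (N_ord N1))" .
  let ?k = "fst T1 (N_ord N1 * ordF ?L)"
  have k: "[?k = fst T1 (N_ord N1)] (mod int (N_ord N1))" "[?k = fst T1 (ordF ?L)] (mod int (ordF ?L))"
    using pos mult_ge_one[OF pos(1,3)] by (auto intro!: Zhat_mod[OF T'(1)])
  then have km: "[m1 = ?k] (mod int (N_ord N1))" using m1(1) cong_sym cong_trans by blast
  note gk = gt_pair_cong[OF km g HOL.refl]
  have T3k: "T3 N1 m1 (F2_emb f1) (F2_emb w) = K #>\<^bsub>B 3\<^esub> F2_emb (F2_endo ?k f1 w)" if "w \<in> carrier F2" for w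
    using gt_pair.T3_emb[OF gk(1) HOL.refl f(1) that] gk(3) gt_pair.pi3_def[OF gk(1)] by simp
  have T3m: "T3 N1 m1 (F2_emb f1) (F2_emb w) = K #>\<^bsub>B 3\<^esub> F2_emb (F2_endo m1 f1 w)" if "w \<in> carrier F2" for w
    using T3_emb[OF HOL.refl f(1) that] pi3_def by simp
  \<comment> \<open>The level at which \<open>hat_endo\<close> reads the second pair is the one at
    which that pair is reduced modulo the source, because \<open>N_PB3\<close> of the source is the
    kernel of \<open>T3\<close> on \<open>PB 3\<close>.\<close>
  have "endo_vimage ?k f1 ?L = face_level N2"
  proof -
    have "F2_endo ?k f1 a \<in> ?L \<longleftrightarrow> F2_emb a \<in> N_PB3 N2" if a: "a \<in> carrier F2" for a
      using a f(1) T3k[OF a] N_PB3_T4_kernel N2 B.rcos_eq_self_iff[OF N_PB3_facts(2)[OF N1], of "F2_emb (F2_endo ?k f1 a)"]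
      by (simp add: face_level_eq)
    then show ?thesis by (auto simp: face_level_eq[of N2])
  qed
  then have "hat_endo T1 (snd T2) ?L = ?L #>\<^bsub>F2\<^esub> F2_endo ?k f1 f2"
    using hat_endo_apply[OF T(1) T'(4) L _ f(2), of ?k f1] m1(2) m2(2) k(2) f(1) by (simp add: represents_def)
  also have "\<dots> = ?L #>\<^bsub>F2\<^esub> F2_endo m1 f1 f2"
    using face_level_coset_iff[OF N1, of "F2_endo ?k f1 f2" "F2_endo m1 f1 f2"] T3k[OF f(2)] T3m[OF f(2)] f by simp
  finally have "snd (pair_mult T1 T2) ?L = ?L #>\<^bsub>F2\<^esub> (f1 \<otimes>\<^bsub>F2\<^esub> F2_endo m1 f1 f2)"
    using m1(2) f by (simp add: pair_mult_def cF2.mult_hat_apply[OF L] cF2.coset_mult[OF L])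
  then show ?thesis using A f reduction_eq_iff[OF pair_mult_closed[OF T] N1] by simp
qed

lemma reduction_one:
  assumes N: "N \<in> NFI_PB4"
  shows "reduction N pair_one = shadow N 0 \<one>\<^bsub>F2\<^esub>"
proof -
  note L = face_level_FIN[OF NFI_D(5)[OF N]]
  have "N_ord N \<ge> 1" using N_ord_pos[OF N] by simp
  then have "[0 = fst pair_one (N_ord N)] (mod int (N_ord N))" by (rule cong_sym[OF fst_pair_one])
  moreover have "snd pair_one (face_level N) = face_level N #>\<^bsub>F2\<^esub> \<one>\<^bsub>F2\<^esub>"
    using L by (simp add: pair_one_def cF2.one_hat cF2.coset_one)
  ultimately show ?thesis using reduction_eq_iff[OF pair_one_closed N F2.one_closed] by blast
qed

section \<open>The action and the functor\<close>

lemma carrier_GT_hat_monoid: "carrier GT_hat_monoid = {T \<in> pairs_hat. weak_hat T}"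
  using weak_hat_iff by (auto simp: GT_hat_monoid_def simp del: mem_Sigma_iff)

lemma mult_GT_hat_monoid: "S \<otimes>\<^bsub>GT_hat_monoid\<^esub> T = pair_mult S T"
  and one_GT_hat_monoid: "\<one>\<^bsub>GT_hat_monoid\<^esub> = pair_one"
  by (simp_all add: GT_hat_monoid_def pair_mult_def pair_one_def)

lemma reduction_composite:
  assumes T: "T1 \<in> pairs_hat" "weak_hat T1" "T2 \<in> pairs_hat" "weak_hat T2" and N: "N \<in> NFI_PB4"
  obtains m1 f1 m2 f2 where "f1 \<in> carrier F2" "reduction N T1 = shadow N m1 f1" "gt_pair N m1 (F2_emb f1)"
    "f2 \<in> carrier F2" "reduction (T4_kernel N m1 (F2_emb f1)) T2 = shadow (T4_kernel N m1 (F2_emb f1)) m2 f2"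
    "gt_pair (T4_kernel N m1 (F2_emb f1)) m2 (F2_emb f2)"
    "gt_pair_comp N m1 (F2_emb f1) m2 (F2_emb f2) (F2_emb (F2_endo m1 f1 f2))"
    "reduction N (pair_mult T1 T2) = shadow N (2 * m1 * m2 + m1 + m2) (f1 \<otimes>\<^bsub>F2\<^esub> F2_endo m1 f1 f2)"
proof -
  obtain m1 f1 where 1: "f1 \<in> carrier F2" "reduction N T1 = shadow N m1 f1" using reduction_ex[OF T(1) N] by blast
  note g1 = weak_hat_gt_pair[OF T(2) N 1]
  let ?N = "T4_kernel N m1 (F2_emb f1)"
  have N': "?N \<in> NFI_PB4" by (rule gt_pair.T4_kernel_NFI[OF g1])
  obtain m2 f2 where 2: "f2 \<in> carrier F2" "reduction ?N T2 = shadow ?N m2 f2" using reduction_ex[OF T(3) N'] by blast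
  note g2 = weak_hat_gt_pair[OF T(4) N' 2]
  show thesis
    by (rule that[OF 1 g1 2 g2 gt_pair_comp_emb[OF g1 1(1) 2(1) g2]
      reduction_pair_mult[OF T(1,3) N 1(1) 2(1) 1(2) g1 HOL.refl 2(2)]])
qed

lemma weak_hat_pair_mult:
  assumes T: "T1 \<in> pairs_hat" "weak_hat T1" "T2 \<in> pairs_hat" "weak_hat T2"
  shows "weak_hat (pair_mult T1 T2)"
  unfolding weak_hat_def
proof (intro ballI allI impI)
  fix N m f assume N: "N \<in> NFI_PB4" and f: "f \<in> carrier F2" and r: "reduction N (pair_mult T1 T2) = shadow N m f"
  obtain m1 f1 m2 f2 where *: "f1 \<in> carrier F2" "f2 \<in> carrier F2"
    "gt_pair_comp N m1 (F2_emb f1) m2 (F2_emb f2) (F2_emb (F2_endo m1 f1 f2))"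
    "reduction N (pair_mult T1 T2) = shadow N (2 * m1 * m2 + m1 + m2) (f1 \<otimes>\<^bsub>F2\<^esub> F2_endo m1 f1 f2)"
    using reduction_composite[OF T N] by metis
  have "gt_pair N (2 * m1 * m2 + m1 + m2) (F2_emb (f1 \<otimes>\<^bsub>F2\<^esub> F2_endo m1 f1 f2))"
    using gt_pair_comp.gt_pair_compose[OF *(3)] *(1,2) by (simp add: emb_mult)
  then show "gt_pair N m (F2_emb f)" by (rule shadow_cong(1)) (use f r *(4) in simp_all)
qed

lemma weak_hat_one: "weak_hat pair_one"
  unfolding weak_hat_def
proof (intro ballI allI impI)
  fix N m f assume N: "N \<in> NFI_PB4" and f: "f \<in> carrier F2" and r: "reduction N pair_one = shadow N m f"
  show "gt_pair N m (F2_emb f)"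
    by (rule shadow_cong(1)[OF gt_pair_id'[OF N] f]) (use r reduction_one[OF N] in simp)
qed

lemma monoid_GT_hat: "monoid GT_hat_monoid"
  by (rule monoidI)
    (simp_all add: carrier_GT_hat_monoid mult_GT_hat_monoid one_GT_hat_monoid pair_mult_closed pair_one_closed
      weak_hat_pair_mult weak_hat_one pair_mult_assoc pair_mult_one del: mem_Sigma_iff)

interpretation GT_hat: group GT_hat
  unfolding GT_hat_def by (rule monoid.units_group[OF monoid_GT_hat])

lemma GT_hat_ops: "S \<otimes>\<^bsub>GT_hat\<^esub> T = pair_mult S T" "\<one>\<^bsub>GT_hat\<^esub> = pair_one"
  by (simp_all add: GT_hat_def units_of_mult units_of_one mult_GT_hat_monoid one_GT_hat_monoid)

lemma GT_hat_D: "T \<in> carrier GT_hat \<Longrightarrow> T \<in> pairs_hat" "T \<in> carrier GT_hat \<Longrightarrow> weak_hat T"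
  by (auto simp: GT_hat_def units_of_carrier Units_def carrier_GT_hat_monoid simp del: mem_Sigma_iff)

lemma reduction_GT:
  assumes T: "T \<in> carrier GT_hat" and N: "N \<in> NFI_PB4"
    and f1: "f1 \<in> carrier F2" "reduction N T = shadow N m1 f1"
  shows "unit_mod N m1" "T3_onto N m1 (F2_emb f1)"
proof -
  let ?S = "inv\<^bsub>GT_hat\<^esub> T"
  have S: "?S \<in> carrier GT_hat" using T by simp
  have TS: "pair_mult T ?S = pair_one" using GT_hat.r_inv[OF T] by (simp add: GT_hat_ops)
  note g1 = weak_hat_gt_pair[OF GT_hat_D(2)[OF T] N f1]
  let ?N = "T4_kernel N m1 (F2_emb f1)"
  have N': "?N \<in> NFI_PB4" by (rule gt_pair.T4_kernel_NFI[OF g1])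
  obtain m2 f2 where f2: "f2 \<in> carrier F2" "reduction ?N ?S = shadow ?N m2 f2"
    using reduction_ex[OF GT_hat_D(1)[OF S] N'] by blast
  note g2 = weak_hat_gt_pair[OF GT_hat_D(2)[OF S] N' f2]
  interpret gt_pair_comp N m1 "F2_emb f1" m2 "F2_emb f2" "F2_emb (F2_endo m1 f1 f2)"
    by (rule gt_pair_comp_emb[OF g1 f1(1) f2(1) g2])
  have eq: "shadow N 0 \<one>\<^bsub>F2\<^esub> = shadow N l (f1 \<otimes>\<^bsub>F2\<^esub> F2_endo m1 f1 f2)"
    using reduction_pair_mult[OF GT_hat_D(1)[OF T] GT_hat_D(1)[OF S] N f1(1) f2(1) f1(2) g1 HOL.refl f2(2)]
      reduction_one[OF N] by (simp add: TS)
  then have "[0 = l] (mod int (N_ord N))" by (simp add: shadow_eq_iff)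
  from cong_sym[OF this] have "[2 * l + 1 = 2 * 0 + 1] (mod int (N_ord N))" by (intro cong_add cong_mult cong_refl)
  \<comment> \<open>The inverse of \<open>2 * m1 + 1\<close> is \<open>2 * m2 + 1\<close>, where
    \<open>m2\<close> belongs to the inverse pair.\<close>
  then show "unit_mod N m1" unfolding unit_mod_def mu_mult[symmetric] by auto
  show "T3_onto N m1 (F2_emb f1)"
    unfolding T3_onto_def
  proof
    fix v assume v: "v \<in> carrier (PB 3)"
    \<comment> \<open>The inverse pair yields the preimage: \<open>T3\<close> of the composite is
      the projection, so a pure lift \<open>w\<close> of the value of the inverse at
      \<open>v\<close> is sent to the class of \<open>v\<close>.\<close>
    obtain w where w: "w \<in> carrier (PB 3)" "T3 N' m2 (F2_emb f2) v = P2.pi3 w" by (rule P2.T3_PB[OF v])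
    have "T3 N l (F2_emb (f1 \<otimes>\<^bsub>F2\<^esub> F2_endo m1 f1 f2)) = T3 N 0 (F2_emb \<one>\<^bsub>F2\<^esub>)"
      by (rule shadow_cong(3)[OF gt_pair_id'[OF N] _ eq]) (use f1(1) f2(1) in simp)
    then have "T3 N m1 (F2_emb f1) w = T3 N 0 \<one>\<^bsub>B 3\<^esub> v"
      using T3_compose[OF PB_in_B[OF v] PB_in_B[OF w(1)] w(2)] f1(1) f2(1) by (simp add: emb_mult emb_one)
    then show "\<exists>w\<in>carrier (PB 3). T3 N m1 (F2_emb f1) w = N_PB3 N #>\<^bsub>B 3\<^esub> v"
      using w(1) T3_id[OF N PB_in_B[OF v]] by auto
  qed
qed

lemma NFI_act_eq:
  assumes "T \<in> carrier GT_hat" "N \<in> NFI_PB4" "f \<in> carrier F2" "reduction N T = shadow N m f"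
  shows "NFI_act N T = T4_kernel N m (F2_emb f)"
  using shadow_source_eq[OF weak_hat_gt_pair[OF GT_hat_D(2)[OF assms(1)] assms(2-4)] assms(3)] assms(4)
  by (simp add: NFI_act_def shadow_source_def)

lemma reduction_Hom:
  assumes T: "T \<in> carrier GT_hat" and N: "N \<in> NFI_PB4"
  shows "reduction N T \<in> Hom GTSh (NFI_act N T) N" "NFI_act N T \<in> NFI_PB4"
proof -
  obtain m f where f: "f \<in> carrier F2" "reduction N T = shadow N m f" using reduction_ex[OF GT_hat_D(1)[OF T] N] by blast
  note g = weak_hat_gt_pair[OF GT_hat_D(2)[OF T] N f]
  show "reduction N T \<in> Hom GTSh (NFI_act N T) N"
    unfolding NFI_act_eq[OF T N f] f(2) by (rule Hom_GTSh_I[OF N f(1) g reduction_GT[OF T N f]])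
  show "NFI_act N T \<in> NFI_PB4"
    unfolding NFI_act_eq[OF T N f] by (rule gt_pair.T4_kernel_NFI[OF g])
qed

text \<open>Action law and functoriality come from one and the same composite of representatives:
  the kernels agree by \<open>T4_kernel_compose\<close>, the shadows by
  \<open>shadow_comp_eq\<close>.\<close>

lemma reduction_mult:
  assumes T: "T1 \<in> carrier GT_hat" "T2 \<in> carrier GT_hat" and N: "N \<in> NFI_PB4"
  shows "NFI_act N (pair_mult T1 T2) = NFI_act (NFI_act N T1) T2"
    and "reduction N (pair_mult T1 T2) = shadow_comp (NFI_act N T1) N (reduction N T1) (reduction (NFI_act N T1) T2)"
proof -
  have T12: "pair_mult T1 T2 \<in> carrier GT_hat" using GT_hat.m_closed[OF T] by (simp add: GT_hat_ops)
  obtain m1 f1 m2 f2 where *: "f1 \<in> carrier F2" "reduction N T1 = shadow N m1 f1" "gt_pair N m1 (F2_emb f1)"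
    "f2 \<in> carrier F2" "reduction (T4_kernel N m1 (F2_emb f1)) T2 = shadow (T4_kernel N m1 (F2_emb f1)) m2 f2"
    "gt_pair (T4_kernel N m1 (F2_emb f1)) m2 (F2_emb f2)"
    "gt_pair_comp N m1 (F2_emb f1) m2 (F2_emb f2) (F2_emb (F2_endo m1 f1 f2))"
    "reduction N (pair_mult T1 T2) = shadow N (2 * m1 * m2 + m1 + m2) (f1 \<otimes>\<^bsub>F2\<^esub> F2_endo m1 f1 f2)"
    by (rule reduction_composite[OF GT_hat_D[OF T(1)] GT_hat_D[OF T(2)] N])
  have f: "f1 \<otimes>\<^bsub>F2\<^esub> F2_endo m1 f1 f2 \<in> carrier F2" using *(1,4) by simp
  note a1 = NFI_act_eq[OF T(1) N *(1,2)]
  note a2 = NFI_act_eq[OF T(2) gt_pair.T4_kernel_NFI[OF *(3)] *(4,5)]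
  show "NFI_act N (pair_mult T1 T2) = NFI_act (NFI_act N T1) T2"
    unfolding a1 a2 NFI_act_eq[OF T12 N f *(8)]
    using gt_pair_comp.T4_kernel_compose[OF *(7)] *(1,4) by (simp add: emb_mult)
  show "reduction N (pair_mult T1 T2) = shadow_comp (NFI_act N T1) N (reduction N T1) (reduction (NFI_act N T1) T2)"
    unfolding a1 *(2,5,8) by (rule shadow_comp_eq[OF *(3,1,4) HOL.refl *(6), symmetric])
qed

lemma NFI_act_one: "N \<in> NFI_PB4 \<Longrightarrow> NFI_act N pair_one = N"
  using NFI_act_eq[OF _ _ F2.one_closed reduction_one, of N] GT_hat.one_closed T4_kernel_id[of N]
  by (simp add: GT_hat_ops emb_one)

lemma GT_hat_NFI_simps:
  "Obj GT_hat_NFI = NFI_PB4" "Hom GT_hat_NFI N1 N2 = {T \<in> carrier GT_hat. NFI_act N2 T = N1}"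
  "Id GT_hat_NFI N = pair_one" "Comp GT_hat_NFI N1 N2 N3 S T = pair_mult S T"
  by (simp_all add: GT_hat_NFI_def GT_hat_ops)

lemma pair_closed:
  "pair_one \<in> carrier GT_hat" "S \<in> carrier GT_hat \<Longrightarrow> T \<in> carrier GT_hat \<Longrightarrow> pair_mult S T \<in> carrier GT_hat"
  using GT_hat.one_closed GT_hat.m_closed by (simp_all add: GT_hat_ops)

lemma right_action: "right_group_action GT_hat NFI_PB4 NFI_act"
  by unfold_locales (simp_all add: GT_hat_ops reduction_Hom(2) NFI_act_one reduction_mult(1))

lemma category_GT_hat_NFI: "category GT_hat_NFI"
  by unfold_locales
    (auto simp: GT_hat_NFI_simps pair_closed NFI_act_one reduction_mult(1) pair_mult_one pair_mult_assoc GT_hat_D(1)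
      simp del: mem_Sigma_iff)

lemma functor_PR: "category_functor GT_hat_NFI GTSh (\<lambda>N. N) (\<lambda>N1 N2 T. reduction N2 T)"
proof (rule category_functor.intro[OF category_GT_hat_NFI category_GTSh], unfold_locales)
  fix a b f assume "a \<in> Obj GT_hat_NFI" "b \<in> Obj GT_hat_NFI" "f \<in> Hom GT_hat_NFI a b"
  then show "reduction b f \<in> Hom GTSh a b" using reduction_Hom(1)[of f b] by (auto simp: GT_hat_NFI_simps)
next
  fix a b c f g assume "a \<in> Obj GT_hat_NFI" "b \<in> Obj GT_hat_NFI" "c \<in> Obj GT_hat_NFI"
    "f \<in> Hom GT_hat_NFI a b" "g \<in> Hom GT_hat_NFI b c"
  then show "reduction c (Comp GT_hat_NFI a b c g f) = Comp GTSh a b c (reduction c g) (reduction b f)"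
    using reduction_mult(2)[of g f c] by (auto simp: GT_hat_NFI_simps Comp_GTSh)
qed (simp_all add: GT_hat_NFI_simps Obj_GTSh Id_GTSh reduction_one)

theorem proposition2p2:
  shows "right_group_action GT_hat NFI_PB4 NFI_act
    \<and> category_functor GT_hat_NFI GTSh (\<lambda>N. N) (\<lambda>N1 N2 T. reduction N2 T)"
  by (rule conjI[OF right_action functor_PR])

end
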